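(* Let $\Lambda$ be an artin algebra and let $\widetilde{Q}$ be the direct sum of representatives of the isomorphism classes of all indecomposable projective-injective $\Lambda$-modules. Let $\mathcal{C}_\Lambda=(\operatorname{Gen}\widetilde{Q})\cap(\operatorname{Cogen}\widetilde{Q})$. (1) The following statements are equivalent: (a) $\operatorname{domdim}\Lambda\geq 2$; (b) $\mathcal{C}_\Lambda$ contains a tilting $\Lambda$-module $T_{\mathcal{C}}$; (c) $\mathcal{C}_\Lambda$ contains a cotilting $\Lambda$-module $C_{\mathcal{C}}$. (2) If a tilting module $T_{\mathcal{C}}$ in $\mathcal{C}_\Lambda$ exists, then $T_{\mathcal{C}}\simeq\widetilde{Q}\oplus\left(\bigoplus_i\Omega^{-1}P_i\right)$, where $\Omega^{-1}P_i$ is the cosyzygy of $P_i$ and the direct sum is taken over representatives of the isomorphism classes of all indecomposable projective non-injective $\Lambda$-modules $P_i$. (3) If a cotilting module $C_{\mathcal{C}}$ in $\mathcal{C}_\Lambda$ exists, then $C_{\mathcal{C}}\simeq\widetilde{Q}\oplus\left(\bigoplus_i\Omega I_i\right)$, where $\Omega I_i$ is the syzygy of $I_i$ and the direct sum is taken over representatives of the isomorphism classes of all indecomposable injective non-projective $\Lambda$-modules $I_i$.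
   Context: All modules are finitely generated left modules. $\operatorname{Gen}(X)$ is the full subcategory of modules $M$ admitting an epimorphism $X^m\to M$ for some $m$; $\operatorname{Cogen}(X)$ is the full subcategory of modules $M$ admitting a monomorphism $M\to X^m$ for some $m$. Dominant dimension: for a minimal injective resolution $0\to{}_\Lambda\Lambda\to I_0\to I_1\to\cdots$, $\operatorname{domdim}\Lambda=\sup\{k\mid I_i \text{ is projective for all } 0\le i<k\}$. A basic $\Lambda$-module $T$ is tilting if (1) $\operatorname{projdim}T\le 1$, (2) $\operatorname{Ext}^1_\Lambda(T,T)=0$, (3) there is an exact sequence $0\to\Lambda\to T_0\to T_1\to 0$ with $T_0,T_1\in\operatorname{add}T$. A basic $\Lambda$-module $C$ is cotilting if (1) $\operatorname{injdim}C\le 1$, (2) $\operatorname{Ext}^1_\Lambda(C,C)=0$, (3) there is an exact sequence $0\to C_0\to C_1\to D\Lambda\to 0$ with $C_0,C_1\in\operatorname{add}C$, where $D$ is the standard duality. (A module is basic if its indecomposable direct summands are pairwise non-isomorphic.) The syzygy $\Omega M$ is the kernel of a projective cover of $M$; the cosyzygy $\Omega^{-1}M$ is the cokernel of an injective envelope of $M$. *)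

theory Defs
  imports "HOL-Algebra.Ideal" "HOL-Algebra.Module" "HOL-Algebra.Elementary_Groups"
    "HOL-Library.Extended_Nat"
begin

section \<open>Left modules over a ring\<close>

text \<open>The library locale \<^locale>\<open>module\<close> requires a commutative ring of scalars, so the axioms are restated
  over a \<^locale>\<open>ring\<close>. The record type and \<^locale>\<open>submodule\<close> are those of the library. The
  multiplicative fields of a module record play no role.\<close>

locale left_module = R?: ring R + M?: abelian_group M
  for R :: "('a, 'r) ring_scheme" (structure) and M :: "('a, 'm) module" (structure) +
  assumes smult_closed [simp, intro]:
      "\<lbrakk>a \<in> carrier R; x \<in> carrier M\<rbrakk> \<Longrightarrow> a \<odot>\<^bsub>M\<^esub> x \<in> carrier M"
    and smult_l_distr:
      "\<lbrakk>a \<in> carrier R; b \<in> carrier R; x \<in> carrier M\<rbrakk> \<Longrightarrow>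
        (a \<oplus> b) \<odot>\<^bsub>M\<^esub> x = a \<odot>\<^bsub>M\<^esub> x \<oplus>\<^bsub>M\<^esub> b \<odot>\<^bsub>M\<^esub> x"
    and smult_r_distr:
      "\<lbrakk>a \<in> carrier R; x \<in> carrier M; y \<in> carrier M\<rbrakk> \<Longrightarrow>
        a \<odot>\<^bsub>M\<^esub> (x \<oplus>\<^bsub>M\<^esub> y) = a \<odot>\<^bsub>M\<^esub> x \<oplus>\<^bsub>M\<^esub> a \<odot>\<^bsub>M\<^esub> y"
    and smult_assoc:
      "\<lbrakk>a \<in> carrier R; b \<in> carrier R; x \<in> carrier M\<rbrakk> \<Longrightarrow>
        (a \<otimes> b) \<odot>\<^bsub>M\<^esub> x = a \<odot>\<^bsub>M\<^esub> (b \<odot>\<^bsub>M\<^esub> x)"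
    and smult_one [simp]: "x \<in> carrier M \<Longrightarrow> \<one> \<odot>\<^bsub>M\<^esub> x = x"

definition fg_module :: "('a, 'r) ring_scheme \<Rightarrow> ('a, 'm) module \<Rightarrow> bool" where
  "fg_module R M \<longleftrightarrow> left_module R M \<and>
     (\<exists>S. finite S \<and> S \<subseteq> carrier M \<and> (\<forall>N. submodule N R M \<and> S \<subseteq> N \<longrightarrow> N = carrier M))"

text \<open>HOL cannot quantify over modules on all types. Every finitely generated left module over a
  ring with elements in \<open>'a\<close> is isomorphic to one of the following type (lemma \<open>fg_module_ex_copy\<close>
  below), so quantification over finitely generated modules is always over this type.\<close>

type_synonym 'a fgmod = "('a, (nat \<Rightarrow> 'a) set) module"

definition mod_hom ::
  "('a, 'r) ring_scheme \<Rightarrow> ('a, 'm) module \<Rightarrow> ('a, 'n) module \<Rightarrow> ('m \<Rightarrow> 'n) set" where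
  "mod_hom R M N = {f \<in> carrier M \<rightarrow> carrier N.
     (\<forall>x\<in>carrier M. \<forall>y\<in>carrier M. f (x \<oplus>\<^bsub>M\<^esub> y) = f x \<oplus>\<^bsub>N\<^esub> f y) \<and>
     (\<forall>a\<in>carrier R. \<forall>x\<in>carrier M. f (a \<odot>\<^bsub>M\<^esub> x) = a \<odot>\<^bsub>N\<^esub> f x)}"

definition mod_mono where
  "mod_mono R M N f \<longleftrightarrow> f \<in> mod_hom R M N \<and> inj_on f (carrier M)"

definition mod_epi where
  "mod_epi R M N f \<longleftrightarrow> f \<in> mod_hom R M N \<and> f ` carrier M = carrier N"

definition mod_iso :: "('a, 'r) ring_scheme \<Rightarrow> ('a, 'm) module \<Rightarrow> ('a, 'n) module \<Rightarrow> bool" where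
  "mod_iso R M N \<longleftrightarrow> (\<exists>f \<in> mod_hom R M N. bij_betw f (carrier M) (carrier N))"

definition zero_module :: "('a, 'm) module \<Rightarrow> bool" where
  "zero_module M \<longleftrightarrow> carrier M = {\<zero>\<^bsub>M\<^esub>}"

lemma (in left_module) smult_l_null: "x \<in> carrier M \<Longrightarrow> \<zero>\<^bsub>R\<^esub> \<odot>\<^bsub>M\<^esub> x = \<zero>\<^bsub>M\<^esub>"
  using smult_l_distr[of "\<zero>\<^bsub>R\<^esub>" "\<zero>\<^bsub>R\<^esub>" x]
  by (metis M.add.l_cancel_one R.l_zero R.zero_closed smult_closed)

lemma (in left_module) smult_r_null: "a \<in> carrier R \<Longrightarrow> a \<odot>\<^bsub>M\<^esub> \<zero>\<^bsub>M\<^esub> = \<zero>\<^bsub>M\<^esub>"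
  using smult_r_distr[of a "\<zero>\<^bsub>M\<^esub>" "\<zero>\<^bsub>M\<^esub>"]
  by (metis M.add.l_cancel_one M.l_zero M.zero_closed smult_closed)

lemma (in left_module) smult_l_minus:
  assumes "a \<in> carrier R" "x \<in> carrier M"
  shows "(\<ominus>\<^bsub>R\<^esub> a) \<odot>\<^bsub>M\<^esub> x = \<ominus>\<^bsub>M\<^esub> (a \<odot>\<^bsub>M\<^esub> x)"
proof -
  have "(\<ominus>\<^bsub>R\<^esub> a) \<odot>\<^bsub>M\<^esub> x \<oplus>\<^bsub>M\<^esub> a \<odot>\<^bsub>M\<^esub> x = \<zero>\<^bsub>M\<^esub>"
    using assms smult_l_distr[of "\<ominus>\<^bsub>R\<^esub> a" a x] by (simp add: R.l_neg smult_l_null)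
  then show ?thesis
    using assms by (simp add: M.minus_equality)
qed

lemma (in left_module) submodule_carrierI:
  assumes "H \<subseteq> carrier M" "H \<noteq> {}"
    and "\<And>x y. \<lbrakk>x \<in> H; y \<in> H\<rbrakk> \<Longrightarrow> x \<oplus>\<^bsub>M\<^esub> y \<in> H"
    and smult: "\<And>a x. \<lbrakk>a \<in> carrier R; x \<in> H\<rbrakk> \<Longrightarrow> a \<odot>\<^bsub>M\<^esub> x \<in> H"
  shows "submodule H R M"
proof -
  have "\<ominus>\<^bsub>M\<^esub> x \<in> H" if "x \<in> H" for x
    using smult[of "\<ominus>\<^bsub>R\<^esub> \<one>\<^bsub>R\<^esub>" x] that assms(1) smult_l_minus[of "\<one>\<^bsub>R\<^esub>" x] by auto
  then have "subgroup H (add_monoid M)"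
    using assms by (intro M.add.subgroupI) (auto simp: a_inv_def)
  then show ?thesis
    using smult by (simp add: submodule_def submodule_axioms_def)
qed

text \<open>Transport of structure along a function that is injective on the carrier.\<close>

definition transport_module :: "('m \<Rightarrow> 'n) \<Rightarrow> ('a, 'm) module \<Rightarrow> ('a, 'n) module" where
  "transport_module e M = (let e' = the_inv_into (carrier M) e in
     \<lparr>carrier = e ` carrier M, mult = undefined, one = undefined, zero = e \<zero>\<^bsub>M\<^esub>,
      add = (\<lambda>u v. e (e' u \<oplus>\<^bsub>M\<^esub> e' v)), smult = (\<lambda>a u. e (a \<odot>\<^bsub>M\<^esub> e' u))\<rparr>)"

context left_module
begin

context
  fixes e :: "'m \<Rightarrow> 'n"
  assumes e: "inj_on e (carrier M)"
begin

lemma transport_simps: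
  "carrier (transport_module e M) = e ` carrier M"
  "\<zero>\<^bsub>transport_module e M\<^esub> = e \<zero>\<^bsub>M\<^esub>"
  "\<lbrakk>x \<in> carrier M; y \<in> carrier M\<rbrakk> \<Longrightarrow> e x \<oplus>\<^bsub>transport_module e M\<^esub> e y = e (x \<oplus>\<^bsub>M\<^esub> y)"
  "x \<in> carrier M \<Longrightarrow> a \<odot>\<^bsub>transport_module e M\<^esub> e x = e (a \<odot>\<^bsub>M\<^esub> x)"
  by (simp_all add: transport_module_def Let_def the_inv_into_f_f[OF e])

lemma left_module_transport: "left_module R (transport_module e M)"
proof -
  have "abelian_group (transport_module e M)"
  proof (rule abelian_groupI; (unfold transport_simps)?)
    fix u assume "u \<in> e ` carrier M"
    then obtain x where x: "x \<in> carrier M" "u = e x" by blast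
    show "\<exists>v\<in>e ` carrier M. v \<oplus>\<^bsub>transport_module e M\<^esub> u = e \<zero>\<^bsub>M\<^esub>"
      using x by (intro bexI[of _ "e (\<ominus>\<^bsub>M\<^esub> x)"]) (auto simp: transport_simps M.l_neg)
  qed (auto simp: transport_simps M.add.m_ac)
  then show ?thesis
    by (auto simp: left_module_def left_module_axioms_def transport_simps R.ring_axioms
        smult_l_distr smult_r_distr smult_assoc)
qed

lemma transport_hom: "e \<in> mod_hom R M (transport_module e M)"
  by (auto simp: mod_hom_def transport_simps)

lemma mod_iso_transport: "mod_iso R M (transport_module e M)"
  using transport_hom e by (auto simp: mod_iso_def bij_betw_def transport_simps)

lemma fg_module_transport:
  assumes "fg_module R M"
  shows "fg_module R (transport_module e M)"
proof -
  obtain S where S: "finite S" "S \<subseteq> carrier M"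
    and gen: "\<And>N. \<lbrakk>submodule N R M; S \<subseteq> N\<rbrakk> \<Longrightarrow> N = carrier M"
    using assms by (auto simp: fg_module_def)
  interpret T: left_module R "transport_module e M"
    by (rule left_module_transport)
  have "N = e ` carrier M" if N: "submodule N R (transport_module e M)" and SN: "e ` S \<subseteq> N" for N
  proof -
    interpret N: submodule N R "transport_module e M" by (rule N)
    define N' where "N' = {x \<in> carrier M. e x \<in> N}"
    have zero: "\<zero>\<^bsub>M\<^esub> \<in> N'"
      using N.one_closed by (simp add: N'_def transport_simps)
    have "submodule N' R M"
    proof (rule submodule_carrierI)
      show "x \<oplus>\<^bsub>M\<^esub> y \<in> N'" if "x \<in> N'" "y \<in> N'" for x y
        using that N.m_closed[of "e x" "e y"] by (simp add: N'_def transport_simps)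
      show "a \<odot>\<^bsub>M\<^esub> x \<in> N'" if "a \<in> carrier R" "x \<in> N'" for a x
        using that N.smult_closed[of a "e x"] by (simp add: N'_def transport_simps)
    qed (use zero in \<open>auto simp: N'_def\<close>)
    then have "N' = carrier M"
      using gen S SN by (auto simp: N'_def)
    then show ?thesis
      using N.subset by (auto simp: N'_def transport_simps)
  qed
  moreover have "finite (e ` S)" "e ` S \<subseteq> carrier (transport_module e M)"
    using S by (auto simp: transport_simps)
  ultimately show ?thesis
    unfolding fg_module_def using left_module_transport by (metis transport_simps(1))
qed

end

lemma fg_carrier_eq_sums:
  assumes "finite S" "S \<subseteq> carrier M"
    and gen: "\<And>N. \<lbrakk>submodule N R M; S \<subseteq> N\<rbrakk> \<Longrightarrow> N = carrier M"
    and x: "x \<in> carrier M"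
  obtains c where "c \<in> S \<rightarrow> carrier R" "x = (\<Oplus>\<^bsub>M\<^esub>s\<in>S. c s \<odot>\<^bsub>M\<^esub> s)"
proof -
  define H where "H = {(\<Oplus>\<^bsub>M\<^esub>s\<in>S. c s \<odot>\<^bsub>M\<^esub> s) | c. c \<in> S \<rightarrow> carrier R}"
  have cl: "(\<lambda>s. c s \<odot>\<^bsub>M\<^esub> s) \<in> S \<rightarrow> carrier M" if "c \<in> S \<rightarrow> carrier R" for c
    using that assms(2) by auto
  have smult_sum: "a \<odot>\<^bsub>M\<^esub> (\<Oplus>\<^bsub>M\<^esub>s\<in>A. f s) = (\<Oplus>\<^bsub>M\<^esub>s\<in>A. a \<odot>\<^bsub>M\<^esub> f s)"
    if "finite A" "f \<in> A \<rightarrow> carrier M" "a \<in> carrier R" for a f and A :: "'m set"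
    using that
  proof (induction A)
    case (insert y F)
    have "(\<lambda>s. a \<odot>\<^bsub>M\<^esub> f s) \<in> F \<rightarrow> carrier M" using insert by auto
    with insert show ?case by (auto simp: M.finsum_insert smult_r_distr M.finsum_closed)
  qed (simp add: smult_r_null)
  have "submodule H R M"
  proof (rule submodule_carrierI)
    show "H \<subseteq> carrier M" using cl by (auto simp: H_def intro!: M.finsum_closed)
    show "H \<noteq> {}" by (auto simp: H_def intro!: exI[of _ "\<lambda>_. \<zero>\<^bsub>R\<^esub>"])
  next
    fix y z assume "y \<in> H" "z \<in> H"
    then obtain c d where cd: "c \<in> S \<rightarrow> carrier R" "y = (\<Oplus>\<^bsub>M\<^esub>s\<in>S. c s \<odot>\<^bsub>M\<^esub> s)"
      "d \<in> S \<rightarrow> carrier R" "z = (\<Oplus>\<^bsub>M\<^esub>s\<in>S. d s \<odot>\<^bsub>M\<^esub> s)" by (auto simp: H_def)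
    have "y \<oplus>\<^bsub>M\<^esub> z = (\<Oplus>\<^bsub>M\<^esub>s\<in>S. c s \<odot>\<^bsub>M\<^esub> s \<oplus>\<^bsub>M\<^esub> d s \<odot>\<^bsub>M\<^esub> s)"
      using cd cl by (simp add: M.finsum_addf)
    also have "\<dots> = (\<Oplus>\<^bsub>M\<^esub>s\<in>S. (c s \<oplus>\<^bsub>R\<^esub> d s) \<odot>\<^bsub>M\<^esub> s)"
      using cd assms(2) by (intro M.finsum_cong') (auto simp: smult_l_distr Pi_iff subset_iff)
    finally show "y \<oplus>\<^bsub>M\<^esub> z \<in> H"
      using cd unfolding H_def by (auto intro!: exI[of _ "\<lambda>s. c s \<oplus>\<^bsub>R\<^esub> d s"])
  next
    fix a y assume a: "a \<in> carrier R" and "y \<in> H"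
    then obtain c where c: "c \<in> S \<rightarrow> carrier R" "y = (\<Oplus>\<^bsub>M\<^esub>s\<in>S. c s \<odot>\<^bsub>M\<^esub> s)"
      by (auto simp: H_def)
    have "a \<odot>\<^bsub>M\<^esub> y = (\<Oplus>\<^bsub>M\<^esub>s\<in>S. a \<odot>\<^bsub>M\<^esub> (c s \<odot>\<^bsub>M\<^esub> s))"
      using c cl a assms(1) by (simp add: smult_sum)
    also have "\<dots> = (\<Oplus>\<^bsub>M\<^esub>s\<in>S. (a \<otimes>\<^bsub>R\<^esub> c s) \<odot>\<^bsub>M\<^esub> s)"
      using c a assms(2) by (intro M.finsum_cong') (auto simp: smult_assoc Pi_iff subset_iff)
    finally show "a \<odot>\<^bsub>M\<^esub> y \<in> H"
      using c a unfolding H_def by (auto intro!: exI[of _ "\<lambda>s. a \<otimes>\<^bsub>R\<^esub> c s"])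
  qed
  moreover have "S \<subseteq> H"
  proof
    fix t assume t: "t \<in> S"
    define c where "c = (\<lambda>s. if s = t then \<one>\<^bsub>R\<^esub> else \<zero>\<^bsub>R\<^esub>)"
    have "(\<Oplus>\<^bsub>M\<^esub>s\<in>S. c s \<odot>\<^bsub>M\<^esub> s) = (\<Oplus>\<^bsub>M\<^esub>s\<in>S. if t = s then s else \<zero>\<^bsub>M\<^esub>)"
      using assms(2) by (intro M.finsum_cong') (auto simp: c_def smult_l_null)
    also have "\<dots> = t"
      using M.finsum_singleton[of t S "\<lambda>s. s"] t assms(1,2) by auto
    finally have "t = (\<Oplus>\<^bsub>M\<^esub>s\<in>S. c s \<odot>\<^bsub>M\<^esub> s)" by simp
    then show "t \<in> H"
      unfolding H_def by (auto simp: c_def)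
  qed
  ultimately have "x \<in> H" using gen x by blast
  then show ?thesis using that by (auto simp: H_def)
qed

end

lemma fg_module_ex_copy:
  fixes R :: "('a, 'r) ring_scheme" and M :: "('a, 'm) module"
  assumes "fg_module R M"
  shows "\<exists>N :: 'a fgmod. fg_module R N \<and> mod_iso R M N"
proof -
  interpret left_module R M using assms by (simp add: fg_module_def)
  obtain S where S: "finite S" "S \<subseteq> carrier M"
    and gen: "\<And>N. \<lbrakk>submodule N R M; S \<subseteq> N\<rbrakk> \<Longrightarrow> N = carrier M"
    using assms by (auto simp: fg_module_def)
  obtain ix :: "'m \<Rightarrow> nat" where ix: "inj_on ix S"
    using finite_imp_inj_to_nat_seg[OF S(1)] by blast
  define e :: "'m \<Rightarrow> (nat \<Rightarrow> 'a) set" where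
    "e x = {c. (\<forall>s\<in>S. c (ix s) \<in> carrier R) \<and> x = (\<Oplus>\<^bsub>M\<^esub>s\<in>S. c (ix s) \<odot>\<^bsub>M\<^esub> s)}" for x
  have "e x \<noteq> {}" if x: "x \<in> carrier M" for x
  proof -
    obtain c where c: "c \<in> S \<rightarrow> carrier R" "x = (\<Oplus>\<^bsub>M\<^esub>s\<in>S. c s \<odot>\<^bsub>M\<^esub> s)"
      by (rule fg_carrier_eq_sums[OF S _ x]) (use gen in auto)
    have "(\<Oplus>\<^bsub>M\<^esub>s\<in>S. c s \<odot>\<^bsub>M\<^esub> s) = (\<Oplus>\<^bsub>M\<^esub>s\<in>S. c (the_inv_into S ix (ix s)) \<odot>\<^bsub>M\<^esub> s)"
      using c S by (intro M.finsum_cong') (auto simp: the_inv_into_f_f[OF ix] Pi_iff subset_iff)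
    then have "(\<lambda>n. c (the_inv_into S ix n)) \<in> e x"
      using c by (auto simp: e_def the_inv_into_f_f[OF ix])
    then show ?thesis by blast
  qed
  moreover have "x = y" if "c \<in> e x" "c \<in> e y" for c x y
    using that by (simp add: e_def)
  ultimately have "inj_on e (carrier M)"
    by (metis ex_in_conv inj_onI)
  then show ?thesis
    using fg_module_transport mod_iso_transport assms by blast
qed

definition short_exact where
  "short_exact R A f B g C \<longleftrightarrow> left_module R A \<and> left_module R B \<and> left_module R C \<and>
     mod_mono R A B f \<and> mod_epi R B C g \<and> f ` carrier A = a_kernel B C g"

definition regular_module :: "('a, 'r) ring_scheme \<Rightarrow> ('a, 'a) module" where
  "regular_module R = \<lparr>carrier = carrier R, mult = undefined, one = undefined,
     zero = \<zero>\<^bsub>R\<^esub>, add = (\<oplus>\<^bsub>R\<^esub>), smult = (\<otimes>\<^bsub>R\<^esub>)\<rparr>"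

definition quot_module :: "('a, 'm) module \<Rightarrow> 'm set \<Rightarrow> ('a, 'm set) module" where
  "quot_module M N = \<lparr>carrier = a_rcosets\<^bsub>M\<^esub> N, mult = undefined, one = undefined,
     zero = N, add = set_add M, smult = (\<lambda>a X. \<Union>x\<in>X. a_r_coset M N (a \<odot>\<^bsub>M\<^esub> x))\<rparr>"

definition direct_sum :: "'i set \<Rightarrow> ('i \<Rightarrow> ('a, 'm) module) \<Rightarrow> ('a, 'i \<Rightarrow> 'm) module" where
  "direct_sum I M = \<lparr>carrier = {x \<in> (\<Pi>\<^sub>E i\<in>I. carrier (M i)). finite {i \<in> I. x i \<noteq> \<zero>\<^bsub>M i\<^esub>}},
     mult = undefined, one = undefined,
     zero = (\<lambda>i\<in>I. \<zero>\<^bsub>M i\<^esub>), add = (\<lambda>x y. \<lambda>i\<in>I. x i \<oplus>\<^bsub>M i\<^esub> y i),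
     smult = (\<lambda>a x. \<lambda>i\<in>I. a \<odot>\<^bsub>M i\<^esub> x i)\<rparr>"

definition direct_sum2 :: "('a, 'm) module \<Rightarrow> ('a, 'n) module \<Rightarrow> ('a, 'm \<times> 'n) module" where
  "direct_sum2 M N = \<lparr>carrier = carrier M \<times> carrier N, mult = undefined, one = undefined,
     zero = (\<zero>\<^bsub>M\<^esub>, \<zero>\<^bsub>N\<^esub>),
     add = (\<lambda>x y. (fst x \<oplus>\<^bsub>M\<^esub> fst y, snd x \<oplus>\<^bsub>N\<^esub> snd y)),
     smult = (\<lambda>a x. (a \<odot>\<^bsub>M\<^esub> fst x, a \<odot>\<^bsub>N\<^esub> snd x))\<rparr>"

definition direct_power :: "nat \<Rightarrow> ('a, 'm) module \<Rightarrow> ('a, nat \<Rightarrow> 'm) module" where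
  "direct_power m M = direct_sum {..<m} (\<lambda>_. M)"

section \<open>Projective and injective modules\<close>

definition projective :: "('a, 'r) ring_scheme \<Rightarrow> ('a, 'm) module \<Rightarrow> bool" where
  "projective R P \<longleftrightarrow> fg_module R P \<and>
     (\<forall>(A :: 'a fgmod) (B :: 'a fgmod) p f.
        fg_module R A \<and> fg_module R B \<and> mod_epi R A B p \<and> f \<in> mod_hom R P B \<longrightarrow>
        (\<exists>g \<in> mod_hom R P A. \<forall>x\<in>carrier P. p (g x) = f x))"

definition injective :: "('a, 'r) ring_scheme \<Rightarrow> ('a, 'm) module \<Rightarrow> bool" where
  "injective R E \<longleftrightarrow> fg_module R E \<and>
     (\<forall>(A :: 'a fgmod) (B :: 'a fgmod) j f.
        fg_module R A \<and> fg_module R B \<and> mod_mono R A B j \<and> f \<in> mod_hom R A E \<longrightarrow>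
        (\<exists>g \<in> mod_hom R B E. \<forall>x\<in>carrier A. g (j x) = f x))"

definition essential :: "('a, 'r) ring_scheme \<Rightarrow> 'm set \<Rightarrow> ('a, 'm) module \<Rightarrow> bool" where
  "essential R N M \<longleftrightarrow> submodule N R M \<and>
     (\<forall>L. submodule L R M \<and> L \<inter> N = {\<zero>\<^bsub>M\<^esub>} \<longrightarrow> L = {\<zero>\<^bsub>M\<^esub>})"

definition superfluous :: "('a, 'r) ring_scheme \<Rightarrow> 'm set \<Rightarrow> ('a, 'm) module \<Rightarrow> bool" where
  "superfluous R N M \<longleftrightarrow> submodule N R M \<and>
     (\<forall>L. submodule L R M \<and> L <+>\<^bsub>M\<^esub> N = carrier M \<longrightarrow> L = carrier M)"

definition injective_envelope ::
  "('a, 'r) ring_scheme \<Rightarrow> ('a, 'm) module \<Rightarrow> ('m \<Rightarrow> 'n) \<Rightarrow> ('a, 'n) module \<Rightarrow> bool" where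
  "injective_envelope R M j E \<longleftrightarrow>
     injective R E \<and> mod_mono R M E j \<and> essential R (j ` carrier M) E"

definition projective_cover ::
  "('a, 'r) ring_scheme \<Rightarrow> ('a, 'n) module \<Rightarrow> ('n \<Rightarrow> 'm) \<Rightarrow> ('a, 'm) module \<Rightarrow> bool" where
  "projective_cover R P p M \<longleftrightarrow>
     projective R P \<and> mod_epi R P M p \<and> superfluous R (a_kernel P M p) P"

definition is_syzygy :: "('a, 'r) ring_scheme \<Rightarrow> ('a, 'm) module \<Rightarrow> ('a, 'n) module \<Rightarrow> bool" where
  "is_syzygy R M Z \<longleftrightarrow>
     (\<exists>(P :: 'a fgmod) p j. projective_cover R P p M \<and> short_exact R Z j P p M)"

definition is_cosyzygy :: "('a, 'r) ring_scheme \<Rightarrow> ('a, 'm) module \<Rightarrow> ('a, 'n) module \<Rightarrow> bool" where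
  "is_cosyzygy R M Z \<longleftrightarrow>
     (\<exists>(E :: 'a fgmod) j p. injective_envelope R M j E \<and> short_exact R M j E p Z)"

definition syzygy :: "('a, 'r) ring_scheme \<Rightarrow> ('a, 'm) module \<Rightarrow> 'a fgmod" where
  "syzygy R M = (SOME Z. is_syzygy R M Z)"

definition cosyzygy :: "('a, 'r) ring_scheme \<Rightarrow> ('a, 'm) module \<Rightarrow> 'a fgmod" where
  "cosyzygy R M = (SOME Z. is_cosyzygy R M Z)"

section \<open>Resolutions, homological dimensions and Ext\<close>

definition projective_resolution ::
  "('a, 'r) ring_scheme \<Rightarrow> ('a, 'm) module \<Rightarrow> (nat \<Rightarrow> ('a, 'n) module) \<Rightarrow>
   (nat \<Rightarrow> 'n \<Rightarrow> 'n) \<Rightarrow> ('n \<Rightarrow> 'm) \<Rightarrow> bool" where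
  "projective_resolution R M P d p \<longleftrightarrow>
     (\<forall>i. projective R (P i)) \<and> (\<forall>i. d i \<in> mod_hom R (P (Suc i)) (P i)) \<and>
     mod_epi R (P 0) M p \<and>
     d 0 ` carrier (P 1) = a_kernel (P 0) M p \<and>
     (\<forall>i. d (Suc i) ` carrier (P (Suc (Suc i))) = a_kernel (P (Suc i)) (P i) (d i))"

definition injective_resolution ::
  "('a, 'r) ring_scheme \<Rightarrow> ('a, 'm) module \<Rightarrow> (nat \<Rightarrow> ('a, 'n) module) \<Rightarrow>
   (nat \<Rightarrow> 'n \<Rightarrow> 'n) \<Rightarrow> ('m \<Rightarrow> 'n) \<Rightarrow> bool" where
  "injective_resolution R M E d j \<longleftrightarrow>
     (\<forall>i. injective R (E i)) \<and> (\<forall>i. d i \<in> mod_hom R (E i) (E (Suc i))) \<and>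
     mod_mono R M (E 0) j \<and>
     j ` carrier M = a_kernel (E 0) (E 1) (d 0) \<and>
     (\<forall>i. d i ` carrier (E i) = a_kernel (E (Suc i)) (E (Suc (Suc i))) (d (Suc i)))"

definition minimal_injective_resolution where
  "minimal_injective_resolution R M E d j \<longleftrightarrow>
     injective_resolution R M E d j \<and> essential R (j ` carrier M) (E 0) \<and>
     (\<forall>i. essential R (d i ` carrier (E i)) (E (Suc i)))"

definition projdim :: "('a, 'r) ring_scheme \<Rightarrow> ('a, 'm) module \<Rightarrow> enat" where
  "projdim R M = Inf {enat n | n. \<exists>(P :: nat \<Rightarrow> 'a fgmod) d p.
     projective_resolution R M P d p \<and> (\<forall>i>n. zero_module (P i))}"

definition injdim :: "('a, 'r) ring_scheme \<Rightarrow> ('a, 'm) module \<Rightarrow> enat" where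
  "injdim R M = Inf {enat n | n. \<exists>(E :: nat \<Rightarrow> 'a fgmod) d j.
     injective_resolution R M E d j \<and> (\<forall>i>n. zero_module (E i))}"

definition domdim :: "('a, 'r) ring_scheme \<Rightarrow> enat" where
  "domdim R = Sup {enat k | k. \<exists>(E :: nat \<Rightarrow> 'a fgmod) d j.
     minimal_injective_resolution R (regular_module R) E d j \<and> (\<forall>i<k. projective R (E i))}"

definition Hom_group ::
  "('a, 'r) ring_scheme \<Rightarrow> ('a, 'm) module \<Rightarrow> ('a, 'n) module \<Rightarrow> ('m \<Rightarrow> 'n) monoid" where
  "Hom_group R M N = \<lparr>carrier = mod_hom R M N \<inter> extensional (carrier M),
     mult = (\<lambda>f g. \<lambda>x\<in>carrier M. f x \<oplus>\<^bsub>N\<^esub> g x), one = (\<lambda>x\<in>carrier M. \<zero>\<^bsub>N\<^esub>)\<rparr>"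

text \<open>The cohomology in degree \<open>n\<close> of \<open>Hom(P\<^sub>0, N) \<rightarrow> Hom(P\<^sub>1, N) \<rightarrow> \<dots>\<close>, where
  \<open>d i : P\<^sub>i\<^sub>+\<^sub>1 \<rightarrow> P\<^sub>i\<close>.\<close>

definition Hom_cohomology ::
  "('a, 'r) ring_scheme \<Rightarrow> (nat \<Rightarrow> ('a, 'm) module) \<Rightarrow> (nat \<Rightarrow> 'm \<Rightarrow> 'm) \<Rightarrow> ('a, 'n) module \<Rightarrow>
   nat \<Rightarrow> ('m \<Rightarrow> 'n) set monoid" where
  "Hom_cohomology R P d N n =
     (let Z = {f \<in> carrier (Hom_group R (P n) N).
                 compose (carrier (P (Suc n))) f (d n) = \<one>\<^bsub>Hom_group R (P (Suc n)) N\<^esub>};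
          B = (case n of 0 \<Rightarrow> {\<one>\<^bsub>Hom_group R (P 0) N\<^esub>}
               | Suc m \<Rightarrow> (\<lambda>g. compose (carrier (P n)) g (d m)) ` carrier (Hom_group R (P m) N))
      in (Hom_group R (P n) N)\<lparr>carrier := Z\<rparr> Mod B)"

text \<open>Up to isomorphism, the choices made by \<open>syzygy\<close>, \<open>cosyzygy\<close> above and \<open>Ext\<close> below do not
  matter.\<close>

definition Ext ::
  "('a, 'r) ring_scheme \<Rightarrow> nat \<Rightarrow> ('a, 'm) module \<Rightarrow> ('a, 'n) module \<Rightarrow>
   ((nat \<Rightarrow> 'a) set \<Rightarrow> 'n) set monoid" where
  "Ext R n M N =
     (let (P :: nat \<Rightarrow> 'a fgmod, d, p) = (SOME (P, d, p). projective_resolution R M P d p)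
      in Hom_cohomology R P d N n)"

section \<open>Artin algebras and the standard duality\<close>

definition artinian_cring :: "('k, 's) ring_scheme \<Rightarrow> bool" where
  "artinian_cring K \<longleftrightarrow> cring K \<and>
     (\<forall>I :: nat \<Rightarrow> 'k set. (\<forall>n. ideal (I n) K \<and> I (Suc n) \<subseteq> I n) \<longrightarrow> (\<exists>n. \<forall>m\<ge>n. I m = I n))"

definition restrict_scalars ::
  "('k \<Rightarrow> 'a) \<Rightarrow> ('a, 'm) module \<Rightarrow> ('k, 'm) module" where
  "restrict_scalars \<phi> M = \<lparr>carrier = carrier M, mult = undefined, one = undefined,
     zero = \<zero>\<^bsub>M\<^esub>, add = (\<oplus>\<^bsub>M\<^esub>), smult = (\<lambda>k x. \<phi> k \<odot>\<^bsub>M\<^esub> x)\<rparr>"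

definition artin_algebra ::
  "('k, 's) ring_scheme \<Rightarrow> ('k \<Rightarrow> 'a) \<Rightarrow> ('a, 'r) ring_scheme \<Rightarrow> bool" where
  "artin_algebra K \<phi> \<Lambda> \<longleftrightarrow> artinian_cring K \<and> ring \<Lambda> \<and> \<phi> \<in> ring_hom K \<Lambda> \<and>
     (\<forall>k\<in>carrier K. \<forall>x\<in>carrier \<Lambda>. \<phi> k \<otimes>\<^bsub>\<Lambda>\<^esub> x = x \<otimes>\<^bsub>\<Lambda>\<^esub> \<phi> k) \<and>
     fg_module K (restrict_scalars \<phi> (regular_module \<Lambda>))"

text \<open>For commutative \<open>K\<close>.\<close>

definition jacobson_radical :: "('k, 's) ring_scheme \<Rightarrow> 'k set" where
  "jacobson_radical K = carrier K \<inter> \<Inter>{I. maximalideal I K}"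

text \<open>The standard duality is \<open>D = Hom\<^sub>K(-, J)\<close> with \<open>J\<close> an injective envelope of \<open>K / rad K\<close>.\<close>

definition duality_module :: "('k, 's) ring_scheme \<Rightarrow> ('k, 'j) module \<Rightarrow> bool" where
  "duality_module K J \<longleftrightarrow>
     (\<exists>\<iota>. injective_envelope K (quot_module (regular_module K) (jacobson_radical K)) \<iota> J)"

text \<open>\<open>D\<Lambda>\<close>: the dual of \<open>\<Lambda>\<close> as a right module over itself, hence a left module.\<close>

definition dual_regular ::
  "('k, 's) ring_scheme \<Rightarrow> ('k \<Rightarrow> 'a) \<Rightarrow> ('a, 'r) ring_scheme \<Rightarrow> ('k, 'j) module \<Rightarrow>
   ('a, 'a \<Rightarrow> 'j) module" where
  "dual_regular K \<phi> \<Lambda> J =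
     (let H = Hom_group K (restrict_scalars \<phi> (regular_module \<Lambda>)) J
      in \<lparr>carrier = carrier H, mult = undefined, one = undefined,
          zero = \<one>\<^bsub>H\<^esub>, add = mult H,
          smult = (\<lambda>a f. \<lambda>x\<in>carrier \<Lambda>. f (x \<otimes>\<^bsub>\<Lambda>\<^esub> a))\<rparr>)"

section \<open>Tilting and cotilting modules\<close>

definition indecomposable :: "('a, 'r) ring_scheme \<Rightarrow> ('a, 'm) module \<Rightarrow> bool" where
  "indecomposable R M \<longleftrightarrow> fg_module R M \<and> \<not> zero_module M \<and>
     (\<forall>N L. submodule N R M \<and> submodule L R M \<and> N \<inter> L = {\<zero>\<^bsub>M\<^esub>} \<and> N <+>\<^bsub>M\<^esub> L = carrier M \<longrightarrow>
        N = {\<zero>\<^bsub>M\<^esub>} \<or> L = {\<zero>\<^bsub>M\<^esub>})"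

definition basic_module :: "('a, 'r) ring_scheme \<Rightarrow> ('a, 'm) module \<Rightarrow> bool" where
  "basic_module R M \<longleftrightarrow> fg_module R M \<and>
     (\<forall>n (X :: nat \<Rightarrow> 'a fgmod).
        (\<forall>i<n. indecomposable R (X i)) \<and> mod_iso R M (direct_sum {..<n} X) \<longrightarrow>
        (\<forall>i<n. \<forall>j<n. i \<noteq> j \<longrightarrow> \<not> mod_iso R (X i) (X j)))"

definition add_cat :: "('a, 'r) ring_scheme \<Rightarrow> ('a, 'm) module \<Rightarrow> ('a, 'n) module set" where
  "add_cat R T = {X. fg_module R X \<and>
     (\<exists>m (Y :: 'a fgmod). fg_module R Y \<and> mod_iso R (direct_sum2 X Y) (direct_power m T))}"

definition Gen :: "('a, 'r) ring_scheme \<Rightarrow> ('a, 'm) module \<Rightarrow> ('a, 'n) module set" where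
  "Gen R X = {M. fg_module R M \<and> (\<exists>m f. mod_epi R (direct_power m X) M f)}"

definition Cogen :: "('a, 'r) ring_scheme \<Rightarrow> ('a, 'm) module \<Rightarrow> ('a, 'n) module set" where
  "Cogen R X = {M. fg_module R M \<and> (\<exists>m f. mod_mono R M (direct_power m X) f)}"

definition tilting :: "('a, 'r) ring_scheme \<Rightarrow> ('a, 'm) module \<Rightarrow> bool" where
  "tilting R T \<longleftrightarrow> basic_module R T \<and> projdim R T \<le> 1 \<and> trivial_group (Ext R 1 T T) \<and>
     (\<exists>(T0 :: 'a fgmod) (T1 :: 'a fgmod) f g. T0 \<in> add_cat R T \<and> T1 \<in> add_cat R T \<and>
        short_exact R (regular_module R) f T0 g T1)"

definition cotilting ::
  "('k, 's) ring_scheme \<Rightarrow> ('k \<Rightarrow> 'a) \<Rightarrow> ('k, 'j) module \<Rightarrow> ('a, 'r) ring_scheme \<Rightarrow>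
   ('a, 'm) module \<Rightarrow> bool" where
  "cotilting K \<phi> J R C \<longleftrightarrow> basic_module R C \<and> injdim R C \<le> 1 \<and> trivial_group (Ext R 1 C C) \<and>
     (\<exists>(C0 :: 'a fgmod) (C1 :: 'a fgmod) f g. C0 \<in> add_cat R C \<and> C1 \<in> add_cat R C \<and>
        short_exact R C0 f C1 g (dual_regular K \<phi> R J))"

text \<open>\<open>S\<close> is a set of representatives of the isomorphism classes of modules with property \<open>P\<close>.\<close>

definition iso_representatives ::
  "('a, 'r) ring_scheme \<Rightarrow> ('a fgmod \<Rightarrow> bool) \<Rightarrow> 'a fgmod set \<Rightarrow> bool" where
  "iso_representatives R P S \<longleftrightarrow>
     (\<forall>M\<in>S. P M) \<and> (\<forall>M. P M \<longrightarrow> (\<exists>!N. N \<in> S \<and> mod_iso R M N))"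

end

theory Submission
  imports Defs
begin

text \<open>Write PI for projective-injective. Then \<open>Gen Q\<close> and \<open>Cogen Q\<close> consist of the quotients and of the
  submodules of PI modules, and the dominant dimension is at least 2 if and only if \<open>\<Lambda>\<close>, equivalently every
  projective module, is the kernel of a map between PI modules. Extending and lifting maps between PI modules
  and projective presentations shows that this holds if and only if \<open>D \<Lambda>\<close>, equivalently every injective module,
  is the cokernel of such a map; of \<open>D \<Lambda>\<close> only the fact that it is an injective cogenerator matters.

  In this case the injective envelope \<open>E\<close> of an indecomposable projective non-injective module \<open>P\<close> is PI,
  and its cosyzygy \<open>Z(P) = E / P\<close> is indecomposable, not projective, cogenerated by PI modules, and determines
  \<open>P\<close>. Maps from a projective submodule of a PI module to a module in \<open>Gen Q\<close> extend, which gives the vanishing of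
  \<open>Ext(Z(P), -)\<close> on \<open>Gen Q\<close> and shows that the module in (2) is tilting.

  Conversely, if \<open>0 \<rightarrow> \<Lambda> \<rightarrow> T0 \<rightarrow> T1 \<rightarrow> 0\<close> is exact with \<open>T0\<close> and \<open>T1\<close> in \<open>Gen Q \<inter> Cogen Q\<close>, then \<open>\<Lambda>\<close> is the kernel of a map
  from a PI module containing \<open>T0\<close> to a PI module. A relative form of Schanuel's lemma compares this sequence,
  and a resolution of \<open>T\<close> by a PI module and a projective one, with \<open>0 \<rightarrow> P \<rightarrow> E \<rightarrow> Z(P) \<rightarrow> 0\<close>. By the Krull-Schmidt
  theorem the indecomposable summands of \<open>T\<close> are then exactly those of the module in (2). The cotilting
  case is dual.\<close>

section \<open>Homomorphisms, submodules and direct sums\<close>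

text \<open>Only the module D \<Lambda> is constructed, not the functor D, so nothing is transported
  by duality: dual statements are proved again with arrows reversed. Modules arise on many carrier
  types (submodules, cosets, tuples, functions), but quantification over modules is possible only
  over \<open>'a fgmod\<close>. Hence direct summands are treated as retracts, pairs of maps with
  \<open>p (i x) = x\<close>, which compose across types, and modules are moved to
  \<open>'a fgmod\<close> by isomorphic copies. The Krull-Schmidt theorem is used without cancelling
  summands: an indecomposable retract of a sum is a retract of one term, and repeated summands are
  excluded by \<open>retract_two_copies\<close>. Both rest on Fitting's lemma, which needs ascending
  and descending chains to stop, whereas the definition of an artin algebra gives only the
  descending condition on ideals of \<open>K\<close>; so artinian commutative rings must be shown
  noetherian. An idempotent of a cosyzygy \<open>E / P\<close> lifts only to some endomorphism of
  \<open>E\<close>; its restriction to the indecomposable \<open>P\<close> is bijective or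
  nilpotent, and essentiality of \<open>P\<close> decides both cases.\<close>

locale base_ring =
  fixes R :: "('a, 'r) ring_scheme" (structure)
begin

abbreviation lm :: "('a, 'm) module \<Rightarrow> bool" where "lm M \<equiv> left_module R M"
abbreviation fg :: "('a, 'm) module \<Rightarrow> bool" where "fg M \<equiv> fg_module R M"
abbreviation Hom :: "('a, 'm) module \<Rightarrow> ('a, 'n) module \<Rightarrow> ('m \<Rightarrow> 'n) set" where "Hom M N \<equiv> mod_hom R M N"
abbreviation sm :: "'m set \<Rightarrow> ('a, 'm) module \<Rightarrow> bool" where "sm N M \<equiv> submodule N R M"
abbreviation miso :: "('a, 'm) module \<Rightarrow> ('a, 'n) module \<Rightarrow> bool" (infix \<open>\<simeq>\<close> 50) where "M \<simeq> N \<equiv> mod_iso R M N"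
abbreviation sub :: "('a, 'm) module \<Rightarrow> 'm set \<Rightarrow> ('a, 'm) module" where "sub M N \<equiv> M\<lparr>carrier := N\<rparr>"

section \<open>Arithmetic in left modules\<close>

lemma fg_lm [simp]: "fg M \<Longrightarrow> lm M"
  by (simp add: fg_module_def)

lemma lm_group: "lm M \<Longrightarrow> abelian_group M"
  by (simp add: left_module_def)

lemma lm_add [simp]: "\<lbrakk>lm M; x \<in> carrier M; y \<in> carrier M\<rbrakk> \<Longrightarrow> x \<oplus>\<^bsub>M\<^esub> y \<in> carrier M"
  and lm_zero [simp]: "lm M \<Longrightarrow> \<zero>\<^bsub>M\<^esub> \<in> carrier M"
  and lm_neg [simp]: "\<lbrakk>lm M; x \<in> carrier M\<rbrakk> \<Longrightarrow> \<ominus>\<^bsub>M\<^esub> x \<in> carrier M"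
  and lm_minus [simp]: "\<lbrakk>lm M; x \<in> carrier M; y \<in> carrier M\<rbrakk> \<Longrightarrow> x \<ominus>\<^bsub>M\<^esub> y \<in> carrier M"
  and lm_smult [simp]: "\<lbrakk>lm M; a \<in> carrier R; x \<in> carrier M\<rbrakk> \<Longrightarrow> a \<odot>\<^bsub>M\<^esub> x \<in> carrier M"
  and lm_l_zero [simp]: "\<lbrakk>lm M; x \<in> carrier M\<rbrakk> \<Longrightarrow> \<zero>\<^bsub>M\<^esub> \<oplus>\<^bsub>M\<^esub> x = x"
  and lm_r_zero [simp]: "\<lbrakk>lm M; x \<in> carrier M\<rbrakk> \<Longrightarrow> x \<oplus>\<^bsub>M\<^esub> \<zero>\<^bsub>M\<^esub> = x"
  and lm_l_neg [simp]: "\<lbrakk>lm M; x \<in> carrier M\<rbrakk> \<Longrightarrow> \<ominus>\<^bsub>M\<^esub> x \<oplus>\<^bsub>M\<^esub> x = \<zero>\<^bsub>M\<^esub>"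
  and lm_r_neg [simp]: "\<lbrakk>lm M; x \<in> carrier M\<rbrakk> \<Longrightarrow> x \<oplus>\<^bsub>M\<^esub> \<ominus>\<^bsub>M\<^esub> x = \<zero>\<^bsub>M\<^esub>"
  and lm_minus_self [simp]: "\<lbrakk>lm M; x \<in> carrier M\<rbrakk> \<Longrightarrow> x \<ominus>\<^bsub>M\<^esub> x = \<zero>\<^bsub>M\<^esub>"
  and lm_minus_add [simp]: "\<lbrakk>lm M; x \<in> carrier M; y \<in> carrier M\<rbrakk> \<Longrightarrow> (x \<ominus>\<^bsub>M\<^esub> y) \<oplus>\<^bsub>M\<^esub> y = x"
  and lm_add_minus [simp]: "\<lbrakk>lm M; x \<in> carrier M; y \<in> carrier M\<rbrakk> \<Longrightarrow> (x \<oplus>\<^bsub>M\<^esub> y) \<ominus>\<^bsub>M\<^esub> y = x"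
  and lm_minus_zero [simp]: "\<lbrakk>lm M; x \<in> carrier M\<rbrakk> \<Longrightarrow> x \<ominus>\<^bsub>M\<^esub> \<zero>\<^bsub>M\<^esub> = x"
  and lm_neg_zero [simp]: "lm M \<Longrightarrow> \<ominus>\<^bsub>M\<^esub> \<zero>\<^bsub>M\<^esub> = \<zero>\<^bsub>M\<^esub>"
  and lm_neg_neg [simp]: "\<lbrakk>lm M; x \<in> carrier M\<rbrakk> \<Longrightarrow> \<ominus>\<^bsub>M\<^esub> (\<ominus>\<^bsub>M\<^esub> x) = x"
  and lm_smult_zero [simp]: "\<lbrakk>lm M; a \<in> carrier R\<rbrakk> \<Longrightarrow> a \<odot>\<^bsub>M\<^esub> \<zero>\<^bsub>M\<^esub> = \<zero>\<^bsub>M\<^esub>"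
  and lm_zero_smult [simp]: "\<lbrakk>lm M; x \<in> carrier M\<rbrakk> \<Longrightarrow> \<zero> \<odot>\<^bsub>M\<^esub> x = \<zero>\<^bsub>M\<^esub>"
  and lm_one_smult [simp]: "\<lbrakk>lm M; x \<in> carrier M\<rbrakk> \<Longrightarrow> \<one> \<odot>\<^bsub>M\<^esub> x = x"
proof -
  show "\<lbrakk>lm M; a \<in> carrier R\<rbrakk> \<Longrightarrow> a \<odot>\<^bsub>M\<^esub> \<zero>\<^bsub>M\<^esub> = \<zero>\<^bsub>M\<^esub>" by (rule left_module.smult_r_null)
  show "\<lbrakk>lm M; x \<in> carrier M\<rbrakk> \<Longrightarrow> \<zero> \<odot>\<^bsub>M\<^esub> x = \<zero>\<^bsub>M\<^esub>" by (rule left_module.smult_l_null)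
  show "\<lbrakk>lm M; x \<in> carrier M\<rbrakk> \<Longrightarrow> \<one> \<odot>\<^bsub>M\<^esub> x = x" by (rule left_module.smult_one)
  show "\<lbrakk>lm M; a \<in> carrier R; x \<in> carrier M\<rbrakk> \<Longrightarrow> a \<odot>\<^bsub>M\<^esub> x \<in> carrier M" by (rule left_module.smult_closed)
next
  assume "lm M"
  then interpret abelian_group M by (rule lm_group)
  show "\<lbrakk>x \<in> carrier M; y \<in> carrier M\<rbrakk> \<Longrightarrow> x \<oplus>\<^bsub>M\<^esub> y \<in> carrier M" by simp
  show "\<zero>\<^bsub>M\<^esub> \<in> carrier M" by simp
  show "x \<in> carrier M \<Longrightarrow> \<ominus>\<^bsub>M\<^esub> x \<in> carrier M" by simp
  show "\<lbrakk>x \<in> carrier M; y \<in> carrier M\<rbrakk> \<Longrightarrow> x \<ominus>\<^bsub>M\<^esub> y \<in> carrier M" by simp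
  show "x \<in> carrier M \<Longrightarrow> \<zero>\<^bsub>M\<^esub> \<oplus>\<^bsub>M\<^esub> x = x" by simp
  show "x \<in> carrier M \<Longrightarrow> x \<oplus>\<^bsub>M\<^esub> \<zero>\<^bsub>M\<^esub> = x" by simp
  show "x \<in> carrier M \<Longrightarrow> \<ominus>\<^bsub>M\<^esub> x \<oplus>\<^bsub>M\<^esub> x = \<zero>\<^bsub>M\<^esub>" by (rule l_neg)
  show "x \<in> carrier M \<Longrightarrow> x \<oplus>\<^bsub>M\<^esub> \<ominus>\<^bsub>M\<^esub> x = \<zero>\<^bsub>M\<^esub>" by (rule r_neg)
  show "x \<in> carrier M \<Longrightarrow> x \<ominus>\<^bsub>M\<^esub> x = \<zero>\<^bsub>M\<^esub>" by (simp add: a_minus_def r_neg)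
  show "\<lbrakk>x \<in> carrier M; y \<in> carrier M\<rbrakk> \<Longrightarrow> (x \<ominus>\<^bsub>M\<^esub> y) \<oplus>\<^bsub>M\<^esub> y = x" by (simp add: a_minus_def a_assoc l_neg)
  show "\<lbrakk>x \<in> carrier M; y \<in> carrier M\<rbrakk> \<Longrightarrow> (x \<oplus>\<^bsub>M\<^esub> y) \<ominus>\<^bsub>M\<^esub> y = x" by (simp add: a_minus_def a_assoc r_neg)
  show "x \<in> carrier M \<Longrightarrow> x \<ominus>\<^bsub>M\<^esub> \<zero>\<^bsub>M\<^esub> = x" by (simp add: a_minus_def)
  show "\<ominus>\<^bsub>M\<^esub> \<zero>\<^bsub>M\<^esub> = \<zero>\<^bsub>M\<^esub>" by simp
  show "x \<in> carrier M \<Longrightarrow> \<ominus>\<^bsub>M\<^esub> (\<ominus>\<^bsub>M\<^esub> x) = x" by simp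
qed

lemma lm_assoc: "\<lbrakk>lm M; x \<in> carrier M; y \<in> carrier M; z \<in> carrier M\<rbrakk> \<Longrightarrow> (x \<oplus>\<^bsub>M\<^esub> y) \<oplus>\<^bsub>M\<^esub> z = x \<oplus>\<^bsub>M\<^esub> (y \<oplus>\<^bsub>M\<^esub> z)"
  and lm_comm: "\<lbrakk>lm M; x \<in> carrier M; y \<in> carrier M\<rbrakk> \<Longrightarrow> x \<oplus>\<^bsub>M\<^esub> y = y \<oplus>\<^bsub>M\<^esub> x"
  and lm_lcomm: "\<lbrakk>lm M; x \<in> carrier M; y \<in> carrier M; z \<in> carrier M\<rbrakk> \<Longrightarrow> x \<oplus>\<^bsub>M\<^esub> (y \<oplus>\<^bsub>M\<^esub> z) = y \<oplus>\<^bsub>M\<^esub> (x \<oplus>\<^bsub>M\<^esub> z)"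
  and lm_neg_add: "\<lbrakk>lm M; x \<in> carrier M; y \<in> carrier M\<rbrakk> \<Longrightarrow> \<ominus>\<^bsub>M\<^esub> (x \<oplus>\<^bsub>M\<^esub> y) = \<ominus>\<^bsub>M\<^esub> x \<oplus>\<^bsub>M\<^esub> \<ominus>\<^bsub>M\<^esub> y"
  and lm_eq_minus: "\<lbrakk>lm M; x \<in> carrier M; y \<in> carrier M\<rbrakk> \<Longrightarrow> x \<ominus>\<^bsub>M\<^esub> y = \<zero>\<^bsub>M\<^esub> \<longleftrightarrow> x = y"
  and lm_neg_unique: "\<lbrakk>lm M; x \<in> carrier M; y \<in> carrier M; x \<oplus>\<^bsub>M\<^esub> y = \<zero>\<^bsub>M\<^esub>\<rbrakk> \<Longrightarrow> x = \<ominus>\<^bsub>M\<^esub> y"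
proof -
  assume "lm M"
  then interpret abelian_group M by (rule lm_group)
  show "\<lbrakk>x \<in> carrier M; y \<in> carrier M; z \<in> carrier M\<rbrakk> \<Longrightarrow> (x \<oplus>\<^bsub>M\<^esub> y) \<oplus>\<^bsub>M\<^esub> z = x \<oplus>\<^bsub>M\<^esub> (y \<oplus>\<^bsub>M\<^esub> z)" by (rule a_assoc)
  show "\<lbrakk>x \<in> carrier M; y \<in> carrier M\<rbrakk> \<Longrightarrow> x \<oplus>\<^bsub>M\<^esub> y = y \<oplus>\<^bsub>M\<^esub> x" by (rule a_comm)
  show "\<lbrakk>x \<in> carrier M; y \<in> carrier M; z \<in> carrier M\<rbrakk> \<Longrightarrow> x \<oplus>\<^bsub>M\<^esub> (y \<oplus>\<^bsub>M\<^esub> z) = y \<oplus>\<^bsub>M\<^esub> (x \<oplus>\<^bsub>M\<^esub> z)" by (rule a_lcomm)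
  show "\<lbrakk>x \<in> carrier M; y \<in> carrier M\<rbrakk> \<Longrightarrow> \<ominus>\<^bsub>M\<^esub> (x \<oplus>\<^bsub>M\<^esub> y) = \<ominus>\<^bsub>M\<^esub> x \<oplus>\<^bsub>M\<^esub> \<ominus>\<^bsub>M\<^esub> y" by (rule minus_add)
  show "\<lbrakk>x \<in> carrier M; y \<in> carrier M\<rbrakk> \<Longrightarrow> x \<ominus>\<^bsub>M\<^esub> y = \<zero>\<^bsub>M\<^esub> \<longleftrightarrow> x = y" by (simp add: a_minus_def) (metis minus_equality minus_minus r_neg a_inv_closed)
  show "\<lbrakk>x \<in> carrier M; y \<in> carrier M; x \<oplus>\<^bsub>M\<^esub> y = \<zero>\<^bsub>M\<^esub>\<rbrakk> \<Longrightarrow> x = \<ominus>\<^bsub>M\<^esub> y" by (simp add: minus_equality)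
qed

lemmas lm_ac = lm_assoc lm_comm lm_lcomm

lemma lm_smult_l_distr: "\<lbrakk>lm M; a \<in> carrier R; b \<in> carrier R; x \<in> carrier M\<rbrakk> \<Longrightarrow> (a \<oplus> b) \<odot>\<^bsub>M\<^esub> x = a \<odot>\<^bsub>M\<^esub> x \<oplus>\<^bsub>M\<^esub> b \<odot>\<^bsub>M\<^esub> x"
  and lm_smult_r_distr: "\<lbrakk>lm M; a \<in> carrier R; x \<in> carrier M; y \<in> carrier M\<rbrakk> \<Longrightarrow> a \<odot>\<^bsub>M\<^esub> (x \<oplus>\<^bsub>M\<^esub> y) = a \<odot>\<^bsub>M\<^esub> x \<oplus>\<^bsub>M\<^esub> a \<odot>\<^bsub>M\<^esub> y"
  and lm_smult_assoc: "\<lbrakk>lm M; a \<in> carrier R; b \<in> carrier R; x \<in> carrier M\<rbrakk> \<Longrightarrow> (a \<otimes> b) \<odot>\<^bsub>M\<^esub> x = a \<odot>\<^bsub>M\<^esub> (b \<odot>\<^bsub>M\<^esub> x)"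
  by (auto simp: left_module.smult_l_distr left_module.smult_r_distr left_module.smult_assoc)

lemma lm_ring: "lm M \<Longrightarrow> ring R"
  by (simp add: left_module_def)

lemma lm_smult_neg: "\<lbrakk>lm M; a \<in> carrier R; x \<in> carrier M\<rbrakk> \<Longrightarrow> a \<odot>\<^bsub>M\<^esub> (\<ominus>\<^bsub>M\<^esub> x) = \<ominus>\<^bsub>M\<^esub> (a \<odot>\<^bsub>M\<^esub> x)"
  by (rule lm_neg_unique) (auto simp flip: lm_smult_r_distr)

lemma lmI:
  assumes "ring R" "abelian_group M"
    and "\<And>a x. \<lbrakk>a \<in> carrier R; x \<in> carrier M\<rbrakk> \<Longrightarrow> a \<odot>\<^bsub>M\<^esub> x \<in> carrier M"
    and "\<And>a b x. \<lbrakk>a \<in> carrier R; b \<in> carrier R; x \<in> carrier M\<rbrakk> \<Longrightarrow> (a \<oplus> b) \<odot>\<^bsub>M\<^esub> x = a \<odot>\<^bsub>M\<^esub> x \<oplus>\<^bsub>M\<^esub> b \<odot>\<^bsub>M\<^esub> x"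
    and "\<And>a x y. \<lbrakk>a \<in> carrier R; x \<in> carrier M; y \<in> carrier M\<rbrakk> \<Longrightarrow> a \<odot>\<^bsub>M\<^esub> (x \<oplus>\<^bsub>M\<^esub> y) = a \<odot>\<^bsub>M\<^esub> x \<oplus>\<^bsub>M\<^esub> a \<odot>\<^bsub>M\<^esub> y"
    and "\<And>a b x. \<lbrakk>a \<in> carrier R; b \<in> carrier R; x \<in> carrier M\<rbrakk> \<Longrightarrow> (a \<otimes> b) \<odot>\<^bsub>M\<^esub> x = a \<odot>\<^bsub>M\<^esub> (b \<odot>\<^bsub>M\<^esub> x)"
    and "\<And>x. x \<in> carrier M \<Longrightarrow> \<one> \<odot>\<^bsub>M\<^esub> x = x"
  shows "lm M"
  unfolding left_module_def left_module_axioms_def using assms by blast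

section \<open>Module homomorphisms\<close>

lemma HomI:
  assumes "\<And>x. x \<in> carrier M \<Longrightarrow> f x \<in> carrier N"
    and "\<And>x y. \<lbrakk>x \<in> carrier M; y \<in> carrier M\<rbrakk> \<Longrightarrow> f (x \<oplus>\<^bsub>M\<^esub> y) = f x \<oplus>\<^bsub>N\<^esub> f y"
    and "\<And>a x. \<lbrakk>a \<in> carrier R; x \<in> carrier M\<rbrakk> \<Longrightarrow> f (a \<odot>\<^bsub>M\<^esub> x) = a \<odot>\<^bsub>N\<^esub> f x"
  shows "f \<in> Hom M N"
  using assms by (auto simp: mod_hom_def)

lemma Hom_simps:
  assumes "f \<in> Hom M N"
  shows "x \<in> carrier M \<Longrightarrow> f x \<in> carrier N"
    and "\<lbrakk>x \<in> carrier M; y \<in> carrier M\<rbrakk> \<Longrightarrow> f (x \<oplus>\<^bsub>M\<^esub> y) = f x \<oplus>\<^bsub>N\<^esub> f y"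
    and "\<lbrakk>a \<in> carrier R; x \<in> carrier M\<rbrakk> \<Longrightarrow> f (a \<odot>\<^bsub>M\<^esub> x) = a \<odot>\<^bsub>N\<^esub> f x"
  using assms by (auto simp: mod_hom_def)

lemma Hom_closed: "\<lbrakk>f \<in> Hom M N; x \<in> carrier M\<rbrakk> \<Longrightarrow> f x \<in> carrier N"
  by (auto simp: mod_hom_def)

lemma Hom_zero: assumes "f \<in> Hom M N" "lm M" "lm N" shows "f \<zero>\<^bsub>M\<^esub> = \<zero>\<^bsub>N\<^esub>"
  using Hom_simps(3)[OF assms(1), of \<zero> "\<zero>\<^bsub>M\<^esub>"] assms lm_ring[OF assms(2)]
  by (simp add: Hom_simps(1)[OF assms(1)] ring.ring_simprules)

lemma Hom_neg: assumes "f \<in> Hom M N" "lm M" "lm N" "x \<in> carrier M" shows "f (\<ominus>\<^bsub>M\<^esub> x) = \<ominus>\<^bsub>N\<^esub> f x"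
  using assms by (intro lm_neg_unique) (auto simp: Hom_simps(1)[OF assms(1)] Hom_zero simp flip: Hom_simps(2)[OF assms(1)])

lemma Hom_minus: assumes "f \<in> Hom M N" "lm M" "lm N" "x \<in> carrier M" "y \<in> carrier M"
  shows "f (x \<ominus>\<^bsub>M\<^esub> y) = f x \<ominus>\<^bsub>N\<^esub> f y"
  using assms by (simp add: a_minus_def Hom_neg Hom_simps(2)[OF assms(1)])

lemmas Hom_all = Hom_simps Hom_zero Hom_neg Hom_minus

lemma Hom_id: "(\<lambda>x. x) \<in> Hom M M"
  by (rule HomI) auto

lemma Hom_comp: assumes "f \<in> Hom L M" "g \<in> Hom M N" shows "(\<lambda>x. g (f x)) \<in> Hom L N"
  by (rule HomI) (auto simp: Hom_simps[OF assms(1)] Hom_simps[OF assms(2)])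

lemma Hom_const_zero: "lm N \<Longrightarrow> (\<lambda>x. \<zero>\<^bsub>N\<^esub>) \<in> Hom M N"
  by (rule HomI) auto

lemma Hom_add: assumes "f \<in> Hom M N" "g \<in> Hom M N" "lm N" shows "(\<lambda>x. f x \<oplus>\<^bsub>N\<^esub> g x) \<in> Hom M N"
  using assms(3)
  by (intro HomI) (auto simp: Hom_simps[OF assms(1)] Hom_simps[OF assms(2)] lm_smult_r_distr lm_ac)

lemma Hom_neg_fun: assumes "f \<in> Hom M N" "lm N" shows "(\<lambda>x. \<ominus>\<^bsub>N\<^esub> f x) \<in> Hom M N"
  using assms(2) by (intro HomI) (auto simp: Hom_simps[OF assms(1)] lm_smult_neg lm_neg_add)

lemma Hom_diff: assumes "f \<in> Hom M N" "g \<in> Hom M N" "lm N" shows "(\<lambda>x. f x \<ominus>\<^bsub>N\<^esub> g x) \<in> Hom M N"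
  unfolding a_minus_def by (intro Hom_add Hom_neg_fun assms)

lemma Hom_cong: assumes "f \<in> Hom M N" "\<And>x. x \<in> carrier M \<Longrightarrow> f x = g x" "lm M" shows "g \<in> Hom M N"
proof (rule HomI)
  fix x y assume "x \<in> carrier M" "y \<in> carrier M"
  with assms(3) show "g (x \<oplus>\<^bsub>M\<^esub> y) = g x \<oplus>\<^bsub>N\<^esub> g y" by (simp flip: assms(2) add: Hom_simps[OF assms(1)])
qed (use assms(3) in \<open>auto simp flip: assms(2) simp: Hom_simps[OF assms(1)]\<close>)

lemma mono_iff: assumes "lm M" "lm N"
  shows "mod_mono R M N f \<longleftrightarrow> f \<in> Hom M N \<and> (\<forall>x\<in>carrier M. f x = \<zero>\<^bsub>N\<^esub> \<longrightarrow> x = \<zero>\<^bsub>M\<^esub>)"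
proof -
  have "inj_on f (carrier M)" if f: "f \<in> Hom M N" and z: "\<forall>x\<in>carrier M. f x = \<zero>\<^bsub>N\<^esub> \<longrightarrow> x = \<zero>\<^bsub>M\<^esub>"
  proof (rule inj_onI)
    fix x y assume xy: "x \<in> carrier M" "y \<in> carrier M" "f x = f y"
    then have "f (x \<ominus>\<^bsub>M\<^esub> y) = \<zero>\<^bsub>N\<^esub>" using assms by (simp add: Hom_minus[OF f] Hom_closed[OF f])
    with z xy assms show "x = y" by (metis lm_eq_minus lm_minus)
  qed
  moreover have "x = \<zero>\<^bsub>M\<^esub>" if "f \<in> Hom M N" "inj_on f (carrier M)" "x \<in> carrier M" "f x = \<zero>\<^bsub>N\<^esub>" for x
    using that assms by (metis Hom_zero inj_onD lm_zero)
  ultimately show ?thesis by (auto simp: mod_mono_def)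
qed

lemma mono_comp: "\<lbrakk>mod_mono R L M f; mod_mono R M N g\<rbrakk> \<Longrightarrow> mod_mono R L N (\<lambda>x. g (f x))"
  by (auto simp: mod_mono_def Hom_comp inj_on_def Hom_closed)

lemma epi_comp: assumes "mod_epi R L M f" "mod_epi R M N g" shows "mod_epi R L N (\<lambda>x. g (f x))"
  using assms Hom_comp[of f L M g N] by (simp add: mod_epi_def image_image[of g f, symmetric])

lemma ker_iff: "x \<in> a_kernel M N f \<longleftrightarrow> x \<in> carrier M \<and> f x = \<zero>\<^bsub>N\<^esub>"
  by (auto simp: a_kernel_def kernel_def)

section \<open>Submodules, also as modules in their own right\<close>

lemma smI:
  assumes "lm M" "N \<subseteq> carrier M" "\<zero>\<^bsub>M\<^esub> \<in> N"
    and "\<And>x y. \<lbrakk>x \<in> N; y \<in> N\<rbrakk> \<Longrightarrow> x \<oplus>\<^bsub>M\<^esub> y \<in> N"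
    and "\<And>a x. \<lbrakk>a \<in> carrier R; x \<in> N\<rbrakk> \<Longrightarrow> a \<odot>\<^bsub>M\<^esub> x \<in> N"
  shows "sm N M"
  using assms by (intro left_module.submodule_carrierI) auto

lemma sm_simps:
  assumes "sm N M"
  shows "\<zero>\<^bsub>M\<^esub> \<in> N" "\<lbrakk>x \<in> N; y \<in> N\<rbrakk> \<Longrightarrow> x \<oplus>\<^bsub>M\<^esub> y \<in> N" "\<lbrakk>a \<in> carrier R; x \<in> N\<rbrakk> \<Longrightarrow> a \<odot>\<^bsub>M\<^esub> x \<in> N"
    "x \<in> N \<Longrightarrow> \<ominus>\<^bsub>M\<^esub> x \<in> N" "\<lbrakk>x \<in> N; y \<in> N\<rbrakk> \<Longrightarrow> x \<ominus>\<^bsub>M\<^esub> y \<in> N"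
proof -
  interpret submodule N R M by (rule assms)
  show 0: "\<zero>\<^bsub>M\<^esub> \<in> N" "\<lbrakk>x \<in> N; y \<in> N\<rbrakk> \<Longrightarrow> x \<oplus>\<^bsub>M\<^esub> y \<in> N" "\<lbrakk>a \<in> carrier R; x \<in> N\<rbrakk> \<Longrightarrow> a \<odot>\<^bsub>M\<^esub> x \<in> N" for x y
    using one_closed m_closed by auto
  show n: "x \<in> N \<Longrightarrow> \<ominus>\<^bsub>M\<^esub> x \<in> N" for x using m_inv_closed by (simp add: a_inv_def)
  show "\<lbrakk>x \<in> N; y \<in> N\<rbrakk> \<Longrightarrow> x \<ominus>\<^bsub>M\<^esub> y \<in> N" using n 0 by (simp add: a_minus_def)
qed

lemma sm_subset: "sm N M \<Longrightarrow> N \<subseteq> carrier M"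
  using submodule.axioms(1) subgroup.subset by fastforce

lemma sm_mem: "\<lbrakk>sm N M; x \<in> N\<rbrakk> \<Longrightarrow> x \<in> carrier M"
  using sm_subset by blast

lemma sm_carrier: "lm M \<Longrightarrow> sm (carrier M) M"
  by (rule smI) auto

lemma sm_zero: "lm M \<Longrightarrow> sm {\<zero>\<^bsub>M\<^esub>} M"
  by (rule smI) auto

lemma sm_Int: "\<lbrakk>lm M; sm N M; sm L M\<rbrakk> \<Longrightarrow> sm (N \<inter> L) M"
  using sm_subset[of N M] by (intro smI) (auto simp: sm_simps)

lemma sm_ker: assumes "f \<in> Hom M N" "lm M" "lm N" shows "sm (a_kernel M N f) M"
  using assms(2,3) by (intro smI) (auto simp: ker_iff Hom_all[OF assms(1)])

lemma sm_image: assumes "f \<in> Hom M N" "lm M" "lm N" "sm L M" shows "sm (f ` L) N"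
proof (rule smI)
  have L: "\<And>x. x \<in> L \<Longrightarrow> x \<in> carrier M" using sm_mem[OF assms(4)] .
  show "f ` L \<subseteq> carrier N" using L Hom_closed[OF assms(1)] by auto
  show "\<zero>\<^bsub>N\<^esub> \<in> f ` L" using Hom_zero[OF assms(1-3)] sm_simps(1)[OF assms(4)] by (metis imageI)
  show "x \<oplus>\<^bsub>N\<^esub> y \<in> f ` L" if "x \<in> f ` L" "y \<in> f ` L" for x y
    using that L sm_simps(2)[OF assms(4)] by (auto simp flip: Hom_simps(2)[OF assms(1)])
  show "a \<odot>\<^bsub>N\<^esub> x \<in> f ` L" if "a \<in> carrier R" "x \<in> f ` L" for a x
    using that L sm_simps(3)[OF assms(4)] by (auto simp flip: Hom_simps(3)[OF assms(1)])
qed (rule assms)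

lemma sm_img: "\<lbrakk>f \<in> Hom M N; lm M; lm N\<rbrakk> \<Longrightarrow> sm (f ` carrier M) N"
  by (rule sm_image) (auto simp: sm_carrier)

lemma sm_vimage: assumes "f \<in> Hom M N" "lm M" "lm N" "sm L N" shows "sm {x \<in> carrier M. f x \<in> L} M"
  using assms(2,3) by (intro smI) (auto simp: Hom_all[OF assms(1)] sm_simps[OF assms(4)])

lemma set_add_iff: "x \<in> L <+>\<^bsub>M\<^esub> N \<longleftrightarrow> (\<exists>u\<in>L. \<exists>v\<in>N. x = u \<oplus>\<^bsub>M\<^esub> v)"
  by (auto simp: set_add_def')

lemma sm_add: assumes "lm M" "sm L M" "sm N M" shows "sm (L <+>\<^bsub>M\<^esub> N) M"
proof (rule smI)
  have L: "\<And>x. x \<in> L \<Longrightarrow> x \<in> carrier M" and N: "\<And>x. x \<in> N \<Longrightarrow> x \<in> carrier M"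
    using sm_mem[OF assms(2)] sm_mem[OF assms(3)] by auto
  show "L <+>\<^bsub>M\<^esub> N \<subseteq> carrier M" using L N assms(1) by (auto simp: set_add_iff)
  show "\<zero>\<^bsub>M\<^esub> \<in> L <+>\<^bsub>M\<^esub> N" using assms(1) sm_simps(1)[OF assms(2)] sm_simps(1)[OF assms(3)]
    by (auto simp: set_add_iff intro!: bexI[of _ "\<zero>\<^bsub>M\<^esub>"])
  show "x \<oplus>\<^bsub>M\<^esub> y \<in> L <+>\<^bsub>M\<^esub> N" if xy: "x \<in> L <+>\<^bsub>M\<^esub> N" "y \<in> L <+>\<^bsub>M\<^esub> N" for x y
  proof -
    obtain u v u' v' where "u \<in> L" "v \<in> N" "x = u \<oplus>\<^bsub>M\<^esub> v" "u' \<in> L" "v' \<in> N" "y = u' \<oplus>\<^bsub>M\<^esub> v'"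
      using xy by (auto simp: set_add_iff)
    then show ?thesis using assms L N unfolding set_add_iff
      by (intro bexI[of _ "u \<oplus>\<^bsub>M\<^esub> u'"] bexI[of _ "v \<oplus>\<^bsub>M\<^esub> v'"]) (auto simp: sm_simps lm_ac)
  qed
  show "a \<odot>\<^bsub>M\<^esub> x \<in> L <+>\<^bsub>M\<^esub> N" if ax: "a \<in> carrier R" "x \<in> L <+>\<^bsub>M\<^esub> N" for a x
  proof -
    obtain u v where "u \<in> L" "v \<in> N" "x = u \<oplus>\<^bsub>M\<^esub> v" using ax by (auto simp: set_add_iff)
    then show ?thesis using assms L N ax unfolding set_add_iff
      by (intro bexI[of _ "a \<odot>\<^bsub>M\<^esub> u"] bexI[of _ "a \<odot>\<^bsub>M\<^esub> v"]) (auto simp: sm_simps lm_smult_r_distr)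
  qed
qed (rule assms)

lemma sm_addI1: "\<lbrakk>lm M; sm L M; sm N M; x \<in> L\<rbrakk> \<Longrightarrow> x \<in> L <+>\<^bsub>M\<^esub> N"
  unfolding set_add_iff by (intro bexI[of _ x] bexI[of _ "\<zero>\<^bsub>M\<^esub>"]) (auto simp: sm_simps sm_mem)

lemma sm_addI2: "\<lbrakk>lm M; sm L M; sm N M; x \<in> N\<rbrakk> \<Longrightarrow> x \<in> L <+>\<^bsub>M\<^esub> N"
  unfolding set_add_iff by (intro bexI[of _ "\<zero>\<^bsub>M\<^esub>"] bexI[of _ x]) (auto simp: sm_simps sm_mem)

lemma lm_sub: assumes "lm M" "sm N M" shows "lm (sub M N)"
proof (rule lmI)
  note lm = assms(1) and sm_simps[OF assms(2), simp] and sm_mem[OF assms(2), simp]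
  show "abelian_group (sub M N)"
  proof (rule abelian_groupI)
    show "\<exists>y\<in>carrier (sub M N). y \<oplus>\<^bsub>sub M N\<^esub> x = \<zero>\<^bsub>sub M N\<^esub>" if "x \<in> carrier (sub M N)" for x
      using that lm by (intro bexI[of _ "\<ominus>\<^bsub>M\<^esub> x"]) auto
    show "x \<oplus>\<^bsub>sub M N\<^esub> y \<oplus>\<^bsub>sub M N\<^esub> z = x \<oplus>\<^bsub>sub M N\<^esub> (y \<oplus>\<^bsub>sub M N\<^esub> z)"
      if "x \<in> carrier (sub M N)" "y \<in> carrier (sub M N)" "z \<in> carrier (sub M N)" for x y z
      using that lm by (simp add: lm_assoc)
    show "x \<oplus>\<^bsub>sub M N\<^esub> y = y \<oplus>\<^bsub>sub M N\<^esub> x"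
      if "x \<in> carrier (sub M N)" "y \<in> carrier (sub M N)" for x y
      using that lm by (simp add: lm_comm)
  qed (use lm in simp_all)
qed (use assms sm_mem[OF assms(2)] lm_ring[OF assms(1)] in
    \<open>simp_all add: sm_simps[OF assms(2)] lm_smult_l_distr lm_smult_r_distr lm_smult_assoc\<close>)

lemma Hom_sub: "\<lbrakk>lm M; sm N M\<rbrakk> \<Longrightarrow> (\<lambda>x. x) \<in> Hom (sub M N) M"
  by (rule HomI) (auto simp: sm_mem)

lemma Hom_sub_from: "\<lbrakk>f \<in> Hom M L; sm N M\<rbrakk> \<Longrightarrow> f \<in> Hom (sub M N) L"
  using sm_mem[of N M] by (auto simp: mod_hom_def)

lemma Hom_sub_to: "\<lbrakk>f \<in> Hom L M; f ` carrier L \<subseteq> N\<rbrakk> \<Longrightarrow> f \<in> Hom L (sub M N)"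
  by (auto simp: mod_hom_def)

lemma sm_sub_iff: assumes "lm M" "sm N M" shows "sm L (sub M N) \<longleftrightarrow> sm L M \<and> L \<subseteq> N"
proof
  assume L: "sm L (sub M N)"
  have "L \<subseteq> N" using sm_subset[OF L] by simp
  moreover have "sm L M"
    using sm_simps[OF L] assms(1) sm_subset[OF assms(2)] calculation by (intro smI) auto
  ultimately show "sm L M \<and> L \<subseteq> N" by blast
next
  assume "sm L M \<and> L \<subseteq> N"
  then show "sm L (sub M N)" using assms
    using sm_subset[of N M] by (intro smI[OF lm_sub]) (auto simp: sm_simps)
qed

end

context base_ring
begin

section \<open>Isomorphisms\<close>

lemma misoI:
  assumes "f \<in> Hom M N" "\<And>y. y \<in> carrier N \<Longrightarrow> g y \<in> carrier M"
    and "\<And>x. x \<in> carrier M \<Longrightarrow> g (f x) = x" "\<And>y. y \<in> carrier N \<Longrightarrow> f (g y) = y"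
  shows "M \<simeq> N"
proof -
  have "bij_betw f (carrier M) (carrier N)"
    by (rule bij_betwI[of _ _ _ g]) (use assms Hom_closed in auto)
  with assms(1) show ?thesis by (auto simp: mod_iso_def)
qed

lemma miso_inv:
  assumes "f \<in> Hom M N" "bij_betw f (carrier M) (carrier N)" "lm M"
  obtains g where "g \<in> Hom N M" "\<And>x. x \<in> carrier M \<Longrightarrow> g (f x) = x" "\<And>y. y \<in> carrier N \<Longrightarrow> f (g y) = y"
    "bij_betw g (carrier N) (carrier M)"
proof -
  define g where "g = the_inv_into (carrier M) f"
  have inj: "inj_on f (carrier M)" and img: "f ` carrier M = carrier N"
    using assms(2) by (auto simp: bij_betw_def)
  have gf: "g (f x) = x" if "x \<in> carrier M" for x using the_inv_into_f_f[OF inj that] by (simp add: g_def)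
  have N: "\<exists>x\<in>carrier M. y = f x" if "y \<in> carrier N" for y using that img by blast
  have "g \<in> Hom N M"
  proof (rule HomI)
    show "g y \<in> carrier M" if "y \<in> carrier N" for y using N[OF that] gf by auto
    show "g (x \<oplus>\<^bsub>N\<^esub> y) = g x \<oplus>\<^bsub>M\<^esub> g y" if "x \<in> carrier N" "y \<in> carrier N" for x y
      using N[OF that(1)] N[OF that(2)] assms(3) by (auto simp: gf simp flip: Hom_simps(2)[OF assms(1)])
    show "g (a \<odot>\<^bsub>N\<^esub> x) = a \<odot>\<^bsub>M\<^esub> g x" if "a \<in> carrier R" "x \<in> carrier N" for a x
      using N[OF that(2)] that(1) assms(3) by (auto simp: gf simp flip: Hom_simps(3)[OF assms(1)])
  qed
  moreover have fg: "f (g y) = y" if "y \<in> carrier N" for y using N[OF that] gf by auto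
  moreover have "bij_betw g (carrier N) (carrier M)" 
    by (rule bij_betwI[of _ _ _ f]) (use gf fg Hom_closed[OF calculation(1)] Hom_closed[OF assms(1)] in auto)
  ultimately show ?thesis using that[of g] gf by blast
qed

lemma misoE:
  assumes "M \<simeq> N" "lm M"
  obtains f g where "f \<in> Hom M N" "g \<in> Hom N M" "\<And>x. x \<in> carrier M \<Longrightarrow> g (f x) = x"
    "\<And>y. y \<in> carrier N \<Longrightarrow> f (g y) = y" "bij_betw f (carrier M) (carrier N)"
  using assms miso_inv unfolding mod_iso_def by metis

lemma miso_refl: "M \<simeq> M"
  by (rule misoI[OF Hom_id]) auto

lemma miso_sym: assumes "M \<simeq> N" "lm M" shows "N \<simeq> M"
proof -
  obtain f g where fg: "f \<in> Hom M N" "g \<in> Hom N M" "\<And>x. x \<in> carrier M \<Longrightarrow> g (f x) = x"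
    "\<And>y. y \<in> carrier N \<Longrightarrow> f (g y) = y" using misoE[OF assms] by metis
  show ?thesis by (rule misoI[OF fg(2), of f]) (use fg Hom_closed[OF fg(1)] in auto)
qed

lemma miso_trans [trans]: assumes "L \<simeq> M" "M \<simeq> N" shows "L \<simeq> N"
proof -
  obtain f g where fg: "f \<in> Hom L M" "bij_betw f (carrier L) (carrier M)" "g \<in> Hom M N" "bij_betw g (carrier M) (carrier N)"
    using assms by (auto simp: mod_iso_def)
  show ?thesis unfolding mod_iso_def
    using bij_betw_trans[OF fg(2) fg(4)] Hom_comp[OF fg(1) fg(3)] by (auto simp: comp_def)
qed

lemma miso_bij: "\<lbrakk>f \<in> Hom M N; bij_betw f (carrier M) (carrier N)\<rbrakk> \<Longrightarrow> M \<simeq> N"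
  by (auto simp: mod_iso_def)

subsection \<open>Retracts\<close>

text \<open>Direct summand up to isomorphism, said with maps only: the carriers may have different
  types and transitivity is composition. Where a complement has to be named it is the kernel of
  \<open>p\<close>, as in \<open>retract_add_cat\<close>.\<close>

definition retract :: "('a, 'm) module \<Rightarrow> ('a, 'n) module \<Rightarrow> bool" where
  "retract X M \<longleftrightarrow> (\<exists>i\<in>Hom X M. \<exists>p\<in>Hom M X. \<forall>x\<in>carrier X. p (i x) = x)"

lemma retractI: "\<lbrakk>i \<in> Hom X M; p \<in> Hom M X; \<And>x. x \<in> carrier X \<Longrightarrow> p (i x) = x\<rbrakk> \<Longrightarrow> retract X M"
  by (auto simp: retract_def)

lemma retractE:
  assumes "retract X M"
  obtains i p where "i \<in> Hom X M" "p \<in> Hom M X" "\<And>x. x \<in> carrier X \<Longrightarrow> p (i x) = x"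
  using assms by (auto simp: retract_def)

lemma retract_trans: assumes "retract L M" "retract M N" shows "retract L N"
proof -
  obtain i p where 1: "i \<in> Hom L M" "p \<in> Hom M L" "\<And>x. x \<in> carrier L \<Longrightarrow> p (i x) = x"
    using retractE[OF assms(1)] by blast
  obtain j q where 2: "j \<in> Hom M N" "q \<in> Hom N M" "\<And>x. x \<in> carrier M \<Longrightarrow> q (j x) = x"
    using retractE[OF assms(2)] by blast
  show ?thesis
    by (rule retractI[OF Hom_comp[OF 1(1) 2(1)] Hom_comp[OF 2(2) 1(2)]]) (use 1 2 Hom_closed[OF 1(1)] in auto)
qed

lemma miso_retract: assumes "M \<simeq> N" "lm M" shows "retract M N"
  by (rule misoE[OF assms], rule retractI)

lemma retract_miso: assumes "M \<simeq> N" "lm M" shows "retract N M"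
  by (rule misoE[OF assms], rule retractI)

subsection \<open>Factorisation\<close>

text \<open>Compose \<open>f\<close> with a set-theoretic section \<open>s\<close> of
  \<open>p\<close>. The section itself is not additive, but \<open>f\<close> is constant on the
  fibres of \<open>p\<close>, whose differences lie in the kernel; so the composite is a
  homomorphism.\<close>

lemma factor_epi:
  assumes "mod_epi R M C p" "f \<in> Hom M X" "lm M" "lm C" "lm X"
    and k: "\<And>x. \<lbrakk>x \<in> carrier M; p x = \<zero>\<^bsub>C\<^esub>\<rbrakk> \<Longrightarrow> f x = \<zero>\<^bsub>X\<^esub>"
  obtains g where "g \<in> Hom C X" "\<And>x. x \<in> carrier M \<Longrightarrow> g (p x) = f x"
proof -
  have p: "p \<in> Hom M C" and img: "p ` carrier M = carrier C" using assms(1) by (auto simp: mod_epi_def)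
  define s where "s c = (SOME x. x \<in> carrier M \<and> p x = c)" for c
  have s: "s c \<in> carrier M \<and> p (s c) = c" if "c \<in> carrier C" for c
    unfolding s_def by (rule someI_ex) (use that img[symmetric] in auto)
  have eq: "f x = f y" if "x \<in> carrier M" "y \<in> carrier M" "p x = p y" for x y
    using k[of "x \<ominus>\<^bsub>M\<^esub> y"] that assms(3-5)
    by (simp add: Hom_minus[OF p] Hom_minus[OF assms(2)] Hom_closed[OF p] Hom_closed[OF assms(2)] lm_eq_minus)
  have "(\<lambda>c. f (s c)) \<in> Hom C X"
  proof (rule HomI)
    show "f (s c) \<in> carrier X" if "c \<in> carrier C" for c using s[OF that] Hom_closed[OF assms(2)] by simp
    show "f (s (x \<oplus>\<^bsub>C\<^esub> y)) = f (s x) \<oplus>\<^bsub>X\<^esub> f (s y)" if "x \<in> carrier C" "y \<in> carrier C" for x y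
      using that s[OF that(1)] s[OF that(2)] s[of "x \<oplus>\<^bsub>C\<^esub> y"] assms(3,4)
        eq[of "s (x \<oplus>\<^bsub>C\<^esub> y)" "s x \<oplus>\<^bsub>M\<^esub> s y"]
      by (simp add: Hom_simps[OF p] Hom_simps[OF assms(2)])
    show "f (s (a \<odot>\<^bsub>C\<^esub> x)) = a \<odot>\<^bsub>X\<^esub> f (s x)" if "a \<in> carrier R" "x \<in> carrier C" for a x
      using that s[OF that(2)] s[of "a \<odot>\<^bsub>C\<^esub> x"] assms(3,4) eq[of "s (a \<odot>\<^bsub>C\<^esub> x)" "a \<odot>\<^bsub>M\<^esub> s x"]
      by (simp add: Hom_simps[OF p] Hom_simps[OF assms(2)])
  qed
  moreover have "f (s (p x)) = f x" if "x \<in> carrier M" for x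
    by (rule eq) (use s[OF Hom_closed[OF p that]] that in simp_all)
  ultimately show ?thesis using that by blast
qed

lemma factor_mono:
  assumes "mod_mono R N M j" "f \<in> Hom X M" "lm N" "lm X" "f ` carrier X \<subseteq> j ` carrier N"
  obtains g where "g \<in> Hom X N" "\<And>x. x \<in> carrier X \<Longrightarrow> j (g x) = f x"
proof -
  have j: "j \<in> Hom N M" and inj: "inj_on j (carrier N)" using assms(1) by (auto simp: mod_mono_def)
  define g where "g x = the_inv_into (carrier N) j (f x)" for x
  have g: "g x \<in> carrier N \<and> j (g x) = f x" if x: "x \<in> carrier X" for x
  proof -
    obtain y where "y \<in> carrier N" "f x = j y" using assms(5) x by auto
    then show ?thesis by (simp add: g_def the_inv_into_f_f[OF inj])
  qed
  have eq: "x = y" if "x \<in> carrier N" "y \<in> carrier N" "j x = j y" for x y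
    using inj that by (auto simp: inj_on_def)
  have "g \<in> Hom X N"
  proof (rule HomI)
    show "g x \<in> carrier N" if "x \<in> carrier X" for x using g that by auto
    show "g (x \<oplus>\<^bsub>X\<^esub> y) = g x \<oplus>\<^bsub>N\<^esub> g y" if "x \<in> carrier X" "y \<in> carrier X" for x y
      by (rule eq) (use g that assms(3,4) in \<open>auto simp: Hom_simps[OF j] Hom_simps[OF assms(2)]\<close>)
    show "g (a \<odot>\<^bsub>X\<^esub> x) = a \<odot>\<^bsub>N\<^esub> g x" if "a \<in> carrier R" "x \<in> carrier X" for a x
      by (rule eq) (use g that assms(3,4) in \<open>auto simp: Hom_simps[OF j] Hom_simps[OF assms(2)]\<close>)
  qed
  then show ?thesis using that g by blast
qed

lemma lm_quot:
  assumes "lm M" "sm N M"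
  shows "lm (quot_module M N)" and "mod_epi R M (quot_module M N) (\<lambda>x. a_r_coset M N x)"
    and "a_kernel M (quot_module M N) (\<lambda>x. a_r_coset M N x) = N"
proof -
  interpret M: abelian_group M using lm_group assms(1) .
  interpret N: abelian_subgroup N M
    by (intro abelian_subgroupI3 M.abelian_group_axioms)
      (use assms(2) in \<open>simp_all add: additive_subgroup_def submodule_def\<close>)
  define q where "q = a_r_coset M N"
  let ?Q = "quot_module M N"
  have car: "carrier ?Q = q ` carrier M" by (auto simp: quot_module_def A_RCOSETS_def' q_def)
  have sub: "\<And>x. x \<in> N \<Longrightarrow> x \<in> carrier M" using sm_mem[OF assms(2)] .
  have add: "q x \<oplus>\<^bsub>?Q\<^esub> q y = q (x \<oplus>\<^bsub>M\<^esub> y)" if "x \<in> carrier M" "y \<in> carrier M" for x y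
    using that by (simp add: quot_module_def q_def N.a_rcos_sum)
  have qeq: "q x = q y \<longleftrightarrow> x \<ominus>\<^bsub>M\<^esub> y \<in> N" if "x \<in> carrier M" "y \<in> carrier M" for x y
    unfolding q_def a_minus_def using that N.a_rcos_module[of y x] N.a_rcos_self[of x]
      M.a_repr_independence[of x N y] N.a_subgroup by metis
  have memq: "u \<in> q x \<longleftrightarrow> (\<exists>n\<in>N. u = n \<oplus>\<^bsub>M\<^esub> x)" for u x
    by (auto simp: q_def a_r_coset_def')
  \<comment> \<open>The scalar multiple of a coset is defined as a union of cosets over all its
    elements. They all coincide because \<open>N\<close> is a submodule, so the union is the single
    coset of \<open>a x\<close>.\<close>
  have smult: "a \<odot>\<^bsub>?Q\<^esub> q x = q (a \<odot>\<^bsub>M\<^esub> x)" if a: "a \<in> carrier R" and x: "x \<in> carrier M" for a x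
  proof -
    have "q (a \<odot>\<^bsub>M\<^esub> u) = q (a \<odot>\<^bsub>M\<^esub> x)" if u: "u \<in> q x" for u
    proof -
      obtain n where n: "n \<in> N" "u = n \<oplus>\<^bsub>M\<^esub> x" using u by (auto simp: memq)
      then show ?thesis using a x assms(1) sub[OF n(1)]
        by (subst qeq) (auto simp: lm_smult_r_distr sm_simps[OF assms(2)])
    qed
    moreover have "x \<in> q x" using x N.a_rcos_self by (simp add: q_def)
    moreover have "a \<odot>\<^bsub>?Q\<^esub> q x = (\<Union>u\<in>q x. q (a \<odot>\<^bsub>M\<^esub> u))" by (simp add: quot_module_def q_def)
    ultimately show ?thesis by blast
  qed
  have zero: "\<zero>\<^bsub>?Q\<^esub> = q \<zero>\<^bsub>M\<^esub>" using M.a_coset_join2[of _ N] N.a_subgroup sm_simps(1)[OF assms(2)] by (simp add: quot_module_def q_def)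
  show L: "lm ?Q"
  proof (rule lmI)
    show "ring R" by (rule lm_ring[OF assms(1)])
    show "abelian_group ?Q"
    proof (rule abelian_groupI)
      show "\<exists>y\<in>carrier ?Q. y \<oplus>\<^bsub>?Q\<^esub> x = \<zero>\<^bsub>?Q\<^esub>" if "x \<in> carrier ?Q" for x
      proof -
        obtain u where "u \<in> carrier M" "x = q u" using \<open>x \<in> carrier ?Q\<close> by (auto simp: car)
        then show ?thesis by (intro bexI[of _ "q (\<ominus>\<^bsub>M\<^esub> u)"]) (auto simp: add zero car M.l_neg)
      qed
    qed (auto simp: car add zero M.a_ac)
  next
    fix a b x assume "a \<in> carrier R" "b \<in> carrier R" "x \<in> carrier ?Q"
    moreover then obtain u where "u \<in> carrier M" "x = q u" by (auto simp: car)
    ultimately show "(a \<oplus> b) \<odot>\<^bsub>?Q\<^esub> x = a \<odot>\<^bsub>?Q\<^esub> x \<oplus>\<^bsub>?Q\<^esub> b \<odot>\<^bsub>?Q\<^esub> x" "(a \<otimes> b) \<odot>\<^bsub>?Q\<^esub> x = a \<odot>\<^bsub>?Q\<^esub> (b \<odot>\<^bsub>?Q\<^esub> x)"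
      using lm_ring[OF assms(1)] assms(1)
      by (auto simp: add smult ring.ring_simprules lm_smult_l_distr lm_smult_assoc)
  qed (use assms(1) lm_ring[OF assms(1)] in \<open>auto simp: car add smult lm_smult_r_distr ring.ring_simprules\<close>)
  show "mod_epi R M ?Q (\<lambda>x. a_r_coset M N x)"
    unfolding mod_epi_def q_def[symmetric] using car by (auto intro!: HomI simp: add smult)
  show "a_kernel M ?Q (\<lambda>x. a_r_coset M N x) = N"
    unfolding q_def[symmetric] using qeq[of _ "\<zero>\<^bsub>M\<^esub>"] assms(1) sub by (auto simp: ker_iff zero)
qed

lemma quot_exists:
  assumes "lm (M :: ('a,'m) module)" "sm N M"
  obtains C :: "('a,'m set) module" and p where "lm C" "mod_epi R M C p" "a_kernel M C p = N"
  using lm_quot[OF assms] that by blast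

subsection \<open>Direct sums\<close>

notation direct_sum2 (infixr \<open>\<uplus>\<close> 65)

lemma ds2_simps [simp]:
  "carrier (M \<uplus> N) = carrier M \<times> carrier N" "\<zero>\<^bsub>M \<uplus> N\<^esub> = (\<zero>\<^bsub>M\<^esub>, \<zero>\<^bsub>N\<^esub>)"
  "x \<oplus>\<^bsub>M \<uplus> N\<^esub> y = (fst x \<oplus>\<^bsub>M\<^esub> fst y, snd x \<oplus>\<^bsub>N\<^esub> snd y)"
  "a \<odot>\<^bsub>M \<uplus> N\<^esub> x = (a \<odot>\<^bsub>M\<^esub> fst x, a \<odot>\<^bsub>N\<^esub> snd x)"
  by (simp_all add: direct_sum2_def)

lemma lm_ds2 [simp]: assumes "lm M" "lm N" shows "lm (M \<uplus> N)"
proof (rule lmI)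
  show "abelian_group (M \<uplus> N)"
  proof (rule abelian_groupI)
    show "\<exists>y\<in>carrier (M \<uplus> N). y \<oplus>\<^bsub>M \<uplus> N\<^esub> x = \<zero>\<^bsub>M \<uplus> N\<^esub>" if "x \<in> carrier (M \<uplus> N)" for x
      using that assms by (intro bexI[of _ "(\<ominus>\<^bsub>M\<^esub> fst x, \<ominus>\<^bsub>N\<^esub> snd x)"]) auto
  qed (use assms in \<open>auto simp: lm_ac\<close>)
qed (use assms lm_ring[OF assms(1)] in \<open>auto simp: lm_smult_l_distr lm_smult_r_distr lm_smult_assoc\<close>)

lemma Hom_fst: "fst \<in> Hom (M \<uplus> N) M" and Hom_snd: "snd \<in> Hom (M \<uplus> N) N"
  by (auto intro!: HomI)

lemma Hom_inl: "\<lbrakk>lm M; lm N\<rbrakk> \<Longrightarrow> (\<lambda>x. (x, \<zero>\<^bsub>N\<^esub>)) \<in> Hom M (M \<uplus> N)"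
  and Hom_inr: "\<lbrakk>lm M; lm N\<rbrakk> \<Longrightarrow> (\<lambda>x. (\<zero>\<^bsub>M\<^esub>, x)) \<in> Hom N (M \<uplus> N)"
  by (auto intro!: HomI)

lemma Hom_pair: assumes "f \<in> Hom L M" "g \<in> Hom L N" shows "(\<lambda>x. (f x, g x)) \<in> Hom L (M \<uplus> N)"
  using assms by (auto intro!: HomI simp: Hom_simps)

lemma Hom_copair: assumes "f \<in> Hom M L" "g \<in> Hom N L" "lm L"
  shows "(\<lambda>x. f (fst x) \<oplus>\<^bsub>L\<^esub> g (snd x)) \<in> Hom (M \<uplus> N) L"
  using Hom_add[OF Hom_comp[OF Hom_fst assms(1)] Hom_comp[OF Hom_snd assms(2)] assms(3)] .

lemma Hom_map: assumes "f \<in> Hom M M'" "g \<in> Hom N N'" shows "(\<lambda>x. (f (fst x), g (snd x))) \<in> Hom (M \<uplus> N) (M' \<uplus> N')"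
  using Hom_pair[OF Hom_comp[OF Hom_fst assms(1)] Hom_comp[OF Hom_snd assms(2)]] .

lemma retract_ds2_l: "\<lbrakk>lm M; lm N\<rbrakk> \<Longrightarrow> retract M (M \<uplus> N)"
  by (rule retractI[OF Hom_inl Hom_fst]) auto

lemma retract_ds2_r: "\<lbrakk>lm M; lm N\<rbrakk> \<Longrightarrow> retract N (M \<uplus> N)"
  by (rule retractI[OF Hom_inr Hom_snd]) auto

lemma retract_ds2: assumes "retract M M'" "retract N N'" shows "retract (M \<uplus> N) (M' \<uplus> N')"
proof -
  obtain i p where 1: "i \<in> Hom M M'" "p \<in> Hom M' M" "\<And>x. x \<in> carrier M \<Longrightarrow> p (i x) = x"
    using retractE[OF assms(1)] by blast
  obtain j q where 2: "j \<in> Hom N N'" "q \<in> Hom N' N" "\<And>x. x \<in> carrier N \<Longrightarrow> q (j x) = x"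
    using retractE[OF assms(2)] by blast
  show ?thesis
    by (rule retractI[OF Hom_map[OF 1(1) 2(1)] Hom_map[OF 1(2) 2(2)]]) (use 1 2 in auto)
qed

lemma ds2_cong: assumes "M \<simeq> M'" "N \<simeq> N'" "lm M" "lm N" shows "M \<uplus> N \<simeq> M' \<uplus> N'"
proof -
  obtain i p where 1: "i \<in> Hom M M'" "p \<in> Hom M' M" "\<And>x. x \<in> carrier M \<Longrightarrow> p (i x) = x"
     "\<And>x. x \<in> carrier M' \<Longrightarrow> i (p x) = x"
    using misoE[OF assms(1,3)] by metis
  obtain j q where 2: "j \<in> Hom N N'" "q \<in> Hom N' N" "\<And>x. x \<in> carrier N \<Longrightarrow> q (j x) = x"
     "\<And>x. x \<in> carrier N' \<Longrightarrow> j (q x) = x"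
    using misoE[OF assms(2,4)] by metis
  show ?thesis
    by (rule misoI[OF Hom_map[OF 1(1) 2(1)], where g = "\<lambda>x. (p (fst x), q (snd x))"])
      (auto simp: 1(3,4) 2(3,4) Hom_closed[OF 1(2)] Hom_closed[OF 2(2)])
qed

lemma ds_simps [simp]:
  "finite I \<Longrightarrow> carrier (direct_sum I M) = (\<Pi>\<^sub>E i\<in>I. carrier (M i))" "\<zero>\<^bsub>direct_sum I M\<^esub> = (\<lambda>i\<in>I. \<zero>\<^bsub>M i\<^esub>)"
  "x \<oplus>\<^bsub>direct_sum I M\<^esub> y = (\<lambda>i\<in>I. x i \<oplus>\<^bsub>M i\<^esub> y i)"
  "a \<odot>\<^bsub>direct_sum I M\<^esub> x = (\<lambda>i\<in>I. a \<odot>\<^bsub>M i\<^esub> x i)"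
  by (auto simp: direct_sum_def)

lemma lm_ds: assumes "finite I" "\<And>i. i \<in> I \<Longrightarrow> lm (M i)" "ring R" shows "lm (direct_sum I M)"
proof (rule lmI)
  note lm = assms(2)
  show "abelian_group (direct_sum I M)"
  proof (rule abelian_groupI)
    show "\<exists>y\<in>carrier (direct_sum I M). y \<oplus>\<^bsub>direct_sum I M\<^esub> x = \<zero>\<^bsub>direct_sum I M\<^esub>"
      if "x \<in> carrier (direct_sum I M)" for x
      using that assms(1,2) by (intro bexI[of _ "\<lambda>i\<in>I. \<ominus>\<^bsub>M i\<^esub> x i"]) (auto simp: PiE_iff intro!: restrict_ext)
  qed (use assms(1,2) in \<open>auto simp: PiE_iff lm_ac fun_eq_iff restrict_def extensional_def\<close>)
qed (use assms in \<open>auto simp: PiE_iff fun_eq_iff restrict_def extensional_def ring.ring_simprules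
      lm_smult_l_distr lm_smult_r_distr lm_smult_assoc\<close>)

lemma Hom_component: "\<lbrakk>finite I; i \<in> I\<rbrakk> \<Longrightarrow> (\<lambda>x. x i) \<in> Hom (direct_sum I M) (M i)"
  by (rule HomI) auto

lemma Hom_tuple: assumes "finite I" "\<And>i. i \<in> I \<Longrightarrow> f i \<in> Hom L (M i)"
  shows "(\<lambda>x. \<lambda>i\<in>I. f i x) \<in> Hom L (direct_sum I M)"
proof (rule HomI)
  show "(\<lambda>i\<in>I. f i x) \<in> carrier (direct_sum I M)" if "x \<in> carrier L" for x
    using that assms Hom_closed[OF assms(2)] by auto
qed (auto intro!: restrict_ext simp: Hom_simps[OF assms(2)])

lemma retract_ds_component: assumes "finite I" "i \<in> I" "\<And>i. i \<in> I \<Longrightarrow> lm (M i)"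
  shows "retract (M i) (direct_sum I M)"
proof (rule retractI)
  show "(\<lambda>x. \<lambda>j\<in>I. if j = i then x else \<zero>\<^bsub>M j\<^esub>) \<in> Hom (M i) (direct_sum I M)"
    by (rule HomI) (use assms in \<open>auto intro!: restrict_ext\<close>)
  show "(\<lambda>x. x i) \<in> Hom (direct_sum I M) (M i)" by (rule Hom_component[OF assms(1,2)])
qed (use assms(2) in auto)

lemma ds_reindex:
  assumes I: "finite I" and bij: "bij_betw \<sigma> I J" and iso: "\<And>i. i \<in> I \<Longrightarrow> X i \<simeq> Y (\<sigma> i)" "\<And>i. i \<in> I \<Longrightarrow> lm (X i)"
  shows "direct_sum I X \<simeq> direct_sum J Y"
proof -
  define \<tau> where "\<tau> = the_inv_into I \<sigma>"
  have J: "finite J" using I bij bij_betw_finite by blast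
  have \<tau>: "\<tau> j \<in> I" "\<sigma> (\<tau> j) = j" if "j \<in> J" for j
    using that bij by (auto simp: \<tau>_def bij_betw_def f_the_inv_into_f intro: the_inv_into_into)
  have \<sigma>: "\<sigma> i \<in> J" "\<tau> (\<sigma> i) = i" if "i \<in> I" for i
    using that bij by (auto simp: \<tau>_def bij_betw_def the_inv_into_f_f)
  have "\<exists>f g. f \<in> Hom (X i) (Y (\<sigma> i)) \<and> (\<forall>y\<in>carrier (Y (\<sigma> i)). g y \<in> carrier (X i)) \<and>
      (\<forall>x\<in>carrier (X i). g (f x) = x) \<and> (\<forall>x\<in>carrier (Y (\<sigma> i)). f (g x) = x)" if "i \<in> I" for i
    using misoE[OF iso[OF that]] Hom_closed by metis
  then obtain f g where *: "\<And>i. i \<in> I \<Longrightarrow> f i \<in> Hom (X i) (Y (\<sigma> i)) \<and> (\<forall>y\<in>carrier (Y (\<sigma> i)). g i y \<in> carrier (X i)) \<and>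
      (\<forall>x\<in>carrier (X i). g i (f i x) = x) \<and> (\<forall>x\<in>carrier (Y (\<sigma> i)). f i (g i x) = x)"
    by metis
  have f: "\<And>i. i \<in> I \<Longrightarrow> f i \<in> Hom (X i) (Y (\<sigma> i))"
    and g: "\<And>i y. \<lbrakk>i \<in> I; y \<in> carrier (Y (\<sigma> i))\<rbrakk> \<Longrightarrow> g i y \<in> carrier (X i)"
    and gf: "\<And>i x. \<lbrakk>i \<in> I; x \<in> carrier (X i)\<rbrakk> \<Longrightarrow> g i (f i x) = x"
    and fg: "\<And>i x. \<lbrakk>i \<in> I; x \<in> carrier (Y (\<sigma> i))\<rbrakk> \<Longrightarrow> f i (g i x) = x"
    using * by blast+
  show ?thesis
  proof (rule misoI)
    show "(\<lambda>x. \<lambda>j\<in>J. f (\<tau> j) (x (\<tau> j))) \<in> Hom (direct_sum I X) (direct_sum J Y)"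
      by (rule Hom_tuple[OF J], rule Hom_comp[OF Hom_component[OF I]])
        (use \<tau> f in metis)+
    show "(\<lambda>i\<in>I. g i (y (\<sigma> i))) \<in> carrier (direct_sum I X)" if "y \<in> carrier (direct_sum J Y)" for y
      using that I J g \<sigma> by (auto simp: PiE_iff)
    show "(\<lambda>i\<in>I. g i ((\<lambda>j\<in>J. f (\<tau> j) (x (\<tau> j))) (\<sigma> i))) = x" if "x \<in> carrier (direct_sum I X)" for x
      using that I gf \<sigma> by (auto simp: PiE_iff fun_eq_iff restrict_def extensional_def)
    show "(\<lambda>j\<in>J. f (\<tau> j) ((\<lambda>i\<in>I. g i (y (\<sigma> i))) (\<tau> j))) = y" if "y \<in> carrier (direct_sum J Y)" for y
      using that J fg \<tau> by (fastforce simp: PiE_iff fun_eq_iff restrict_def extensional_def)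
  qed
qed

lemma ds_insert:
  assumes "finite I" "i \<notin> I"
  shows "direct_sum (insert i I) M \<simeq> M i \<uplus> direct_sum I M"
proof (rule misoI)
  show "(\<lambda>x. (x i, \<lambda>j\<in>I. x j)) \<in> Hom (direct_sum (insert i I) M) (M i \<uplus> direct_sum I M)"
    using assms by (intro Hom_pair Hom_tuple Hom_component) auto
  show "(\<lambda>j\<in>insert i I. if j = i then fst y else snd y j) \<in> carrier (direct_sum (insert i I) M)"
    if "y \<in> carrier (M i \<uplus> direct_sum I M)" for y
    using assms that by (auto simp: PiE_iff)
qed (use assms in \<open>auto simp: PiE_iff extensional_def fun_eq_iff restrict_def\<close>)

lemma ds_Plus:
  assumes "finite I" "finite J"
  shows "direct_sum I X \<uplus> direct_sum J Y \<simeq> direct_sum (I <+> J) (case_sum X Y)"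
proof (rule misoI)
  show "(\<lambda>x. \<lambda>k\<in>I <+> J. case_sum (fst x) (snd x) k) \<in>
      Hom (direct_sum I X \<uplus> direct_sum J Y) (direct_sum (I <+> J) (case_sum X Y))"
  proof (rule Hom_tuple)
    show "(\<lambda>x. case_sum (fst x) (snd x) k) \<in> Hom (direct_sum I X \<uplus> direct_sum J Y) (case_sum X Y k)"
      if "k \<in> I <+> J" for k
      using that
    proof (rule PlusE)
      show ?thesis if "i \<in> I" "k = Inl i" for i
        using Hom_comp[OF Hom_fst Hom_component[OF assms(1) that(1)]] that(2) by simp
      show ?thesis if "i \<in> J" "k = Inr i" for i
        using Hom_comp[OF Hom_snd Hom_component[OF assms(2) that(1)]] that(2) by simp
    qed
  qed (use assms in auto)
  show "(\<lambda>i\<in>I. y (Inl i), \<lambda>j\<in>J. y (Inr j)) \<in> carrier (direct_sum I X \<uplus> direct_sum J Y)"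
    if "y \<in> carrier (direct_sum (I <+> J) (case_sum X Y))" for y
    using that assms by (auto simp: PiE_iff split: sum.splits)
qed (use assms in \<open>auto simp: PiE_iff extensional_def fun_eq_iff restrict_def split: sum.splits\<close>)

lemma ds_empty: "carrier (direct_sum {} M) = {\<zero>\<^bsub>direct_sum {} M\<^esub>}"
  by (auto simp: fun_eq_iff)

lemma retract_ds:
  assumes I: "finite I" and r: "\<And>i. i \<in> I \<Longrightarrow> retract (X i) (Y i)"
  shows "retract (direct_sum I X) (direct_sum I Y)"
proof -
  have "\<exists>f g. f \<in> Hom (X i) (Y i) \<and> g \<in> Hom (Y i) (X i) \<and> (\<forall>x\<in>carrier (X i). g (f x) = x)" if "i \<in> I" for i
    using retractE[OF r[OF that]] by metis
  then obtain f g where *: "\<And>i. i \<in> I \<Longrightarrow> f i \<in> Hom (X i) (Y i) \<and> g i \<in> Hom (Y i) (X i) \<and> (\<forall>x\<in>carrier (X i). g i (f i x) = x)"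
    by metis
  have f: "\<And>i. i \<in> I \<Longrightarrow> f i \<in> Hom (X i) (Y i)" and g: "\<And>i. i \<in> I \<Longrightarrow> g i \<in> Hom (Y i) (X i)"
    and gf: "\<And>i x. \<lbrakk>i \<in> I; x \<in> carrier (X i)\<rbrakk> \<Longrightarrow> g i (f i x) = x"
    using * by blast+
  show ?thesis
    by (rule retractI[where i = "\<lambda>x. \<lambda>i\<in>I. f i (x i)" and p = "\<lambda>x. \<lambda>i\<in>I. g i (x i)"];
        (intro Hom_tuple Hom_comp[OF Hom_component] f g I)?)
      (use I gf in \<open>auto simp: PiE_iff extensional_def fun_eq_iff restrict_def\<close>)
qed

end

section \<open>Exact sequences, projective and injective modules\<close>

context base_ring
begin

subsection \<open>Finitely generated modules\<close>

lemma fgI: "\<lbrakk>lm M; finite S; S \<subseteq> carrier M; \<And>N. \<lbrakk>sm N M; S \<subseteq> N\<rbrakk> \<Longrightarrow> N = carrier M\<rbrakk> \<Longrightarrow> fg M"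
  by (auto simp: fg_module_def)

lemma fgE:
  assumes "fg M"
  obtains S where "finite S" "S \<subseteq> carrier M" "\<And>N. \<lbrakk>sm N M; S \<subseteq> N\<rbrakk> \<Longrightarrow> N = carrier M"
  using assms by (auto simp: fg_module_def)

lemma epi_simps: assumes "mod_epi R M N p" shows "p \<in> Hom M N" "p ` carrier M = carrier N"
  using assms by (auto simp: mod_epi_def)

lemma mono_Hom: "mod_mono R M N p \<Longrightarrow> p \<in> Hom M N"
  by (simp add: mod_mono_def)

lemma mono_eq: "\<lbrakk>mod_mono R M N j; x \<in> carrier M; y \<in> carrier M; j x = j y\<rbrakk> \<Longrightarrow> x = y"
  by (auto simp: mod_mono_def inj_on_def)

lemma split_mono: assumes "i \<in> Hom M N" "\<And>x. x \<in> carrier M \<Longrightarrow> p (i x) = x" shows "mod_mono R M N i"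
  using assms inj_on_inverseI[of "carrier M" p i] by (simp add: mod_mono_def)

lemma fg_epi: assumes "fg M" "mod_epi R M N p" "lm N" shows "fg N"
proof -
  obtain S where S: "finite S" "S \<subseteq> carrier M" "\<And>N. \<lbrakk>sm N M; S \<subseteq> N\<rbrakk> \<Longrightarrow> N = carrier M"
    using fgE[OF assms(1)] by blast
  note p = epi_simps[OF assms(2)]
  show ?thesis
  proof (rule fgI[OF assms(3), of "p ` S"])
    fix L assume L: "sm L N" "p ` S \<subseteq> L"
    have "{x \<in> carrier M. p x \<in> L} = carrier M"
      using S(2,3) L sm_vimage[OF p(1) _ assms(3) L(1)] assms(1) by auto
    then have "p ` carrier M \<subseteq> L" by blast
    then show "L = carrier N" using p(2) sm_subset[OF L(1)] by simp
  qed (use S p in auto)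
qed

lemma miso_epi: "\<lbrakk>f \<in> Hom M N; bij_betw f (carrier M) (carrier N)\<rbrakk> \<Longrightarrow> mod_epi R M N f"
  by (auto simp: mod_epi_def bij_betw_def)

lemma fg_miso: "\<lbrakk>fg M; M \<simeq> N; lm N\<rbrakk> \<Longrightarrow> fg N"
  using fg_epi[of M N] by (auto simp: mod_iso_def dest: miso_epi)

lemma fg_copy:
  assumes "fg M"
  obtains N :: "'a fgmod" where "fg N" "M \<simeq> N" "N \<simeq> M"
  using fg_module_ex_copy[OF assms] miso_sym[of M] assms by auto

lemma fg_ds2 [simp]: assumes "fg M" "fg N" shows "fg (M \<uplus> N)"
proof -
  obtain S where S: "finite S" "S \<subseteq> carrier M" "\<And>N. \<lbrakk>sm N M; S \<subseteq> N\<rbrakk> \<Longrightarrow> N = carrier M"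
    using fgE[OF assms(1)] by blast
  obtain T where T: "finite T" "T \<subseteq> carrier N" "\<And>L. \<lbrakk>sm L N; T \<subseteq> L\<rbrakk> \<Longrightarrow> L = carrier N"
    using fgE[OF assms(2)] by blast
  have lm: "lm M" "lm N" using assms by auto
  show ?thesis
  proof (rule fgI[of _ "(\<lambda>x. (x, \<zero>\<^bsub>N\<^esub>)) ` S \<union> (\<lambda>x. (\<zero>\<^bsub>M\<^esub>, x)) ` T"])
    fix L assume L: "sm L (M \<uplus> N)" "(\<lambda>x. (x, \<zero>\<^bsub>N\<^esub>)) ` S \<union> (\<lambda>x. (\<zero>\<^bsub>M\<^esub>, x)) ` T \<subseteq> L"
    have 1: "{x \<in> carrier M. (x, \<zero>\<^bsub>N\<^esub>) \<in> L} = carrier M"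
      using S(2) L(2) sm_vimage[OF Hom_inl _ _ L(1)] lm by (intro S(3)) auto
    have 2: "{x \<in> carrier N. (\<zero>\<^bsub>M\<^esub>, x) \<in> L} = carrier N"
      using T(2) L(2) sm_vimage[OF Hom_inr _ _ L(1)] lm by (intro T(3)) auto
    have "(x, y) \<in> L" if "x \<in> carrier M" "y \<in> carrier N" for x y
      using sm_simps(2)[OF L(1), of "(x, \<zero>\<^bsub>N\<^esub>)" "(\<zero>\<^bsub>M\<^esub>, y)"] 1 2 that lm by auto
    then show "L = carrier (M \<uplus> N)" using sm_subset[OF L(1)] by auto
  qed (use S T lm in auto)
qed

lemma fg_zero: "\<lbrakk>lm M; carrier M = {\<zero>\<^bsub>M\<^esub>}\<rbrakk> \<Longrightarrow> fg M"
  by (rule fgI[of _ "{}"]) (use sm_simps(1) sm_subset in fastforce)+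

lemma fg_ds: assumes "ring R" "finite I" "\<And>i. i \<in> I \<Longrightarrow> fg (X i)" shows "fg (direct_sum I X)"
  using assms(2,3)
proof (induction I)
  case empty
  show ?case by (intro fg_zero lm_ds ds_empty assms(1)) auto
next
  case (insert i I)
  have "X i \<uplus> direct_sum I X \<simeq> direct_sum (insert i I) X"
    using insert assms(1) by (intro miso_sym[OF ds_insert] lm_ds) auto
  then show ?case
    by (rule fg_miso[rotated]) (use insert assms(1) in \<open>auto intro!: lm_ds\<close>)
qed

lemma fg_power: "\<lbrakk>ring R; fg X\<rbrakk> \<Longrightarrow> fg (direct_power n X)"
  unfolding direct_power_def by (rule fg_ds) auto

lemma direct_power_Suc: "direct_power (Suc n) X \<simeq> X \<uplus> direct_power n X"
  unfolding direct_power_def lessThan_Suc by (rule ds_insert) auto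

lemma regular_simps [simp]: "carrier (regular_module R) = carrier R" "\<zero>\<^bsub>regular_module R\<^esub> = \<zero>"
  "x \<oplus>\<^bsub>regular_module R\<^esub> y = x \<oplus> y" "a \<odot>\<^bsub>regular_module R\<^esub> x = a \<otimes> x"
  by (simp_all add: regular_module_def)

lemma lm_regular: assumes "ring R" shows "lm (regular_module R)"
proof -
  interpret ring R by (rule assms)
  have "abelian_group (regular_module R)"
    by (rule abelian_groupI) (auto simp: a_ac intro!: bexI[of _ "\<ominus> _"] l_neg)
  then show ?thesis by (intro lmI assms) (auto simp: l_distr r_distr m_assoc)
qed

lemma fg_regular: assumes "ring R" shows "fg (regular_module R)"
proof (rule fgI[OF lm_regular[OF assms], of "{\<one>}"])
  fix N assume N: "sm N (regular_module R)" "{\<one>} \<subseteq> N"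
  interpret ring R by (rule assms)
  have "x \<in> N" if "x \<in> carrier R" for x using sm_simps(3)[OF N(1) that, of \<one>] N(2) that by simp
  then show "N = carrier (regular_module R)" using sm_subset[OF N(1)] by auto
qed (use assms in \<open>auto simp: ring.ring_simprules\<close>)

lemma Hom_regular: "\<lbrakk>lm M; x \<in> carrier M\<rbrakk> \<Longrightarrow> (\<lambda>a. a \<odot>\<^bsub>M\<^esub> x) \<in> Hom (regular_module R) M"
  by (rule HomI) (auto simp: lm_smult_l_distr lm_smult_assoc)

text \<open>One free summand is added per generator. The induction only asks that the image contain
  the generators treated so far; at the end the image is a submodule containing all of them, hence
  everything.\<close>

lemma free_epi:
  assumes "fg M"
  obtains n f where "mod_epi R (direct_power n (regular_module R)) M f"
proof -
  have lm: "lm M" and R: "ring R" using assms lm_ring[of M] by auto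
  obtain S where S: "finite S" "S \<subseteq> carrier M" "\<And>N. \<lbrakk>sm N M; S \<subseteq> N\<rbrakk> \<Longrightarrow> N = carrier M"
    using fgE[OF assms] by blast
  have "\<exists>n f. f \<in> Hom (direct_power n (regular_module R)) M \<and> S \<subseteq> f ` carrier (direct_power n (regular_module R))"
    using S(1,2)
  proof (induction S)
    case empty
    then show ?case using Hom_const_zero[OF lm] by auto
  next
    case (insert s S)
    let ?P = "\<lambda>n. direct_power n (regular_module R)"
    obtain n f where f: "f \<in> Hom (?P n) M" "S \<subseteq> f ` carrier (?P n)" using insert by auto
    have s: "s \<in> carrier M" using insert by auto
    define g where "g x = fst x \<odot>\<^bsub>M\<^esub> s \<oplus>\<^bsub>M\<^esub> f (snd x)" for x
    have g: "g \<in> Hom (regular_module R \<uplus> ?P n) M"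
      unfolding g_def using Hom_copair[OF Hom_regular[OF lm s] f(1) lm] .
    obtain h where h: "h \<in> Hom (?P (Suc n)) (regular_module R \<uplus> ?P n)"
      "h ` carrier (?P (Suc n)) = carrier (regular_module R \<uplus> ?P n)"
      using direct_power_Suc[of n "regular_module R"] by (auto simp: mod_iso_def bij_betw_def)
    have lmP: "lm (?P n)" using fg_power[OF R fg_regular[OF R], of n] by simp
    have "s = g (\<one>, \<zero>\<^bsub>?P n\<^esub>)"
      using lm s R Hom_zero[OF f(1) lmP lm] by (simp add: g_def)
    moreover have "f x = g (\<zero>, x)" if "x \<in> carrier (?P n)" for x
      using lm s R Hom_closed[OF f(1) that] by (simp add: g_def)
    ultimately have "insert s S \<subseteq> g ` carrier (regular_module R \<uplus> ?P n)"
      using f(2) R lmP by (auto simp: subset_iff image_iff ring.ring_simprules) (metis R lm_zero ring.ring_simprules(2,6))+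
    then have "insert s S \<subseteq> (\<lambda>x. g (h x)) ` carrier (?P (Suc n))"
      using h(2) by (metis image_image)
    then show ?case using Hom_comp[OF h(1) g] by blast
  qed
  then obtain n f where f: "f \<in> Hom (direct_power n (regular_module R)) M"
    "S \<subseteq> f ` carrier (direct_power n (regular_module R))" by blast
  have "f ` carrier (direct_power n (regular_module R)) = carrier M"
    using S(3)[OF sm_img[OF f(1)]] f(2) lm fg_power[OF R fg_regular[OF R], of n] by auto
  with f(1) show ?thesis using that by (auto simp: mod_epi_def)
qed

subsection \<open>Short exact sequences\<close>

abbreviation ses where "ses A f B g C \<equiv> short_exact R A f B g C"

lemma ses_simps:
  assumes "ses A f B g C"
  shows "lm A" "lm B" "lm C" "f \<in> Hom A B" "g \<in> Hom B C" "mod_mono R A B f" "mod_epi R B C g"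
    and "x \<in> carrier A \<Longrightarrow> g (f x) = \<zero>\<^bsub>C\<^esub>"
    and "\<lbrakk>y \<in> carrier B; g y = \<zero>\<^bsub>C\<^esub>\<rbrakk> \<Longrightarrow> y \<in> f ` carrier A"
    and "g ` carrier B = carrier C" "f ` carrier A = a_kernel B C g"
proof -
  show *: "lm A" "lm B" "lm C" "f \<in> Hom A B" "g \<in> Hom B C" "mod_mono R A B f" "mod_epi R B C g"
    "f ` carrier A = a_kernel B C g" "g ` carrier B = carrier C"
    using assms by (auto simp: short_exact_def mod_mono_def mod_epi_def)
  show "x \<in> carrier A \<Longrightarrow> g (f x) = \<zero>\<^bsub>C\<^esub>" using *(8) by (auto simp: ker_iff)
  show "\<lbrakk>y \<in> carrier B; g y = \<zero>\<^bsub>C\<^esub>\<rbrakk> \<Longrightarrow> y \<in> f ` carrier A" using *(8) by (auto simp: ker_iff)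
qed

lemma sesI:
  assumes "lm A" "lm B" "lm C" "mod_mono R A B f" "mod_epi R B C g"
    "\<And>x. x \<in> carrier A \<Longrightarrow> g (f x) = \<zero>\<^bsub>C\<^esub>"
    "\<And>y. \<lbrakk>y \<in> carrier B; g y = \<zero>\<^bsub>C\<^esub>\<rbrakk> \<Longrightarrow> \<exists>x\<in>carrier A. y = f x"
  shows "ses A f B g C"
  using assms Hom_closed[OF mono_Hom[OF assms(4)]] unfolding short_exact_def by (auto simp: ker_iff image_iff)

lemma ses_ker: assumes "mod_epi R B C g" "lm B" "lm C" shows "ses (sub B (a_kernel B C g)) (\<lambda>x. x) B g C"
proof (rule sesI)
  have s: "sm (a_kernel B C g) B" using sm_ker assms epi_simps by blast
  show "lm (sub B (a_kernel B C g))" using lm_sub s assms by blast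
  show "mod_mono R (sub B (a_kernel B C g)) B (\<lambda>x. x)" using Hom_sub s assms by (auto simp: mod_mono_def)
qed (use assms in \<open>auto simp: ker_iff\<close>)

lemma Hom_inverse_zero_iff:
  assumes "q \<in> Hom M N" "r \<in> Hom N M" "lm M" "lm N" "r (q x) = x"
  shows "q x = \<zero>\<^bsub>N\<^esub> \<longleftrightarrow> x = \<zero>\<^bsub>M\<^esub>"
  using Hom_zero[OF assms(1,3,4)] Hom_zero[OF assms(2,4,3)] assms(5) by metis

text \<open>The quotient consists of cosets, so it has the wrong type to be quantified over;
  composing the projection with an isomorphism to a copy on \<open>'a fgmod\<close> keeps the
  kernel.\<close>

lemma ses_coker:
  fixes A :: "('a, 'm) module" and B :: "('a, 'n) module"
  assumes "mod_mono R A B f" "lm A" "fg B"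
  obtains C :: "'a fgmod" and g where "fg C" "ses A f B g C"
proof -
  have lm: "lm A" "lm B" using assms by auto
  obtain Q :: "('a, 'n set) module" and p where Q: "lm Q" "mod_epi R B Q p" "a_kernel B Q p = f ` carrier A"
    by (rule quot_exists[OF lm(2) sm_img[OF mono_Hom[OF assms(1)] lm]])
  have fgQ: "fg Q" using fg_epi[OF assms(3) Q(2,1)] .
  obtain C :: "'a fgmod" where C: "fg C" "Q \<simeq> C" using fg_copy[OF fgQ] by blast
  obtain q r where q: "q \<in> Hom Q C" "r \<in> Hom C Q" "\<And>x. x \<in> carrier Q \<Longrightarrow> r (q x) = x" "bij_betw q (carrier Q) (carrier C)"
    using misoE[OF C(2) Q(1)] by metis
  have inj: "q x = \<zero>\<^bsub>C\<^esub> \<longleftrightarrow> x = \<zero>\<^bsub>Q\<^esub>" if "x \<in> carrier Q" for x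
    using Hom_inverse_zero_iff[OF q(1,2) Q(1) _ q(3)[OF that]] C(1) by simp
  have "a_kernel B C (\<lambda>x. q (p x)) = f ` carrier A"
    unfolding Q(3)[symmetric] set_eq_iff ker_iff using inj Hom_closed[OF epi_simps(1)[OF Q(2)]] by blast
  moreover have "mod_epi R B C (\<lambda>x. q (p x))"
    using epi_comp[OF Q(2) miso_epi[OF q(1,4)]] .
  ultimately have "ses A f B (\<lambda>x. q (p x)) C"
    unfolding short_exact_def using lm C(1) assms(1) by auto
  then show ?thesis using that C(1) by blast
qed

lemma ses_ds2: assumes "ses A f B g C" "ses A' f' B' g' C'"
  shows "ses (A \<uplus> A') (\<lambda>x. (f (fst x), f' (snd x))) (B \<uplus> B') (\<lambda>x. (g (fst x), g' (snd x))) (C \<uplus> C')"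
proof -
  note 1 = ses_simps[OF assms(1)] and 2 = ses_simps[OF assms(2)]
  have img: "(\<lambda>x. (u (fst x), v (snd x))) ` (S \<times> T) = u ` S \<times> v ` T" for u :: "'x \<Rightarrow> 'y" and v :: "'z \<Rightarrow> 'w" and S T
    by force
  have "mod_mono R (A \<uplus> A') (B \<uplus> B') (\<lambda>x. (f (fst x), f' (snd x)))"
    unfolding mod_mono_def using Hom_map[OF 1(4) 2(4)]
    by (auto simp: inj_on_def dest: mono_eq[OF 1(6)] mono_eq[OF 2(6)])
  moreover have "mod_epi R (B \<uplus> B') (C \<uplus> C') (\<lambda>x. (g (fst x), g' (snd x)))"
    unfolding mod_epi_def using Hom_map[OF 1(5) 2(5)] by (simp add: img 1(10) 2(10))
  ultimately show ?thesis
    unfolding short_exact_def by (simp add: 1(1-3) 2(1-3) img 1(11) 2(11)) (auto simp: ker_iff)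
qed

lemma ses_miso: assumes "ses A f B g C" "C \<simeq> C'" "lm C'" obtains g' where "ses A f B g' C'"
proof -
  note 1 = ses_simps[OF assms(1)]
  obtain q r where q: "q \<in> Hom C C'" "r \<in> Hom C' C" "\<And>x. x \<in> carrier C \<Longrightarrow> r (q x) = x" "bij_betw q (carrier C) (carrier C')"
    using misoE[OF assms(2) 1(3)] by metis
  have inj: "q x = \<zero>\<^bsub>C'\<^esub> \<longleftrightarrow> x = \<zero>\<^bsub>C\<^esub>" if "x \<in> carrier C" for x
    using Hom_inverse_zero_iff[OF q(1,2) 1(3) assms(3) q(3)[OF that]] .
  have "ses A f B (\<lambda>x. q (g x)) C'"
  proof (rule sesI)
    show "mod_epi R B C' (\<lambda>x. q (g x))" using epi_comp[OF 1(7) miso_epi[OF q(1,4)]] .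
  qed (use 1(1,2,6,8,9) assms(3) inj 1(3) Hom_closed[OF 1(5)] in auto)
  then show ?thesis using that by blast
qed

lemma ses_miso1: assumes "ses A f B g C" "A \<simeq> A'" "lm A'" obtains f' where "ses A' f' B g C"
proof -
  note 1 = ses_simps[OF assms(1)]
  obtain q r where q: "q \<in> Hom A A'" "r \<in> Hom A' A" "\<And>x. x \<in> carrier A \<Longrightarrow> r (q x) = x" "\<And>x. x \<in> carrier A' \<Longrightarrow> q (r x) = x"
    using misoE[OF assms(2) 1(1)] by metis
  have "mod_mono R A' B (\<lambda>x. f (r x))"
    by (rule mono_comp[OF split_mono[OF q(2,4)] 1(6)])
  then have "ses A' (\<lambda>x. f (r x)) B g C"
  proof (intro sesI)
    fix y assume "y \<in> carrier B" "g y = \<zero>\<^bsub>C\<^esub>"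
    then obtain x where "x \<in> carrier A" "y = f x" using 1(9) by blast
    then show "\<exists>x\<in>carrier A'. y = f (r x)" using q(3) Hom_closed[OF q(1)] by (intro bexI[of _ "q x"]) auto
  qed (use 1 assms(3) Hom_closed[OF q(2)] in auto)
  then show ?thesis using that by blast
qed

text \<open>Dimension shifting in both directions; with \<open>a\<close> and \<open>b\<close> identities this is Schanuel's lemma.\<close>

lemma retract_coker:
  assumes 1: "ses F i I \<pi> C" and 2: "ses F' t T0 \<tau> T1"
    and a: "a \<in> Hom F F'" and b: "b \<in> Hom F' F" and ba: "\<And>x. x \<in> carrier F \<Longrightarrow> b (a x) = x"
    and h: "h \<in> Hom I T0" "\<And>x. x \<in> carrier F \<Longrightarrow> h (i x) = t (a x)"
    and g: "g \<in> Hom T0 I" "\<And>y. y \<in> carrier F' \<Longrightarrow> g (t y) = i (b y)"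
  shows "retract C (I \<uplus> T1)"
proof -
  note 1 = ses_simps[OF 1] and 2 = ses_simps[OF 2]
  \<comment> \<open>Since \<open>g h i = i b a = i\<close> and
    \<open>\<tau> h i = \<tau> t a = 0\<close>, this map vanishes on the image of \<open>F\<close>
    and descends to \<open>C\<close>. The pair \<open>(\<pi>, \<psi>)\<close> undoes it because
    \<open>\<pi> x = \<pi> (x - g h x) + \<psi> (\<tau> (h x))\<close>.\<close>
  have *: "(\<lambda>x. (x \<ominus>\<^bsub>I\<^esub> g (h x), \<tau> (h x))) \<in> Hom I (I \<uplus> T1)"
    by (intro Hom_pair Hom_diff Hom_id Hom_comp[OF h(1)] g(1) 2(5) 1(2))
  obtain \<phi> where \<phi>: "\<phi> \<in> Hom C (I \<uplus> T1)" "\<And>x. x \<in> carrier I \<Longrightarrow> \<phi> (\<pi> x) = (x \<ominus>\<^bsub>I\<^esub> g (h x), \<tau> (h x))"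
  proof (rule factor_epi[OF 1(7) *])
    show "(x \<ominus>\<^bsub>I\<^esub> g (h x), \<tau> (h x)) = \<zero>\<^bsub>I \<uplus> T1\<^esub>" if "x \<in> carrier I" "\<pi> x = \<zero>\<^bsub>C\<^esub>" for x
      using 1(9)[OF that] h(2) g(2) ba 2(8) Hom_closed[OF a] 1(2) Hom_closed[OF 1(4)] by auto
  qed (use 1 2 in auto)
  obtain \<psi> where \<psi>: "\<psi> \<in> Hom T1 C" "\<And>x. x \<in> carrier T0 \<Longrightarrow> \<psi> (\<tau> x) = \<pi> (g x)"
  proof (rule factor_epi[OF 2(7) Hom_comp[OF g(1) 1(5)]])
    show "\<pi> (g x) = \<zero>\<^bsub>C\<^esub>" if "x \<in> carrier T0" "\<tau> x = \<zero>\<^bsub>T1\<^esub>" for x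
      using 2(9)[OF that] g(2) 1(8) Hom_closed[OF b] by auto
  qed (use 1 2 in auto)
  show ?thesis
  proof (rule retractI[OF \<phi>(1) Hom_copair[OF 1(5) \<psi>(1) 1(3)]])
    fix c assume "c \<in> carrier C"
    then obtain x where x: "x \<in> carrier I" "c = \<pi> x" using 1(10) by blast
    show "\<pi> (fst (\<phi> c)) \<oplus>\<^bsub>C\<^esub> \<psi> (snd (\<phi> c)) = c"
      using x \<phi>(2) \<psi>(2) Hom_closed[OF h(1) x(1)] Hom_closed[OF g(1)] 1(2,3) Hom_closed[OF 1(5)]
      by (simp flip: Hom_simps(2)[OF 1(5)])
  qed
qed

lemma retract_ker:
  assumes 1: "ses K k P p M" and 2: "ses K' k' P' p' M'"
    and a: "a \<in> Hom M M'" and b: "b \<in> Hom M' M" and ba: "\<And>x. x \<in> carrier M \<Longrightarrow> b (a x) = x"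
    and h: "h \<in> Hom P P'" "\<And>x. x \<in> carrier P \<Longrightarrow> p' (h x) = a (p x)"
    and g: "g \<in> Hom P' P" "\<And>y. y \<in> carrier P' \<Longrightarrow> p (g y) = b (p' y)"
  shows "retract K (P \<uplus> K')"
proof -
  note 1 = ses_simps[OF 1] and 2 = ses_simps[OF 2]
  obtain \<sigma> where \<sigma>: "\<sigma> \<in> Hom K K'" "\<And>x. x \<in> carrier K \<Longrightarrow> k' (\<sigma> x) = h (k x)"
  proof (rule factor_mono[OF 2(6) Hom_comp[OF 1(4) h(1)]])
    show "(\<lambda>x. h (k x)) ` carrier K \<subseteq> k' ` carrier K'"
      using 2(9) h(2) 1(8) Hom_zero[OF a 1(3) 2(3)] Hom_closed[OF 1(4)] Hom_closed[OF h(1)] by auto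
  qed (use 1 2 in auto)
  \<comment> \<open>The values lie in the kernel of \<open>p\<close> because
    \<open>p g h = b a p = p\<close> and \<open>p g k' = b p' k' = 0\<close>, so the map factors
    through \<open>K\<close>. At \<open>(k x, \<sigma> x)\<close> the relation
    \<open>k' \<sigma> = h k\<close> cancels the two terms with \<open>g\<close> and leaves
    \<open>k x\<close>.\<close>
  have *: "(\<lambda>x. (fst x \<ominus>\<^bsub>P\<^esub> g (h (fst x))) \<oplus>\<^bsub>P\<^esub> g (k' (snd x))) \<in> Hom (P \<uplus> K') P"
    by (rule Hom_copair[OF Hom_diff[OF Hom_id Hom_comp[OF h(1) g(1)] 1(2)] Hom_comp[OF 2(4) g(1)] 1(2)])
  obtain \<rho> where \<rho>: "\<rho> \<in> Hom (P \<uplus> K') K"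
    "\<And>x. x \<in> carrier (P \<uplus> K') \<Longrightarrow> k (\<rho> x) = (fst x \<ominus>\<^bsub>P\<^esub> g (h (fst x))) \<oplus>\<^bsub>P\<^esub> g (k' (snd x))"
  proof (rule factor_mono[OF 1(6) *])
    show "(\<lambda>x. (fst x \<ominus>\<^bsub>P\<^esub> g (h (fst x))) \<oplus>\<^bsub>P\<^esub> g (k' (snd x))) ` carrier (P \<uplus> K') \<subseteq> k ` carrier K"
    proof (rule image_subsetI, rule 1(9))
      fix x assume x: "x \<in> carrier (P \<uplus> K')"
      then show "(fst x \<ominus>\<^bsub>P\<^esub> g (h (fst x))) \<oplus>\<^bsub>P\<^esub> g (k' (snd x)) \<in> carrier P"
        using Hom_closed[OF *] by blast
      show "p ((fst x \<ominus>\<^bsub>P\<^esub> g (h (fst x))) \<oplus>\<^bsub>P\<^esub> g (k' (snd x))) = \<zero>\<^bsub>M\<^esub>"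
        using x 1(2,3) 2(8) Hom_closed[OF h(1)] Hom_closed[OF g(1)] Hom_closed[OF 2(4)] Hom_closed[OF 1(5)]
        by (auto simp: Hom_simps(2)[OF 1(5)] Hom_minus[OF 1(5) 1(2,3)] g(2) h(2) ba Hom_zero[OF b 2(3) 1(3)])
    qed
  qed (use 1 2 in auto)
  show ?thesis
  proof (rule retractI[OF Hom_pair[OF 1(4) \<sigma>(1)] \<rho>(1)])
    fix x assume x: "x \<in> carrier K"
    have "k (\<rho> (k x, \<sigma> x)) = k x"
      using x 1(2) Hom_closed[OF 1(4) x] Hom_closed[OF \<sigma>(1) x] Hom_closed[OF g(1)] Hom_closed[OF h(1)]
      by (simp add: \<rho>(2) \<sigma>(2))
    then show "\<rho> (k x, \<sigma> x) = x"
      using mono_eq[OF 1(6)] Hom_closed[OF \<rho>(1)] Hom_closed[OF 1(4) x] Hom_closed[OF \<sigma>(1) x] x by simp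
  qed
qed

subsection \<open>Projective and injective modules\<close>

abbreviation proj where "proj P \<equiv> projective R P"
abbreviation inj where "inj P \<equiv> injective R P"

lemma proj_fg [simp]: "proj P \<Longrightarrow> fg P" and inj_fg [simp]: "inj E \<Longrightarrow> fg E"
  by (auto simp: projective_def injective_def)

text \<open>Projectivity is defined by lifting against modules of type \<open>'a fgmod\<close>.
  Conjugation with isomorphic copies gives lifting against finitely generated modules on arbitrary
  carriers; \<open>inj_extend\<close> does the same for injectivity.\<close>

lemma proj_lift:
  assumes "proj P" "fg A" "fg B" "mod_epi R A B p" "f \<in> Hom P B"
  obtains g where "g \<in> Hom P A" "\<And>x. x \<in> carrier P \<Longrightarrow> p (g x) = f x"
proof -
  obtain A' :: "'a fgmod" where A': "fg A'" "A \<simeq> A'" using fg_copy[OF assms(2)] by blast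
  obtain B' :: "'a fgmod" where B': "fg B'" "B \<simeq> B'" using fg_copy[OF assms(3)] by blast
  obtain \<alpha> \<alpha>' where \<alpha>: "\<alpha> \<in> Hom A A'" "\<alpha>' \<in> Hom A' A" "\<And>x. x \<in> carrier A \<Longrightarrow> \<alpha>' (\<alpha> x) = x"
    using misoE[OF A'(2)] assms(2) fg_lm by metis
  obtain \<beta> \<beta>' where \<beta>: "\<beta> \<in> Hom B B'" "\<beta>' \<in> Hom B' B" "\<And>x. x \<in> carrier B \<Longrightarrow> \<beta>' (\<beta> x) = x" "\<And>x. x \<in> carrier B' \<Longrightarrow> \<beta> (\<beta>' x) = x"
    using misoE[OF B'(2)] assms(3) fg_lm by metis
  note p = epi_simps[OF assms(4)]
  have "\<exists>x\<in>carrier A'. y = \<beta> (p (\<alpha>' x))" if y: "y \<in> carrier B'" for y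
  proof -
    have "\<beta>' y \<in> p ` carrier A" using Hom_closed[OF \<beta>(2) y] p by simp
    then obtain x where "x \<in> carrier A" "\<beta>' y = p x" by blast
    then show ?thesis using y \<beta>(4)[OF y] \<alpha>(3) Hom_closed[OF \<alpha>(1)] by (intro bexI[of _ "\<alpha> x"]) auto
  qed
  then have "mod_epi R A' B' (\<lambda>x. \<beta> (p (\<alpha>' x)))"
    unfolding mod_epi_def using Hom_comp[OF Hom_comp[OF \<alpha>(2) p(1)] \<beta>(1)]
      Hom_closed[OF Hom_comp[OF Hom_comp[OF \<alpha>(2) p(1)] \<beta>(1)]] by blast
  then obtain g where g: "g \<in> Hom P A'" "\<forall>x\<in>carrier P. \<beta> (p (\<alpha>' (g x))) = \<beta> (f x)"
    using assms(1) A'(1) B'(1) Hom_comp[OF assms(5) \<beta>(1)] unfolding projective_def by meson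
  have "p (\<alpha>' (g x)) = f x" if "x \<in> carrier P" for x
    using g(2) that \<beta>(3) Hom_closed[OF assms(5) that] Hom_closed[OF p(1) Hom_closed[OF \<alpha>(2) Hom_closed[OF g(1) that]]]
    by metis
  then show ?thesis using that Hom_comp[OF g(1) \<alpha>(2)] by blast
qed

lemma inj_extend:
  assumes "inj E" "fg A" "fg B" "mod_mono R A B j" "f \<in> Hom A E"
  obtains g where "g \<in> Hom B E" "\<And>x. x \<in> carrier A \<Longrightarrow> g (j x) = f x"
proof -
  obtain A' :: "'a fgmod" where A': "fg A'" "A \<simeq> A'" using fg_copy[OF assms(2)] by blast
  obtain B' :: "'a fgmod" where B': "fg B'" "B \<simeq> B'" using fg_copy[OF assms(3)] by blast
  obtain \<alpha> \<alpha>' where \<alpha>: "\<alpha> \<in> Hom A A'" "\<alpha>' \<in> Hom A' A" "\<And>x. x \<in> carrier A \<Longrightarrow> \<alpha>' (\<alpha> x) = x" "\<And>x. x \<in> carrier A' \<Longrightarrow> \<alpha> (\<alpha>' x) = x"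
    using misoE[OF A'(2)] assms(2) fg_lm by metis
  obtain \<beta> \<beta>' where \<beta>: "\<beta> \<in> Hom B B'" "\<beta>' \<in> Hom B' B" "\<And>x. x \<in> carrier B \<Longrightarrow> \<beta>' (\<beta> x) = x"
    using misoE[OF B'(2)] assms(3) fg_lm by metis
  note j = mono_Hom[OF assms(4)]
  have "mod_mono R A' B' (\<lambda>x. \<beta> (j (\<alpha>' x)))"
  proof -
    have "inj_on (\<lambda>x. \<beta> (j (\<alpha>' x))) (carrier A')"
    proof (rule inj_onI)
      fix x y assume *: "x \<in> carrier A'" "y \<in> carrier A'" "\<beta> (j (\<alpha>' x)) = \<beta> (j (\<alpha>' y))"
      then have "j (\<alpha>' x) = j (\<alpha>' y)" using \<beta>(3) Hom_closed[OF j] Hom_closed[OF \<alpha>(2)] by metis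
      then have "\<alpha>' x = \<alpha>' y" using mono_eq[OF assms(4)] Hom_closed[OF \<alpha>(2)] * by metis
      then show "x = y" using \<alpha>(4) * by metis
    qed
    then show ?thesis unfolding mod_mono_def using Hom_comp[OF Hom_comp[OF \<alpha>(2) j] \<beta>(1)] by auto
  qed
  then obtain g where g: "g \<in> Hom B' E" "\<forall>x\<in>carrier A'. g (\<beta> (j (\<alpha>' x))) = f (\<alpha>' x)"
    using assms(1) A'(1) B'(1) Hom_comp[OF \<alpha>(2) assms(5)] unfolding injective_def by meson
  have "g (\<beta> (j x)) = f x" if "x \<in> carrier A" for x
    using g(2) that \<alpha>(3) Hom_closed[OF \<alpha>(1) that] by metis
  then show ?thesis using that Hom_comp[OF \<beta>(1) g(1)] by blast
qed

lemma proj_retract: assumes "proj P" "retract X P" "fg X" shows "proj X"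
  unfolding projective_def
proof (intro conjI assms(3) allI impI)
  fix A B :: "'a fgmod" and p f assume *: "fg A \<and> fg B \<and> mod_epi R A B p \<and> f \<in> Hom X B"
  obtain i r where r: "i \<in> Hom X P" "r \<in> Hom P X" "\<And>x. x \<in> carrier X \<Longrightarrow> r (i x) = x"
    using retractE[OF assms(2)] by metis
  obtain g where "g \<in> Hom P A" "\<And>x. x \<in> carrier P \<Longrightarrow> p (g x) = f (r x)"
    using proj_lift[OF assms(1), of A B p "\<lambda>x. f (r x)"] * Hom_comp[OF r(2)] by metis
  then show "\<exists>g\<in>Hom X A. \<forall>x\<in>carrier X. p (g x) = f x"
    using r Hom_closed[OF r(1)] Hom_comp[OF r(1)] by (intro bexI[of _ "\<lambda>x. g (i x)"]) auto
qed

lemma inj_retract: assumes "inj E" "retract X E" "fg X" shows "inj X"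
  unfolding injective_def
proof (intro conjI assms(3) allI impI)
  fix A B :: "'a fgmod" and j f assume *: "fg A \<and> fg B \<and> mod_mono R A B j \<and> f \<in> Hom A X"
  obtain i r where r: "i \<in> Hom X E" "r \<in> Hom E X" "\<And>x. x \<in> carrier X \<Longrightarrow> r (i x) = x"
    using retractE[OF assms(2)] by metis
  obtain g where "g \<in> Hom B E" "\<And>x. x \<in> carrier A \<Longrightarrow> g (j x) = i (f x)"
    using inj_extend[OF assms(1), of A B j "\<lambda>x. i (f x)"] * Hom_comp[OF _ r(1)] by metis
  then show "\<exists>g\<in>Hom B X. \<forall>x\<in>carrier A. g (j x) = f x"
    using r * Hom_closed[of f A X] Hom_comp[OF _ r(2)] by (intro bexI[of _ "\<lambda>x. r (g x)"]) auto
qed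

lemma proj_miso: "\<lbrakk>proj P; P \<simeq> X; lm X\<rbrakk> \<Longrightarrow> proj X"
  by (rule proj_retract[of P X]) (simp_all add: retract_miso fg_miso[of P X])

lemma inj_miso: "\<lbrakk>inj P; P \<simeq> X; lm X\<rbrakk> \<Longrightarrow> inj X"
  by (rule inj_retract[of P X]) (simp_all add: retract_miso fg_miso[of P X])

lemma proj_ds2: assumes "proj P" "proj P'" shows "proj (P \<uplus> P')"
  unfolding projective_def
proof (intro conjI fg_ds2 proj_fg assms allI impI)
  fix A B :: "'a fgmod" and p f assume "fg A \<and> fg B \<and> mod_epi R A B p \<and> f \<in> Hom (P \<uplus> P') B"
  then have *: "fg A" "fg B" "mod_epi R A B p" and f: "f \<in> Hom (P \<uplus> P') B" by auto
  note p = epi_simps(1)[OF *(3)]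
  have lm: "lm P" "lm P'" "lm A" "lm B" using assms * by auto
  obtain g where g: "g \<in> Hom P A" "\<And>x. x \<in> carrier P \<Longrightarrow> p (g x) = f (x, \<zero>\<^bsub>P'\<^esub>)"
    using proj_lift[OF assms(1) * Hom_comp[OF Hom_inl[OF lm(1,2)] f]] by metis
  obtain g' where g': "g' \<in> Hom P' A" "\<And>x. x \<in> carrier P' \<Longrightarrow> p (g' x) = f (\<zero>\<^bsub>P\<^esub>, x)"
    using proj_lift[OF assms(2) * Hom_comp[OF Hom_inr[OF lm(1,2)] f]] by metis
  have "p (g (fst x) \<oplus>\<^bsub>A\<^esub> g' (snd x)) = f x" if x: "x \<in> carrier (P \<uplus> P')" for x
  proof -
    obtain a b where x: "x = (a, b)" "a \<in> carrier P" "b \<in> carrier P'" using x by auto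
    have "f x = f (a, \<zero>\<^bsub>P'\<^esub>) \<oplus>\<^bsub>B\<^esub> f (\<zero>\<^bsub>P\<^esub>, b)"
      using x lm Hom_simps(2)[OF f, of "(a, \<zero>\<^bsub>P'\<^esub>)" "(\<zero>\<^bsub>P\<^esub>, b)"] by simp
    then show ?thesis
      using x by (simp add: Hom_simps(2)[OF p] Hom_closed[OF g(1)] Hom_closed[OF g'(1)] g(2) g'(2))
  qed
  then show "\<exists>g\<in>Hom (P \<uplus> P') A. \<forall>x\<in>carrier (P \<uplus> P'). p (g x) = f x"
    by (intro bexI[OF _ Hom_copair[OF g(1) g'(1) lm(3)]] ballI)
qed

lemma inj_ds2: assumes "inj P" "inj P'" shows "inj (P \<uplus> P')"
  unfolding injective_def
proof (intro conjI fg_ds2 inj_fg assms allI impI)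
  fix A B :: "'a fgmod" and j f assume "fg A \<and> fg B \<and> mod_mono R A B j \<and> f \<in> Hom A (P \<uplus> P')"
  then have *: "fg A" "fg B" "mod_mono R A B j" and f: "f \<in> Hom A (P \<uplus> P')" by auto
  obtain g where g: "g \<in> Hom B P" "\<And>x. x \<in> carrier A \<Longrightarrow> g (j x) = fst (f x)"
    using inj_extend[OF assms(1) * Hom_comp[OF f Hom_fst]] by metis
  obtain g' where g': "g' \<in> Hom B P'" "\<And>x. x \<in> carrier A \<Longrightarrow> g' (j x) = snd (f x)"
    using inj_extend[OF assms(2) * Hom_comp[OF f Hom_snd]] by metis
  show "\<exists>g\<in>Hom B (P \<uplus> P'). \<forall>x\<in>carrier A. g (j x) = f x"
    using Hom_pair[OF g(1) g'(1)] g(2) g'(2) by (intro bexI[of _ "\<lambda>x. (g x, g' x)"]) auto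
qed

lemma proj_zero: assumes "lm M" "carrier M = {\<zero>\<^bsub>M\<^esub>}" shows "proj M"
  unfolding projective_def
proof (intro conjI fg_zero assms allI impI)
  fix A B :: "'a fgmod" and p f assume *: "fg A \<and> fg B \<and> mod_epi R A B p \<and> f \<in> Hom M B"
  then have "\<forall>x\<in>carrier M. p \<zero>\<^bsub>A\<^esub> = f x"
    using assms Hom_zero[of p A B] Hom_zero[of f M B] by (auto simp: mod_epi_def)
  then show "\<exists>g\<in>Hom M A. \<forall>x\<in>carrier M. p (g x) = f x"
    using Hom_const_zero[of A M] * by (intro bexI[of _ "\<lambda>x. \<zero>\<^bsub>A\<^esub>"]) auto
qed

lemma inj_zero: assumes "lm M" "carrier M = {\<zero>\<^bsub>M\<^esub>}" shows "inj M"
  unfolding injective_def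
proof (intro conjI fg_zero assms allI impI)
  fix A B :: "'a fgmod" and j f assume *: "fg A \<and> fg B \<and> mod_mono R A B j \<and> f \<in> Hom A M"
  then have "\<forall>x\<in>carrier A. f x = \<zero>\<^bsub>M\<^esub>"
    using assms Hom_closed[of f A M] by auto
  then show "\<exists>g\<in>Hom B M. \<forall>x\<in>carrier A. g (j x) = f x"
    using Hom_const_zero[OF assms(1)] by (intro bexI[of _ "\<lambda>x. \<zero>\<^bsub>M\<^esub>"]) auto
qed

lemma proj_regular: assumes "ring R" shows "proj (regular_module R)"
  unfolding projective_def
proof (intro conjI fg_regular assms allI impI)
  fix A B :: "'a fgmod" and p f assume *: "fg A \<and> fg B \<and> mod_epi R A B p \<and> f \<in> Hom (regular_module R) B"
  then have f: "f \<in> Hom (regular_module R) B" and p: "p \<in> Hom A B" "p ` carrier A = carrier B"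
    by (auto simp: mod_epi_def)
  have one: "\<one> \<in> carrier (regular_module R)" using assms by (simp add: ring.ring_simprules)
  obtain a where a: "a \<in> carrier A" "p a = f \<one>" using Hom_closed[OF f one] p(2) by (metis imageE)
  have "p (r \<odot>\<^bsub>A\<^esub> a) = f r" if "r \<in> carrier R" for r
    using Hom_simps(3)[OF f that one] assms that a monoid.r_one[of R r] ring.is_monoid[of R]
    by (simp add: Hom_simps(3)[OF p(1)])
  then show "\<exists>g\<in>Hom (regular_module R) A. \<forall>x\<in>carrier (regular_module R). p (g x) = f x"
    using Hom_regular[of A a] a * by (intro bexI[of _ "\<lambda>r. r \<odot>\<^bsub>A\<^esub> a"]) auto
qed

lemma proj_ds: assumes "ring R" "finite I" "\<And>i. i \<in> I \<Longrightarrow> proj (X i)" shows "proj (direct_sum I X)"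
  using assms(2,3)
proof (induction I)
  case empty
  show ?case by (intro proj_zero lm_ds ds_empty assms(1)) auto
next
  case (insert i I)
  have "X i \<uplus> direct_sum I X \<simeq> direct_sum (insert i I) X"
    using insert assms(1) by (intro miso_sym[OF ds_insert] lm_ds) auto
  then show ?case
    by (rule proj_miso[rotated]) (use insert assms(1) in \<open>auto intro!: lm_ds proj_ds2\<close>)
qed

lemma inj_ds: assumes "ring R" "finite I" "\<And>i. i \<in> I \<Longrightarrow> inj (X i)" shows "inj (direct_sum I X)"
  using assms(2,3)
proof (induction I)
  case empty
  show ?case by (intro inj_zero lm_ds ds_empty assms(1)) auto
next
  case (insert i I)
  have "X i \<uplus> direct_sum I X \<simeq> direct_sum (insert i I) X"
    using insert assms(1) by (intro miso_sym[OF ds_insert] lm_ds) auto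
  then show ?case
    by (rule inj_miso[rotated]) (use insert assms(1) in \<open>auto intro!: lm_ds inj_ds2\<close>)
qed

lemma proj_power: "\<lbrakk>ring R; proj X\<rbrakk> \<Longrightarrow> proj (direct_power n X)"
  unfolding direct_power_def by (rule proj_ds) auto

lemma inj_power: "\<lbrakk>ring R; inj X\<rbrakk> \<Longrightarrow> inj (direct_power n X)"
  unfolding direct_power_def by (rule inj_ds) auto

text \<open>A free module mapped onto \<open>M\<close>, copied to \<open>'a fgmod\<close>, with no
  minimality claimed; minimal covers come from \<open>projective_cover_exists\<close>.\<close>

lemma proj_cover_free:
  assumes "fg M"
  obtains F :: "'a fgmod" and f where "proj F" "mod_epi R F M f"
proof -
  have R: "ring R" using assms lm_ring[of M] by simp
  obtain n f where f: "mod_epi R (direct_power n (regular_module R)) M f" using free_epi[OF assms] by blast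
  have P: "proj (direct_power n (regular_module R))" by (intro proj_power proj_regular R)
  obtain F :: "'a fgmod" where F: "fg F" "direct_power n (regular_module R) \<simeq> F" "F \<simeq> direct_power n (regular_module R)"
    by (rule fg_copy[OF proj_fg[OF P]])
  have "proj F" using proj_miso[OF P F(2)] F(1) by simp
  obtain h where "h \<in> Hom F (direct_power n (regular_module R))" "bij_betw h (carrier F) (carrier (direct_power n (regular_module R)))"
    using F(3) by (auto simp: mod_iso_def)
  then show ?thesis using that[OF \<open>proj F\<close> epi_comp[OF miso_epi f]] by blast
qed

lemma proj_epi_retract: assumes "proj P" "fg M" "mod_epi R M P p" shows "retract P M"
proof -
  obtain g where "g \<in> Hom P M" "\<And>x. x \<in> carrier P \<Longrightarrow> p (g x) = x"
    using proj_lift[OF assms(1,2) _ assms(3) Hom_id] assms(1) by auto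
  then show ?thesis using retractI epi_simps(1)[OF assms(3)] by metis
qed

lemma inj_mono_retract: assumes "inj E" "fg M" "mod_mono R E M j" shows "retract E M"
proof -
  obtain g where "g \<in> Hom M E" "\<And>x. x \<in> carrier E \<Longrightarrow> g (j x) = x"
    using inj_extend[OF assms(1) _ assms(2,3) Hom_id] assms(1) by auto
  then show ?thesis using retractI mono_Hom[OF assms(3)] by metis
qed

end

section \<open>Chain conditions\<close>

text \<open>The flag selects the direction, so that each closure property is proved once for both
  chain conditions.\<close>

definition chain_le :: "bool \<Rightarrow> 'b set \<Rightarrow> 'b set \<Rightarrow> bool" where
  "chain_le up A B \<longleftrightarrow> (if up then A \<subseteq> B else B \<subseteq> A)"

context base_ring
begin

definition chain_cond :: "bool \<Rightarrow> ('a, 'm) module \<Rightarrow> bool" where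
  "chain_cond up M \<longleftrightarrow> (\<forall>X :: nat \<Rightarrow> 'm set. (\<forall>n. sm (X n) M \<and> chain_le up (X n) (X (Suc n))) \<longrightarrow>
     (\<exists>n. \<forall>m\<ge>n. X m = X n))"

abbreviation acc :: "('a, 'm) module \<Rightarrow> bool" where "acc M \<equiv> chain_cond True M"
abbreviation dcc :: "('a, 'm) module \<Rightarrow> bool" where "dcc M \<equiv> chain_cond False M"

lemma chain_le_image: "chain_le up A B \<Longrightarrow> chain_le up (f ` A) (f ` B)"
  by (auto simp: chain_le_def split: if_splits)

lemma chain_condE:
  assumes "chain_cond up M" "\<And>n. sm (X n) M" "\<And>n. chain_le up (X n) (X (Suc n))"
  obtains n where "\<And>m. m \<ge> n \<Longrightarrow> X m = X n"
  using assms unfolding chain_cond_def by metis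

lemma chain_condI:
  assumes "\<And>X. \<lbrakk>\<And>n. sm (X n) M; \<And>n. chain_le up (X n) (X (Suc n))\<rbrakk> \<Longrightarrow> \<exists>n. \<forall>m\<ge>n. X m = X n"
  shows "chain_cond up M"
  using assms unfolding chain_cond_def by auto

lemma cc_mono: assumes "chain_cond up M" "mod_mono R N M j" "lm N" "lm M" shows "chain_cond up N"
proof (rule chain_condI)
  fix X assume X: "\<And>n. sm (X n) N" "\<And>n. chain_le up (X n) (X (Suc n))"
  note j = mono_Hom[OF assms(2)]
  have *: "chain_le up (j ` X n) (j ` X (Suc n))" for n
    using X(2)[of n] by (rule chain_le_image)
  obtain n where n: "\<And>m. m \<ge> n \<Longrightarrow> j ` X m = j ` X n"
    using chain_condE[OF assms(1), of "\<lambda>n. j ` X n"] sm_image[OF j assms(3,4) X(1)] * by metis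
  have "inj_on j (carrier N)" using assms(2) by (simp add: mod_mono_def)
  then have "X m = X n" if "m \<ge> n" for m
    using n[OF that] sm_subset[OF X(1)] by (metis inj_on_image_eq_iff)
  then show "\<exists>n. \<forall>m\<ge>n. X m = X n" by blast
qed

lemma cc_epi: assumes "chain_cond up M" "mod_epi R M N p" "lm N" "lm M" shows "chain_cond up N"
proof (rule chain_condI)
  fix X assume X: "\<And>n. sm (X n) N" "\<And>n. chain_le up (X n) (X (Suc n))"
  note p = epi_simps[OF assms(2)]
  define Y where "Y n = {x \<in> carrier M. p x \<in> X n}" for n
  have *: "chain_le up (Y n) (Y (Suc n))" for n
    using X(2)[of n] by (auto simp: chain_le_def Y_def split: if_splits)
  have "sm (Y n) M" for n unfolding Y_def by (rule sm_vimage[OF p(1) assms(4,3) X(1)])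
  then obtain n where n: "\<And>m. m \<ge> n \<Longrightarrow> Y m = Y n"
    using chain_condE[OF assms(1), of Y] * by metis
  have "p ` Y m = X m" for m
    using sm_subset[OF X(1)[of m]] by (auto simp: Y_def image_iff p(2)[symmetric])
  then show "\<exists>n. \<forall>m\<ge>n. X m = X n" using n by metis
qed

lemma chain_stable_le: assumes "\<And>n. chain_le up (X n) (X (Suc n))" "m \<le> n" shows "chain_le up (X m) (X n)"
  using assms(2)
proof (induction n rule: dec_induct)
  case (step n)
  then show ?case using assms(1)[of n] by (auto simp: chain_le_def split: if_splits)
qed (simp add: chain_le_def)

text \<open>A chain stops as soon as its traces on the kernel and its images under \<open>f\<close>
  both stop: nested submodules with the same trace and the same image coincide, since an element of
  the larger one differs from one of the smaller by an element of the kernel.\<close>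

lemma cc_ext:
  assumes f: "f \<in> Hom M N" and lm: "lm M" "lm N"
    and N: "chain_cond up N" and K: "chain_cond up (sub M (a_kernel M N f))"
  shows "chain_cond up M"
proof (rule chain_condI)
  fix X assume X: "\<And>n. sm (X n) M" "\<And>n. chain_le up (X n) (X (Suc n))"
  let ?K = "a_kernel M N f"
  have smK: "sm ?K M" by (rule sm_ker[OF f lm])
  have "chain_le up (X n \<inter> ?K) (X (Suc n) \<inter> ?K)" "chain_le up (f ` X n) (f ` X (Suc n))" for n
    using X(2)[of n] chain_le_image[OF X(2)[of n]] by (auto simp: chain_le_def split: if_splits)
  moreover have "sm (X n \<inter> ?K) (sub M ?K)" for n
    using sm_sub_iff[OF lm(1) smK] sm_Int[OF lm(1) X(1) smK] by simp
  ultimately obtain n1 n2 where n1: "\<And>m. m \<ge> n1 \<Longrightarrow> X m \<inter> ?K = X n1 \<inter> ?K"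
    and n2: "\<And>m. m \<ge> n2 \<Longrightarrow> f ` X m = f ` X n2"
    using chain_condE[OF K, of "\<lambda>n. X n \<inter> ?K"] chain_condE[OF N, of "\<lambda>n. f ` X n"] sm_image[OF f lm X(1)]
    by metis
  define n where "n = max n1 n2"
  have key: "B \<subseteq> A" if AB: "sm A M" "sm B M" "A \<subseteq> B" "A \<inter> ?K = B \<inter> ?K" "f ` A = f ` B" for A B
  proof
    fix b assume b: "b \<in> B"
    then obtain a where a: "a \<in> A" "f b = f a" using AB(5) by blast
    have car: "a \<in> carrier M" "b \<in> carrier M" using a b AB sm_mem by metis+
    have "b \<ominus>\<^bsub>M\<^esub> a \<in> ?K" using a(2) car lm by (simp add: ker_iff Hom_minus[OF f] Hom_closed[OF f])
    moreover have "b \<ominus>\<^bsub>M\<^esub> a \<in> B" using sm_simps(5)[OF AB(2) b] a(1) AB(3) by auto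
    ultimately have "b \<ominus>\<^bsub>M\<^esub> a \<in> A" using AB(4) by blast
    then have "(b \<ominus>\<^bsub>M\<^esub> a) \<oplus>\<^bsub>M\<^esub> a \<in> A" using sm_simps(2)[OF AB(1)] a(1) by blast
    then show "b \<in> A" using car lm by simp
  qed
  have "X m = X n" if "m \<ge> n" for m
  proof -
    have "X m \<inter> ?K = X n \<inter> ?K" "f ` X m = f ` X n"
      using n1[of m] n1[of n] n2[of m] n2[of n] that by (simp_all add: n_def)
    moreover have "chain_le up (X n) (X m)" by (rule chain_stable_le[of up X]) (use X(2) that in auto)
    ultimately show ?thesis
      using key[OF X(1)[of n] X(1)[of m]] key[OF X(1)[of m] X(1)[of n]] by (auto simp: chain_le_def split: if_splits)
  qed
  then show "\<exists>n. \<forall>m\<ge>n. X m = X n" by blast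
qed

lemma cc_ds2: assumes "lm M" "lm N" "chain_cond up M" "chain_cond up N" shows "chain_cond up (M \<uplus> N)"
proof (rule cc_ext[OF Hom_snd])
  let ?K = "a_kernel (M \<uplus> N) N snd"
  have K: "sm ?K (M \<uplus> N)" by (rule sm_ker[OF Hom_snd]) (use assms in auto)
  have "mod_mono R (sub (M \<uplus> N) ?K) M fst"
    unfolding mod_mono_def using Hom_sub_from[OF Hom_fst K] by (auto simp: inj_on_def ker_iff)
  then show "chain_cond up (sub (M \<uplus> N) ?K)"
    by (rule cc_mono[OF assms(3)]) (use lm_sub[OF _ K] assms in auto)
qed (use assms in auto)

lemma cc_simple: assumes "\<And>N. sm N M \<Longrightarrow> N = {\<zero>\<^bsub>M\<^esub>} \<or> N = carrier M" "lm M" shows "chain_cond up M"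
proof (rule chain_condI)
  fix X assume X: "\<And>n. sm (X n) M" "\<And>n. chain_le up (X n) (X (Suc n))"
  \<comment> \<open>\<open>E\<close> is the extreme submodule that a chain cannot leave once it is
    reached; a chain that never reaches it is constant at the other one.\<close>
  define E where "E = (if up then carrier M else {\<zero>\<^bsub>M\<^esub>})"
  show "\<exists>n. \<forall>m\<ge>n. X m = X n"
  proof (cases "\<exists>n. X n = E")
    case True
    then obtain n where n: "X n = E" by blast
    have "X m = E" if "m \<ge> n" for m
    proof -
      have "chain_le up (X n) (X m)" by (rule chain_stable_le[of up X]) (use X(2) that in auto)
      then show ?thesis
        using n sm_subset[OF X(1)[of m]] sm_simps(1)[OF X(1)[of m]] by (auto simp: E_def chain_le_def split: if_splits)
    qed
    then show ?thesis using n by blast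
  next
    case False
    then have "X n = (if up then {\<zero>\<^bsub>M\<^esub>} else carrier M)" for n
      using assms(1)[OF X(1)[of n]] by (auto simp: E_def split: if_splits)
    then show ?thesis by simp
  qed
qed

lemma cc_zero: assumes "lm M" "carrier M = {\<zero>\<^bsub>M\<^esub>}" shows "chain_cond up M"
  using sm_subset[of _ M] sm_simps(1)[of _ M] assms by (intro cc_simple) auto

lemma cc_power:
  assumes "ring R" "lm X" "chain_cond up X" shows "chain_cond up (direct_power n X)"
proof (induction n)
  case 0
  have "lm (direct_sum {} (\<lambda>_::nat. X))" by (rule lm_ds) (use assms in auto)
  then show ?case unfolding direct_power_def by (intro cc_zero) (auto simp: ds_empty)
next
  case (Suc n)
  have lm: "lm (direct_power n X)" for n unfolding direct_power_def by (rule lm_ds) (use assms in auto)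
  obtain f g where "f \<in> Hom (direct_power (Suc n) X) (X \<uplus> direct_power n X)" "\<And>x. x \<in> carrier (direct_power (Suc n) X) \<Longrightarrow> g (f x) = x"
    using misoE[OF direct_power_Suc lm] by metis
  then have "mod_mono R (direct_power (Suc n) X) (X \<uplus> direct_power n X) f" by (rule split_mono)
  then show ?case by (rule cc_mono[OF cc_ds2[OF assms(2) lm assms(3) Suc] _ lm lm_ds2[OF assms(2) lm]])
qed

lemma cc_fg: assumes "ring R" "chain_cond up (regular_module R)" "fg M" shows "chain_cond up M"
proof -
  obtain n f where f: "mod_epi R (direct_power n (regular_module R)) M f" using free_epi[OF assms(3)] by blast
  show ?thesis
    by (rule cc_epi[OF cc_power[OF assms(1) lm_regular[OF assms(1)] assms(2)] f fg_lm[OF assms(3)]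
      fg_lm[OF fg_power[OF assms(1) fg_regular[OF assms(1)]]]])
qed

text \<open>Otherwise every member of the family could be replaced by a strictly further one, and
  iterating this choice gives a chain that never stops. The flag \<open>True\<close> yields a
  maximal member, \<open>False\<close> a minimal one.\<close>

lemma chain_extremal:
  assumes "chain_cond up M" "N0 \<in> \<S>" "\<And>N. N \<in> \<S> \<Longrightarrow> sm N M"
  obtains N where "N \<in> \<S>" "\<And>L. \<lbrakk>L \<in> \<S>; chain_le up N L\<rbrakk> \<Longrightarrow> L = N"
proof (rule ccontr)
  assume "\<not> thesis"
  then have "\<forall>N\<in>\<S>. \<exists>L. L \<in> \<S> \<and> chain_le up N L \<and> L \<noteq> N" using that by blast
  then obtain F where F: "\<And>N. N \<in> \<S> \<Longrightarrow> F N \<in> \<S> \<and> chain_le up N (F N) \<and> F N \<noteq> N" by metis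
  define X where "X n = (F ^^ n) N0" for n
  have X: "X n \<in> \<S>" for n by (induction n) (use F assms(2) in \<open>auto simp: X_def\<close>)
  have Suc: "X (Suc n) = F (X n)" for n by (simp add: X_def)
  obtain n where "\<And>m. m \<ge> n \<Longrightarrow> X m = X n"
    using chain_condE[OF assms(1), of X] assms(3)[OF X] F[OF X] by (metis Suc)
  then have "F (X n) = X n" using Suc[of n] by (metis le_SucI order_refl)
  then show False using F[OF X] by blast
qed

text \<open>A maximal \<open>L\<close> among the finitely generated submodules inside
  \<open>N\<close> equals \<open>N\<close>: for \<open>x\<close> in \<open>N\<close> the sum
  \<open>L + R x\<close> is again such a submodule. Generation is phrased with submodules of
  \<open>M\<close>, so that all members of the family live in one lattice.\<close>

lemma acc_fg_sub: assumes "acc M" "lm M" "sm N M" shows "fg (sub M N)"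
proof -
  let ?\<S> = "{L. sm L M \<and> L \<subseteq> N \<and> (\<exists>S. finite S \<and> S \<subseteq> L \<and> (\<forall>H. sm H M \<and> S \<subseteq> H \<longrightarrow> L \<subseteq> H))}"
  have "{\<zero>\<^bsub>M\<^esub>} \<in> ?\<S>" using sm_zero[OF assms(2)] sm_simps(1)[OF assms(3)] sm_simps(1)[of _ M]
    by (auto intro!: exI[of _ "{}"])
  then obtain L where L: "L \<in> ?\<S>" and max: "\<And>L'. \<lbrakk>L' \<in> ?\<S>; chain_le True L L'\<rbrakk> \<Longrightarrow> L' = L"
    by (rule chain_extremal[OF assms(1)]) auto
  then obtain S where S: "finite S" "S \<subseteq> L" "\<And>H. \<lbrakk>sm H M; S \<subseteq> H\<rbrakk> \<Longrightarrow> L \<subseteq> H" and Lsm: "sm L M" "L \<subseteq> N" by auto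
  have "N \<subseteq> L"
  proof
    fix x assume x: "x \<in> N"
    have xM: "x \<in> carrier M" using sm_mem[OF assms(3) x] .
    let ?C = "(\<lambda>a. a \<odot>\<^bsub>M\<^esub> x) ` carrier R"
    have C: "sm ?C M" using sm_img[OF Hom_regular[OF assms(2) xM] lm_regular assms(2)] lm_ring[OF assms(2)] by simp
    have xC: "x \<in> ?C" using xM assms(2) lm_ring[OF assms(2)]
      by (auto simp: image_iff ring.ring_simprules intro!: bexI[of _ \<one>])
    have LC: "sm (L <+>\<^bsub>M\<^esub> ?C) M" by (rule sm_add[OF assms(2) Lsm(1) C])
    have "L <+>\<^bsub>M\<^esub> ?C \<subseteq> N" using Lsm(2) x by (auto simp: set_add_iff intro!: sm_simps(2,3)[OF assms(3)])
    moreover have "L <+>\<^bsub>M\<^esub> ?C \<subseteq> H" if H: "sm H M" "insert x S \<subseteq> H" for H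
      using H S(3)[OF H(1)] by (auto simp: set_add_iff intro!: sm_simps(2,3)[OF H(1)])
    moreover have "insert x S \<subseteq> L <+>\<^bsub>M\<^esub> ?C"
      using S(2) sm_addI1[OF assms(2) Lsm(1) C] sm_addI2[OF assms(2) Lsm(1) C xC] by auto
    ultimately have "L <+>\<^bsub>M\<^esub> ?C \<in> ?\<S>" using LC S(1) by (auto intro!: exI[of _ "insert x S"])
    then have "L <+>\<^bsub>M\<^esub> ?C = L"
      using max sm_addI1[OF assms(2) Lsm(1) C] by (auto simp: chain_le_def)
    then show "x \<in> L" using sm_addI2[OF assms(2) Lsm(1) C xC] by simp
  qed
  then have "L = N" using Lsm(2) by blast
  show ?thesis
  proof (rule fgI[OF lm_sub[OF assms(2,3)] S(1)])
    show "S \<subseteq> carrier (sub M N)" using S(2) Lsm(2) by auto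
    show "H = carrier (sub M N)" if "sm H (sub M N)" "S \<subseteq> H" for H
      using that S(3)[of H] sm_sub_iff[OF assms(2,3)] \<open>L = N\<close> by auto
  qed
qed

subsection \<open>Commutative artinian rings are noetherian\<close>

lemma Hom_mult: assumes "cring R" "r \<in> carrier R" shows "(\<lambda>x. r \<otimes> x) \<in> Hom (regular_module R) (regular_module R)"
proof -
  interpret cring R by (rule assms(1))
  show ?thesis using assms(2) by (intro HomI) (auto simp: r_distr m_lcomm)
qed

text \<open>A minimal ideal \<open>I\<close> without ascending chain condition satisfies \<open>r I = 0\<close> or \<open>r I = I\<close> for all \<open>r\<close>,
  hence is a vector space over the field \<open>R / ann I\<close>, so a complement of a line in \<open>I\<close> is a proper ideal.\<close>

lemma artinian_noetherian:
  assumes "cring R" and dcc: "dcc (regular_module R)"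
  shows "acc (regular_module R)"
proof (rule ccontr)
  assume nacc: "\<not> acc (regular_module R)"
  interpret cring R by (rule assms(1))
  let ?A = "regular_module R"
  have lmA: "lm ?A" by (rule lm_regular[OF ring_axioms])
  let ?\<S> = "{I. sm I ?A \<and> \<not> acc (sub ?A I)}"
  have "mod_mono R ?A (sub ?A (carrier ?A)) (\<lambda>x. x)"
    by (auto simp: mod_mono_def intro!: HomI)
  then have "carrier ?A \<in> ?\<S>"
    using cc_mono[of True "sub ?A (carrier ?A)" ?A] nacc lmA lm_sub[OF lmA sm_carrier[OF lmA]] sm_carrier[OF lmA] by auto
  then obtain I where I: "I \<in> ?\<S>" and min: "\<And>L. \<lbrakk>L \<in> ?\<S>; chain_le False I L\<rbrakk> \<Longrightarrow> L = I"
    by (rule chain_extremal[OF dcc]) auto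
  have Ism: "sm I ?A" and Inacc: "\<not> acc (sub ?A I)" using I by auto
  have sub_acc: "acc (sub ?A L)" if "sm L ?A" "L \<subseteq> I" "L \<noteq> I" for L
    using min[of L] that by (auto simp: chain_le_def)
  note Isimps = sm_simps[OF Ism, simplified]
  have Icar: "x \<in> carrier R" if "x \<in> I" for x using sm_mem[OF Ism that] by simp
  have lmI: "lm (sub ?A I)" by (rule lm_sub[OF lmA Ism])
  \<comment> \<open>Multiplication by \<open>r\<close> maps \<open>I\<close> onto
    \<open>r I\<close>, with kernel an ideal inside \<open>I\<close>. If neither alternative held,
    image and kernel would both be proper in \<open>I\<close>, hence noetherian by minimality, and
    so would \<open>I\<close> be.\<close>
  have dich: "(\<forall>x\<in>I. r \<otimes> x = \<zero>) \<or> (\<lambda>x. r \<otimes> x) ` I = I" if r: "r \<in> carrier R" for r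
  proof (rule ccontr)
    assume neg: "\<not> ?thesis"
    let ?f = "\<lambda>x. r \<otimes> x"
    have im: "?f ` I \<subseteq> I" using Isimps(3) r by auto
    have ism: "sm (?f ` I) ?A" by (rule sm_image[OF Hom_mult[OF assms(1) r] lmA lmA Ism])
    have f: "?f \<in> Hom (sub ?A I) (sub ?A (?f ` I))"
      by (rule Hom_sub_to[OF Hom_sub_from[OF Hom_mult[OF assms(1) r] Ism]]) auto
    have lmi: "lm (sub ?A (?f ` I))" by (rule lm_sub[OF lmA ism])
    let ?K = "a_kernel (sub ?A I) (sub ?A (?f ` I)) ?f"
    have "sm ?K (sub ?A I)" by (rule sm_ker[OF f lmI lmi])
    then have K: "sm ?K ?A" "?K \<subseteq> I" using sm_sub_iff[OF lmA Ism] by auto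
    have "?K \<noteq> I" using neg by (auto simp: set_eq_iff ker_iff)
    then have K': "acc (sub (sub ?A I) ?K)" using sub_acc[OF K] by simp
    have "acc (sub ?A (?f ` I))" using sub_acc[OF ism im] neg by auto
    from cc_ext[OF f lmI lmi this K'] Inacc show False by (rule notE[rotated])
  qed
  have "\<exists>x0\<in>I. x0 \<noteq> \<zero>"
  proof (rule ccontr)
    assume "\<not> ?thesis"
    then have "I = {\<zero>}" using Isimps(1) by blast
    then have "acc (sub ?A I)" by (intro cc_zero[OF lmI]) simp
    with Inacc show False by blast
  qed
  then obtain x0 where x0: "x0 \<in> I" "x0 \<noteq> \<zero>" by blast
  \<comment> \<open>If \<open>r\<close> does not annihilate \<open>I\<close> then
    \<open>r I = I\<close>, hence \<open>I = r^n I\<close>. The descending chain of ideals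
    \<open>r^n R\<close> stops, so \<open>r^n = r^(n+1) s\<close> for some \<open>n\<close> and
    \<open>s\<close>. Writing \<open>x\<close> in \<open>I\<close> as \<open>r^n y\<close> gives
    \<open>s r x = x\<close>.\<close>
  have inv: "\<exists>s\<in>carrier R. \<forall>x\<in>I. s \<otimes> (r \<otimes> x) = x" if r: "r \<in> carrier R" and nz: "\<exists>x\<in>I. r \<otimes> x \<noteq> \<zero>" for r
  proof -
    have rI: "(\<lambda>x. r \<otimes> x) ` I = I" using dich[OF r] nz by blast
    have pow: "\<exists>y\<in>I. x = r [^] n \<otimes> y" if "x \<in> I" for x and n :: nat
      using that
    proof (induction n arbitrary: x)
      case (Suc n)
      then obtain y where y: "y \<in> I" "x = r [^] n \<otimes> y" by blast
      then obtain z where "z \<in> I" "y = r \<otimes> z" using rI by blast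
      then show ?case using y r Icar by (intro bexI[of _ z]) (auto simp: m_assoc)
    qed (use Icar in auto)
    define X where "X n = (\<lambda>a. r [^] n \<otimes> a) ` carrier R" for n :: nat
    have Xsm: "sm (X n) ?A" for n
      using sm_img[OF Hom_mult[OF assms(1)] lmA lmA, of "r [^] n"] r by (simp add: X_def)
    have "X (Suc n) \<subseteq> X n" for n using r by (auto simp: X_def m_assoc)
    then obtain n where n: "\<And>m. m \<ge> n \<Longrightarrow> X m = X n"
      using chain_condE[OF dcc, of X] Xsm by (metis chain_le_def)
    have "r [^] n \<in> X n" using r by (auto simp: X_def image_iff intro!: bexI[of _ \<one>])
    then have "r [^] n \<in> X (Suc n)" using n[of "Suc n"] by simp
    then obtain s where s: "s \<in> carrier R" "r [^] n = r [^] Suc n \<otimes> s" by (auto simp: X_def)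
    have "s \<otimes> (r \<otimes> x) = x" if x: "x \<in> I" for x
    proof -
      obtain y where y: "y \<in> I" "x = r [^] n \<otimes> y" using pow[OF x] by blast
      have "s \<otimes> (r \<otimes> (r [^] n \<otimes> y)) = (r [^] Suc n \<otimes> s) \<otimes> y"
        using s(1) r Icar[OF y(1)] by (simp add: m_ac)
      then show ?thesis unfolding y(2) s(2)[symmetric] .
    qed
    then show ?thesis using s(1) by blast
  qed
  \<comment> \<open>A maximal member of this family is the complement of the line through
    \<open>x0\<close>. Zorn's lemma provides it, because \<open>I\<close> is assumed to violate the
    ascending chain condition.\<close>
  let ?\<N> = "{N. sm N ?A \<and> N \<subseteq> I \<and> x0 \<notin> N}"
  have "\<exists>N\<in>?\<N>. \<forall>X\<in>?\<N>. N \<subseteq> X \<longrightarrow> X = N"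
  proof (rule subset_Zorn_nonempty)
    have "{\<zero>} \<in> ?\<N>" using sm_zero[OF lmA] Isimps(1) x0 by auto
    then show "?\<N> \<noteq> {}" by blast
    show "\<Union> \<C> \<in> ?\<N>" if C: "\<C> \<noteq> {}" "subset.chain ?\<N> \<C>" for \<C>
    proof -
      have C': "\<And>N. N \<in> \<C> \<Longrightarrow> sm N ?A \<and> N \<subseteq> I \<and> x0 \<notin> N"
        and ch: "\<And>N L. \<lbrakk>N \<in> \<C>; L \<in> \<C>\<rbrakk> \<Longrightarrow> N \<subseteq> L \<or> L \<subseteq> N"
        using C(2) by (auto simp: subset.chain_def)
      have "sm (\<Union> \<C>) ?A"
      proof (rule smI[OF lmA])
        show "\<Union> \<C> \<subseteq> carrier ?A" using C' Icar by fastforce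
        show "\<zero>\<^bsub>?A\<^esub> \<in> \<Union> \<C>" using C(1) C' sm_simps(1)[of _ ?A] by fastforce
        show "x \<oplus>\<^bsub>?A\<^esub> y \<in> \<Union> \<C>" if "x \<in> \<Union> \<C>" "y \<in> \<Union> \<C>" for x y
        proof -
          obtain N where "N \<in> \<C>" "x \<in> N" "y \<in> N" using \<open>x \<in> \<Union> \<C>\<close> \<open>y \<in> \<Union> \<C>\<close> ch by blast
          then show ?thesis using C' sm_simps(2)[of N ?A x y] by blast
        qed
        show "a \<odot>\<^bsub>?A\<^esub> x \<in> \<Union> \<C>" if "a \<in> carrier R" "x \<in> \<Union> \<C>" for a x
          using that C' sm_simps(3)[of _ ?A a x] by blast
      qed
      then show ?thesis using C' by blast
    qed
  qed
  then obtain N where N: "sm N ?A" "N \<subseteq> I" "x0 \<notin> N"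
    and Nmax: "\<And>X. \<lbrakk>sm X ?A; X \<subseteq> I; x0 \<notin> X; N \<subseteq> X\<rbrakk> \<Longrightarrow> X = N" by auto
  let ?C = "\<lambda>y. (\<lambda>a. a \<otimes> y) ` carrier R"
  have Csm: "sm (?C y) ?A" if "y \<in> I" for y
    using sm_img[OF Hom_regular[of ?A y] lmA lmA] lmA Icar[OF that] by simp
  have CI: "?C y \<subseteq> I" if "y \<in> I" for y using Isimps(3) that by auto
  have Cmem: "y \<in> ?C y" if "y \<in> I" for y using Icar[OF that] by (auto simp: image_iff intro!: bexI[of _ \<one>])
  have nz: "\<exists>z\<in>I. a \<otimes> z \<noteq> \<zero>" if "a \<otimes> y \<noteq> \<zero>" "y \<in> I" for a y using that by blast
  \<comment> \<open>If \<open>y\<close> lies outside \<open>N\<close>, maximality puts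
    \<open>x0\<close> into \<open>N + R y\<close>. The coefficient of \<open>y\<close> acts
    invertibly on \<open>I\<close>, so the equation can be solved for \<open>y\<close>.\<close>
  have span: "y \<in> N <+>\<^bsub>?A\<^esub> ?C x0" if y: "y \<in> I" for y
  proof (cases "y \<in> N")
    case False
    have sum: "sm (N <+>\<^bsub>?A\<^esub> ?C y) ?A" by (rule sm_add[OF lmA N(1) Csm[OF y]])
    have "N <+>\<^bsub>?A\<^esub> ?C y \<subseteq> I" using N(2) CI[OF y] by (auto simp: set_add_iff subset_iff intro!: Isimps(2))
    moreover have "N \<subseteq> N <+>\<^bsub>?A\<^esub> ?C y" using sm_addI1[OF lmA N(1) Csm[OF y]] by blast
    moreover have "N <+>\<^bsub>?A\<^esub> ?C y \<noteq> N" using sm_addI2[OF lmA N(1) Csm[OF y] Cmem[OF y]] False by blast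
    ultimately have "x0 \<in> N <+>\<^bsub>?A\<^esub> ?C y" using Nmax[OF sum] by blast
    then obtain n r where nr: "n \<in> N" "r \<in> carrier R" "x0 = n \<oplus> r \<otimes> y" by (auto simp: set_add_iff)
    have nc: "n \<in> carrier R" and yc: "y \<in> carrier R" using N nr Icar y by auto
    have "r \<otimes> y \<noteq> \<zero>" using nr nc N(3) by auto
    then obtain s where s: "s \<in> carrier R" "s \<otimes> (r \<otimes> y) = y" using inv[OF nr(2) nz] y by blast
    have "(\<ominus> s) \<otimes> n \<oplus> s \<otimes> x0 = s \<otimes> (r \<otimes> y)"
      using nr s(1) nc yc by (simp add: r_distr l_minus) (simp add: a_assoc[symmetric] l_neg)
    then have "y = (\<ominus> s) \<otimes> n \<oplus> s \<otimes> x0" using s by simp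
    moreover have "(\<ominus> s) \<otimes> n \<in> N" using sm_simps(3)[OF N(1), of "\<ominus> s" n] s nr by simp
    ultimately show ?thesis using s(1) by (auto simp: set_add_iff)
  qed (use sm_addI1[OF lmA N(1) Csm[OF x0(1)]] in blast)
  have accN: "acc (sub ?A N)" using sub_acc N x0 by blast
  have lmC: "lm (sub ?A (?C x0))" by (rule lm_sub[OF lmA Csm[OF x0(1)]])
  have accC: "acc (sub ?A (?C x0))"
  proof (rule cc_simple[OF _ lmC])
    fix L assume "sm L (sub ?A (?C x0))"
    then have L: "sm L ?A" "L \<subseteq> ?C x0" using sm_sub_iff[OF lmA Csm[OF x0(1)]] by auto
    show "L = {\<zero>\<^bsub>sub ?A (?C x0)\<^esub>} \<or> L = carrier (sub ?A (?C x0))"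
    proof (cases "L \<subseteq> {\<zero>}")
      case True
      then show ?thesis using sm_simps(1)[OF L(1)] by auto
    next
      case False
      then obtain a where a: "a \<in> carrier R" "a \<otimes> x0 \<in> L" "a \<otimes> x0 \<noteq> \<zero>" using L(2) by auto
      then obtain s where "s \<in> carrier R" "s \<otimes> (a \<otimes> x0) = x0" using inv[OF a(1) nz] x0(1) by blast
      then have "x0 \<in> L" using sm_simps(3)[OF L(1), of s "a \<otimes> x0"] a by simp
      then have "?C x0 \<subseteq> L" using sm_simps(3)[OF L(1)] by auto
      then show ?thesis using L(2) by auto
    qed
  qed
  have lmN: "lm (sub ?A N)" by (rule lm_sub[OF lmA N(1)])
  \<comment> \<open>\<open>N\<close> is proper in \<open>I\<close>, hence noetherian, and the line
    through \<open>x0\<close> has only trivial submodules. Thus \<open>I\<close> is a quotient of a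
    noetherian module, against its choice.\<close>
  have "mod_epi R (sub ?A N \<uplus> sub ?A (?C x0)) (sub ?A I) (\<lambda>x. fst x \<oplus>\<^bsub>sub ?A I\<^esub> snd x)"
    unfolding mod_epi_def
  proof
    show "(\<lambda>x. fst x \<oplus>\<^bsub>sub ?A I\<^esub> snd x) \<in> Hom (sub ?A N \<uplus> sub ?A (?C x0)) (sub ?A I)"
      by (rule Hom_copair[OF _ _ lmI]) (use N(2) CI[OF x0(1)] in \<open>auto intro!: HomI simp: subset_iff\<close>)
    show "(\<lambda>x. fst x \<oplus>\<^bsub>sub ?A I\<^esub> snd x) ` carrier (sub ?A N \<uplus> sub ?A (?C x0)) = carrier (sub ?A I)"
    proof
      show "(\<lambda>x. fst x \<oplus>\<^bsub>sub ?A I\<^esub> snd x) ` carrier (sub ?A N \<uplus> sub ?A (?C x0)) \<subseteq> carrier (sub ?A I)"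
        using N(2) CI[OF x0(1)] by (auto simp: subset_iff intro!: Isimps(2))
      show "carrier (sub ?A I) \<subseteq> (\<lambda>x. fst x \<oplus>\<^bsub>sub ?A I\<^esub> snd x) ` carrier (sub ?A N \<uplus> sub ?A (?C x0))"
      proof
        fix y assume "y \<in> carrier (sub ?A I)"
        then obtain u v where "u \<in> N" "v \<in> ?C x0" "y = u \<oplus> v" using span[of y] by (auto simp: set_add_iff)
        then show "y \<in> (\<lambda>x. fst x \<oplus>\<^bsub>sub ?A I\<^esub> snd x) ` carrier (sub ?A N \<uplus> sub ?A (?C x0))"
          by (intro image_eqI[of _ _ "(u, v)"]) auto
      qed
    qed
  qed
  then have "acc (sub ?A I)"
    by (rule cc_epi[OF cc_ds2[OF lmN lmC accN accC] _ lmI lm_ds2[OF lmN lmC]])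
  with Inacc show False by blast
qed

lemma sm_regular_iff: assumes "cring R" shows "sm I (regular_module R) \<longleftrightarrow> ideal I R"
proof -
  interpret cring R by (rule assms)
  show ?thesis
  proof
    assume sm: "sm I (regular_module R)"
    show "ideal I R"
    proof (rule idealI[OF ring_axioms])
      show "subgroup I (add_monoid R)"
        using submodule.axioms(1)[OF sm] by (simp add: regular_module_def subgroup_def m_inv_def)
      show "x \<otimes> a \<in> I" "a \<otimes> x \<in> I" if "a \<in> I" "x \<in> carrier R" for a x
        using sm_simps(3)[OF sm, of x a] sm_mem[OF sm that(1)] that m_comm by auto
    qed
  next
    assume "ideal I R"
    then interpret ideal I R .
    show "sm I (regular_module R)"
      by (rule smI[OF lm_regular[OF ring_axioms]]) (auto simp: I_l_closed a_subset[THEN subsetD])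
  qed
qed

lemma artinian_cring_cc:
  assumes "artinian_cring R" shows "chain_cond up (regular_module R)"
proof -
  interpret cring R using assms by (simp add: artinian_cring_def)
  have "dcc (regular_module R)"
  proof (rule chain_condI)
    fix X assume "\<And>n. sm (X n) (regular_module R)" "\<And>n. chain_le False (X n) (X (Suc n))"
    then show "\<exists>n. \<forall>m\<ge>n. X m = X n"
      using assms sm_regular_iff[OF cring_axioms] unfolding artinian_cring_def chain_le_def by simp
  qed
  then show ?thesis using artinian_noetherian[OF cring_axioms] by (cases up) auto
qed

end

section \<open>The Krull-Schmidt theorem\<close>

text \<open>Both chain conditions are demanded because Fitting's lemma stops kernels and images of
  powers at the same time.\<close>

locale artin_ring = base_ring R for R :: "('a, 'r) ring_scheme" (structure) +
  assumes ring_R: "ring R" and cc_regular: "\<And>up. chain_cond up (regular_module R)"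
begin

lemma fg_cc: "fg M \<Longrightarrow> chain_cond up M"
  by (rule cc_fg[OF ring_R cc_regular])

lemma fg_sub: "\<lbrakk>fg M; sm N M\<rbrakk> \<Longrightarrow> fg (sub M N)"
  by (rule acc_fg_sub[OF fg_cc]) auto

lemma fg_mono: assumes "mod_mono R N M j" "lm N" "fg M" shows "fg N"
proof -
  note j = mono_Hom[OF assms(1)]
  have s: "sm (j ` carrier N) M" using sm_img[OF j assms(2)] assms(3) by simp
  have "N \<simeq> sub M (j ` carrier N)"
    by (rule miso_bij[OF Hom_sub_to[OF j]]) (use assms(1) in \<open>auto simp: mod_mono_def bij_betw_def\<close>)
  then have "sub M (j ` carrier N) \<simeq> N" using assms(2) by (rule miso_sym)
  then show ?thesis by (rule fg_miso[OF fg_sub[OF assms(3) s] _ assms(2)])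
qed

lemma fg_retract: assumes "retract X M" "lm X" "fg M" shows "fg X"
proof -
  obtain i p where "i \<in> Hom X M" "\<And>x. x \<in> carrier X \<Longrightarrow> p (i x) = x" using retractE[OF assms(1)] by metis
  then show ?thesis by (rule fg_mono[OF split_mono assms(2,3)])
qed

lemma fg_ses: assumes "ses A f B g C" "fg B" shows "fg A" "fg C"
  using fg_mono[OF ses_simps(6,1)[OF assms(1)] assms(2)] fg_epi[OF assms(2) ses_simps(7,3)[OF assms(1)]] by auto

subsection \<open>Endomorphisms\<close>

abbreviation bij_on where "bij_on M e \<equiv> bij_betw e (carrier M) (carrier M)"

lemma Hom_funpow: assumes "e \<in> Hom M M" shows "(e ^^ n) \<in> Hom M M"
proof (induction n)
  case 0
  then show ?case using Hom_id by (simp add: id_def)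
next
  case (Suc n)
  then show ?case using Hom_comp[OF Suc assms] by (simp add: comp_def)
qed

text \<open>Kernels of powers ascend and images descend; take \<open>n\<close> beyond the point
  where both stop, with a successor to make it positive. Then \<open>ker e^(2n) = ker e^n\<close>
  makes the intersection zero, and \<open>im e^(2n) = im e^n\<close> provides for each
  \<open>x\<close> an element \<open>e^n z\<close> with \<open>e^n x = e^n (e^n z)\<close>, so that
  \<open>x - e^n z\<close> is in the kernel.\<close>

lemma fitting:
  assumes M: "fg M" and e: "e \<in> Hom M M"
  obtains n where "n > 0" "a_kernel M M (e ^^ n) \<inter> (e ^^ n) ` carrier M = {\<zero>\<^bsub>M\<^esub>}"
    "a_kernel M M (e ^^ n) <+>\<^bsub>M\<^esub> (e ^^ n) ` carrier M = carrier M"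
proof -
  have lm: "lm M" using M by simp
  note p = Hom_funpow[OF e]
  define K where "K n = a_kernel M M (e ^^ n)" for n
  define L where "L n = (e ^^ n) ` carrier M" for n
  have K: "sm (K n) M" and L: "sm (L n) M" for n
    using sm_ker[OF p lm lm] sm_img[OF p lm lm] by (auto simp: K_def L_def)
  have cK: "chain_le True (K n) (K (Suc n))" for n
    using Hom_zero[OF e lm lm] by (auto simp: chain_le_def K_def ker_iff)
  obtain n1 where n1: "\<And>m. m \<ge> n1 \<Longrightarrow> K m = K n1" using chain_condE[where X = K, OF fg_cc[OF M] K cK] by metis
  have cL: "chain_le False (L n) (L (Suc n))" for n
    using Hom_closed[OF e] by (auto simp: chain_le_def L_def funpow_swap1 image_iff)
  obtain n2 where n2: "\<And>m. m \<ge> n2 \<Longrightarrow> L m = L n2" using chain_condE[where X = L, OF fg_cc[OF M] L cL] by metis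
  define n where "n = Suc (max n1 n2)"
  have Kn: "K (n + n) = K n" and Ln: "L (n + n) = L n"
    using n1[of "n + n"] n1[of n] n2[of "n + n"] n2[of n] by (simp_all add: n_def)
  have "x = \<zero>\<^bsub>M\<^esub>" if x: "x \<in> K n" "x \<in> L n" for x
  proof -
    obtain y where y: "y \<in> carrier M" "x = (e ^^ n) y" using x(2) by (auto simp: L_def)
    then have "y \<in> K (n + n)" using x(1) by (simp add: K_def ker_iff funpow_add)
    then have "y \<in> K n" unfolding Kn .
    then show ?thesis using y by (simp add: K_def ker_iff)
  qed
  then have 1: "K n \<inter> L n = {\<zero>\<^bsub>M\<^esub>}" using sm_simps(1)[OF K] sm_simps(1)[OF L] by auto
  have "x \<in> K n <+>\<^bsub>M\<^esub> L n" if x: "x \<in> carrier M" for x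
  proof -
    have "(e ^^ n) x \<in> L (n + n)" unfolding Ln using x by (auto simp: L_def)
    then obtain z where z: "z \<in> carrier M" "(e ^^ n) x = (e ^^ n) ((e ^^ n) z)" by (auto simp: L_def funpow_add)
    note c = Hom_closed[OF p]
    have "x \<ominus>\<^bsub>M\<^esub> (e ^^ n) z \<in> K n" using x z c lm by (simp add: K_def ker_iff Hom_minus[OF p lm lm])
    moreover have "(x \<ominus>\<^bsub>M\<^esub> (e ^^ n) z) \<oplus>\<^bsub>M\<^esub> (e ^^ n) z = x" using x z c lm by simp
    ultimately show ?thesis unfolding set_add_iff
      using z(1) by (intro bexI[of _ "x \<ominus>\<^bsub>M\<^esub> (e ^^ n) z"] bexI[of _ "(e ^^ n) z"]) (auto simp: L_def)
  qed
  then have 2: "K n <+>\<^bsub>M\<^esub> L n = carrier M" using sm_subset[OF sm_add[OF lm K L]] by blast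
  show ?thesis using that[of n] 1 2 by (simp add: K_def L_def n_def)
qed

lemma funpow_zero: assumes "e \<in> Hom M M" "lm M" "x \<in> carrier M" "e x = \<zero>\<^bsub>M\<^esub>" "n > 0" shows "(e ^^ n) x = \<zero>\<^bsub>M\<^esub>"
  using assms(5)
proof (induction n)
  case (Suc n)
  then show ?case using Hom_zero[OF assms(1,2,2)] assms(4) by (cases n) auto
qed simp

lemma ker_zero_mono: "\<lbrakk>f \<in> Hom M N; lm M; lm N; \<And>x. \<lbrakk>x \<in> carrier M; f x = \<zero>\<^bsub>N\<^esub>\<rbrakk> \<Longrightarrow> x = \<zero>\<^bsub>M\<^esub>\<rbrakk> \<Longrightarrow> mod_mono R M N f"
  by (simp add: mono_iff)

lemma funpow_image_subset: assumes "e \<in> Hom M M" "n > 0" shows "(e ^^ n) ` carrier M \<subseteq> e ` carrier M"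
proof -
  obtain k where k: "n = Suc k" using assms(2) by (cases n) auto
  then show ?thesis using Hom_closed[OF Hom_funpow[OF assms(1)]] by auto
qed

lemma endo_bij_of_kernel:
  assumes M: "fg M" and e: "e \<in> Hom M M" and n: "n > 0"
    and K: "a_kernel M M (e ^^ n) = {\<zero>\<^bsub>M\<^esub>}" and L: "(e ^^ n) ` carrier M = carrier M"
  shows "bij_on M e"
proof -
  have lm: "lm M" using M by simp
  have "mod_mono R M M e"
    using K funpow_zero[OF e lm _ _ n] by (intro ker_zero_mono[OF e lm lm]) (auto simp: ker_iff set_eq_iff)
  moreover have "e ` carrier M = carrier M"
    using funpow_image_subset[OF e n] L Hom_closed[OF e] by auto
  ultimately show ?thesis by (simp add: mod_mono_def bij_betw_def)
qed

lemma mono_endo_bij: assumes M: "fg M" and e: "mod_mono R M M e" shows "bij_on M e"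
proof -
  have lm: "lm M" using M by simp
  note h = mono_Hom[OF e]
  obtain n where n: "n > 0" "a_kernel M M (e ^^ n) <+>\<^bsub>M\<^esub> (e ^^ n) ` carrier M = carrier M"
    by (rule fitting[OF M h])
  have *: "x = \<zero>\<^bsub>M\<^esub>" if "x \<in> carrier M" "(e ^^ m) x = \<zero>\<^bsub>M\<^esub>" for m x
    using that
  proof (induction m)
    case (Suc m)
    then show ?case
      using mono_eq[OF e, of "(e ^^ m) x" "\<zero>\<^bsub>M\<^esub>"] Hom_zero[OF h lm lm] Hom_closed[OF Hom_funpow[OF h]] lm by simp
  qed simp
  have K: "a_kernel M M (e ^^ n) = {\<zero>\<^bsub>M\<^esub>}"
    using *[of _ n] Hom_zero[OF Hom_funpow[OF h] lm lm] lm by (auto simp: ker_iff)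
  have "(e ^^ n) ` carrier M = carrier M"
  proof
    show "carrier M \<subseteq> (e ^^ n) ` carrier M"
      using n(2) Hom_closed[OF Hom_funpow[OF h]] lm unfolding K by (auto simp: set_add_iff set_eq_iff)
  qed (use Hom_closed[OF Hom_funpow[OF h]] in auto)
  then show ?thesis by (rule endo_bij_of_kernel[OF M h n(1) K])
qed

lemma epi_endo_bij: assumes M: "fg M" and e: "mod_epi R M M e" shows "bij_on M e"
proof -
  have lm: "lm M" using M by simp
  note h = epi_simps[OF e]
  obtain n where n: "n > 0" "a_kernel M M (e ^^ n) \<inter> (e ^^ n) ` carrier M = {\<zero>\<^bsub>M\<^esub>}"
    by (rule fitting[OF M h(1)])
  have L: "(e ^^ m) ` carrier M = carrier M" for m
  proof (induction m)
    case (Suc m)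
    have "(e ^^ Suc m) ` carrier M = e ` ((e ^^ m) ` carrier M)" by (simp add: image_image)
    then show ?case unfolding Suc h(2) .
  qed simp
  have "a_kernel M M (e ^^ n) \<subseteq> carrier M" by (auto simp: ker_iff)
  then have K: "a_kernel M M (e ^^ n) = {\<zero>\<^bsub>M\<^esub>}"
    using n(2) unfolding L by (simp add: Int_absorb2)
  show ?thesis by (rule endo_bij_of_kernel[OF M h(1) n(1) K L])
qed

subsection \<open>Indecomposable modules\<close>

abbreviation indec where "indec M \<equiv> indecomposable R M"

lemma indec_fg [simp]: "indec X \<Longrightarrow> fg X"
  by (simp add: indecomposable_def)

lemma indec_nonzero: assumes "indec X" obtains x where "x \<in> carrier X" "x \<noteq> \<zero>\<^bsub>X\<^esub>"
  using assms lm_zero[of X] by (auto simp: indecomposable_def zero_module_def)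

lemma indecD: "\<lbrakk>indec X; sm N X; sm L X; N \<inter> L = {\<zero>\<^bsub>X\<^esub>}; N <+>\<^bsub>X\<^esub> L = carrier X\<rbrakk> \<Longrightarrow> N = {\<zero>\<^bsub>X\<^esub>} \<or> L = {\<zero>\<^bsub>X\<^esub>}"
  unfolding indecomposable_def by blast

text \<open>One of the two summands in Fitting's decomposition vanishes. If it is the kernel,
  \<open>e\<close> is bijective; if it is the image, \<open>e\<close> is nilpotent.\<close>

lemma indec_endo:
  assumes X: "indec X" and e: "e \<in> Hom X X"
  shows "bij_on X e \<or> (\<exists>n. \<forall>x\<in>carrier X. (e ^^ n) x = \<zero>\<^bsub>X\<^esub>)"
proof -
  have M: "fg X" and lm: "lm X" using X by auto
  obtain n where n: "n > 0" "a_kernel X X (e ^^ n) \<inter> (e ^^ n) ` carrier X = {\<zero>\<^bsub>X\<^esub>}"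
    "a_kernel X X (e ^^ n) <+>\<^bsub>X\<^esub> (e ^^ n) ` carrier X = carrier X"
    by (rule fitting[OF M e])
  have s: "sm (a_kernel X X (e ^^ n)) X" "sm ((e ^^ n) ` carrier X) X"
    using sm_ker[OF Hom_funpow[OF e] lm lm] sm_img[OF Hom_funpow[OF e] lm lm] by auto
  consider "a_kernel X X (e ^^ n) = {\<zero>\<^bsub>X\<^esub>}" | "(e ^^ n) ` carrier X = {\<zero>\<^bsub>X\<^esub>}"
    using indecD[OF X s n(2,3)] by blast
  then show ?thesis
  proof cases
    case 1
    have "(e ^^ n) ` carrier X = carrier X"
      using n(3) Hom_closed[OF Hom_funpow[OF e]] lm unfolding 1 by (auto simp: set_add_iff set_eq_iff)
    then show ?thesis using endo_bij_of_kernel[OF M e n(1) 1] by blast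
  qed blast
qed

lemma bij_on_comp: "\<lbrakk>bij_on M e; bij_on M f\<rbrakk> \<Longrightarrow> bij_on M (\<lambda>x. f (e x))"
  using bij_betw_trans[of e _ _ f] by (auto simp: comp_def)

lemma bij_on_of_comp:
  assumes "indec X" "fg A" "i \<in> Hom X A" "p \<in> Hom A X" "bij_on X (\<lambda>x. p (i x))"
  shows "retract X A"
proof -
  obtain g where g: "g \<in> Hom X X" "\<And>x. x \<in> carrier X \<Longrightarrow> g (p (i x)) = x"
    using miso_inv[OF Hom_comp[OF assms(3,4)] assms(5) fg_lm[OF indec_fg[OF assms(1)]]] by metis
  show ?thesis by (rule retractI[OF assms(3) Hom_comp[OF assms(4) g(1)]]) (use g in auto)
qed

text \<open>The composite forces \<open>i\<close> to be injective and \<open>p\<close> to be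
  surjective, and for endomorphisms of a finitely generated module each of these already implies
  bijectivity.\<close>

lemma bij_on_comp_factors:
  assumes M: "fg M" and i: "i \<in> Hom M M" and p: "p \<in> Hom M M" and b: "bij_on M (\<lambda>x. p (i x))"
  shows "bij_on M i" "bij_on M p"
proof -
  have "inj_on (p \<circ> i) (carrier M)" using b by (simp add: bij_betw_def comp_def)
  then have "inj_on i (carrier M)" by (rule inj_on_imageI2)
  then show "bij_on M i" using i by (intro mono_endo_bij[OF M]) (simp add: mod_mono_def)
  have "p ` i ` carrier M = carrier M" using b by (simp add: bij_betw_def image_image)
  then have "p ` carrier M = carrier M" using Hom_closed[OF i] Hom_closed[OF p] by blast
  then show "bij_on M p" using p by (intro epi_endo_bij[OF M]) (simp add: mod_epi_def)
qed

text \<open>After composing with the inverse \<open>u\<close> of the sum,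
  \<open>u e + u f = 1\<close>. If \<open>u e\<close> is nilpotent, then \<open>u f\<close> is
  injective, because \<open>u e\<close> acts as the identity on its kernel. Injective endomorphisms
  are bijective, and then \<open>f\<close> is bijective as a factor.\<close>

lemma indec_local:
  assumes X: "indec X" and e: "e \<in> Hom X X" and f: "f \<in> Hom X X"
    and b: "bij_on X (\<lambda>x. e x \<oplus>\<^bsub>X\<^esub> f x)"
  shows "bij_on X e \<or> bij_on X f"
proof -
  have M: "fg X" and lm: "lm X" using X by auto
  obtain u where u: "u \<in> Hom X X" "\<And>x. x \<in> carrier X \<Longrightarrow> u (e x \<oplus>\<^bsub>X\<^esub> f x) = x"
    using miso_inv[OF Hom_add[OF e f lm] b lm] by metis
  note ue = Hom_comp[OF e u(1)] and uf = Hom_comp[OF f u(1)]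
  have sum: "u (e x) \<oplus>\<^bsub>X\<^esub> u (f x) = x" if "x \<in> carrier X" for x
    using u(2)[OF that] Hom_simps(2)[OF u(1)] Hom_closed[OF e that] Hom_closed[OF f that] by simp
  show ?thesis
  proof (rule ccontr)
    assume neg: "\<not> ?thesis"
    then have "\<not> bij_on X (\<lambda>x. u (e x))" "\<not> bij_on X (\<lambda>x. u (f x))"
      using bij_on_comp_factors(1)[OF M e u(1)] bij_on_comp_factors(1)[OF M f u(1)] by blast+
    then obtain n m where n: "\<And>x. x \<in> carrier X \<Longrightarrow> ((\<lambda>x. u (e x)) ^^ n) x = \<zero>\<^bsub>X\<^esub>"
      and m: "\<not> bij_on X (\<lambda>x. u (f x))"
      using indec_endo[OF X ue] by blast
    have "mod_mono R X X (\<lambda>x. u (f x))"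
    proof (rule ker_zero_mono[OF uf lm lm])
      fix x assume x: "x \<in> carrier X" "u (f x) = \<zero>\<^bsub>X\<^esub>"
      then have "u (e x) = x" using sum[OF x(1)] Hom_closed[OF ue x(1)] lm by simp
      then have "((\<lambda>x. u (e x)) ^^ k) x = x" for k by (induction k) auto
      then show "x = \<zero>\<^bsub>X\<^esub>" using n[OF x(1)] by simp
    qed
    then show False using mono_endo_bij[OF M] m by blast
  qed
qed

text \<open>The identity of \<open>X\<close> is the sum of its parts through \<open>A\<close> and
  through \<open>B\<close>. Locality of the endomorphism ring makes one part bijective, and
  composing with its inverse turns it into a retraction.\<close>

lemma retract_sum_indec:
  assumes X: "indec X" and A: "fg A" and B: "fg B" and r: "retract X (A \<uplus> B)"
  shows "retract X A \<or> retract X B"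
proof -
  have lm: "lm X" "lm A" "lm B" using X A B by auto
  obtain i p where ip: "i \<in> Hom X (A \<uplus> B)" "p \<in> Hom (A \<uplus> B) X" "\<And>x. x \<in> carrier X \<Longrightarrow> p (i x) = x"
    using retractE[OF r] by metis
  note iA = Hom_comp[OF ip(1) Hom_fst] and iB = Hom_comp[OF ip(1) Hom_snd]
    and pA = Hom_comp[OF Hom_inl[OF lm(2,3)] ip(2)] and pB = Hom_comp[OF Hom_inr[OF lm(2,3)] ip(2)]
  have id: "p (fst (i x), \<zero>\<^bsub>B\<^esub>) \<oplus>\<^bsub>X\<^esub> p (\<zero>\<^bsub>A\<^esub>, snd (i x)) = x" if x: "x \<in> carrier X" for x
  proof -
    have "i x \<in> carrier (A \<uplus> B)" by (rule Hom_closed[OF ip(1) x])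
    then have "fst (i x) \<in> carrier A" "snd (i x) \<in> carrier B" by auto
    then show ?thesis
      using Hom_simps(2)[OF ip(2), of "(fst (i x), \<zero>\<^bsub>B\<^esub>)" "(\<zero>\<^bsub>A\<^esub>, snd (i x))"] lm ip(3)[OF x] by simp
  qed
  have "bij_on X (\<lambda>x. p (fst (i x), \<zero>\<^bsub>B\<^esub>) \<oplus>\<^bsub>X\<^esub> p (\<zero>\<^bsub>A\<^esub>, snd (i x)))"
    using bij_betw_id[of "carrier X"] by (rule bij_betw_cong[THEN iffD1, rotated]) (simp add: id)
  then show ?thesis
    using indec_local[OF X Hom_comp[OF iA pA] Hom_comp[OF iB pB]] bij_on_of_comp[OF X A iA pA] bij_on_of_comp[OF X B iB pB]
    by blast
qed

text \<open>A nonzero idempotent is not nilpotent, so it is bijective by \<open>indec_endo\<close>,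
  and an injective idempotent is the identity.\<close>

lemma indec_idem:
  assumes X: "indec X" and e: "e \<in> Hom X X" and id: "\<And>x. x \<in> carrier X \<Longrightarrow> e (e x) = e x" and nz: "x0 \<in> carrier X" "e x0 \<noteq> \<zero>\<^bsub>X\<^esub>"
    and x: "x \<in> carrier X"
  shows "e x = x"
proof -
  have pow: "(e ^^ Suc n) x0 = e x0" for n by (induction n) (use id nz in auto)
  have "\<not> (\<exists>n. \<forall>x\<in>carrier X. (e ^^ n) x = \<zero>\<^bsub>X\<^esub>)"
  proof
    assume "\<exists>n. \<forall>x\<in>carrier X. (e ^^ n) x = \<zero>\<^bsub>X\<^esub>"
    then obtain n where n: "\<And>x. x \<in> carrier X \<Longrightarrow> (e ^^ n) x = \<zero>\<^bsub>X\<^esub>" by blast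
    have "(e ^^ n) (e x0) = e x0" using pow[of n] by (simp only: funpow_Suc_right comp_apply)
    then show False using n[OF Hom_closed[OF e nz(1)]] nz(2) by simp
  qed
  then have "bij_on X e" using indec_endo[OF X e] by blast
  then show ?thesis using id[OF x] Hom_closed[OF e x] x by (metis bij_betw_def inj_onD)
qed

text \<open>The composite of \<open>p\<close> and \<open>i\<close> is an idempotent endomorphism of
  \<open>Y\<close>. It is nonzero because \<open>X\<close> is, so it is the identity.\<close>

lemma retract_indec_iso: assumes X: "indec X" and Y: "indec Y" and r: "retract X Y" shows "X \<simeq> Y"
proof -
  obtain i p where ip: "i \<in> Hom X Y" "p \<in> Hom Y X" "\<And>x. x \<in> carrier X \<Longrightarrow> p (i x) = x"
    using retractE[OF r] by metis
  obtain x0 where x0: "x0 \<in> carrier X" "x0 \<noteq> \<zero>\<^bsub>X\<^esub>" by (rule indec_nonzero[OF X])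
  have nz: "i (p (i x0)) \<noteq> \<zero>\<^bsub>Y\<^esub>" using x0 ip(3)[OF x0(1)] Hom_zero[OF ip(2)] X Y by force
  have "i (p y) = y" if "y \<in> carrier Y" for y
    by (rule indec_idem[OF Y Hom_comp[OF ip(2,1)] _ Hom_closed[OF ip(1) x0(1)] nz that])
      (use ip(3) Hom_closed[OF ip(2)] in simp)
  then show ?thesis by (intro misoI[OF ip(1) Hom_closed[OF ip(2)] ip(3)])
qed

lemma retract_ds_indec:
  assumes X: "indec X" and I: "finite I" and M: "\<And>i. i \<in> I \<Longrightarrow> fg (M i)" and r: "retract X (direct_sum I M)"
  shows "\<exists>i\<in>I. retract X (M i)"
  using I M r
proof (induction I)
  case empty
  obtain i p where ip: "i \<in> Hom X (direct_sum {} M)" "p \<in> Hom (direct_sum {} M) X" "\<And>x. x \<in> carrier X \<Longrightarrow> p (i x) = x"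
    using retractE[OF empty(2)] by metis
  obtain x0 where x0: "x0 \<in> carrier X" "x0 \<noteq> \<zero>\<^bsub>X\<^esub>" by (rule indec_nonzero[OF X])
  have lm: "lm (direct_sum {} M)" by (rule lm_ds) (auto simp: ring_R)
  have "i x0 = \<zero>\<^bsub>direct_sum {} M\<^esub>" using Hom_closed[OF ip(1) x0(1)] ds_empty[of M] by blast
  then have "x0 = \<zero>\<^bsub>X\<^esub>" using ip(3)[OF x0(1)] Hom_zero[OF ip(2) lm] X by simp
  with x0 show ?case by blast
next
  case (insert i I)
  have fg: "fg (direct_sum I M)" "fg (direct_sum (insert i I) M)" "fg (M i)"
    using insert by (auto intro!: fg_ds[OF ring_R])
  have "retract X (M i \<uplus> direct_sum I M)"
    using retract_trans[OF insert(5) miso_retract[OF ds_insert[OF insert(1,2)]]] fg by simp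
  then have "retract X (M i) \<or> retract X (direct_sum I M)"
    by (rule retract_sum_indec[OF X fg(3,1)])
  then show ?case using insert by auto
qed

lemma retract_power_indec: "\<lbrakk>indec X; fg M; retract X (direct_power n M)\<rbrakk> \<Longrightarrow> retract X M"
  unfolding direct_power_def by (drule retract_ds_indec) auto

text \<open>If \<open>X \<uplus> X\<close> is a retract of \<open>X \<uplus> A\<close> and \<open>X\<close> is not one of \<open>A\<close>, then modulo the radical of the
  local ring \<open>End X\<close> the identity 2 by 2 matrix is a column times a row.\<close>

lemma retract_two_copies:
  assumes X: "indec X" and A: "fg A" and r: "retract (X \<uplus> X) (X \<uplus> A)"
  shows "retract X A"
proof (rule ccontr)
  assume neg: "\<not> retract X A"
  have M: "fg X" and lm: "lm X" "lm A" using X A by auto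
  obtain i p where ip: "i \<in> Hom (X \<uplus> X) (X \<uplus> A)" "p \<in> Hom (X \<uplus> A) (X \<uplus> X)"
    "\<And>x. x \<in> carrier (X \<uplus> X) \<Longrightarrow> p (i x) = x"
    using retractE[OF r] by metis
  note il = Hom_comp[OF Hom_inl[OF lm(1,1)] ip(1)] and ir = Hom_comp[OF Hom_inr[OF lm(1,1)] ip(1)]
    and pl = Hom_comp[OF Hom_inl[OF lm] ip(2)] and pr = Hom_comp[OF Hom_inr[OF lm] ip(2)]
  \<comment> \<open>Block form: the columns of \<open>i\<close> are \<open>(a, \<alpha>)\<close> and
    \<open>(b, \<beta>)\<close>, the rows of \<open>p\<close> are \<open>(c, \<gamma>)\<close> and
    \<open>(d, \<delta>)\<close>; Greek letters mark the entries that pass through \<open>A\<close>.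
    The facts \<open>1\<close> and \<open>2\<close> are the two diagonal entries and one
    off-diagonal entry of \<open>p i = 1\<close>.\<close>
  let ?a = "\<lambda>x. fst (i (x, \<zero>\<^bsub>X\<^esub>))" and ?b = "\<lambda>x. fst (i (\<zero>\<^bsub>X\<^esub>, x))"
    and ?\<alpha> = "\<lambda>x. snd (i (x, \<zero>\<^bsub>X\<^esub>))" and ?\<beta> = "\<lambda>x. snd (i (\<zero>\<^bsub>X\<^esub>, x))"
    and ?c = "\<lambda>x. fst (p (x, \<zero>\<^bsub>A\<^esub>))" and ?d = "\<lambda>x. snd (p (x, \<zero>\<^bsub>A\<^esub>))"
    and ?\<gamma> = "\<lambda>x. fst (p (\<zero>\<^bsub>X\<^esub>, x))" and ?\<delta> = "\<lambda>x. snd (p (\<zero>\<^bsub>X\<^esub>, x))"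
  note a = Hom_comp[OF il Hom_fst] and b = Hom_comp[OF ir Hom_fst]
    and \<alpha> = Hom_comp[OF il Hom_snd] and \<beta> = Hom_comp[OF ir Hom_snd]
    and c = Hom_comp[OF pl Hom_fst] and d = Hom_comp[OF pl Hom_snd]
    and \<gamma> = Hom_comp[OF pr Hom_fst] and \<delta> = Hom_comp[OF pr Hom_snd]
  have split: "p (fst z, \<zero>\<^bsub>A\<^esub>) \<oplus>\<^bsub>X \<uplus> X\<^esub> p (\<zero>\<^bsub>X\<^esub>, snd z) = p z" if z: "z \<in> carrier (X \<uplus> A)" for z
    using Hom_simps(2)[OF ip(2), of "(fst z, \<zero>\<^bsub>A\<^esub>)" "(\<zero>\<^bsub>X\<^esub>, snd z)"] z lm by auto
  have 1: "?c (?a x) \<oplus>\<^bsub>X\<^esub> ?\<gamma> (?\<alpha> x) = x" if x: "x \<in> carrier X" for x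
  proof -
    have z: "i (x, \<zero>\<^bsub>X\<^esub>) \<in> carrier (X \<uplus> A)" using Hom_closed[OF ip(1)] x lm by simp
    then show ?thesis using split[OF z] ip(3)[of "(x, \<zero>\<^bsub>X\<^esub>)"] x lm by (simp add: prod_eq_iff)
  qed
  have 2: "?d (?b x) \<oplus>\<^bsub>X\<^esub> ?\<delta> (?\<beta> x) = x" "?c (?b x) \<oplus>\<^bsub>X\<^esub> ?\<gamma> (?\<beta> x) = \<zero>\<^bsub>X\<^esub>" if x: "x \<in> carrier X" for x
  proof -
    have z: "i (\<zero>\<^bsub>X\<^esub>, x) \<in> carrier (X \<uplus> A)" using Hom_closed[OF ip(1)] x lm by simp
    then show "?d (?b x) \<oplus>\<^bsub>X\<^esub> ?\<delta> (?\<beta> x) = x" "?c (?b x) \<oplus>\<^bsub>X\<^esub> ?\<gamma> (?\<beta> x) = \<zero>\<^bsub>X\<^esub>"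
      using split[OF z] ip(3)[of "(\<zero>\<^bsub>X\<^esub>, x)"] x lm by (simp_all add: prod_eq_iff)
  qed
  have idb: "bij_on X f" if "\<And>x. x \<in> carrier X \<Longrightarrow> f x = x" for f
    using bij_betw_id[of "carrier X"] by (rule bij_betw_cong[THEN iffD1, rotated]) (simp add: that)
  have "bij_on X (\<lambda>x. ?c (?a x)) \<or> bij_on X (\<lambda>x. ?\<gamma> (?\<alpha> x))"
    by (rule indec_local[OF X Hom_comp[OF a c] Hom_comp[OF \<alpha> \<gamma>] idb[OF 1]])
  then have ca: "bij_on X (\<lambda>x. ?c (?a x))" using bij_on_of_comp[OF X A \<alpha> \<gamma>] neg by blast
  have "bij_on X (\<lambda>x. ?d (?b x)) \<or> bij_on X (\<lambda>x. ?\<delta> (?\<beta> x))"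
    by (rule indec_local[OF X Hom_comp[OF b d] Hom_comp[OF \<beta> \<delta>] idb[OF 2(1)]])
  then have db: "bij_on X (\<lambda>x. ?d (?b x))" using bij_on_of_comp[OF X A \<beta> \<delta>] neg by blast
  \<comment> \<open>\<open>c\<close> and \<open>b\<close> are bijective as factors of
    \<open>c a\<close> and \<open>d b\<close>. The off-diagonal relation
    \<open>c b + \<gamma> \<beta> = 0\<close> then makes \<open>\<gamma> \<beta>\<close> injective,
    hence bijective, so \<open>X\<close> would be a retract of \<open>A\<close>.\<close>
  have cb: "bij_on X (\<lambda>x. ?c (?b x))"
    using bij_on_comp[OF bij_on_comp_factors(1)[OF M b d db] bij_on_comp_factors(2)[OF M a c ca]] .
  have "mod_mono R X X (\<lambda>x. ?\<gamma> (?\<beta> x))"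
  proof (rule ker_zero_mono[OF Hom_comp[OF \<beta> \<gamma>] lm(1,1)])
    fix x assume x: "x \<in> carrier X" "?\<gamma> (?\<beta> x) = \<zero>\<^bsub>X\<^esub>"
    then have "?c (?b x) = \<zero>\<^bsub>X\<^esub>" using 2(2)[OF x(1)] Hom_closed[OF Hom_comp[OF b c] x(1)] lm by simp
    moreover have "?c (?b \<zero>\<^bsub>X\<^esub>) = \<zero>\<^bsub>X\<^esub>" using Hom_zero[OF Hom_comp[OF b c] lm(1,1)] by simp
    ultimately show "x = \<zero>\<^bsub>X\<^esub>" using cb x(1) lm(1) unfolding bij_betw_def inj_on_def by (metis lm_zero)
  qed
  then show False using mono_endo_bij[OF M] bij_on_of_comp[OF X A \<beta> \<gamma>] neg by blast
qed

lemma sum_split: "\<lbrakk>L <+>\<^bsub>M\<^esub> N = S; x \<in> S\<rbrakk> \<Longrightarrow> \<exists>u\<in>L. \<exists>v\<in>N. x = u \<oplus>\<^bsub>M\<^esub> v"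
  by (auto simp: set_add_iff)

lemma internal_sum_bij:
  assumes "lm M" "sm N M" "sm L M" "N \<inter> L = {\<zero>\<^bsub>M\<^esub>}" "N <+>\<^bsub>M\<^esub> L = carrier M"
  shows "(\<lambda>x. fst x \<oplus>\<^bsub>M\<^esub> snd x) \<in> Hom (sub M N \<uplus> sub M L) M"
    and "bij_betw (\<lambda>x. fst x \<oplus>\<^bsub>M\<^esub> snd x) (carrier (sub M N \<uplus> sub M L)) (carrier M)"
proof -
  let ?f = "\<lambda>x. fst x \<oplus>\<^bsub>M\<^esub> snd x"
  have lm: "lm (sub M N)" "lm (sub M L)" using lm_sub assms by auto
  have Nc: "\<And>y. y \<in> N \<Longrightarrow> y \<in> carrier M" and Lc: "\<And>y. y \<in> L \<Longrightarrow> y \<in> carrier M"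
    using sm_mem[OF assms(2)] sm_mem[OF assms(3)] by auto
  show f: "?f \<in> Hom (sub M N \<uplus> sub M L) M"
    by (rule Hom_copair[OF Hom_sub Hom_sub]) (use assms in auto)
  have "mod_mono R (sub M N \<uplus> sub M L) M ?f"
  proof (rule ker_zero_mono[OF f lm_ds2[OF lm] assms(1)])
    fix x assume x: "x \<in> carrier (sub M N \<uplus> sub M L)" "?f x = \<zero>\<^bsub>M\<^esub>"
    have c: "fst x \<in> N" "snd x \<in> L" using x(1) by auto
    have "fst x = \<ominus>\<^bsub>M\<^esub> snd x" using lm_neg_unique[OF assms(1) _ _ x(2)] Nc Lc c by blast
    then have "fst x \<in> N \<inter> L" using sm_simps(4)[OF assms(3) c(2)] c by simp
    then have "fst x = \<zero>\<^bsub>M\<^esub>" using assms(4) by blast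
    moreover then have "snd x = \<zero>\<^bsub>M\<^esub>" using x(2) Lc[OF c(2)] assms(1) by simp
    ultimately show "x = \<zero>\<^bsub>sub M N \<uplus> sub M L\<^esub>" by (simp add: prod_eq_iff)
  qed
  moreover have "?f ` carrier (sub M N \<uplus> sub M L) = carrier M"
  proof
    show "carrier M \<subseteq> ?f ` carrier (sub M N \<uplus> sub M L)"
    proof
      fix x assume "x \<in> carrier M"
      then obtain u v where "u \<in> N" "v \<in> L" "x = u \<oplus>\<^bsub>M\<^esub> v" using sum_split[OF assms(5)] by blast
      then show "x \<in> ?f ` carrier (sub M N \<uplus> sub M L)" by (intro image_eqI[of _ _ "(u, v)"]) auto
    qed
  qed (use Nc Lc assms(1) in auto)
  ultimately show "bij_betw ?f (carrier (sub M N \<uplus> sub M L)) (carrier M)"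
    by (simp add: mod_mono_def bij_betw_def)
qed

lemma internal_sum_iso:
  assumes "lm M" "sm N M" "sm L M" "N \<inter> L = {\<zero>\<^bsub>M\<^esub>}" "N <+>\<^bsub>M\<^esub> L = carrier M"
  shows "sub M N \<uplus> sub M L \<simeq> M"
  by (rule miso_bij[OF internal_sum_bij[OF assms]])

text \<open>The proof takes a minimal counterexample among the submodules that are retracts of
  \<open>M\<close>. The retract hypothesis in the indecomposable case hands properties of
  \<open>M\<close>, such as projectivity, to its pieces; the sum case allows any module isomorphic
  to the sum, so that users never meet internal direct sums.\<close>

lemma indec_induct [consumes 1, case_names zero indec sum]:
  fixes M :: "'a fgmod"
  assumes M: "fg M"
    and z: "\<And>N. \<lbrakk>lm N; carrier N = {\<zero>\<^bsub>N\<^esub>}\<rbrakk> \<Longrightarrow> P N"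
    and i: "\<And>N. \<lbrakk>indec N; retract N M\<rbrakk> \<Longrightarrow> P N"
    and s: "\<And>A B N. \<lbrakk>fg A; fg B; fg N; P A; P B; A \<uplus> B \<simeq> N\<rbrakk> \<Longrightarrow> P N"
  shows "P M"
proof (rule ccontr)
  assume neg: "\<not> P M"
  have lm: "lm M" using M by simp
  have inc: "M \<simeq> sub M (carrier M)" by (rule misoI[where f = "\<lambda>x. x" and g = "\<lambda>x. x"]) (auto intro!: HomI)
  have fgc: "fg (sub M N)" if "sm N M" for N using fg_sub[OF M that] .
  let ?\<S> = "{N. sm N M \<and> retract (sub M N) M \<and> \<not> P (sub M N)}"
  have "carrier M \<in> ?\<S>"
    using neg sm_carrier[OF lm] retract_miso[OF inc lm] by simp
  then obtain N where N: "N \<in> ?\<S>" and min: "\<And>L. \<lbrakk>L \<in> ?\<S>; chain_le False N L\<rbrakk> \<Longrightarrow> L = N"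
    by (rule chain_extremal[OF fg_cc[OF M]]) auto
  have Nsm: "sm N M" and rN: "retract (sub M N) M" and nP: "\<not> P (sub M N)" using N by auto
  have lmN: "lm (sub M N)" and fgN: "fg (sub M N)" using fgc[OF Nsm] by auto
  have "\<not> zero_module (sub M N)" using z[OF lmN] nP by (auto simp: zero_module_def)
  moreover have "\<not> indec (sub M N)" using i rN nP by blast
  ultimately obtain A B where AB: "sm A (sub M N)" "sm B (sub M N)" "A \<inter> B = {\<zero>\<^bsub>M\<^esub>}" "A <+>\<^bsub>sub M N\<^esub> B = N"
    "A \<noteq> {\<zero>\<^bsub>M\<^esub>}" "B \<noteq> {\<zero>\<^bsub>M\<^esub>}"
    using fgN by (auto simp: indecomposable_def)
  then have iso: "sub M A \<uplus> sub M B \<simeq> sub M N"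
    using internal_sum_iso[OF lmN AB(1,2)] by simp
  have A: "sm A M" "A \<subseteq> N" and B: "sm B M" "B \<subseteq> N" using AB sm_sub_iff[OF lm Nsm] by auto
  have "A \<noteq> N" "B \<noteq> N" using AB A B by blast+
  have rA: "retract (sub M A) M" and rB: "retract (sub M B) M"
    using retract_trans[OF retract_trans[OF retract_ds2_l miso_retract[OF iso]] rN]
      retract_trans[OF retract_trans[OF retract_ds2_r miso_retract[OF iso]] rN] fgc[OF A(1)] fgc[OF B(1)] by auto
  have "P (sub M A)" "P (sub M B)"
    using min[of A] min[of B] A B rA rB \<open>A \<noteq> N\<close> \<open>B \<noteq> N\<close> by (auto simp: chain_le_def)
  then show False using s[OF fgc[OF A(1)] fgc[OF B(1)] fgN _ _ iso] nP by blast
qed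

lemma zero_iso: "\<lbrakk>lm M; lm N; carrier M = {\<zero>\<^bsub>M\<^esub>}; carrier N = {\<zero>\<^bsub>N\<^esub>}\<rbrakk> \<Longrightarrow> M \<simeq> N"
  by (rule misoI[OF Hom_const_zero, where g = "\<lambda>_. \<zero>\<^bsub>M\<^esub>"]) auto

definition decomp :: "('a, 'm) module \<Rightarrow> (nat \<Rightarrow> 'a fgmod) \<Rightarrow> nat \<Rightarrow> bool" where
  "decomp M X n \<longleftrightarrow> (\<forall>i<n. indec (X i)) \<and> M \<simeq> direct_sum {..<n} X"

lemma decomp_exists:
  assumes "fg M"
  obtains n X where "decomp M X n"
proof -
  obtain N :: "'a fgmod" where N: "fg N" "M \<simeq> N" using fg_copy[OF assms] by blast
  have "\<exists>X n. decomp N X n"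
    using N(1)
  proof (induction rule: indec_induct)
    case (zero N)
    have "N \<simeq> direct_sum {} (\<lambda>_::nat. N)"
      by (rule zero_iso[OF zero(1) lm_ds zero(2) ds_empty]) (auto simp: ring_R)
    then have "decomp N (\<lambda>_. N) 0" by (simp add: decomp_def)
    then show ?case by blast
  next
    case (indec N)
    have "N \<simeq> direct_sum {..<1::nat} (\<lambda>_. N)"
      by (rule misoI[where f = "\<lambda>x. \<lambda>i\<in>{..<1::nat}. x" and g = "\<lambda>x. x 0"])
        (use indec in \<open>auto intro!: Hom_tuple Hom_id simp: PiE_iff extensional_def fun_eq_iff\<close>)
    then show ?case using indec by (intro exI[of _ "\<lambda>_. N"] exI[of _ 1]) (simp add: decomp_def)
  next
    case (sum A B N)
    obtain X n Y m where X: "decomp A X n" and Y: "decomp B Y m" using sum by blast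
    have lm: "lm A" "lm B" "lm (A \<uplus> B)" using sum by auto
    have ind: "\<And>k. k \<in> {..<n} <+> {..<m} \<Longrightarrow> indec (case_sum X Y k)"
      using X Y by (auto simp: decomp_def)
    have "\<exists>\<sigma>. bij_betw \<sigma> ({..<n} <+> {..<m}) {..<n + m}"
      by (rule finite_same_card_bij) (auto simp: card_Plus)
    then obtain \<sigma> where \<sigma>: "bij_betw \<sigma> ({..<n} <+> {..<m}) {..<n + m}" by blast
    define Z where "Z k = case_sum X Y (the_inv_into ({..<n} <+> {..<m}) \<sigma> k)" for k
    have Z\<sigma>: "Z (\<sigma> k) = case_sum X Y k" if "k \<in> {..<n} <+> {..<m}" for k
      using that \<sigma> by (auto simp: Z_def bij_betw_def the_inv_into_f_f)
    have Zi: "indec (Z k)" if "k < n + m" for k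
      unfolding Z_def using that \<sigma> by (intro ind) (auto simp: bij_betw_def intro!: the_inv_into_into)
    have "N \<simeq> A \<uplus> B" by (rule miso_sym[OF \<open>A \<uplus> B \<simeq> N\<close> lm(3)])
    also have "A \<uplus> B \<simeq> direct_sum {..<n} X \<uplus> direct_sum {..<m} Y"
      using X Y lm by (intro ds2_cong) (auto simp: decomp_def)
    also have "\<dots> \<simeq> direct_sum ({..<n} <+> {..<m}) (case_sum X Y)" by (rule ds_Plus) auto
    also have "\<dots> \<simeq> direct_sum {..<n + m} Z"
      by (rule ds_reindex[OF _ \<sigma>]) (use ind in \<open>auto simp: Z\<sigma> miso_refl\<close>)
    finally have "N \<simeq> direct_sum {..<n + m} Z" .
    then show ?case using Zi by (auto simp: decomp_def)
  qed
  then show ?thesis using that miso_trans[OF N(2)] by (auto simp: decomp_def)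
qed

end

context artin_ring
begin

section \<open>Basic modules and their indecomposable retracts\<close>

lemma ds_remove: assumes "finite I" "i \<in> I" shows "direct_sum I X \<simeq> X i \<uplus> direct_sum (I - {i}) X"
  using ds_insert[of "I - {i}" i X] assms by (simp add: insert_absorb)

text \<open>The definition of a basic module concerns all decompositions. If another one had two
  isomorphic summands, both would be isomorphic to some \<open>Y k\<close>, making
  \<open>Y k \<uplus> Y k\<close> a retract of \<open>Y k\<close> plus the remaining members of the
  family. Then \<open>retract_two_copies\<close> makes \<open>Y k\<close> a retract of these
  remaining members, hence isomorphic to one of them.\<close>

lemma basic_of_family:
  fixes Y :: "'i \<Rightarrow> 'a fgmod" and T :: "('a, 't) module"
  assumes I: "finite I" and Y: "\<And>i. i \<in> I \<Longrightarrow> indec (Y i)"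
    and non: "\<And>i j. \<lbrakk>i \<in> I; j \<in> I; i \<noteq> j\<rbrakk> \<Longrightarrow> \<not> Y i \<simeq> Y j"
    and T: "fg T" "T \<simeq> direct_sum I Y"
  shows "basic_module R T"
  unfolding basic_module_def
proof (intro conjI allI impI notI T(1))
  fix n :: nat and X :: "nat \<Rightarrow> 'a fgmod" and i j
  assume "(\<forall>i<n. indec (X i)) \<and> T \<simeq> direct_sum {..<n} X" and ij: "i < n" "j < n" "i \<noteq> j" and iso: "X i \<simeq> X j"
  then have X: "\<And>i. i < n \<Longrightarrow> indec (X i)" and TX: "T \<simeq> direct_sum {..<n} X" by auto
  have lmX: "lm (X i)" if "i < n" for i using X[OF that] by simp
  have fgI: "fg (direct_sum J Y)" if "J \<subseteq> I" for J
    using that Y I by (intro fg_ds[OF ring_R]) (auto intro: finite_subset indec_fg)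
  have fgn: "fg (direct_sum J X)" if "J \<subseteq> {..<n}" for J
    using that X by (intro fg_ds[OF ring_R]) (auto intro: finite_subset indec_fg)
  have XY: "retract (direct_sum {..<n} X) (direct_sum I Y)"
    using retract_trans[OF retract_miso[OF TX] miso_retract[OF T(2)]] T(1) by simp
  have "retract (X i) (direct_sum I Y)"
    using ij lmX by (intro retract_trans[OF retract_ds_component XY]) auto
  then obtain k where k: "k \<in> I" "retract (X i) (Y k)"
    using retract_ds_indec[OF X[OF ij(1)] I] Y indec_fg by blast
  have iso1: "Y k \<simeq> X i" using miso_sym[OF retract_indec_iso[OF X[OF ij(1)] Y[OF k(1)] k(2)] lmX[OF ij(1)]] .
  then have iso2: "Y k \<simeq> X j" using iso by (rule miso_trans)
  have lmk: "lm (Y k)" using Y[OF k(1)] by simp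
  have "retract (X j) (direct_sum ({..<n} - {i}) X)"
    using ij lmX by (intro retract_ds_component) auto
  then have "retract (Y k) (direct_sum ({..<n} - {i}) X)"
    by (rule retract_trans[OF miso_retract[OF iso2 lmk]])
  then have "retract (Y k \<uplus> Y k) (X i \<uplus> direct_sum ({..<n} - {i}) X)"
    by (rule retract_ds2[OF miso_retract[OF iso1 lmk]])
  also have "retract (X i \<uplus> direct_sum ({..<n} - {i}) X) (direct_sum {..<n} X)"
    using ij(1) fgn[of "{..<n}"] by (intro retract_miso ds_remove) auto
  also (retract_trans) note XY
  also (retract_trans) have "retract (direct_sum I Y) (Y k \<uplus> direct_sum (I - {k}) Y)"
    using fgI[of I] by (intro miso_retract ds_remove I k(1)) auto
  finally (retract_trans) have "retract (Y k) (direct_sum (I - {k}) Y)"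
    by (rule retract_two_copies[OF Y[OF k(1)] fgI, rotated]) auto
  then obtain l where l: "l \<in> I - {k}" "retract (Y k) (Y l)"
    using retract_ds_indec[OF Y[OF k(1)], of "I - {k}" Y] Y I indec_fg by blast
  then have "Y k \<simeq> Y l" using retract_indec_iso[OF Y[OF k(1)] Y] by blast
  then show False using non[OF k(1)] l(1) by blast
qed

text \<open>A basic module is determined by its set of indecomposable retracts: all multiplicities
  are one, so matching isomorphism classes is a bijection between the index sets.\<close>

lemma basic_iso_family:
  fixes Y :: "'i \<Rightarrow> 'a fgmod" and T :: "('a, 't) module"
  assumes T: "basic_module R T" and I: "finite I" and Y: "\<And>i. i \<in> I \<Longrightarrow> indec (Y i)"
    and non: "\<And>i j. \<lbrakk>i \<in> I; j \<in> I; i \<noteq> j\<rbrakk> \<Longrightarrow> \<not> Y i \<simeq> Y j"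
    and YT: "\<And>i. i \<in> I \<Longrightarrow> retract (Y i) T"
    and TY: "\<And>X :: 'a fgmod. \<lbrakk>indec X; retract X T\<rbrakk> \<Longrightarrow> \<exists>i\<in>I. X \<simeq> Y i"
  shows "T \<simeq> direct_sum I Y"
proof -
  have fgT: "fg T" using T by (simp add: basic_module_def)
  then have lmT: "lm T" by simp
  obtain n X where "decomp T X n" by (rule decomp_exists[OF fgT])
  then have X: "\<And>i. i < n \<Longrightarrow> indec (X i)" and TX: "T \<simeq> direct_sum {..<n} X" by (auto simp: decomp_def)
  have lmX: "lm (X i)" if "i < n" for i using X[OF that] by simp
  have Xnon: "i = j" if "i < n" "j < n" "X i \<simeq> X j" for i j
    using T X TX that unfolding basic_module_def by blast
  have XT: "retract (X i) T" if "i < n" for i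
    using that lmX by (intro retract_trans[OF retract_ds_component retract_miso[OF TX lmT]]) auto
  have "\<forall>i. \<exists>k. i < n \<longrightarrow> k \<in> I \<and> X i \<simeq> Y k"
    using TY[OF X XT] by blast
  then obtain \<sigma> where \<sigma>: "\<And>i. i < n \<Longrightarrow> \<sigma> i \<in> I" "\<And>i. i < n \<Longrightarrow> X i \<simeq> Y (\<sigma> i)" by metis
  have "bij_betw \<sigma> {..<n} I"
    unfolding bij_betw_def
  proof
    show "inj_on \<sigma> {..<n}"
    proof (rule inj_onI)
      fix i j assume *: "i \<in> {..<n}" "j \<in> {..<n}" "\<sigma> i = \<sigma> j"
      then have "Y (\<sigma> i) \<simeq> X j" using miso_sym[OF \<sigma>(2) lmX, of j] by simp
      then have "X i \<simeq> X j" using miso_trans[OF \<sigma>(2)] * by blast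
      then show "i = j" using Xnon * by blast
    qed
    show "\<sigma> ` {..<n} = I"
    proof
      show "I \<subseteq> \<sigma> ` {..<n}"
      proof
        fix k assume k: "k \<in> I"
        have "retract (Y k) (direct_sum {..<n} X)"
          by (rule retract_trans[OF YT[OF k] miso_retract[OF TX lmT]])
        then obtain i where i: "i < n" "retract (Y k) (X i)"
          using retract_ds_indec[OF Y[OF k], of "{..<n}" X] X indec_fg by blast
        have "Y k \<simeq> X i" by (rule retract_indec_iso[OF Y[OF k] X[OF i(1)] i(2)])
        then have "Y k \<simeq> Y (\<sigma> i)" using \<sigma>(2)[OF i(1)] by (rule miso_trans)
        then have "k = \<sigma> i" using non[OF k \<sigma>(1)[OF i(1)]] by blast
        then show "k \<in> \<sigma> ` {..<n}" using i(1) by blast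
      qed
    qed (use \<sigma>(1) in auto)
  qed
  then have "direct_sum {..<n} X \<simeq> direct_sum I Y"
    using \<sigma>(2) lmX by (intro ds_reindex) auto
  then show ?thesis by (rule miso_trans[OF TX])
qed

text \<open>Reduces membership in add \<open>T\<close> to indecomposable retracts: each of the
  \<open>n\<close> summands of \<open>Z\<close> goes into its own copy of \<open>T\<close>.\<close>

lemma retract_power_of_indec:
  assumes Z: "fg Z" and T: "lm T" and r: "\<And>X :: 'a fgmod. \<lbrakk>indec X; retract X Z\<rbrakk> \<Longrightarrow> retract X T"
  shows "\<exists>m. retract Z (direct_power m T)"
proof -
  have lmZ: "lm Z" using Z by simp
  obtain n X where "decomp Z X n" by (rule decomp_exists[OF Z])
  then have X: "\<And>i. i < n \<Longrightarrow> indec (X i)" and ZX: "Z \<simeq> direct_sum {..<n} X" by (auto simp: decomp_def)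
  have "retract (X i) Z" if "i < n" for i
    using that X indec_fg fg_lm by (intro retract_trans[OF retract_ds_component retract_miso[OF ZX lmZ]]) auto
  then have "retract (direct_sum {..<n} X) (direct_sum {..<n} (\<lambda>_. T))"
    using r X by (intro retract_ds) auto
  then show ?thesis
    unfolding direct_power_def using retract_trans[OF miso_retract[OF ZX lmZ]] by blast
qed

section \<open>Injective envelopes and projective covers\<close>

lemma ker_retract_image:
  assumes "lm E" "sm K E" "sm L E" "K \<inter> L = {\<zero>\<^bsub>E\<^esub>}" "K <+>\<^bsub>E\<^esub> L = carrier E"
  shows "retract (sub E L) E"
proof -
  have lm: "lm (sub E K)" "lm (sub E L)" using lm_sub assms by auto
  show ?thesis
    by (rule retract_trans[OF retract_ds2_r[OF lm] miso_retract[OF internal_sum_iso[OF assms] lm_ds2[OF lm]]])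
qed

text \<open>Choose a submodule of \<open>E0\<close> minimal among the injective ones that contain
  \<open>M\<close>. If \<open>L\<close> meets \<open>M\<close> trivially, the projection of
  \<open>L \<uplus> M\<close> to \<open>M\<close> extends to an endomorphism \<open>e\<close> that
  kills \<open>L\<close> and fixes \<open>M\<close>. The image of a Fitting power of
  \<open>e\<close> is an injective summand containing \<open>M\<close>, hence everything by
  minimality, so its kernel vanishes, and \<open>L\<close> with it.\<close>

lemma envelope_in_injective:
  fixes E0 :: "'a fgmod"
  assumes E0: "inj E0" and j0: "mod_mono R M E0 j0" and M: "fg M"
  obtains E :: "'a fgmod" where "injective_envelope R M j0 E"
proof -
  have lm: "lm E0" "lm M" using E0 M by auto
  note j = mono_Hom[OF j0]
  have jM: "sm (j0 ` carrier M) E0" by (rule sm_img[OF j lm(2,1)])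
  let ?\<S> = "{N. sm N E0 \<and> j0 ` carrier M \<subseteq> N \<and> inj (sub E0 N)}"
  have "E0 \<simeq> sub E0 (carrier E0)" by (rule misoI[where f = "\<lambda>x. x" and g = "\<lambda>x. x"]) (auto intro!: HomI)
  then have "inj (sub E0 (carrier E0))" by (rule inj_miso[OF E0]) (simp add: lm_sub sm_carrier lm)
  then have "carrier E0 \<in> ?\<S>"
    using sm_carrier[OF lm(1)] sm_subset[OF jM] by auto
  then obtain N where N: "N \<in> ?\<S>" and min: "\<And>L. \<lbrakk>L \<in> ?\<S>; chain_le False N L\<rbrakk> \<Longrightarrow> L = N"
    by (rule chain_extremal[OF fg_cc[OF inj_fg[OF E0]]]) auto
  then have Nsm: "sm N E0" and jN: "j0 ` carrier M \<subseteq> N" and inj: "inj (sub E0 N)" by auto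
  let ?E = "sub E0 N"
  have fgE: "fg ?E" and lmE: "lm ?E" using inj by auto
  have jE: "j0 \<in> Hom M ?E" using jN by (intro Hom_sub_to[OF j]) auto
  have monoE: "mod_mono R M ?E j0" using j0 jE by (simp add: mod_mono_def)
  have smj: "sm (j0 ` carrier M) ?E" by (rule sm_img[OF jE lm(2) lmE])
  have "L = {\<zero>\<^bsub>?E\<^esub>}" if L: "sm L ?E" "L \<inter> j0 ` carrier M = {\<zero>\<^bsub>?E\<^esub>}" for L
  proof -
    have fgL: "fg (sub ?E L)" and lmL: "lm (sub ?E L)" using fg_sub[OF fgE L(1)] by auto
    have Lc: "x \<in> L \<Longrightarrow> x \<in> carrier ?E" for x using sm_mem[OF L(1)] .
    let ?g = "\<lambda>x. fst x \<oplus>\<^bsub>?E\<^esub> j0 (snd x)"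
    have g: "?g \<in> Hom (sub ?E L \<uplus> M) ?E" by (rule Hom_copair[OF Hom_sub[OF lmE L(1)] jE lmE])
    have mg: "mod_mono R (sub ?E L \<uplus> M) ?E ?g"
    proof (rule ker_zero_mono[OF g lm_ds2[OF lmL lm(2)] lmE])
      fix x assume x: "x \<in> carrier (sub ?E L \<uplus> M)" "?g x = \<zero>\<^bsub>?E\<^esub>"
      have c: "fst x \<in> L" "snd x \<in> carrier M" using x(1) by auto
      have "fst x = \<ominus>\<^bsub>?E\<^esub> j0 (snd x)" by (rule lm_neg_unique[OF lmE Lc[OF c(1)] Hom_closed[OF jE c(2)] x(2)])
      then have "fst x \<in> L \<inter> j0 ` carrier M" using sm_simps(4)[OF smj] c by simp
      then have 0: "fst x = \<zero>\<^bsub>?E\<^esub>" using L(2) by blast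
      then have "j0 (snd x) = \<zero>\<^bsub>?E\<^esub>" using x(2) Hom_closed[OF j c(2)] lm(1) by simp
      then have "snd x = \<zero>\<^bsub>M\<^esub>" using monoE c(2) lm(2) lmE by (simp add: mono_iff)
      with 0 show "x = \<zero>\<^bsub>sub ?E L \<uplus> M\<^esub>" by (simp add: prod_eq_iff)
    qed
    obtain e where e: "e \<in> Hom ?E ?E" "\<And>x. x \<in> carrier (sub ?E L \<uplus> M) \<Longrightarrow> e (?g x) = j0 (snd x)"
      by (rule inj_extend[OF inj fg_ds2[OF fgL M] fgE mg Hom_comp[OF Hom_snd jE]]) blast
    have eL: "e x = \<zero>\<^bsub>?E\<^esub>" if "x \<in> L" for x
      using e(2)[of "(x, \<zero>\<^bsub>M\<^esub>)"] that Hom_zero[OF j lm(2,1)] lm sm_mem[OF Nsm, of x] Lc[OF that] by simp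
    have ej: "e (j0 x) = j0 x" if "x \<in> carrier M" for x
      using e(2)[of "(\<zero>\<^bsub>?E\<^esub>, x)"] that sm_simps(1)[OF L(1)] lm(1) Hom_closed[OF j that] by simp
    obtain n where n: "n > 0" "a_kernel ?E ?E (e ^^ n) \<inter> (e ^^ n) ` carrier ?E = {\<zero>\<^bsub>?E\<^esub>}"
      "a_kernel ?E ?E (e ^^ n) <+>\<^bsub>?E\<^esub> (e ^^ n) ` carrier ?E = carrier ?E"
      by (rule fitting[OF fgE e(1)])
    let ?K = "a_kernel ?E ?E (e ^^ n)" and ?I = "(e ^^ n) ` carrier ?E"
    have K: "sm ?K ?E" and I: "sm ?I ?E"
      using sm_ker[OF Hom_funpow[OF e(1)] lmE lmE] sm_img[OF Hom_funpow[OF e(1)] lmE lmE] by auto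
    have I': "sm ?I E0" "?I \<subseteq> N" using I sm_sub_iff[OF lm(1) Nsm] by auto
    have "(e ^^ m) (j0 x) = j0 x" if "x \<in> carrier M" for m x by (induction m) (use ej that in auto)
    then have "j0 ` carrier M \<subseteq> ?I" using Hom_closed[OF jE] by (metis image_eqI image_subsetI)
    moreover have "inj (sub E0 ?I)"
      using inj_retract[OF inj ker_retract_image[OF lmE K I n(2,3)] fg_sub[OF fgE I]] by simp
    ultimately have "?I = N" using min[of ?I] I' by (auto simp: chain_le_def)
    then have "?K \<subseteq> {\<zero>\<^bsub>?E\<^esub>}" using n(2) by (auto simp: ker_iff)
    moreover have "L \<subseteq> ?K" using funpow_zero[OF e(1) lmE Lc eL n(1)] Lc by (auto simp: ker_iff)
    ultimately show ?thesis using sm_simps(1)[OF L(1)] by blast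
  qed
  then have "essential R (j0 ` carrier M) ?E" unfolding essential_def using smj by blast
  then show ?thesis using that[of ?E] inj monoE by (simp add: injective_envelope_def)
qed

text \<open>Choose a submodule of a free module minimal among the projective ones that still map
  onto \<open>M\<close>. If \<open>L\<close> together with the kernel is everything,
  \<open>p\<close> lifts along its restriction to \<open>L\<close>, giving an endomorphism
  \<open>e\<close> with image in \<open>L\<close> and \<open>p e = p\<close>. The image of a Fitting
  power of \<open>e\<close> is a projective summand mapping onto \<open>M\<close>, hence everything,
  so \<open>L\<close> is everything.\<close>

lemma projective_cover_exists:
  assumes M: "fg M"
  obtains P :: "'a fgmod" and p where "projective_cover R P p M"
proof -
  obtain P0 :: "'a fgmod" and p where P0: "proj P0" and p0: "mod_epi R P0 M p"
    by (rule proj_cover_free[OF M])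
  have lm: "lm P0" "lm M" using P0 M by auto
  note p = epi_simps[OF p0]
  let ?\<S> = "{N. sm N P0 \<and> p ` N = carrier M \<and> proj (sub P0 N)}"
  have "P0 \<simeq> sub P0 (carrier P0)" by (rule misoI[where f = "\<lambda>x. x" and g = "\<lambda>x. x"]) (auto intro!: HomI)
  then have "proj (sub P0 (carrier P0))" by (rule proj_miso[OF P0]) (simp add: lm_sub sm_carrier lm)
  then have "carrier P0 \<in> ?\<S>"
    using sm_carrier[OF lm(1)] p by auto
  then obtain N where N: "N \<in> ?\<S>" and min: "\<And>L. \<lbrakk>L \<in> ?\<S>; chain_le False N L\<rbrakk> \<Longrightarrow> L = N"
    by (rule chain_extremal[OF fg_cc[OF proj_fg[OF P0]]]) auto
  then have Nsm: "sm N P0" and pN: "p ` N = carrier M" and proj: "proj (sub P0 N)" by auto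
  let ?P = "sub P0 N"
  have fgP: "fg ?P" and lmP: "lm ?P" using proj by auto
  have pP: "p \<in> Hom ?P M" by (rule Hom_sub_from[OF p(1) Nsm])
  have epiP: "mod_epi R ?P M p" using pP pN by (simp add: mod_epi_def)
  have smk: "sm (a_kernel ?P M p) ?P" by (rule sm_ker[OF pP lmP lm(2)])
  have "L = carrier ?P" if L: "sm L ?P" "L <+>\<^bsub>?P\<^esub> a_kernel ?P M p = carrier ?P" for L
  proof -
    have fgL: "fg (sub ?P L)" using fg_sub[OF fgP L(1)] .
    have Lc: "x \<in> L \<Longrightarrow> x \<in> carrier ?P" for x using sm_mem[OF L(1)] .
    have "carrier M \<subseteq> p ` L"
    proof
      fix y assume "y \<in> carrier M"
      then obtain x where x: "x \<in> carrier ?P" "y = p x" using pN by auto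
      obtain u v where uv: "u \<in> L" "v \<in> a_kernel ?P M p" "x = u \<oplus>\<^bsub>?P\<^esub> v" using sum_split[OF L(2) x(1)] by blast
      then have "y = p u" using x Lc[OF uv(1)] Hom_simps(2)[OF pP] Hom_closed[OF pP] lm(2) by (simp add: ker_iff)
      then show "y \<in> p ` L" using uv(1) by blast
    qed
    then have "mod_epi R (sub ?P L) M p"
      unfolding mod_epi_def using Hom_sub_from[OF pP L(1)] Hom_closed[OF pP Lc] by auto
    then obtain e where e: "e \<in> Hom ?P (sub ?P L)" "\<And>x. x \<in> carrier ?P \<Longrightarrow> p (e x) = p x"
      using proj_lift[OF proj fgL M _ pP] by metis
    have eP: "e \<in> Hom ?P ?P" using Hom_comp[OF e(1) Hom_sub[OF lmP L(1)]] .
    obtain n where n: "n > 0" "a_kernel ?P ?P (e ^^ n) \<inter> (e ^^ n) ` carrier ?P = {\<zero>\<^bsub>?P\<^esub>}"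
      "a_kernel ?P ?P (e ^^ n) <+>\<^bsub>?P\<^esub> (e ^^ n) ` carrier ?P = carrier ?P"
      by (rule fitting[OF fgP eP])
    let ?K = "a_kernel ?P ?P (e ^^ n)" and ?I = "(e ^^ n) ` carrier ?P"
    have K: "sm ?K ?P" and I: "sm ?I ?P"
      using sm_ker[OF Hom_funpow[OF eP] lmP lmP] sm_img[OF Hom_funpow[OF eP] lmP lmP] by auto
    have I': "sm ?I P0" "?I \<subseteq> N" using I sm_sub_iff[OF lm(1) Nsm] by auto
    have pe: "p ((e ^^ m) x) = p x" if "x \<in> carrier ?P" for m x
      by (induction m) (use e(2) Hom_closed[OF Hom_funpow[OF eP] that] in auto)
    have "p ` ?I = p ` carrier ?P" unfolding image_image by (rule image_cong[OF refl pe])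
    then have "p ` ?I = carrier M" using pN by simp
    moreover have "proj (sub P0 ?I)"
      using proj_retract[OF proj ker_retract_image[OF lmP K I n(2,3)] fg_sub[OF fgP I]] by simp
    ultimately have "?I = N" using min[of ?I] I' by (auto simp: chain_le_def)
    moreover have "?I \<subseteq> L" using funpow_image_subset[OF eP n(1)] Hom_closed[OF e(1)] by auto
    ultimately show ?thesis using sm_subset[OF L(1)] by auto
  qed
  then have "superfluous R (a_kernel ?P M p) ?P" unfolding superfluous_def using smk by blast
  then show ?thesis using that[of ?P p] proj epiP by (simp add: projective_cover_def)
qed

lemma essential_mono:
  assumes "essential R (j ` carrier M) E" "j \<in> Hom M E" "f \<in> Hom E X" "lm M" "lm E" "lm X"
    and m: "\<And>x. \<lbrakk>x \<in> carrier M; f (j x) = \<zero>\<^bsub>X\<^esub>\<rbrakk> \<Longrightarrow> x = \<zero>\<^bsub>M\<^esub>"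
  shows "mod_mono R E X f"
proof -
  have "a_kernel E X f \<inter> j ` carrier M = {\<zero>\<^bsub>E\<^esub>}"
    using m Hom_zero[OF assms(2,4,5)] Hom_zero[OF assms(3,5,6)] assms(4,5)
    by (auto simp: ker_iff image_iff intro!: bexI[of _ "\<zero>\<^bsub>M\<^esub>"])
  then have "a_kernel E X f = {\<zero>\<^bsub>E\<^esub>}"
    using assms(1) sm_ker[OF assms(3,5,6)] unfolding essential_def by blast
  then show ?thesis by (intro ker_zero_mono[OF assms(3,5,6)]) (auto simp: ker_iff set_eq_iff)
qed

lemma superfluous_epi:
  assumes "superfluous R (a_kernel P M p) P" "p \<in> Hom P M" "f \<in> Hom X P" "lm M" "lm P" "lm X"
    and e: "\<And>y. y \<in> carrier M \<Longrightarrow> \<exists>x\<in>carrier X. p (f x) = y"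
  shows "mod_epi R X P f"
proof -
  have "x \<in> f ` carrier X <+>\<^bsub>P\<^esub> a_kernel P M p" if x: "x \<in> carrier P" for x
  proof -
    obtain z where z: "z \<in> carrier X" "p (f z) = p x" using e[OF Hom_closed[OF assms(2) x]] by blast
    have c: "f z \<in> carrier P" by (rule Hom_closed[OF assms(3) z(1)])
    have "x \<ominus>\<^bsub>P\<^esub> f z \<in> a_kernel P M p"
      using x c z assms(4,5) Hom_closed[OF assms(2)] by (simp add: ker_iff Hom_minus[OF assms(2,5,4)])
    moreover have "x = f z \<oplus>\<^bsub>P\<^esub> (x \<ominus>\<^bsub>P\<^esub> f z)" using x c assms(5) lm_comm[of P "f z" "x \<ominus>\<^bsub>P\<^esub> f z"] by simp
    ultimately show ?thesis unfolding set_add_iff using z(1) by blast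
  qed
  moreover have s: "sm (f ` carrier X) P" by (rule sm_img[OF assms(3,6,5)])
  ultimately have "f ` carrier X <+>\<^bsub>P\<^esub> a_kernel P M p = carrier P"
    using sm_subset[OF sm_add[OF assms(5) s sm_ker[OF assms(2,5,4)]]] by blast
  then show ?thesis using assms(1,3) s unfolding superfluous_def mod_epi_def by blast
qed

lemma envelope_simps:
  assumes "injective_envelope R M j E"
  shows "inj E" "mod_mono R M E j" "essential R (j ` carrier M) E" "j \<in> Hom M E" "fg E" "lm E"
  using assms mono_Hom by (auto simp: injective_envelope_def)

lemma cover_simps:
  assumes "projective_cover R P p M"
  shows "proj P" "mod_epi R P M p" "superfluous R (a_kernel P M p) P" "p \<in> Hom P M" "fg P" "lm P"
  using assms epi_simps(1) by (auto simp: projective_cover_def)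

text \<open>Extend \<open>f\<close> to the envelope. The extension is injective on \<open>M\<close>,
  hence injective by essentiality, and an injective submodule splits off.\<close>

lemma envelope_retract:
  assumes "injective_envelope R M j E" "lm M" "fg X" "f \<in> Hom M X" "mod_mono R M X f" "inj X"
  shows "retract E X"
proof -
  note E = envelope_simps[OF assms(1)]
  have fgM: "fg M" by (rule fg_mono[OF E(2) assms(2) E(5)])
  obtain g where g: "g \<in> Hom E X" "\<And>x. x \<in> carrier M \<Longrightarrow> g (j x) = f x"
    using inj_extend[OF assms(6) fgM E(5,2) assms(4)] by metis
  have "mod_mono R E X g"
    by (rule essential_mono[OF E(3,4) g(1) assms(2) E(6) fg_lm[OF assms(3)]])
      (use g(2) assms(2,3,5) in \<open>simp add: mono_iff\<close>)
  then show ?thesis by (rule inj_mono_retract[OF E(1) assms(3)])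
qed

lemma cover_retract:
  assumes "projective_cover R P p M" "lm M" "fg X" "mod_epi R X M f" "proj X"
  shows "retract P X"
proof -
  note P = cover_simps[OF assms(1)]
  have lmX: "lm X" using assms(3) by simp
  have fgM: "fg M" by (rule fg_epi[OF P(5,2) assms(2)])
  obtain g where g: "g \<in> Hom X P" "\<And>x. x \<in> carrier X \<Longrightarrow> p (g x) = f x"
    using proj_lift[OF assms(5) P(5) fgM P(2) epi_simps(1)[OF assms(4)]] by metis
  have "mod_epi R X P g"
    by (rule superfluous_epi[OF P(3,4) g(1) assms(2) P(6) lmX])
      (use g(2) epi_simps(2)[OF assms(4)] in \<open>metis imageE\<close>)
  then show ?thesis by (rule proj_epi_retract[OF P(1) assms(3)])
qed

lemma cover_exists_syzygy:
  assumes "fg M"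
  obtains P :: "'a fgmod" and p j where "projective_cover R P p M" "ses (syzygy R M) j P p M" "fg (syzygy R M)"
proof -
  obtain P :: "'a fgmod" and p where P: "projective_cover R P p M" by (rule projective_cover_exists[OF assms])
  have "ses (sub P (a_kernel P M p)) (\<lambda>x. x) P p M"
    by (rule ses_ker[OF cover_simps(2,6)[OF P] fg_lm[OF assms]])
  then have "\<exists>Z :: 'a fgmod. is_syzygy R M Z" unfolding is_syzygy_def using P by blast
  then have "is_syzygy R M (syzygy R M)" unfolding syzygy_def by (rule someI_ex)
  then obtain P :: "'a fgmod" and p j where P: "projective_cover R P p M" "ses (syzygy R M) j P p M"
    unfolding is_syzygy_def by blast
  then show ?thesis using that fg_ses(1)[OF P(2)] cover_simps(5)[OF P(1)] by blast
qed

end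

locale artin_inj = artin_ring R for R :: "('a, 'r) ring_scheme" (structure) +
  fixes H :: "('a, 'h) module"
  assumes inj_H: "injective R H"
    and cogen_H: "\<And>M :: 'a fgmod. fg_module R M \<Longrightarrow> \<exists>n j. mod_mono R M (direct_power n H) j"
begin

lemma inj_hull:
  assumes "fg M"
  obtains E :: "'a fgmod" and j where "inj E" "mod_mono R M E j"
proof -
  obtain N :: "'a fgmod" where N: "fg N" "M \<simeq> N" by (rule fg_copy[OF assms])
  obtain n j where j: "mod_mono R N (direct_power n H) j" using cogen_H[OF N(1)] by blast
  have P: "inj (direct_power n H)" by (rule inj_power[OF ring_R inj_H])
  obtain E :: "'a fgmod" where E: "fg E" "direct_power n H \<simeq> E" by (rule fg_copy[OF inj_fg[OF P]])
  have iE: "inj E" using inj_miso[OF P E(2)] E(1) by simp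
  obtain f where f: "mod_mono R M N f" using N(2) by (auto simp: mod_iso_def bij_betw_def mod_mono_def)
  obtain g where g: "mod_mono R (direct_power n H) E g"
    using E(2) by (auto simp: mod_iso_def bij_betw_def mod_mono_def)
  have "mod_mono R M E (\<lambda>x. g (j (f x)))" by (rule mono_comp[OF mono_comp[OF f j] g])
  then show ?thesis using that iE by blast
qed

lemma envelope_exists:
  assumes "fg M"
  obtains E :: "'a fgmod" and j where "injective_envelope R M j E"
proof -
  obtain E :: "'a fgmod" and j where "inj E" "mod_mono R M E j" by (rule inj_hull[OF assms])
  then show ?thesis by (rule envelope_in_injective[OF _ _ assms that])
qed

lemma envelope_exists_ses:
  assumes "fg M"
  obtains E Z :: "'a fgmod" and j p where "injective_envelope R M j E" "ses M j E p Z" "fg Z"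
proof -
  obtain E :: "'a fgmod" and j where E: "injective_envelope R M j E" by (rule envelope_exists[OF assms])
  obtain Z :: "'a fgmod" and p where "fg Z" "ses M j E p Z"
    using ses_coker[OF envelope_simps(2)[OF E] fg_lm[OF assms] envelope_simps(5)[OF E]] by metis
  then show ?thesis using that E by blast
qed

lemma envelope_exists_cosyzygy:
  assumes "fg M"
  obtains E :: "'a fgmod" and j p where "injective_envelope R M j E" "ses M j E p (cosyzygy R M)" "fg (cosyzygy R M)"
proof -
  have "\<exists>Z :: 'a fgmod. is_cosyzygy R M Z"
    using envelope_exists_ses[OF assms] unfolding is_cosyzygy_def by metis
  then have "is_cosyzygy R M (cosyzygy R M)" unfolding cosyzygy_def by (rule someI_ex)
  then obtain E :: "'a fgmod" and j p where E: "injective_envelope R M j E" "ses M j E p (cosyzygy R M)"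
    unfolding is_cosyzygy_def by blast
  then show ?thesis using that fg_ses(2)[OF E(2)] envelope_simps(5)[OF E(1)] by blast
qed

end

section \<open>Resolutions, dimensions and Ext\<close>

context artin_ring
begin

lemma zero_moduleD: "zero_module M \<Longrightarrow> carrier M = {\<zero>\<^bsub>M\<^esub>}"
  by (simp add: zero_module_def)

lemma mono_zero_iff: "\<lbrakk>mod_mono R M N f; lm M; lm N; x \<in> carrier M\<rbrakk> \<Longrightarrow> f x = \<zero>\<^bsub>N\<^esub> \<longleftrightarrow> x = \<zero>\<^bsub>M\<^esub>"
  using mono_iff[of M N f] Hom_zero[of f M N] by blast

lemma mono_kernel: "\<lbrakk>mod_mono R M N f; lm M; lm N\<rbrakk> \<Longrightarrow> a_kernel M N f = {\<zero>\<^bsub>M\<^esub>}"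
  using mono_zero_iff[of M N f] by (auto simp: ker_iff)

lemma kernel_comp_mono:
  assumes "mod_mono R N L m" "p \<in> Hom M N" "lm N" "lm L"
  shows "a_kernel M L (\<lambda>x. m (p x)) = a_kernel M N p"
  unfolding set_eq_iff ker_iff using mono_zero_iff[OF assms(1,3,4) Hom_closed[OF assms(2)]] by blast

lemma proj_resolution_exists:
  assumes M: "fg M"
  shows "\<exists>(P :: nat \<Rightarrow> 'a fgmod) d p. projective_resolution R M P d p"
proof -
  obtain P0 :: "'a fgmod" and p where P0: "proj P0" and p: "mod_epi R P0 M p"
    by (rule proj_cover_free[OF M])
  have "\<forall>N :: 'a fgmod. \<exists>(P :: 'a fgmod) q. fg N \<longrightarrow> proj P \<and> mod_epi R P N q"
    using proj_cover_free by metis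
  then obtain PP :: "'a fgmod \<Rightarrow> 'a fgmod" and qq where PP: "\<And>N. fg N \<Longrightarrow> proj (PP N) \<and> mod_epi R (PP N) N (qq N)" by metis
  define \<Omega> where "\<Omega> N = sub (PP N) (a_kernel (PP N) N (qq N))" for N
  \<comment> \<open>\<open>C k\<close> is the \<open>k\<close>-th kernel, a submodule of
    \<open>P k\<close>, and \<open>P (Suc k)\<close> is a projective module mapped onto it. The
    differential is this map \<open>qq (C k)\<close> followed by the inclusion, which is the
    identity on elements.\<close>
  define C where "C k = (\<Omega> ^^ k) (sub P0 (a_kernel P0 M p))" for k
  define P where "P k = (case k of 0 \<Rightarrow> P0 | Suc k \<Rightarrow> PP (C k))" for k
  have fgk: "fg (sub X (a_kernel X Y f))" if "fg X" "fg Y" "mod_epi R X Y f" for X Y :: "('a, 'z) module" and f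
    using fg_sub[OF that(1) sm_ker[OF epi_simps(1)[OF that(3)]]] that by simp
  have C0: "C 0 = sub P0 (a_kernel P0 M p)" and CS: "C (Suc k) = sub (PP (C k)) (a_kernel (PP (C k)) (C k) (qq (C k)))" for k
    by (simp_all add: C_def \<Omega>_def)
  have "fg (C k)" for k
  proof (induction k)
    case 0
    show ?case unfolding C0 using fg_sub[OF proj_fg[OF P0] sm_ker[OF epi_simps(1)[OF p]]] P0 M by simp
  next
    case (Suc k)
    then show ?case unfolding CS using PP[OF Suc] by (intro fgk) auto
  qed
  then have PPC: "proj (PP (C k))" "mod_epi R (PP (C k)) (C k) (qq (C k))" for k using PP by auto
  have P: "proj (P k)" for k using P0 PPC by (cases k) (auto simp: P_def)
  have PS: "P (Suc k) = PP (C k)" "P 0 = P0" for k by (simp_all add: P_def)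
  have inc: "(\<lambda>x. x) \<in> Hom (C k) (P k)" and z: "\<zero>\<^bsub>C k\<^esub> = \<zero>\<^bsub>P k\<^esub>" for k
  proof -
    have "(\<lambda>x. x) \<in> Hom (C k) (P k) \<and> \<zero>\<^bsub>C k\<^esub> = \<zero>\<^bsub>P k\<^esub>"
    proof (cases k)
      case 0
      show ?thesis unfolding 0 C0 PS using Hom_sub[OF _ sm_ker[OF epi_simps(1)[OF p]]] P0 M by simp
    next
      case (Suc l)
      have "fg (C l)" using \<open>\<And>k. fg (C k)\<close> .
      then show ?thesis unfolding Suc CS PS
        using Hom_sub[OF _ sm_ker[OF epi_simps(1)[OF PPC(2)[of l]]]] PPC(1)[of l] by simp
    qed
    then show "(\<lambda>x. x) \<in> Hom (C k) (P k)" "\<zero>\<^bsub>C k\<^esub> = \<zero>\<^bsub>P k\<^esub>" by auto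
  qed
  have d: "qq (C k) \<in> Hom (P (Suc k)) (P k)" for k
    using Hom_comp[OF epi_simps(1)[OF PPC(2)] inc] by (simp add: PS)
  have img: "qq (C k) ` carrier (P (Suc k)) = carrier (C k)" for k
    using epi_simps(2)[OF PPC(2)] by (simp add: PS)
  have "carrier (C (Suc k)) = a_kernel (P (Suc k)) (P k) (qq (C k))" for k
    by (auto simp: CS PS ker_iff z)
  then have "projective_resolution R M P (\<lambda>k. qq (C k)) p"
    unfolding projective_resolution_def using P d p img img[of 0] by (simp add: PS(2) C0)
  then show ?thesis by blast
qed

text \<open>The infimum of the empty set is infinity, and that of a nonempty set of extended
  naturals is attained.\<close>

lemma Inf_enat_le_1: "Inf S \<le> (1 :: enat) \<Longrightarrow> \<exists>x\<in>S. x \<le> 1"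
  unfolding Inf_enat_def by (cases "S = {}") (auto intro: LeastI)

lemma projdim_le_1D:
  assumes "projdim R M \<le> 1" "fg M"
  obtains P1 P0 :: "'a fgmod" and f g where "proj P1" "proj P0" "ses P1 f P0 g M"
proof -
  obtain n and P :: "nat \<Rightarrow> 'a fgmod" and d p where n: "enat n \<le> 1" and r: "projective_resolution R M P d p"
    and z: "\<forall>i>n. zero_module (P i)"
    using Inf_enat_le_1[OF assms(1)[unfolded projdim_def]] by blast
  have "zero_module (P 2)" using n z by (simp add: one_enat_def)
  then have P2: "carrier (P 2) = {\<zero>\<^bsub>P 2\<^esub>}" by (rule zero_moduleD)
  have P: "proj (P i)" and d: "d i \<in> Hom (P (Suc i)) (P i)" and p: "mod_epi R (P 0) M p"
    and ex: "d 0 ` carrier (P 1) = a_kernel (P 0) M p" "d 1 ` carrier (P 2) = a_kernel (P 1) (P 0) (d 0)" for i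
    using r by (auto simp: projective_resolution_def numeral_2_eq_2)
  have lm: "lm (P i)" for i using P[of i] by simp
  have d1: "d 1 \<in> Hom (P 2) (P 1)" and d0: "d 0 \<in> Hom (P 1) (P 0)" using d[of 1] d[of 0] by (simp_all add: numeral_2_eq_2)
  have "a_kernel (P 1) (P 0) (d 0) = {\<zero>\<^bsub>P 1\<^esub>}"
    using ex(2) Hom_zero[OF d1 lm lm] by (simp add: P2)
  then have "mod_mono R (P 1) (P 0) (d 0)"
    by (intro ker_zero_mono[OF d0 lm lm]) (auto simp: ker_iff set_eq_iff)
  then have "ses (P 1) (d 0) (P 0) p M"
    unfolding short_exact_def using lm assms(2) p ex(1) by simp
  then show ?thesis using that P by blast
qed

lemma projdim_le_1I:
  fixes P1 P0 :: "'a fgmod"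
  assumes "proj P1" "proj P0" "ses P1 f P0 g M"
  shows "projdim R M \<le> 1"
proof -
  note s = ses_simps[OF assms(3)]
  \<comment> \<open>The resolution is continued by zero modules; the zero submodule of
    \<open>P0\<close> supplies one of the right type.\<close>
  define Z where "Z = sub P0 {\<zero>\<^bsub>P0\<^esub>}"
  have lmZ: "lm Z" unfolding Z_def by (rule lm_sub[OF s(2) sm_zero[OF s(2)]])
  have Z: "carrier Z = {\<zero>\<^bsub>Z\<^esub>}" by (simp add: Z_def)
  have pZ: "proj Z" by (rule proj_zero[OF lmZ Z])
  define P where "P i = (case i of 0 \<Rightarrow> P0 | Suc 0 \<Rightarrow> P1 | _ \<Rightarrow> Z)" for i :: nat
  define d where "d i = (case i of 0 \<Rightarrow> f | Suc 0 \<Rightarrow> (\<lambda>_. \<zero>\<^bsub>P1\<^esub>) | _ \<Rightarrow> (\<lambda>_. \<zero>\<^bsub>Z\<^esub>))" for i :: nat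
  have P_simps: "P 0 = P0" "P (Suc 0) = P1" "P (Suc (Suc i)) = Z" "d 0 = f" "d (Suc 0) = (\<lambda>_. \<zero>\<^bsub>P1\<^esub>)" "d (Suc (Suc i)) = (\<lambda>_. \<zero>\<^bsub>Z\<^esub>)" for i
    by (simp_all add: P_def d_def)
  have "projective_resolution R M P d g"
    unfolding projective_resolution_def
  proof (intro conjI allI)
    show "proj (P i)" for i using assms(1,2) pZ by (auto simp: P_def split: nat.splits)
    show "d i \<in> Hom (P (Suc i)) (P i)" for i
    proof -
      have "i = 0 \<or> i = Suc 0 \<or> (\<exists>k. i = Suc (Suc k))" by (metis not0_implies_Suc)
      then show ?thesis
        using s(4) Hom_const_zero[OF s(1), of Z] Hom_const_zero[OF lmZ, of Z] by (auto simp: P_simps)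
    qed
    show "d 0 ` carrier (P 1) = a_kernel (P 0) M g" using s(11) by (simp add: P_simps)
    show "d (Suc i) ` carrier (P (Suc (Suc i))) = a_kernel (P (Suc i)) (P i) (d i)" for i
    proof (cases i)
      case 0
      have "a_kernel P1 P0 f = {\<zero>\<^bsub>P1\<^esub>}" by (rule mono_kernel[OF s(6,1,2)])
      then show ?thesis using Z by (simp add: 0 P_simps)
    next
      case (Suc k)
      have "a_kernel Z X (\<lambda>_. \<zero>\<^bsub>X\<^esub>) = {\<zero>\<^bsub>Z\<^esub>}" for X :: "'a fgmod"
        using Z by (simp add: a_kernel_def kernel_def)
      with Suc show ?thesis using Z by (cases k) (simp_all add: P_simps)
    qed
  qed (use s(7) in \<open>simp add: P_simps\<close>)
  moreover have "\<forall>i>1. zero_module (P i)" using Z by (auto simp: P_def zero_module_def split: nat.splits)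
  ultimately have "Inf {enat n |n. \<exists>(P :: nat \<Rightarrow> 'a fgmod) d p. projective_resolution R M P d p \<and> (\<forall>i>n. zero_module (P i))} \<le> enat 1"
    by (intro Inf_lower) blast
  then show ?thesis unfolding projdim_def by (simp add: one_enat_def)
qed

text \<open>Schanuel's lemma: comparing the two presentations of \<open>M\<close> over the identity
  makes \<open>K\<close> a retract of \<open>X \<uplus> P1\<close>.\<close>

lemma ker_proj:
  assumes "proj P1" "proj P0" "ses P1 f P0 g M" "proj X" "ses K k X p M"
  shows "proj K"
proof -
  note s = ses_simps[OF assms(3)] and t = ses_simps[OF assms(5)]
  have fgM: "fg M" using fg_epi[OF proj_fg[OF assms(2)] s(7,3)] .
  obtain h where h: "h \<in> Hom X P0" "\<And>x. x \<in> carrier X \<Longrightarrow> g (h x) = p x"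
    using proj_lift[OF assms(4) proj_fg[OF assms(2)] fgM s(7) t(5)] by metis
  obtain h' where h': "h' \<in> Hom P0 X" "\<And>x. x \<in> carrier P0 \<Longrightarrow> p (h' x) = g x"
    using proj_lift[OF assms(2) proj_fg[OF assms(4)] fgM t(7) s(5)] by metis
  have "retract K (X \<uplus> P1)"
    by (rule retract_ker[OF assms(5,3) Hom_id Hom_id _ h(1) _ h'(1)]) (use h(2) h'(2) in auto)
  then show ?thesis
    by (rule proj_retract[OF proj_ds2[OF assms(4,1)] _ fg_ses(1)[OF assms(5) proj_fg[OF assms(4)]]])
qed

lemma injdim_le_1D:
  assumes "injdim R M \<le> 1" "fg M"
  obtains E1 E0 :: "'a fgmod" and f g where "inj E1" "inj E0" "ses M f E0 g E1"
proof -
  obtain n and E :: "nat \<Rightarrow> 'a fgmod" and d j where n: "enat n \<le> 1" and r: "injective_resolution R M E d j"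
    and z: "\<forall>i>n. zero_module (E i)"
    using Inf_enat_le_1[OF assms(1)[unfolded injdim_def]] by blast
  have "zero_module (E 2)" using n z by (simp add: one_enat_def)
  then have E2: "carrier (E 2) = {\<zero>\<^bsub>E 2\<^esub>}" by (rule zero_moduleD)
  have E: "inj (E i)" and d: "d i \<in> Hom (E i) (E (Suc i))" and j: "mod_mono R M (E 0) j"
    and ex: "j ` carrier M = a_kernel (E 0) (E 1) (d 0)" "d 0 ` carrier (E 0) = a_kernel (E 1) (E 2) (d 1)" for i
    using r by (auto simp: injective_resolution_def numeral_2_eq_2)
  have lm: "lm (E i)" for i using E[of i] by simp
  have d1: "d 1 \<in> Hom (E 1) (E 2)" and d0: "d 0 \<in> Hom (E 0) (E 1)" using d[of 1] d[of 0] by (simp_all add: numeral_2_eq_2)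
  have "a_kernel (E 1) (E 2) (d 1) = carrier (E 1)"
    using Hom_closed[OF d1] E2 by (auto simp: ker_iff)
  then have "mod_epi R (E 0) (E 1) (d 0)" using ex(2) d0 by (simp add: mod_epi_def)
  then have "ses M j (E 0) (d 0) (E 1)"
    unfolding short_exact_def using lm assms(2) j ex(1) by simp
  then show ?thesis using that E by blast
qed

lemma injdim_le_1I:
  fixes E1 E0 :: "'a fgmod"
  assumes "inj E1" "inj E0" "ses M f E0 g E1"
  shows "injdim R M \<le> 1"
proof -
  note s = ses_simps[OF assms(3)]
  define Z where "Z = sub E0 {\<zero>\<^bsub>E0\<^esub>}"
  have lmZ: "lm Z" unfolding Z_def by (rule lm_sub[OF s(2) sm_zero[OF s(2)]])
  have Z: "carrier Z = {\<zero>\<^bsub>Z\<^esub>}" by (simp add: Z_def)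
  have pZ: "inj Z" by (rule inj_zero[OF lmZ Z])
  define E where "E i = (case i of 0 \<Rightarrow> E0 | Suc 0 \<Rightarrow> E1 | _ \<Rightarrow> Z)" for i :: nat
  define d where "d i = (case i of 0 \<Rightarrow> g | _ \<Rightarrow> (\<lambda>_. \<zero>\<^bsub>Z\<^esub>))" for i :: nat
  have E_simps: "E 0 = E0" "E (Suc 0) = E1" "E (Suc (Suc i)) = Z" "d 0 = g" "d (Suc i) = (\<lambda>_. \<zero>\<^bsub>Z\<^esub>)" for i
    by (simp_all add: E_def d_def)
  have iE: "inj (E i)" for i using assms(1,2) pZ by (auto simp: E_def split: nat.splits)
  have ne: "carrier (E i) \<noteq> {}" for i using lm_zero[OF fg_lm[OF inj_fg[OF iE[of i]]]] by blast
  have "injective_resolution R M E d f"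
    unfolding injective_resolution_def
  proof (intro conjI allI)
    show "inj (E i)" for i by (rule iE)
    show "d i \<in> Hom (E i) (E (Suc i))" for i
      using s(5) Hom_const_zero[OF lmZ, of "E i"] by (cases i) (auto simp: E_simps)
    show "f ` carrier M = a_kernel (E 0) (E 1) (d 0)" using s(11) by (simp add: E_simps)
    show "d i ` carrier (E i) = a_kernel (E (Suc i)) (E (Suc (Suc i))) (d (Suc i))" for i
      using s(10) Z ne by (cases i) (simp_all add: E_simps a_kernel_def kernel_def image_constant_conv)
  qed (use s(6) in \<open>simp add: E_simps\<close>)
  moreover have "\<forall>i>1. zero_module (E i)" using Z by (auto simp: E_def zero_module_def split: nat.splits)
  ultimately have "Inf {enat n |n. \<exists>(E :: nat \<Rightarrow> 'a fgmod) d j. injective_resolution R M E d j \<and> (\<forall>i>n. zero_module (E i))} \<le> enat 1"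
    by (intro Inf_lower) blast
  then show ?thesis unfolding injdim_def by (simp add: one_enat_def)
qed

lemma coker_inj:
  assumes "inj E1" "inj E0" "ses M f E0 g E1" "inj X" "ses M i X p C"
  shows "inj C"
proof -
  note s = ses_simps[OF assms(3)] and t = ses_simps[OF assms(5)]
  have fgM: "fg M" using fg_mono[OF s(6,1) inj_fg[OF assms(2)]] .
  obtain h where h: "h \<in> Hom X E0" "\<And>x. x \<in> carrier M \<Longrightarrow> h (i x) = f x"
    using inj_extend[OF assms(2) fgM inj_fg[OF assms(4)] t(6) s(4)] by metis
  obtain h' where h': "h' \<in> Hom E0 X" "\<And>x. x \<in> carrier M \<Longrightarrow> h' (f x) = i x"
    using inj_extend[OF assms(4) fgM inj_fg[OF assms(2)] s(6) t(4)] by metis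
  have "retract C (X \<uplus> E1)"
    by (rule retract_coker[OF assms(5,3) Hom_id Hom_id _ h(1) _ h'(1)]) (use h(2) h'(2) in auto)
  then show ?thesis
    by (rule inj_retract[OF inj_ds2[OF assms(4,1)] _ fg_ses(2)[OF assms(5) inj_fg[OF assms(4)]]])
qed

section \<open>Vanishing of Ext in degree one\<close>

lemma Hom_restrict: assumes "f \<in> Hom M N" "lm M" shows "restrict f (carrier M) \<in> Hom M N"
  by (rule Hom_cong[OF assms(1)]) (use assms(2) in auto)

lemma comm_group_Hom: assumes "lm M" "lm N" shows "comm_group (Hom_group R M N)"
proof (rule comm_groupI)
  note simps = Hom_group_def and lm = assms
  fix f g h
  let ?G = "Hom_group R M N"
  assume f: "f \<in> carrier ?G"
  then have f': "f \<in> Hom M N" "f \<in> extensional (carrier M)" by (auto simp: simps)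
  note fc = Hom_closed[OF f'(1)]
  show "\<one>\<^bsub>?G\<^esub> \<otimes>\<^bsub>?G\<^esub> f = f" using f' fc lm by (auto simp: simps fun_eq_iff extensional_def)
  show "\<exists>y\<in>carrier ?G. y \<otimes>\<^bsub>?G\<^esub> f = \<one>\<^bsub>?G\<^esub>"
    using fc lm Hom_restrict[OF Hom_neg_fun[OF f'(1) lm(2)] lm(1)]
    by (intro bexI[of _ "\<lambda>x\<in>carrier M. \<ominus>\<^bsub>N\<^esub> f x"]) (auto simp: simps intro!: restrict_ext)
  assume g: "g \<in> carrier ?G"
  then have g': "g \<in> Hom M N" "g \<in> extensional (carrier M)" by (auto simp: simps)
  note gc = Hom_closed[OF g'(1)]
  show "f \<otimes>\<^bsub>?G\<^esub> g \<in> carrier ?G"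
    using Hom_restrict[OF Hom_add[OF f'(1) g'(1) lm(2)] lm(1)] by (simp add: simps)
  show "f \<otimes>\<^bsub>?G\<^esub> g = g \<otimes>\<^bsub>?G\<^esub> f" using fc gc lm_comm[OF lm(2)] by (auto simp: simps intro!: restrict_ext)
  assume h: "h \<in> carrier ?G"
  then have h': "h \<in> Hom M N" by (auto simp: simps)
  show "f \<otimes>\<^bsub>?G\<^esub> g \<otimes>\<^bsub>?G\<^esub> h = f \<otimes>\<^bsub>?G\<^esub> (g \<otimes>\<^bsub>?G\<^esub> h)"
    using fc gc Hom_closed[OF h'] lm_assoc[OF lm(2)] by (auto simp: simps intro!: restrict_ext)
next
  show "\<one>\<^bsub>Hom_group R M N\<^esub> \<in> carrier (Hom_group R M N)"
    using Hom_restrict[OF Hom_const_zero[OF assms(2)] assms(1)] by (simp add: Hom_group_def)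
qed

lemma trivial_FactGroup_self:
  fixes G (structure)
  assumes "comm_group G" "subgroup Z G"
  shows "trivial_group (G\<lparr>carrier := Z\<rparr> Mod Z)"
proof -
  interpret G: comm_group G by (rule assms(1))
  let ?H = "G\<lparr>carrier := Z\<rparr>"
  interpret H: group ?H by (rule G.subgroup_imp_group[OF assms(2)])
  have sub: "subgroup Z ?H" using H.subgroup_self by simp
  have "Z \<lhd> ?H"
    unfolding H.normal_inv_iff using sub H.m_closed H.inv_closed by auto
  then interpret N: normal Z ?H .
  have "carrier (?H Mod Z) = {Z}"
  proof -
    have "Z #>\<^bsub>?H\<^esub> x = Z" if "x \<in> Z" for x using H.coset_join2[OF _ sub, of x] that by simp
    moreover have "Z \<noteq> {}" using subgroup.one_closed[OF assms(2)] by blast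
    ultimately show ?thesis by (auto simp: FactGroup_def RCOSETS_def)
  qed
  then show ?thesis using group.trivial_group[OF N.factorgroup_is_group] by blast
qed

text \<open>A cocycle is a map on \<open>P 1\<close> that vanishes on the kernel of
  \<open>d 0\<close>, that is, a map on the first syzygy; it is a coboundary exactly when this map
  extends to \<open>P 0\<close>. The hypothesis ranges over all projective presentations because
  \<open>Ext\<close> picks its resolution by choice.\<close>

lemma Ext1_trivial:
  fixes M :: "('a, 'm) module" and N :: "('a, 'n) module"
  assumes M: "fg M" and N: "fg N"
    and ext: "\<And>(K :: 'a fgmod) (P :: 'a fgmod) k p f. \<lbrakk>proj P; ses K k P p M; f \<in> Hom K N\<rbrakk> \<Longrightarrow>
      \<exists>g\<in>Hom P N. \<forall>x\<in>carrier K. g (k x) = f x"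
  shows "trivial_group (Ext R 1 M N)"
proof -
  obtain P :: "nat \<Rightarrow> 'a fgmod" and d p where some: "(SOME (P :: nat \<Rightarrow> 'a fgmod, d, p). projective_resolution R M P d p) = (P, d, p)"
    by (metis prod_cases3)
  have "\<exists>t. case t of (P :: nat \<Rightarrow> 'a fgmod, d, p) \<Rightarrow> projective_resolution R M P d p"
    using proj_resolution_exists[OF M] by auto
  from someI_ex[OF this] have r: "projective_resolution R M P d p" unfolding some by simp
  have P: "proj (P i)" and d: "d i \<in> Hom (P (Suc i)) (P i)" and p: "mod_epi R (P 0) M p"
    and ex: "d 0 ` carrier (P 1) = a_kernel (P 0) M p" "d (Suc i) ` carrier (P (Suc (Suc i))) = a_kernel (P (Suc i)) (P i) (d i)" for i
    using r by (auto simp: projective_resolution_def)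
  have lm: "lm (P i)" for i using P[of i] by simp
  have lmN: "lm N" using N by simp
  have d0: "d 0 \<in> Hom (P 1) (P 0)" and d1: "d 1 \<in> Hom (P 2) (P 1)" and ex1: "d 1 ` carrier (P 2) = a_kernel (P 1) (P 0) (d 0)"
    using d[of 0] d[of 1] ex(2)[of 0] by (simp_all add: numeral_2_eq_2)
  let ?G = "Hom_group R (P 1) N"
  define Z where "Z = {f \<in> carrier ?G. compose (carrier (P 2)) f (d 1) = \<one>\<^bsub>Hom_group R (P 2) N\<^esub>}"
  define B where "B = (\<lambda>g. compose (carrier (P 1)) g (d 0)) ` carrier (Hom_group R (P 0) N)"
  have E: "Ext R 1 M N = ?G\<lparr>carrier := Z\<rparr> Mod B"
    unfolding Ext_def some Hom_cohomology_def Z_def B_def by (simp add: Let_def numeral_2_eq_2)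
  have Ziff: "f \<in> Z \<longleftrightarrow> f \<in> Hom (P 1) N \<and> f \<in> extensional (carrier (P 1)) \<and> (\<forall>x\<in>carrier (P 1). d 0 x = \<zero>\<^bsub>P 0\<^esub> \<longrightarrow> f x = \<zero>\<^bsub>N\<^esub>)" for f
  proof -
    have "compose (carrier (P 2)) f (d 1) = \<one>\<^bsub>Hom_group R (P 2) N\<^esub> \<longleftrightarrow> (\<forall>y\<in>carrier (P 2). f (d 1 y) = \<zero>\<^bsub>N\<^esub>)"
      by (auto simp: Hom_group_def compose_def restrict_def fun_eq_iff)
    also have "\<dots> \<longleftrightarrow> (\<forall>x\<in>a_kernel (P 1) (P 0) (d 0). f x = \<zero>\<^bsub>N\<^esub>)" unfolding ex1[symmetric] by blast
    finally show ?thesis by (auto simp: Z_def Hom_group_def ker_iff)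
  qed
  have "Z = B"
  proof
    show "B \<subseteq> Z"
    proof
      fix f assume "f \<in> B"
      then obtain g where g: "g \<in> Hom (P 0) N" "f = compose (carrier (P 1)) g (d 0)" by (auto simp: B_def Hom_group_def)
      then show "f \<in> Z" unfolding Ziff compose_def
        using Hom_restrict[OF Hom_comp[OF d0 g(1)] lm] Hom_zero[OF g(1) lm lmN] by simp
    qed
    show "Z \<subseteq> B"
    proof
      fix f assume "f \<in> Z"
      then have f: "f \<in> Hom (P 1) N" "f \<in> extensional (carrier (P 1))"
        and f0: "\<And>x. \<lbrakk>x \<in> carrier (P 1); d 0 x = \<zero>\<^bsub>P 0\<^esub>\<rbrakk> \<Longrightarrow> f x = \<zero>\<^bsub>N\<^esub>" by (auto simp: Ziff)
      let ?K = "sub (P 0) (a_kernel (P 0) M p)"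
      have ses: "ses ?K (\<lambda>x. x) (P 0) p M" by (rule ses_ker[OF p lm fg_lm[OF M]])
      have epi: "mod_epi R (P 1) ?K (d 0)"
        unfolding mod_epi_def using ex(1) Hom_sub_to[OF d0, of "a_kernel (P 0) M p"] by simp
      obtain f' where f': "f' \<in> Hom ?K N" "\<And>x. x \<in> carrier (P 1) \<Longrightarrow> f' (d 0 x) = f x"
        using factor_epi[OF epi f(1) lm ses_simps(1)[OF ses] lmN] f0 by auto
      obtain g where g: "g \<in> Hom (P 0) N" "\<And>x. x \<in> carrier ?K \<Longrightarrow> g x = f' x"
        using ext[OF P ses f'(1)] by blast
      have dc: "d 0 x \<in> carrier ?K" if "x \<in> carrier (P 1)" for x using ex(1) that by auto
      have "compose (carrier (P 1)) (restrict g (carrier (P 0))) (d 0) = f"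
        using f(2) g(2)[OF dc] f'(2) Hom_closed[OF d0] by (auto simp: compose_def fun_eq_iff extensional_def)
      moreover have "restrict g (carrier (P 0)) \<in> carrier (Hom_group R (P 0) N)"
        using Hom_restrict[OF g(1) lm] by (simp add: Hom_group_def)
      ultimately show "f \<in> B" unfolding B_def by blast
    qed
  qed
  have cg: "comm_group ?G" by (rule comm_group_Hom[OF lm lmN])
  have "subgroup Z ?G"
  proof -
    interpret G: comm_group ?G by (rule cg)
    interpret G0: comm_group "Hom_group R (P 0) N" by (rule comm_group_Hom[OF lm lmN])
    have "(\<lambda>g. compose (carrier (P 1)) g (d 0)) \<in> hom (Hom_group R (P 0) N) ?G"
    proof (rule homI)
      fix f g assume fg: "f \<in> carrier (Hom_group R (P 0) N)" "g \<in> carrier (Hom_group R (P 0) N)"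
      then show "compose (carrier (P 1)) f (d 0) \<in> carrier ?G"
        using Hom_restrict[OF Hom_comp[OF d0, of f N] lm] by (simp add: Hom_group_def compose_def)
      show "compose (carrier (P 1)) (f \<otimes>\<^bsub>Hom_group R (P 0) N\<^esub> g) (d 0) =
        compose (carrier (P 1)) f (d 0) \<otimes>\<^bsub>?G\<^esub> compose (carrier (P 1)) g (d 0)"
        using Hom_closed[OF d0] by (auto simp: Hom_group_def compose_def intro!: restrict_ext)
    qed
    then have "group_hom (Hom_group R (P 0) N) ?G (\<lambda>g. compose (carrier (P 1)) g (d 0))"
      by (intro group_hom.intro group_hom_axioms.intro G.is_group G0.is_group)
    from group_hom.img_is_subgroup[OF this] show ?thesis unfolding \<open>Z = B\<close> B_def .
  qed
  then show ?thesis unfolding E \<open>Z = B\<close>[symmetric] by (rule trivial_FactGroup_self[OF cg])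
qed

end

context artin_inj
begin

lemma minimal_resolution_exists:
  assumes M: "fg M"
  shows "\<exists>(E :: nat \<Rightarrow> 'a fgmod) d j. minimal_injective_resolution R M E d j"
proof -
  \<comment> \<open>The passage to the cosyzygy is iterated, so its source and target must have the
    same type. Hence \<open>M\<close> is replaced by a copy, and the first embedding is precomposed
    with the isomorphism.\<close>
  obtain N0 :: "'a fgmod" where N0: "fg N0" "M \<simeq> N0" by (rule fg_copy[OF M])
  obtain i where i: "i \<in> Hom M N0" "bij_betw i (carrier M) (carrier N0)" using N0(2) by (auto simp: mod_iso_def)
  have "\<forall>N :: 'a fgmod. \<exists>(E :: 'a fgmod) j (Z :: 'a fgmod) p. fg N \<longrightarrow> injective_envelope R N j E \<and> ses N j E p Z \<and> fg Z"
    using envelope_exists_ses by metis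
  then obtain EE jj ZZ pp where
    *: "\<And>N :: 'a fgmod. fg N \<Longrightarrow> injective_envelope R N (jj N) (EE N :: 'a fgmod) \<and> ses N (jj N) (EE N) (pp N) (ZZ N :: 'a fgmod) \<and> fg (ZZ N)"
    by metis
  define C where "C k = (ZZ ^^ k) N0" for k
  have C: "C 0 = N0" "C (Suc k) = ZZ (C k)" for k by (simp_all add: C_def)
  have "fg (C k)" for k by (induction k) (use N0 * in \<open>auto simp: C\<close>)
  then have env: "injective_envelope R (C k) (jj (C k)) (EE (C k))"
    and ses: "ses (C k) (jj (C k)) (EE (C k)) (pp (C k)) (C (Suc k))" for k
    using * by (auto simp: C)
  note e = envelope_simps[OF env] and s = ses_simps[OF ses]
  define d where "d k x = jj (C (Suc k)) (pp (C k) x)" for k x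
  have d: "d k \<in> Hom (EE (C k)) (EE (C (Suc k)))" for k
    unfolding d_def by (rule Hom_comp[OF s(5,4)])
  have kd: "a_kernel (EE (C k)) (EE (C (Suc k))) (d k) = jj (C k) ` carrier (C k)" for k
    unfolding s(11) d_def by (rule kernel_comp_mono[OF s(6,5,1,2)])
  have im: "d k ` carrier (EE (C k)) = jj (C (Suc k)) ` carrier (C (Suc k))" for k
    unfolding d_def s(10)[symmetric] by (simp add: image_image)
  have ij: "mod_mono R M (EE N0) (\<lambda>x. jj N0 (i x))"
    by (rule mono_comp[OF _ e(2)[of 0, unfolded C]]) (use i in \<open>simp add: mod_mono_def bij_betw_def\<close>)
  have ii: "(\<lambda>x. jj N0 (i x)) ` carrier M = jj N0 ` carrier N0"
    using i(2) by (simp add: bij_betw_def image_image[of "jj N0" i, symmetric])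
  have "minimal_injective_resolution R M (\<lambda>k. EE (C k)) d (\<lambda>x. jj N0 (i x))"
    unfolding minimal_injective_resolution_def injective_resolution_def
  proof (intro conjI allI)
    show "(\<lambda>x. jj N0 (i x)) ` carrier M = a_kernel (EE (C 0)) (EE (C 1)) (d 0)"
      using kd[of 0] by (simp add: ii C)
    show "d k ` carrier (EE (C k)) = a_kernel (EE (C (Suc k))) (EE (C (Suc (Suc k)))) (d (Suc k))" for k
      using im kd by simp
    show "essential R ((\<lambda>x. jj N0 (i x)) ` carrier M) (EE (C 0))" using e(3)[of 0] by (simp add: ii C)
    show "essential R (d k ` carrier (EE (C k))) (EE (C (Suc k)))" for k unfolding im by (rule e(3))
  qed (use e(1) d ij in \<open>auto simp: C\<close>)
  then show ?thesis by blast
qed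

section \<open>Projective-injective modules and dominant dimension\<close>

definition PI :: "('a, 'm) module \<Rightarrow> bool" where "PI M \<longleftrightarrow> proj M \<and> inj M"

text \<open>Unlike the resolution in the dominant dimension, this copresentation is not asked to be
  minimal, which makes the condition easy to pass to sums and retracts. \<open>coker_PI\<close> is
  the dual notion.\<close>

definition ker_PI :: "('a, 'm) module \<Rightarrow> bool" where
  "ker_PI F \<longleftrightarrow> (\<exists>(E0 :: 'a fgmod) (E1 :: 'a fgmod) j d. PI E0 \<and> PI E1 \<and> mod_mono R F E0 j \<and> d \<in> Hom E0 E1 \<and>
     j ` carrier F = a_kernel E0 E1 d)"

definition coker_PI :: "('a, 'm) module \<Rightarrow> bool" where
  "coker_PI I \<longleftrightarrow> (\<exists>(P0 :: 'a fgmod) (P1 :: 'a fgmod) p d. PI P0 \<and> PI P1 \<and> mod_epi R P0 I p \<and> d \<in> Hom P1 P0 \<and>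
     d ` carrier P1 = a_kernel P0 I p)"

lemma ker_PI_E:
  assumes "ker_PI F"
  obtains E0 E1 :: "'a fgmod" and j d where "PI E0" "PI E1" "mod_mono R F E0 j" "d \<in> Hom E0 E1"
    "j ` carrier F = a_kernel E0 E1 d"
  using assms unfolding ker_PI_def by blast

lemma coker_PI_E:
  assumes "coker_PI I"
  obtains P0 P1 :: "'a fgmod" and p d where "PI P0" "PI P1" "mod_epi R P0 I p" "d \<in> Hom P1 P0"
    "d ` carrier P1 = a_kernel P0 I p"
  using assms unfolding coker_PI_def by blast

lemma PI_I: "\<lbrakk>proj M; inj M\<rbrakk> \<Longrightarrow> PI M"
  by (simp add: PI_def)

lemma PI_simps [simp]: "PI M \<Longrightarrow> proj M" "PI M \<Longrightarrow> inj M"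
  by (simp_all add: PI_def)

lemma PI_retract: assumes "retract X M" "PI M" "lm X" shows "PI X"
proof -
  have "fg X" by (rule fg_retract[OF assms(1,3) proj_fg[OF PI_simps(1)[OF assms(2)]]])
  then show ?thesis
    by (intro PI_I proj_retract[OF PI_simps(1)[OF assms(2)] assms(1)] inj_retract[OF PI_simps(2)[OF assms(2)] assms(1)])
qed

lemma PI_ds2: "\<lbrakk>PI M; PI N\<rbrakk> \<Longrightarrow> PI (M \<uplus> N)"
  by (intro PI_I proj_ds2 inj_ds2) simp_all

lemma PI_zero: "\<lbrakk>lm M; carrier M = {\<zero>\<^bsub>M\<^esub>}\<rbrakk> \<Longrightarrow> PI M"
  by (intro PI_I proj_zero inj_zero)

lemma PI_copy:
  assumes "PI M" obtains N :: "'a fgmod" where "PI N" "M \<simeq> N" "N \<simeq> M"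
proof -
  obtain N :: "'a fgmod" where "fg N" "M \<simeq> N" "N \<simeq> M" by (rule fg_copy[of M]) (use assms in simp)
  then show ?thesis
    using that PI_I[OF proj_miso[OF PI_simps(1)[OF assms]] inj_miso[OF PI_simps(2)[OF assms]]] fg_lm by blast
qed

text \<open>From an arbitrary copresentation to the minimal one: \<open>E 0\<close> is an envelope,
  hence a retract of \<open>X0\<close>. The image of \<open>E 0\<close> in \<open>E 1\<close> has
  \<open>E 1\<close> as its envelope and embeds into the projective-injective module
  \<open>E 0 \<uplus> X1\<close>, so \<open>E 1\<close> is a retract of the latter.\<close>

lemma domdim_ge_2: "domdim R \<ge> 2 \<longleftrightarrow> ker_PI (regular_module R)"
proof
  assume *: "domdim R \<ge> 2"
  let ?S = "{enat k |k. \<exists>(E :: nat \<Rightarrow> 'a fgmod) d j. minimal_injective_resolution R (regular_module R) E d j \<and> (\<forall>i<k. proj (E i))}"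
  \<comment> \<open>If all members were below 2 they would be at most 1, and so would their
    supremum; hence the bound 2 is witnessed by a single resolution.\<close>
  have "\<exists>x\<in>?S. x \<ge> 2"
  proof (rule ccontr)
    assume "\<not> ?thesis"
    then have lt: "x < 2" if "x \<in> ?S" for x using that by (meson not_le)
    have "x \<le> 1" if "x \<in> ?S" for x using lt[OF that] by (cases x) (simp_all add: one_enat_def numeral_eq_enat)
    then have "Sup ?S \<le> 1" by (rule Sup_least)
    with * have "(2 :: enat) \<le> 1" unfolding domdim_def by (rule order_trans)
    then show False by (simp add: one_enat_def numeral_eq_enat)
  qed
  then obtain k and E :: "nat \<Rightarrow> 'a fgmod" and d j where k: "k \<ge> 2" and r: "minimal_injective_resolution R (regular_module R) E d j"
    and P: "\<And>i. i < k \<Longrightarrow> proj (E i)"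
    by (auto simp: numeral_eq_enat)
  then have "PI (E 0)" "PI (E 1)" "mod_mono R (regular_module R) (E 0) j" "d 0 \<in> Hom (E 0) (E 1)"
    "j ` carrier (regular_module R) = a_kernel (E 0) (E 1) (d 0)"
    unfolding minimal_injective_resolution_def injective_resolution_def PI_def by auto
  then show "ker_PI (regular_module R)" unfolding ker_PI_def by blast
next
  assume "ker_PI (regular_module R)"
  then obtain X0 X1 :: "'a fgmod" and i c where X: "PI X0" "PI X1" and i: "mod_mono R (regular_module R) X0 i"
    and c: "c \<in> Hom X0 X1" "i ` carrier (regular_module R) = a_kernel X0 X1 c"
    by (rule ker_PI_E)
  let ?A = "regular_module R"
  have fgA: "fg ?A" by (rule fg_regular[OF ring_R])
  then have lmA: "lm ?A" by simp
  obtain E :: "nat \<Rightarrow> 'a fgmod" and d j where r: "minimal_injective_resolution R ?A E d j"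
    using minimal_resolution_exists[OF fgA] by blast
  have E: "inj (E k)" and d: "d k \<in> Hom (E k) (E (Suc k))" and j: "mod_mono R ?A (E 0) j"
    and k0: "j ` carrier ?A = a_kernel (E 0) (E 1) (d 0)"
    and ess: "essential R (j ` carrier ?A) (E 0)" "essential R (d 0 ` carrier (E 0)) (E 1)" for k
    using r unfolding minimal_injective_resolution_def injective_resolution_def by auto
  have lm: "lm (E k)" for k using E[of k] by simp
  have fgE: "fg (E k)" for k using E[of k] by simp
  have d0: "d 0 \<in> Hom (E 0) (E 1)" using d[of 0] by simp
  have env0: "injective_envelope R ?A j (E 0)" using E j ess(1) by (simp add: injective_envelope_def)
  have fgX: "fg X0" "fg X1" "lm X0" "lm X1" using X by auto
  have "retract (E 0) X0"
    by (rule envelope_retract[OF env0 lmA fgX(1) mono_Hom[OF i] i]) (use X in simp)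
  then have P0: "PI (E 0)" by (rule PI_retract[OF _ X(1) lm])
  obtain h where h: "h \<in> Hom (E 0) X0" "\<And>x. x \<in> carrier ?A \<Longrightarrow> h (j x) = i x"
    using inj_extend[OF PI_simps(2)[OF X(1)] fgA fgE j mono_Hom[OF i]] by metis
  obtain g where g: "g \<in> Hom X0 (E 0)" "\<And>x. x \<in> carrier ?A \<Longrightarrow> g (i x) = j x"
    using inj_extend[OF E fgA fgX(1) i mono_Hom[OF j]] by metis
  \<comment> \<open>The kernel of this map is exactly the image of \<Lambda>: if both components
    vanish then \<open>h x = i a\<close> for some \<open>a\<close>, and
    \<open>x = g (h x) = g (i a) = j a\<close>. So it induces an embedding of the image of
    \<open>d 0\<close>.\<close>
  let ?f = "\<lambda>x. (x \<ominus>\<^bsub>E 0\<^esub> g (h x), c (h x))"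
  have f: "?f \<in> Hom (E 0) (E 0 \<uplus> X1)"
    by (intro Hom_pair Hom_diff Hom_id Hom_comp[OF h(1) g(1)] Hom_comp[OF h(1) c(1)] lm)
  have kf: "?f x = \<zero>\<^bsub>E 0 \<uplus> X1\<^esub> \<longleftrightarrow> d 0 x = \<zero>\<^bsub>E 1\<^esub>" if x: "x \<in> carrier (E 0)" for x
  proof -
    have "d 0 x = \<zero>\<^bsub>E 1\<^esub> \<longleftrightarrow> x \<in> j ` carrier ?A" using x k0 by (simp add: ker_iff)
    also have "\<dots> \<longleftrightarrow> ?f x = \<zero>\<^bsub>E 0 \<uplus> X1\<^esub>"
    proof
      assume "x \<in> j ` carrier ?A"
      then obtain a where a: "a \<in> carrier ?A" "x = j a" by blast
      then have "i a \<in> a_kernel X0 X1 c" using c(2) by blast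
      then show "?f x = \<zero>\<^bsub>E 0 \<uplus> X1\<^esub>" using a h(2) g(2) x lm by (simp add: ker_iff)
    next
      assume 0: "?f x = \<zero>\<^bsub>E 0 \<uplus> X1\<^esub>"
      then have "h x \<in> i ` carrier ?A" using c(2) Hom_closed[OF h(1) x] by (simp add: ker_iff)
      then obtain a where a: "a \<in> carrier ?A" "h x = i a" by blast
      moreover have "x = g (h x)" using 0 x lm_eq_minus[OF lm x Hom_closed[OF g(1) Hom_closed[OF h(1) x]]] by simp
      ultimately show "x \<in> j ` carrier ?A" using g(2) by auto
    qed
    finally show ?thesis ..
  qed
  let ?D = "sub (E 1) (d 0 ` carrier (E 0))"
  have smD: "sm (d 0 ` carrier (E 0)) (E 1)" by (rule sm_img[OF d0 lm lm])
  have lmD: "lm ?D" by (rule lm_sub[OF lm smD])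
  have epiD: "mod_epi R (E 0) ?D (d 0)" unfolding mod_epi_def using Hom_sub_to[OF d0] by auto
  have lmX: "lm (E 0 \<uplus> X1)" by (intro lm_ds2 lm fgX)
  obtain u where u: "u \<in> Hom ?D (E 0 \<uplus> X1)" "\<And>x. x \<in> carrier (E 0) \<Longrightarrow> u (d 0 x) = ?f x"
    by (rule factor_epi[OF epiD f lm lmD lmX]) (use kf in auto)
  have um: "mod_mono R ?D (E 0 \<uplus> X1) u"
    by (rule ker_zero_mono[OF u(1) lmD lmX]) (use u(2) kf in auto)
  have "mod_mono R ?D (E 1) (\<lambda>x. x)"
    using Hom_sub[OF lm smD] by (simp add: mod_mono_def)
  then have env1: "injective_envelope R ?D (\<lambda>x. x) (E 1)" using E ess(2) by (simp add: injective_envelope_def)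
  have PX: "PI (E 0 \<uplus> X1)" by (rule PI_ds2[OF P0 X(2)])
  have "retract (E 1) (E 0 \<uplus> X1)"
    by (rule envelope_retract[OF env1 lmD _ u(1) um]) (use PX in auto)
  then have "PI (E 1)" by (rule PI_retract[OF _ PX lm])
  then have "\<forall>i<2. proj (E i)" using P0 by (auto simp: less_2_cases_iff)
  then have "enat 2 \<le> domdim R" unfolding domdim_def using r by (intro Sup_upper) blast
  then show "domdim R \<ge> 2" by (simp add: numeral_eq_enat)
qed

end

section \<open>Projective-injective presentations\<close>

context artin_inj
begin

text \<open>The classes generated and cogenerated by projective-injective modules, without reference
  to representatives; \<open>Gen_iff\<close> and \<open>Cogen_iff\<close> identify them with those
  of \<open>Q\<close>.\<close>

definition genPI :: "('a, 'm) module \<Rightarrow> bool" where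
  "genPI N \<longleftrightarrow> fg N \<and> (\<exists>(Y :: 'a fgmod) q. PI Y \<and> mod_epi R Y N q)"

definition cogenPI :: "('a, 'm) module \<Rightarrow> bool" where
  "cogenPI N \<longleftrightarrow> fg N \<and> (\<exists>(Y :: 'a fgmod) m. PI Y \<and> mod_mono R N Y m)"

lemma genPI_fg: "genPI N \<Longrightarrow> fg N" and cogenPI_fg: "cogenPI N \<Longrightarrow> fg N"
  by (auto simp: genPI_def cogenPI_def)

lemma genPI_E:
  assumes "genPI N" obtains Y :: "'a fgmod" and q where "PI Y" "mod_epi R Y N q"
  using assms unfolding genPI_def by blast

lemma cogenPI_E:
  assumes "cogenPI N" obtains Y :: "'a fgmod" and m where "PI Y" "mod_mono R N Y m"
  using assms unfolding cogenPI_def by blast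

lemma miso_epi_mono:
  assumes "M \<simeq> N"
  obtains f where "mod_epi R M N f" "mod_mono R M N f"
  using assms by (auto simp: mod_iso_def mod_mono_def mod_epi_def bij_betw_def)

lemma genPI_I: assumes "PI Y" "mod_epi R Y N q" "lm N" shows "genPI N"
proof -
  obtain Y' :: "'a fgmod" where Y': "PI Y'" "Y' \<simeq> Y" by (rule PI_copy[OF assms(1)])
  obtain f where f: "mod_epi R Y' Y f" using miso_epi_mono[OF Y'(2)] by metis
  have "fg N" by (rule fg_epi[OF proj_fg[OF PI_simps(1)[OF assms(1)]] assms(2,3)])
  then show ?thesis unfolding genPI_def using Y'(1) epi_comp[OF f assms(2)] by blast
qed

lemma cogenPI_I: assumes "PI Y" "mod_mono R N Y m" "lm N" shows "cogenPI N"
proof -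
  obtain Y' :: "'a fgmod" where Y': "PI Y'" "Y \<simeq> Y'" by (rule PI_copy[OF assms(1)])
  obtain f where f: "mod_mono R Y Y' f" using miso_epi_mono[OF Y'(2)] by metis
  have "fg N" by (rule fg_mono[OF assms(2,3) proj_fg[OF PI_simps(1)[OF assms(1)]]])
  then show ?thesis unfolding cogenPI_def using Y'(1) mono_comp[OF assms(2) f] by blast
qed

lemma PI_genPI: "PI Y \<Longrightarrow> genPI Y" and PI_cogenPI: "PI Y \<Longrightarrow> cogenPI Y"
  by (auto intro!: genPI_I[of Y Y "\<lambda>x. x"] cogenPI_I[of Y Y "\<lambda>x. x"] simp: mod_epi_def mod_mono_def Hom_id)

lemma genPI_epi: assumes "genPI M" "mod_epi R M N f" "lm N" shows "genPI N"
proof -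
  obtain Y :: "'a fgmod" and q where "PI Y" "mod_epi R Y M q" by (rule genPI_E[OF assms(1)])
  then show ?thesis using genPI_I[OF _ epi_comp[OF _ assms(2)] assms(3)] by blast
qed

lemma cogenPI_mono: assumes "cogenPI M" "mod_mono R N M f" "lm N" shows "cogenPI N"
proof -
  obtain Y :: "'a fgmod" and q where "PI Y" "mod_mono R M Y q" by (rule cogenPI_E[OF assms(1)])
  then show ?thesis using cogenPI_I[OF _ mono_comp[OF assms(2)] assms(3)] by blast
qed

lemma split_epi:
  assumes "i \<in> Hom X M" "p \<in> Hom M X" "\<And>x. x \<in> carrier X \<Longrightarrow> p (i x) = x"
  shows "mod_epi R M X p"
proof -
  have "carrier X \<subseteq> p ` carrier M"
  proof
    fix x assume "x \<in> carrier X"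
    then show "x \<in> p ` carrier M" using assms(3)[of x, symmetric] Hom_closed[OF assms(1)] by blast
  qed
  then show ?thesis unfolding mod_epi_def using assms(2) Hom_closed[OF assms(2)] by blast
qed

lemma retract_epi_mono:
  assumes "retract X M"
  obtains i p where "mod_mono R X M i" "mod_epi R M X p"
proof -
  obtain i p where ip: "i \<in> Hom X M" "p \<in> Hom M X" "\<And>x. x \<in> carrier X \<Longrightarrow> p (i x) = x"
    using retractE[OF assms] by metis
  show ?thesis by (rule that[OF split_mono[OF ip(1,3)] split_epi[OF ip]])
qed

lemma genPI_retract: "\<lbrakk>retract X M; genPI M; lm X\<rbrakk> \<Longrightarrow> genPI X"
  by (erule retract_epi_mono) (rule genPI_epi)

lemma cogenPI_retract: "\<lbrakk>retract X M; cogenPI M; lm X\<rbrakk> \<Longrightarrow> cogenPI X"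
  by (erule retract_epi_mono) (rule cogenPI_mono)

lemma epi_ds2: assumes "mod_epi R M M' f" "mod_epi R N N' g" shows "mod_epi R (M \<uplus> N) (M' \<uplus> N') (\<lambda>x. (f (fst x), g (snd x)))"
proof -
  have "(\<lambda>x. (f (fst x), g (snd x))) ` (S \<times> T) = f ` S \<times> g ` T" for S T by force
  then show ?thesis using epi_simps[OF assms(1)] epi_simps[OF assms(2)] by (simp add: mod_epi_def Hom_map)
qed

lemma mono_ds2: assumes "mod_mono R M M' f" "mod_mono R N N' g" shows "mod_mono R (M \<uplus> N) (M' \<uplus> N') (\<lambda>x. (f (fst x), g (snd x)))"
  using Hom_map[OF mono_Hom[OF assms(1)] mono_Hom[OF assms(2)]] mono_eq[OF assms(1)] mono_eq[OF assms(2)]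
  unfolding mod_mono_def inj_on_def by (metis ds2_simps(1) fst_conv snd_conv prod.collapse mem_Times_iff)

lemma genPI_ds2: assumes "genPI M" "genPI N" shows "genPI (M \<uplus> N)"
proof -
  obtain Y :: "'a fgmod" and q where 1: "PI Y" "mod_epi R Y M q" by (rule genPI_E[OF assms(1)])
  obtain Y' :: "'a fgmod" and q' where 2: "PI Y'" "mod_epi R Y' N q'" by (rule genPI_E[OF assms(2)])
  show ?thesis
    by (rule genPI_I[OF PI_ds2[OF 1(1) 2(1)] epi_ds2[OF 1(2) 2(2)]]) (intro lm_ds2 fg_lm genPI_fg assms)
qed

lemma cogenPI_ds2: assumes "cogenPI M" "cogenPI N" shows "cogenPI (M \<uplus> N)"
proof -
  obtain Y :: "'a fgmod" and q where 1: "PI Y" "mod_mono R M Y q" by (rule cogenPI_E[OF assms(1)])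
  obtain Y' :: "'a fgmod" and q' where 2: "PI Y'" "mod_mono R N Y' q'" by (rule cogenPI_E[OF assms(2)])
  show ?thesis
    by (rule cogenPI_I[OF PI_ds2[OF 1(1) 2(1)] mono_ds2[OF 1(2) 2(2)]]) (intro lm_ds2 fg_lm cogenPI_fg assms)
qed

lemma lm_power: "lm X \<Longrightarrow> lm (direct_power n X)"
  unfolding direct_power_def by (rule lm_ds) (auto simp: ring_R)

lemma power_0_carrier: "carrier (direct_power 0 X) = {\<zero>\<^bsub>direct_power 0 X\<^esub>}"
  by (simp add: direct_power_def ds_empty[simplified])

lemma PI_power: "PI X \<Longrightarrow> PI (direct_power n X)"
  by (intro PI_I proj_power inj_power ring_R) simp_all

lemma genPI_power: assumes "genPI X" shows "genPI (direct_power n X)"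
proof -
  have lm: "lm X" using genPI_fg[OF assms] by simp
  show ?thesis
  proof (induction n)
    case 0
    show ?case by (rule PI_genPI[OF PI_zero[OF lm_power[OF lm] power_0_carrier]])
  next
    case (Suc n)
    show ?case
      by (rule genPI_retract[OF miso_retract[OF direct_power_Suc lm_power[OF lm]] genPI_ds2[OF assms Suc] lm_power[OF lm]])
  qed
qed

lemma cogenPI_power: assumes "cogenPI X" shows "cogenPI (direct_power n X)"
proof -
  have lm: "lm X" using cogenPI_fg[OF assms] by simp
  show ?thesis
  proof (induction n)
    case 0
    show ?case by (rule PI_cogenPI[OF PI_zero[OF lm_power[OF lm] power_0_carrier]])
  next
    case (Suc n)
    show ?case
      by (rule cogenPI_retract[OF miso_retract[OF direct_power_Suc lm_power[OF lm]] cogenPI_ds2[OF assms Suc] lm_power[OF lm]])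
  qed
qed

subsection \<open>Copresentations of projectives and presentations of injectives\<close>

lemma miso_image_kernel:
  assumes "f \<in> Hom E E'" "f' \<in> Hom E' E" "\<And>x. x \<in> carrier E \<Longrightarrow> f' (f x) = x" "\<And>x. x \<in> carrier E' \<Longrightarrow> f (f' x) = x"
  shows "f ` a_kernel E L d = a_kernel E' L (\<lambda>x. d (f' x))"
proof (intro subset_antisym subsetI)
  fix y assume "y \<in> f ` a_kernel E L d"
  then obtain x where "x \<in> carrier E" "d x = \<zero>\<^bsub>L\<^esub>" "y = f x" by (auto simp: ker_iff)
  then show "y \<in> a_kernel E' L (\<lambda>x. d (f' x))"
    using assms(3) Hom_closed[OF assms(1)] by (simp add: ker_iff)
next
  fix y assume "y \<in> a_kernel E' L (\<lambda>x. d (f' x))"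
  then show "y \<in> f ` a_kernel E L d"
    using assms(4) Hom_closed[OF assms(2)] by (intro image_eqI[of _ _ "f' y"]) (simp_all add: ker_iff)
qed

text \<open>Frees \<open>ker_PI\<close> from the type in its definition: conjugating
  \<open>d\<close> with isomorphisms to copies keeps exactness. \<open>coker_PI_I\<close> is the
  same for cokernels.\<close>

lemma ker_PI_I:
  assumes "PI E0" "PI E1" "mod_mono R F E0 j" "d \<in> Hom E0 E1" "j ` carrier F = a_kernel E0 E1 d"
  shows "ker_PI F"
proof -
  have lm: "lm E0" "lm E1" using assms by auto
  obtain E0' :: "'a fgmod" where E0': "PI E0'" "E0 \<simeq> E0'" by (rule PI_copy[OF assms(1)])
  obtain E1' :: "'a fgmod" where E1': "PI E1'" "E1 \<simeq> E1'" by (rule PI_copy[OF assms(2)])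
  obtain f f' where f: "f \<in> Hom E0 E0'" "f' \<in> Hom E0' E0" "\<And>x. x \<in> carrier E0 \<Longrightarrow> f' (f x) = x" "\<And>x. x \<in> carrier E0' \<Longrightarrow> f (f' x) = x"
    by (rule misoE[OF E0'(2) lm(1)]) blast
  obtain g where g: "mod_mono R E1 E1' g" using miso_epi_mono[OF E1'(2)] by metis
  have lm': "lm E0'" "lm E1'" using E0' E1' by auto
  have "a_kernel E0' E1' (\<lambda>x. g (d (f' x))) = a_kernel E0' E1 (\<lambda>x. d (f' x))"
    by (rule kernel_comp_mono[OF g Hom_comp[OF f(2) assms(4)] lm(2) lm'(2)])
  also have "\<dots> = f ` a_kernel E0 E1 d" by (rule miso_image_kernel[OF f, symmetric])
  finally have "(\<lambda>x. f (j x)) ` carrier F = a_kernel E0' E1' (\<lambda>x. g (d (f' x)))"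
    by (simp add: assms(5)[symmetric] image_image)
  then show ?thesis unfolding ker_PI_def
    using E0'(1) E1'(1) mono_comp[OF assms(3) split_mono[OF f(1,3)]] Hom_comp[OF Hom_comp[OF f(2) assms(4)] mono_Hom[OF g]]
    by blast
qed

lemma coker_PI_I:
  assumes "PI P0" "PI P1" "mod_epi R P0 I p" "d \<in> Hom P1 P0" "d ` carrier P1 = a_kernel P0 I p"
  shows "coker_PI I"
proof -
  have lm: "lm P0" "lm P1" using assms by auto
  obtain P0' :: "'a fgmod" where P0': "PI P0'" "P0 \<simeq> P0'" by (rule PI_copy[OF assms(1)])
  obtain P1' :: "'a fgmod" where P1': "PI P1'" "P1' \<simeq> P1" by (rule PI_copy[OF assms(2)])
  obtain f f' where f: "f \<in> Hom P0 P0'" "f' \<in> Hom P0' P0" "\<And>x. x \<in> carrier P0 \<Longrightarrow> f' (f x) = x" "\<And>x. x \<in> carrier P0' \<Longrightarrow> f (f' x) = x"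
    by (rule misoE[OF P0'(2) lm(1)]) blast
  obtain g where g: "mod_epi R P1' P1 g" using miso_epi_mono[OF P1'(2)] by metis
  have "(\<lambda>x. f (d (g x))) ` carrier P1' = f ` a_kernel P0 I p"
    using epi_simps(2)[OF g] by (simp add: assms(5)[symmetric] image_image[symmetric, of f "\<lambda>x. d (g x)"] image_image[symmetric, of d g])
  also have "\<dots> = a_kernel P0' I (\<lambda>x. p (f' x))" by (rule miso_image_kernel[OF f])
  finally have *: "(\<lambda>x. f (d (g x))) ` carrier P1' = a_kernel P0' I (\<lambda>x. p (f' x))" .
  have i: "mod_epi R P0' P0 f'" by (rule split_epi[OF f(1-3)])
  show ?thesis unfolding coker_PI_def
    using P0'(1) P1'(1) epi_comp[OF i assms(3)] Hom_comp[OF Hom_comp[OF epi_simps(1)[OF g] assms(4)] f(1)] *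
    by blast
qed

lemma ker_PI_ds2: assumes "ker_PI M" "ker_PI N" shows "ker_PI (M \<uplus> N)"
proof -
  obtain E0 E1 :: "'a fgmod" and j d where 1: "PI E0" "PI E1" "mod_mono R M E0 j" "d \<in> Hom E0 E1"
    "j ` carrier M = a_kernel E0 E1 d" by (rule ker_PI_E[OF assms(1)])
  obtain E0' E1' :: "'a fgmod" and j' d' where 2: "PI E0'" "PI E1'" "mod_mono R N E0' j'" "d' \<in> Hom E0' E1'"
    "j' ` carrier N = a_kernel E0' E1' d'" by (rule ker_PI_E[OF assms(2)])
  have "(\<lambda>x. (j (fst x), j' (snd x))) ` (S \<times> T) = j ` S \<times> j' ` T" for S T by force
  then show ?thesis
    by (intro ker_PI_I[OF PI_ds2[OF 1(1) 2(1)] PI_ds2[OF 1(2) 2(2)] mono_ds2[OF 1(3) 2(3)] Hom_map[OF 1(4) 2(4)]])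
      (auto simp: 1(5) 2(5) a_kernel_def kernel_def)
qed

lemma coker_PI_ds2: assumes "coker_PI M" "coker_PI N" shows "coker_PI (M \<uplus> N)"
proof -
  obtain P0 P1 :: "'a fgmod" and p d where 1: "PI P0" "PI P1" "mod_epi R P0 M p" "d \<in> Hom P1 P0"
    "d ` carrier P1 = a_kernel P0 M p" by (rule coker_PI_E[OF assms(1)])
  obtain P0' P1' :: "'a fgmod" and p' d' where 2: "PI P0'" "PI P1'" "mod_epi R P0' N p'" "d' \<in> Hom P1' P0'"
    "d' ` carrier P1' = a_kernel P0' N p'" by (rule coker_PI_E[OF assms(2)])
  have "(\<lambda>x. (d (fst x), d' (snd x))) ` (S \<times> T) = d ` S \<times> d' ` T" for S T by force
  then show ?thesis
    by (intro coker_PI_I[OF PI_ds2[OF 1(1) 2(1)] PI_ds2[OF 1(2) 2(2)] epi_ds2[OF 1(3) 2(3)] Hom_map[OF 1(4) 2(4)]])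
      (auto simp: 1(5) 2(5) a_kernel_def kernel_def)
qed

text \<open>The idempotent \<open>a b\<close> of \<open>F'\<close> extends to \<open>g\<close> on
  \<open>E0\<close>. Within \<open>F'\<close> the elements fixed by \<open>g\<close> are those
  coming from \<open>F\<close>, so adjoining \<open>1 - g\<close> to the differential cuts its
  kernel down to \<open>F\<close>.\<close>

lemma ker_PI_retract:
  assumes r: "retract F F'" and F': "ker_PI F'" "fg F'" and F: "lm F"
  shows "ker_PI F"
proof -
  obtain a b where ab: "a \<in> Hom F F'" "b \<in> Hom F' F" "\<And>x. x \<in> carrier F \<Longrightarrow> b (a x) = x"
    by (rule retractE[OF r]) blast
  obtain E0 E1 :: "'a fgmod" and j d where E: "PI E0" "PI E1" and j: "mod_mono R F' E0 j" and d: "d \<in> Hom E0 E1"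
    "j ` carrier F' = a_kernel E0 E1 d" by (rule ker_PI_E[OF F'(1)])
  have lm: "lm E0" "lm E1" "fg E0" "lm F'" using E F' by auto
  note jh = mono_Hom[OF j]
  obtain g where g: "g \<in> Hom E0 E0" "\<And>x. x \<in> carrier F' \<Longrightarrow> g (j x) = j (a (b x))"
    by (rule inj_extend[OF PI_simps(2)[OF E(1)] F'(2) lm(3) j Hom_comp[OF Hom_comp[OF ab(2,1)] jh]]) blast
  let ?d = "\<lambda>x. (x \<ominus>\<^bsub>E0\<^esub> g x, d x)"
  have dh: "?d \<in> Hom E0 (E0 \<uplus> E1)" by (intro Hom_pair Hom_diff Hom_id g(1) d(1) lm)
  have "(\<lambda>x. j (a x)) ` carrier F = a_kernel E0 (E0 \<uplus> E1) ?d"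
  proof (intro subset_antisym subsetI)
    fix y assume "y \<in> (\<lambda>x. j (a x)) ` carrier F"
    then obtain x where x: "x \<in> carrier F" "y = j (a x)" by blast
    have ax: "a x \<in> carrier F'" by (rule Hom_closed[OF ab(1) x(1)])
    have "j (a x) \<in> a_kernel E0 E1 d" using d(2) ax by blast
    then show "y \<in> a_kernel E0 (E0 \<uplus> E1) ?d"
      using x g(2)[OF ax] ab(3)[OF x(1)] lm by (simp add: ker_iff)
  next
    fix y assume y: "y \<in> a_kernel E0 (E0 \<uplus> E1) ?d"
    then have yc: "y \<in> carrier E0" and "d y = \<zero>\<^bsub>E1\<^esub>" and yg: "y \<ominus>\<^bsub>E0\<^esub> g y = \<zero>\<^bsub>E0\<^esub>" by (simp_all add: ker_iff)
    then have "y \<in> j ` carrier F'" using d(2) by (simp add: ker_iff)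
    then obtain z where z: "z \<in> carrier F'" "y = j z" by blast
    have "y = g y" using yg lm_eq_minus[OF lm(1) yc Hom_closed[OF g(1) yc]] by simp
    then have "y = j (a (b z))" using z g(2) by simp
    then show "y \<in> (\<lambda>x. j (a x)) ` carrier F" using Hom_closed[OF ab(2) z(1)] by blast
  qed
  from ker_PI_I[OF E(1) PI_ds2[OF E] mono_comp[OF split_mono[OF ab(1,3)] j] dh this] show ?thesis .
qed

text \<open>Here the idempotent lifts to \<open>g\<close> on \<open>P0\<close>, and the image of
  \<open>1 - g\<close> is added to the relations. If \<open>b (p x) = 0\<close> then
  \<open>p (g x) = 0\<close>, so \<open>x = (x - g x) + g x\<close> is a sum of a new relation and
  an old one.\<close>

lemma coker_PI_retract:
  assumes r: "retract I I'" and I': "coker_PI I'" "fg I'" and I: "lm I"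
  shows "coker_PI I"
proof -
  obtain a b where ab: "a \<in> Hom I I'" "b \<in> Hom I' I" "\<And>x. x \<in> carrier I \<Longrightarrow> b (a x) = x"
    by (rule retractE[OF r]) blast
  obtain P0 P1 :: "'a fgmod" and p d where P: "PI P0" "PI P1" and p: "mod_epi R P0 I' p" and d: "d \<in> Hom P1 P0"
    "d ` carrier P1 = a_kernel P0 I' p" by (rule coker_PI_E[OF I'(1)])
  have lm: "lm P0" "lm P1" "fg P0" "lm I'" using P I' by auto
  note ph = epi_simps(1)[OF p]
  obtain g where g: "g \<in> Hom P0 P0" "\<And>x. x \<in> carrier P0 \<Longrightarrow> p (g x) = a (b (p x))"
    by (rule proj_lift[OF PI_simps(1)[OF P(1)] lm(3) I'(2) p Hom_comp[OF ph Hom_comp[OF ab(2,1)]]]) blast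
  have be: "mod_epi R I' I b" by (rule split_epi[OF ab])
  let ?d = "\<lambda>x. (fst x \<ominus>\<^bsub>P0\<^esub> g (fst x)) \<oplus>\<^bsub>P0\<^esub> d (snd x)"
  have dh: "?d \<in> Hom (P0 \<uplus> P1) P0" by (rule Hom_copair[OF Hom_diff[OF Hom_id g(1)] d(1)]) (rule lm)+
  have "?d ` carrier (P0 \<uplus> P1) = a_kernel P0 I (\<lambda>x. b (p x))"
  proof (intro subset_antisym subsetI)
    fix y assume "y \<in> ?d ` carrier (P0 \<uplus> P1)"
    then obtain x z where xz: "x \<in> carrier P0" "z \<in> carrier P1" "y = (x \<ominus>\<^bsub>P0\<^esub> g x) \<oplus>\<^bsub>P0\<^esub> d z" by auto
    have gx: "g x \<in> carrier P0" and dz: "d z \<in> carrier P0" using Hom_closed[OF g(1) xz(1)] Hom_closed[OF d(1) xz(2)] .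
    have "d z \<in> a_kernel P0 I' p" using xz d(2) by blast
    then have pd: "p (d z) = \<zero>\<^bsub>I'\<^esub>" by (simp add: ker_iff)
    have bp: "b (p x) \<in> carrier I" by (rule Hom_closed[OF ab(2) Hom_closed[OF ph xz(1)]])
    have "b (p y) = (b (p x) \<ominus>\<^bsub>I\<^esub> b (p (g x))) \<oplus>\<^bsub>I\<^esub> b (p (d z))"
      using xz gx dz lm I by (simp add: Hom_simps(2)[OF Hom_comp[OF ph ab(2)]] Hom_minus[OF Hom_comp[OF ph ab(2)]])
    also have "\<dots> = \<zero>\<^bsub>I\<^esub>"
      using pd Hom_zero[OF ab(2) lm(4) I] g(2)[OF xz(1)] ab(3)[OF bp] bp I by simp
    finally show "y \<in> a_kernel P0 I (\<lambda>x. b (p x))" using xz gx dz lm by (simp add: ker_iff)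
  next
    fix x assume x: "x \<in> a_kernel P0 I (\<lambda>x. b (p x))"
    then have xc: "x \<in> carrier P0" and 0: "b (p x) = \<zero>\<^bsub>I\<^esub>" by (simp_all add: ker_iff)
    have "p (g x) = \<zero>\<^bsub>I'\<^esub>" using g(2)[OF xc] 0 Hom_zero[OF ab(1) I lm(4)] by simp
    then have "g x \<in> d ` carrier P1" using d(2) Hom_closed[OF g(1) xc] by (simp add: ker_iff)
    then obtain z where z: "z \<in> carrier P1" "g x = d z" by blast
    then have "x = ?d (x, z)" using xc lm Hom_closed[OF g(1) xc] by (simp flip: z(2))
    then show "x \<in> ?d ` carrier (P0 \<uplus> P1)" using xc z(1) by (intro image_eqI[of _ _ "(x, z)"]) auto
  qed
  then show ?thesis by (rule coker_PI_I[OF P(1) PI_ds2[OF P] epi_comp[OF p be] dh])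
qed

lemma ker_PI_PI: assumes "PI Y" shows "ker_PI Y"
proof (rule ker_PI_I[OF assms assms])
  show "(\<lambda>_. \<zero>\<^bsub>Y\<^esub>) \<in> Hom Y Y" using assms by (intro Hom_const_zero) simp
qed (auto simp: mod_mono_def Hom_id ker_iff)

lemma coker_PI_PI: assumes "PI Y" shows "coker_PI Y"
proof (rule coker_PI_I[OF assms assms])
  have lm: "lm Y" using assms by simp
  show "(\<lambda>_. \<zero>\<^bsub>Y\<^esub>) \<in> Hom Y Y" by (rule Hom_const_zero[OF lm])
  show "(\<lambda>_. \<zero>\<^bsub>Y\<^esub>) ` carrier Y = a_kernel Y Y (\<lambda>x. x)"
    using lm_zero[OF lm] by (force simp: a_kernel_def kernel_def)
qed (auto simp: mod_epi_def Hom_id)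

lemma ker_PI_power: assumes "ker_PI X" "fg X" shows "ker_PI (direct_power n X)"
proof (induction n)
  case 0
  show ?case by (rule ker_PI_PI[OF PI_zero[OF lm_power power_0_carrier]]) (use assms in simp)
next
  case (Suc n)
  have lm: "lm X" using assms(2) by simp
  show ?case
    by (rule ker_PI_retract[OF miso_retract[OF direct_power_Suc lm_power[OF lm]] ker_PI_ds2[OF assms(1) Suc]
      fg_ds2[OF assms(2) fg_power[OF ring_R assms(2)]] lm_power[OF lm]])
qed

lemma coker_PI_power: assumes "coker_PI X" "fg X" shows "coker_PI (direct_power n X)"
proof (induction n)
  case 0
  show ?case by (rule coker_PI_PI[OF PI_zero[OF lm_power power_0_carrier]]) (use assms in simp)
next
  case (Suc n)
  have lm: "lm X" using assms(2) by simp
  show ?case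
    by (rule coker_PI_retract[OF miso_retract[OF direct_power_Suc lm_power[OF lm]] coker_PI_ds2[OF assms(1) Suc]
      fg_ds2[OF assms(2) fg_power[OF ring_R assms(2)]] lm_power[OF lm]])
qed

lemma proj_retract_free: assumes "proj P" shows "\<exists>n. retract P (direct_power n (regular_module R))"
proof -
  obtain n f where f: "mod_epi R (direct_power n (regular_module R)) P f" by (rule free_epi[OF proj_fg[OF assms]])
  then show ?thesis using proj_epi_retract[OF assms fg_power[OF ring_R fg_regular[OF ring_R]] f] by blast
qed

lemma inj_retract_cofree: assumes "inj I" shows "\<exists>n. retract I (direct_power n H)"
proof -
  obtain N :: "'a fgmod" where N: "fg N" "I \<simeq> N" by (rule fg_copy[OF inj_fg[OF assms]])
  obtain n j where j: "mod_mono R N (direct_power n H) j" using cogen_H[OF N(1)] by blast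
  obtain i where i: "mod_mono R I N i" using miso_epi_mono[OF N(2)] by metis
  show ?thesis using inj_mono_retract[OF assms fg_power[OF ring_R inj_fg[OF inj_H]] mono_comp[OF i j]] by blast
qed

lemma ker_PI_proj: assumes "ker_PI (regular_module R)" "proj P" shows "ker_PI P"
proof -
  obtain n where "retract P (direct_power n (regular_module R))" using proj_retract_free[OF assms(2)] by blast
  then show ?thesis
    by (rule ker_PI_retract[OF _ ker_PI_power[OF assms(1) fg_regular[OF ring_R]] fg_power[OF ring_R fg_regular[OF ring_R]]
      fg_lm[OF proj_fg[OF assms(2)]]])
qed

lemma coker_PI_inj: assumes "coker_PI H" "inj I" shows "coker_PI I"
proof -
  obtain n where "retract I (direct_power n H)" using inj_retract_cofree[OF assms(2)] by blast
  then show ?thesis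
    by (rule coker_PI_retract[OF _ coker_PI_power[OF assms(1) inj_fg[OF inj_H]] fg_power[OF ring_R inj_fg[OF inj_H]]
      fg_lm[OF inj_fg[OF assms(2)]]])
qed

text \<open>A map from a projective module onto \<open>I\<close> extends from that module to a
  projective-injective \<open>E0\<close>, and the extension \<open>q\<close> is still onto. A
  projective \<open>F'\<close> covering the kernel of \<open>q\<close> embeds into \<open>X0\<close>
  as the kernel of \<open>c\<close>, and its map to \<open>E0\<close> extends to \<open>g\<close> on
  \<open>X0\<close>. The obstacle is that \<open>g\<close> need not land in the kernel of
  \<open>q\<close>.\<close>

lemma coker_PI_of_ker_PI:
  assumes k: "\<And>F :: 'a fgmod. proj F \<Longrightarrow> ker_PI F" and I: "inj I"
  shows "coker_PI I"
proof -
  have fgI: "fg I" and lmI: "lm I" using I by auto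
  obtain F :: "'a fgmod" and p where F: "proj F" "mod_epi R F I p" by (rule proj_cover_free[OF fgI])
  obtain E0 E1 :: "'a fgmod" and j d where E: "PI E0" and j: "mod_mono R F E0 j"
    by (rule ker_PI_E[OF k[OF F(1)]])
  have fgF: "fg F" and fgE: "fg E0" and lmE: "lm E0" using F E by auto
  obtain q where q: "q \<in> Hom E0 I" "\<And>x. x \<in> carrier F \<Longrightarrow> q (j x) = p x"
    by (rule inj_extend[OF I fgF fgE j epi_simps(1)[OF F(2)]]) blast
  have qe: "mod_epi R E0 I q"
  proof -
    have "carrier I \<subseteq> q ` carrier E0"
      unfolding epi_simps(2)[OF F(2), symmetric] using q(2) Hom_closed[OF mono_Hom[OF j]] by (metis image_eqI image_subsetI)
    then show ?thesis unfolding mod_epi_def using q(1) Hom_closed[OF q(1)] by blast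
  qed
  let ?N = "sub E0 (a_kernel E0 I q)"
  have smN: "sm (a_kernel E0 I q) E0" by (rule sm_ker[OF q(1) lmE lmI])
  obtain F' :: "'a fgmod" and e where F': "proj F'" "mod_epi R F' ?N e" by (rule proj_cover_free[OF fg_sub[OF fgE smN]])
  have fgF': "fg F'" using F' by simp
  have eh: "e \<in> Hom F' E0" using Hom_comp[OF epi_simps(1)[OF F'(2)] Hom_sub[OF lmE smN]] .
  obtain X0 X1 :: "'a fgmod" and j' c where X: "PI X0" "PI X1" and j': "mod_mono R F' X0 j'" and c: "c \<in> Hom X0 X1"
    "j' ` carrier F' = a_kernel X0 X1 c" by (rule ker_PI_E[OF k[OF F'(1)]])
  have fgX: "fg X0" "fg X1" "lm X0" "lm X1" using X by auto
  obtain g where g: "g \<in> Hom X0 E0" "\<And>x. x \<in> carrier F' \<Longrightarrow> g (j' x) = e x"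
    by (rule inj_extend[OF PI_simps(2)[OF E] fgF' fgX(1) j' eh]) blast
  let ?C = "sub X1 (c ` carrier X0)"
  have smC: "sm (c ` carrier X0) X1" by (rule sm_img[OF c(1) fgX(3,4)])
  have fgC: "fg ?C" and lmC: "lm ?C" using fg_sub[OF fgX(2) smC] by auto
  have ce: "mod_epi R X0 ?C c" unfolding mod_epi_def using Hom_sub_to[OF c(1)] by simp
  have ec: "q (e y) = \<zero>\<^bsub>I\<^esub>" if "y \<in> carrier F'" for y
    using Hom_closed[OF epi_simps(1)[OF F'(2)] that] by (simp add: ker_iff)
  \<comment> \<open>The defect \<open>q g\<close> vanishes on \<open>F'\<close>, so it factors
    through the image of \<open>c\<close>. Extended to \<open>X1\<close> by injectivity of
    \<open>I\<close> and lifted along \<open>q\<close> it becomes \<open>V\<close>. Then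
    \<open>g - V c\<close> lands in the kernel of \<open>q\<close>, and still covers it because
    \<open>c\<close> vanishes on \<open>F'\<close>.\<close>
  obtain u where u: "u \<in> Hom ?C I" "\<And>x. x \<in> carrier X0 \<Longrightarrow> u (c x) = q (g x)"
  proof (rule factor_epi[OF ce Hom_comp[OF g(1) q(1)] fgX(3) lmC lmI])
    fix x assume x: "x \<in> carrier X0" "c x = \<zero>\<^bsub>?C\<^esub>"
    then have "x \<in> a_kernel X0 X1 c" by (simp add: ker_iff)
    then obtain y where "y \<in> carrier F'" "x = j' y" unfolding c(2)[symmetric] by blast
    then show "q (g x) = \<zero>\<^bsub>I\<^esub>" using g(2) ec by simp
  qed blast
  have mC: "mod_mono R ?C X1 (\<lambda>x. x)" using Hom_sub[OF fgX(4) smC] by (simp add: mod_mono_def)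
  obtain U where U: "U \<in> Hom X1 I" "\<And>x. x \<in> carrier ?C \<Longrightarrow> U x = u x"
    by (rule inj_extend[OF I fgC fgX(2) mC u(1)]) blast
  obtain V where V: "V \<in> Hom X1 E0" "\<And>x. x \<in> carrier X1 \<Longrightarrow> q (V x) = U x"
    by (rule proj_lift[OF PI_simps(1)[OF X(2)] fgE fgI qe U(1)]) blast
  let ?d = "\<lambda>x. g x \<ominus>\<^bsub>E0\<^esub> V (c x)"
  have dh: "?d \<in> Hom X0 E0" by (intro Hom_diff Hom_comp[OF c(1) V(1)] g(1) lmE)
  have "?d ` carrier X0 = a_kernel E0 I q"
  proof (intro subset_antisym subsetI)
    fix y assume "y \<in> ?d ` carrier X0"
    then obtain x where x: "x \<in> carrier X0" "y = ?d x" by blast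
    have cc: "g x \<in> carrier E0" "c x \<in> carrier X1" "V (c x) \<in> carrier E0" "c x \<in> carrier ?C"
      using Hom_closed[OF g(1) x(1)] Hom_closed[OF c(1) x(1)] Hom_closed[OF V(1) Hom_closed[OF c(1) x(1)]] x(1) by auto
    have "q y = q (g x) \<ominus>\<^bsub>I\<^esub> q (V (c x))" using x cc by (simp add: Hom_minus[OF q(1) lmE lmI])
    also have "\<dots> = \<zero>\<^bsub>I\<^esub>" using V(2)[OF cc(2)] U(2)[OF cc(4)] u(2)[OF x(1)] Hom_closed[OF q(1) cc(1)] lmI by simp
    finally show "y \<in> a_kernel E0 I q" using x cc lmE by (simp add: ker_iff)
  next
    fix y assume "y \<in> a_kernel E0 I q"
    then have "y \<in> carrier ?N" by simp
    then have "y \<in> e ` carrier F'" unfolding epi_simps(2)[OF F'(2)] .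
    then obtain z where z: "z \<in> carrier F'" "y = e z" by blast
    have jz: "j' z \<in> carrier X0" by (rule Hom_closed[OF mono_Hom[OF j'] z(1)])
    have "j' z \<in> a_kernel X0 X1 c" using z(1) c(2) by blast
    then have "c (j' z) = \<zero>\<^bsub>X1\<^esub>" by (simp add: ker_iff)
    then have "y = ?d (j' z)"
      using z g(2)[OF z(1)] Hom_zero[OF V(1) fgX(4) lmE] Hom_closed[OF eh z(1)] lmE by simp
    then show "y \<in> ?d ` carrier X0" using jz by blast
  qed
  then show ?thesis by (rule coker_PI_I[OF E X(1) qe dh])
qed

text \<open>Lifting an embedding of \<open>F\<close> into an injective module embeds
  \<open>F\<close> into a projective-injective \<open>P0\<close>; the cokernel lies in an injective
  \<open>I'\<close>, presented by \<open>X1\<close> and \<open>X0\<close>. The lift \<open>g\<close>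
  of \<open>P0\<close> to \<open>X0\<close> maps \<open>F\<close> only into the image of
  \<open>d'\<close>. There it is \<open>d'\<close> after a map from \<open>F\<close> to
  \<open>X1\<close>; extending that map to \<open>V\<close> on \<open>P0\<close>, the difference
  \<open>g - d' V\<close> vanishes on \<open>F\<close>.\<close>

lemma ker_PI_of_coker_PI:
  assumes k: "\<And>I :: 'a fgmod. inj I \<Longrightarrow> coker_PI I" and F: "proj F"
  shows "ker_PI F"
proof -
  have fgF: "fg F" and lmF: "lm F" using F by auto
  obtain I :: "'a fgmod" and i where I: "inj I" "mod_mono R F I i" by (rule inj_hull[OF fgF])
  obtain P0 P1 :: "'a fgmod" and p d where P: "PI P0" and p: "mod_epi R P0 I p"
    by (rule coker_PI_E[OF k[OF I(1)]])
  have fgI: "fg I" and fgP: "fg P0" and lmP: "lm P0" and lmI: "lm I" using I P by auto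
  obtain \<kappa> where \<kappa>: "\<kappa> \<in> Hom F P0" "\<And>x. x \<in> carrier F \<Longrightarrow> p (\<kappa> x) = i x"
    by (rule proj_lift[OF F fgP fgI p mono_Hom[OF I(2)]]) blast
  have \<kappa>m: "mod_mono R F P0 \<kappa>"
    by (rule ker_zero_mono[OF \<kappa>(1) lmF lmP]) (metis \<kappa>(2) Hom_zero[OF epi_simps(1)[OF p] lmP lmI] mono_zero_iff[OF I(2) lmF lmI])
  obtain C :: "'a fgmod" and \<pi> where C: "fg C" "ses F \<kappa> P0 \<pi> C" by (rule ses_coker[OF \<kappa>m lmF fgP])
  note s = ses_simps[OF C(2)]
  obtain I' :: "'a fgmod" and m where I': "inj I'" "mod_mono R C I' m" by (rule inj_hull[OF C(1)])
  have fgI': "fg I'" and lmI': "lm I'" using I' by auto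
  obtain X0 X1 :: "'a fgmod" and p' d' where X: "PI X0" "PI X1" and p': "mod_epi R X0 I' p'" and d': "d' \<in> Hom X1 X0"
    "d' ` carrier X1 = a_kernel X0 I' p'" by (rule coker_PI_E[OF k[OF I'(1)]])
  have fgX: "fg X0" "fg X1" "lm X0" "lm X1" using X by auto
  note ph = epi_simps(1)[OF p']
  obtain g where g: "g \<in> Hom P0 X0" "\<And>x. x \<in> carrier P0 \<Longrightarrow> p' (g x) = m (\<pi> x)"
    by (rule proj_lift[OF PI_simps(1)[OF P] fgX(1) fgI' p' Hom_comp[OF s(5) mono_Hom[OF I'(2)]]]) blast
  let ?N = "sub X0 (a_kernel X0 I' p')"
  have smN: "sm (a_kernel X0 I' p') X0" by (rule sm_ker[OF ph fgX(3) lmI'])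
  have m0: "m \<zero>\<^bsub>C\<^esub> = \<zero>\<^bsub>I'\<^esub>" by (rule Hom_zero[OF mono_Hom[OF I'(2)] s(3) lmI'])
  have "(\<lambda>x. g (\<kappa> x)) ` carrier F \<subseteq> a_kernel X0 I' p'"
    using s(8) g Hom_closed[OF \<kappa>(1)] Hom_closed[OF g(1)] m0 by (auto simp: a_kernel_def kernel_def)
  then have gk: "(\<lambda>x. g (\<kappa> x)) \<in> Hom F ?N" by (rule Hom_sub_to[OF Hom_comp[OF \<kappa>(1) g(1)]])
  have de: "mod_epi R X1 ?N d'" unfolding mod_epi_def using d' Hom_sub_to[OF d'(1)] by simp
  obtain l where l: "l \<in> Hom F X1" "\<And>x. x \<in> carrier F \<Longrightarrow> d' (l x) = g (\<kappa> x)"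
    by (rule proj_lift[OF F fgX(2) fg_sub[OF fgX(1) smN] de gk]) blast
  obtain V where V: "V \<in> Hom P0 X1" "\<And>x. x \<in> carrier F \<Longrightarrow> V (\<kappa> x) = l x"
    by (rule inj_extend[OF PI_simps(2)[OF X(2)] fgF fgP \<kappa>m l(1)]) blast
  let ?d = "\<lambda>x. g x \<ominus>\<^bsub>X0\<^esub> d' (V x)"
  have dh: "?d \<in> Hom P0 X0" by (intro Hom_diff Hom_comp[OF V(1) d'(1)] g(1) fgX)
  have "\<kappa> ` carrier F = a_kernel P0 X0 ?d"
  proof (intro subset_antisym subsetI)
    fix y assume "y \<in> \<kappa> ` carrier F"
    then obtain x where x: "x \<in> carrier F" "y = \<kappa> x" by blast
    then show "y \<in> a_kernel P0 X0 ?d"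
      using V(2) l(2) Hom_closed[OF \<kappa>(1) x(1)] Hom_closed[OF g(1)] fgX(3) by (simp add: ker_iff)
  next
    fix y assume y: "y \<in> a_kernel P0 X0 ?d"
    then have yc: "y \<in> carrier P0" and 0: "?d y = \<zero>\<^bsub>X0\<^esub>" by (simp_all add: ker_iff)
    have cc: "g y \<in> carrier X0" "V y \<in> carrier X1" "d' (V y) \<in> carrier X0"
      using Hom_closed[OF g(1) yc] Hom_closed[OF V(1) yc] Hom_closed[OF d'(1) Hom_closed[OF V(1) yc]] .
    have "g y = d' (V y)" using 0 lm_eq_minus[OF fgX(3) cc(1,3)] by simp
    moreover have "d' (V y) \<in> a_kernel X0 I' p'" using cc(2) d'(2) by blast
    ultimately have "p' (g y) = \<zero>\<^bsub>I'\<^esub>" by (simp add: ker_iff)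
    then have "m (\<pi> y) = \<zero>\<^bsub>I'\<^esub>" using g(2)[OF yc] by simp
    then have "\<pi> y = \<zero>\<^bsub>C\<^esub>" using mono_zero_iff[OF I'(2) s(3) lmI' Hom_closed[OF s(5) yc]] by simp
    then show "y \<in> \<kappa> ` carrier F" by (rule s(9)[OF yc])
  qed
  then show ?thesis by (rule ker_PI_I[OF P X(1) \<kappa>m dh])
qed

lemma ker_PI_regular_iff: "ker_PI (regular_module R) \<longleftrightarrow> coker_PI H"
proof
  assume "ker_PI (regular_module R)"
  from ker_PI_proj[OF this] show "coker_PI H" by (rule coker_PI_of_ker_PI[OF _ inj_H])
next
  assume "coker_PI H"
  from coker_PI_inj[OF this] show "ker_PI (regular_module R)"
    by (rule ker_PI_of_coker_PI[OF _ proj_regular[OF ring_R]])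
qed

section \<open>Presentations from tilting and cotilting sequences, and their converses\<close>

text \<open>Since \<open>T0\<close> is a quotient of a projective-injective \<open>W\<close>, the
  map \<open>f\<close> lifts to \<open>W\<close> and then extends over \<open>Y\<close>, which
  contains \<open>T0\<close>. This gives \<open>h\<close> from \<open>Y\<close> to \<open>T0\<close>
  with \<open>h m f = f\<close>. If \<open>m (h y) = y\<close> and \<open>g (h y) = 0\<close>, then
  \<open>h y\<close> comes from \<open>A\<close>, and so does \<open>y\<close>.\<close>

lemma ker_PI_of_tilting:
  assumes A: "proj A" and s: "ses A f T0 g T1" and T: "genPI T0" "cogenPI T0" "cogenPI T1"
  shows "ker_PI A"
proof -
  note s = ses_simps[OF s]
  have fgA: "fg A" and fgT: "fg T0" using A genPI_fg[OF T(1)] by auto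
  obtain W :: "'a fgmod" and q where W: "PI W" "mod_epi R W T0 q" by (rule genPI_E[OF T(1)])
  obtain Y :: "'a fgmod" and m where Y: "PI Y" "mod_mono R T0 Y m" by (rule cogenPI_E[OF T(2)])
  obtain Y1 :: "'a fgmod" and m1 where Y1: "PI Y1" "mod_mono R T1 Y1 m1" by (rule cogenPI_E[OF T(3)])
  have fgs: "fg W" "fg Y" "fg Y1" "lm Y" "lm Y1" using W Y Y1 by auto
  have i: "mod_mono R A Y (\<lambda>x. m (f x))" by (rule mono_comp[OF s(6) Y(2)])
  note mh = mono_Hom[OF Y(2)] and m1h = mono_Hom[OF Y1(2)]
  obtain l where l: "l \<in> Hom A W" "\<And>x. x \<in> carrier A \<Longrightarrow> q (l x) = f x"
    by (rule proj_lift[OF A fgs(1) fgT W(2) s(4)]) blast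
  obtain L where L: "L \<in> Hom Y W" "\<And>x. x \<in> carrier A \<Longrightarrow> L (m (f x)) = l x"
    by (rule inj_extend[OF PI_simps(2)[OF W(1)] fgA fgs(2) i l(1)]) blast
  let ?h = "\<lambda>x. q (L x)"
  have h: "?h \<in> Hom Y T0" by (rule Hom_comp[OF L(1) epi_simps(1)[OF W(2)]])
  have hi: "?h (m (f x)) = f x" if "x \<in> carrier A" for x using L(2)[OF that] l(2)[OF that] by simp
  let ?d = "\<lambda>x. (x \<ominus>\<^bsub>Y\<^esub> m (?h x), m1 (g (?h x)))"
  have dh: "?d \<in> Hom Y (Y \<uplus> Y1)"
    by (intro Hom_pair Hom_diff Hom_id Hom_comp[OF h mh] Hom_comp[OF h Hom_comp[OF s(5) m1h]] fgs)
  have "(\<lambda>x. m (f x)) ` carrier A = a_kernel Y (Y \<uplus> Y1) ?d"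
  proof (intro subset_antisym subsetI)
    fix y assume "y \<in> (\<lambda>x. m (f x)) ` carrier A"
    then obtain x where x: "x \<in> carrier A" "y = m (f x)" by blast
    have mf: "m (f x) \<in> carrier Y" by (rule Hom_closed[OF mh Hom_closed[OF s(4) x(1)]])
    show "y \<in> a_kernel Y (Y \<uplus> Y1) ?d"
      using x mf hi[OF x(1)] s(8)[OF x(1)] fgs Hom_zero[OF m1h s(3) fgs(5)] by (simp add: ker_iff)
  next
    fix y assume y: "y \<in> a_kernel Y (Y \<uplus> Y1) ?d"
    then have yc: "y \<in> carrier Y" and 0: "y \<ominus>\<^bsub>Y\<^esub> m (?h y) = \<zero>\<^bsub>Y\<^esub>" and 1: "m1 (g (?h y)) = \<zero>\<^bsub>Y1\<^esub>" by (simp_all add: ker_iff)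
    have hc: "?h y \<in> carrier T0" by (rule Hom_closed[OF h yc])
    have "g (?h y) = \<zero>\<^bsub>T1\<^esub>" using 1 mono_zero_iff[OF Y1(2) s(3) fgs(5) Hom_closed[OF s(5) hc]] by simp
    then obtain x where x: "x \<in> carrier A" "?h y = f x" using s(9)[OF hc] by blast
    have "y = m (?h y)" using 0 lm_eq_minus[OF fgs(4) yc Hom_closed[OF mh hc]] by simp
    then show "y \<in> (\<lambda>x. m (f x)) ` carrier A" using x by (metis image_eqI)
  qed
  then show ?thesis by (rule ker_PI_I[OF Y(1) PI_ds2[OF Y(1) Y1(1)] i dh])
qed

text \<open>Extending \<open>g\<close> over \<open>Y\<close> and lifting along \<open>W\<close> onto
  \<open>I\<close> gives \<open>h\<close> from \<open>C1\<close> to \<open>W\<close> with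
  \<open>g q h = g\<close>. If \<open>g (q x) = 0\<close> then \<open>q x = f c\<close> for some
  \<open>c\<close>, and \<open>x = (x - h (q x)) + h (f c)\<close> is in the image of the
  differential.\<close>

lemma coker_PI_of_cotilting:
  assumes I: "inj I" and s: "ses C0 f C1 g I" and C: "genPI C1" "cogenPI C1" "genPI C0"
  shows "coker_PI I"
proof -
  note s = ses_simps[OF s]
  have fgI: "fg I" and fgC: "fg C1" using I genPI_fg[OF C(1)] by auto
  obtain W :: "'a fgmod" and q where W: "PI W" "mod_epi R W C1 q" by (rule genPI_E[OF C(1)])
  obtain Y :: "'a fgmod" and m where Y: "PI Y" "mod_mono R C1 Y m" by (rule cogenPI_E[OF C(2)])
  obtain W0 :: "'a fgmod" and q0 where W0: "PI W0" "mod_epi R W0 C0 q0" by (rule genPI_E[OF C(3)])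
  have fgs: "fg W" "fg Y" "fg W0" "lm W" using W Y W0 by auto
  have p: "mod_epi R W I (\<lambda>x. g (q x))" by (rule epi_comp[OF W(2) s(7)])
  note qh = epi_simps(1)[OF W(2)] and q0h = epi_simps(1)[OF W0(2)]
  obtain G where G: "G \<in> Hom Y I" "\<And>x. x \<in> carrier C1 \<Longrightarrow> G (m x) = g x"
    by (rule inj_extend[OF I fgC fgs(2) Y(2) s(5)]) blast
  obtain L where L: "L \<in> Hom Y W" "\<And>x. x \<in> carrier Y \<Longrightarrow> g (q (L x)) = G x"
    by (rule proj_lift[OF PI_simps(1)[OF Y(1)] fgs(1) fgI p G(1)]) blast
  let ?h = "\<lambda>x. L (m x)"
  have h: "?h \<in> Hom C1 W" by (rule Hom_comp[OF mono_Hom[OF Y(2)] L(1)])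
  have ph: "g (q (?h x)) = g x" if "x \<in> carrier C1" for x
    using L(2)[OF Hom_closed[OF mono_Hom[OF Y(2)] that]] G(2)[OF that] by simp
  let ?d = "\<lambda>x. (fst x \<ominus>\<^bsub>W\<^esub> ?h (q (fst x))) \<oplus>\<^bsub>W\<^esub> ?h (f (q0 (snd x)))"
  have dh: "?d \<in> Hom (W \<uplus> W0) W"
    by (rule Hom_copair[OF Hom_diff[OF Hom_id Hom_comp[OF qh h] fgs(4)] Hom_comp[OF Hom_comp[OF q0h s(4)] h] fgs(4)])
  have "?d ` carrier (W \<uplus> W0) = a_kernel W I (\<lambda>x. g (q x))"
  proof (intro subset_antisym subsetI)
    fix y assume "y \<in> ?d ` carrier (W \<uplus> W0)"
    then obtain x c where xc: "x \<in> carrier W" "c \<in> carrier W0" "y = (x \<ominus>\<^bsub>W\<^esub> ?h (q x)) \<oplus>\<^bsub>W\<^esub> ?h (f (q0 c))" by auto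
    have c1: "q x \<in> carrier C1" "?h (q x) \<in> carrier W" using Hom_closed[OF qh xc(1)] Hom_closed[OF h Hom_closed[OF qh xc(1)]] .
    have c2: "q0 c \<in> carrier C0" "f (q0 c) \<in> carrier C1" "?h (f (q0 c)) \<in> carrier W"
      using Hom_closed[OF q0h xc(2)] Hom_closed[OF s(4) Hom_closed[OF q0h xc(2)]]
        Hom_closed[OF h Hom_closed[OF s(4) Hom_closed[OF q0h xc(2)]]] .
    note P = epi_simps(1)[OF p]
    have "g (q y) = (g (q x) \<ominus>\<^bsub>I\<^esub> g (q (?h (q x)))) \<oplus>\<^bsub>I\<^esub> g (q (?h (f (q0 c))))"
      unfolding xc(3) using xc c1 c2 fgs(4) s(3) by (simp add: Hom_simps(2)[OF P] Hom_minus[OF P])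
    also have "\<dots> = \<zero>\<^bsub>I\<^esub>" using ph[OF c1(1)] ph[OF c2(2)] s(8)[OF c2(1)] Hom_closed[OF s(5) c1(1)] s(3) by simp
    finally show "y \<in> a_kernel W I (\<lambda>x. g (q x))" using xc c1 c2 fgs(4) by (simp add: ker_iff)
  next
    fix x assume "x \<in> a_kernel W I (\<lambda>x. g (q x))"
    then have xc: "x \<in> carrier W" and "g (q x) = \<zero>\<^bsub>I\<^esub>" by (simp_all add: ker_iff)
    then obtain c where c: "c \<in> carrier C0" "q x = f c" using s(9)[OF Hom_closed[OF qh xc]] by blast
    then have "c \<in> q0 ` carrier W0" unfolding epi_simps(2)[OF W0(2)] by simp
    then obtain w where w: "w \<in> carrier W0" "c = q0 w" by blast
    have hc: "?h (q x) \<in> carrier W" by (rule Hom_closed[OF h Hom_closed[OF qh xc]])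
    have "x = (x \<ominus>\<^bsub>W\<^esub> ?h (q x)) \<oplus>\<^bsub>W\<^esub> ?h (q x)" using xc hc fgs(4) by simp
    then have "x = ?d (x, w)" using c(2) w(2) by simp
    then show "x \<in> ?d ` carrier (W \<uplus> W0)" using xc w(1) by (intro image_eqI[of _ _ "(x, w)"]) auto
  qed
  then show ?thesis by (rule coker_PI_I[OF W(1) PI_ds2[OF W(1) W0(1)] p dh])
qed

text \<open>The maps \<open>h\<close> and \<open>g\<close> compare two embeddings of
  \<open>F\<close> into projective-injective modules, and sending \<open>x\<close> to
  \<open>(x - g h x, c h x)\<close> has kernel exactly \<open>F\<close>, as in
  \<open>domdim_ge_2\<close>; so it embeds \<open>Z\<close>.\<close>

lemma coker_cogenPI:
  assumes s: "ses F i E \<pi> Z" and F: "fg F" "ker_PI F" and E: "PI E"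
  shows "cogenPI Z"
proof -
  note s = ses_simps[OF s]
  obtain X0 X1 :: "'a fgmod" and j c where X: "PI X0" "PI X1" and j: "mod_mono R F X0 j" and c: "c \<in> Hom X0 X1"
    "j ` carrier F = a_kernel X0 X1 c" by (rule ker_PI_E[OF F(2)])
  have fgs: "fg E" "fg X0" "lm X1" using E X by auto
  obtain h where h: "h \<in> Hom E X0" "\<And>x. x \<in> carrier F \<Longrightarrow> h (i x) = j x"
    by (rule inj_extend[OF PI_simps(2)[OF X(1)] F(1) fgs(1) s(6) mono_Hom[OF j]]) blast
  obtain g where g: "g \<in> Hom X0 E" "\<And>x. x \<in> carrier F \<Longrightarrow> g (j x) = i x"
    by (rule inj_extend[OF PI_simps(2)[OF E] F(1) fgs(2) j s(4)]) blast
  let ?f = "\<lambda>x. (x \<ominus>\<^bsub>E\<^esub> g (h x), c (h x))"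
  have f: "?f \<in> Hom E (E \<uplus> X1)"
    by (intro Hom_pair Hom_diff Hom_id Hom_comp[OF h(1) g(1)] Hom_comp[OF h(1) c(1)] s(2))
  have lm: "lm (E \<uplus> X1)" by (rule lm_ds2[OF s(2) fgs(3)])
  have k1: "?f x = \<zero>\<^bsub>E \<uplus> X1\<^esub>" if x: "x \<in> carrier E" "\<pi> x = \<zero>\<^bsub>Z\<^esub>" for x
  proof -
    obtain a where a: "a \<in> carrier F" "x = i a" using s(9)[OF x] by blast
    have "j a \<in> a_kernel X0 X1 c" using a(1) c(2) by blast
    then show ?thesis using a h(2) g(2) Hom_closed[OF s(4)] s(2) by (simp add: ker_iff)
  qed
  have k2: "\<pi> x = \<zero>\<^bsub>Z\<^esub>" if x: "x \<in> carrier E" and 0: "?f x = \<zero>\<^bsub>E \<uplus> X1\<^esub>" for x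
  proof -
    have hx: "h x \<in> carrier X0" by (rule Hom_closed[OF h(1) x])
    have "h x \<in> a_kernel X0 X1 c" using 0 hx by (simp add: ker_iff)
    then obtain a where a: "a \<in> carrier F" "h x = j a" unfolding c(2)[symmetric] by blast
    have "x = g (h x)" using 0 lm_eq_minus[OF s(2) x Hom_closed[OF g(1) hx]] by simp
    then have "x = i a" using a g(2) by simp
    then show ?thesis using s(8)[OF a(1)] by simp
  qed
  obtain u where u: "u \<in> Hom Z (E \<uplus> X1)" "\<And>x. x \<in> carrier E \<Longrightarrow> u (\<pi> x) = ?f x"
    by (rule factor_epi[OF s(7) f s(2,3) lm k1]) blast+
  have "mod_mono R Z (E \<uplus> X1) u"
  proof (rule ker_zero_mono[OF u(1) s(3) lm])
    fix z assume z: "z \<in> carrier Z" "u z = \<zero>\<^bsub>E \<uplus> X1\<^esub>"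
    then have "z \<in> \<pi> ` carrier E" using s(10) by simp
    then obtain x where x: "x \<in> carrier E" "z = \<pi> x" by blast
    then show "z = \<zero>\<^bsub>Z\<^esub>" using k2[OF x(1)] u(2)[OF x(1)] z(2) by simp
  qed
  then show ?thesis by (rule cogenPI_I[OF PI_ds2[OF E X(2)] _ s(3)])
qed

text \<open>For \<open>y\<close> in \<open>K\<close> the element \<open>h (k y)\<close> lies in the
  kernel of \<open>p0\<close>, hence is some \<open>d w\<close>. Then
  \<open>k y = (k y - g h (k y)) + g (d w)\<close>, so \<open>P \<uplus> P1\<close> maps onto
  \<open>K\<close>.\<close>

lemma ker_genPI:
  assumes s: "ses K k P p I" and I: "fg I" "coker_PI I" and P: "PI P"
  shows "genPI K"
proof -
  note s = ses_simps[OF s]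
  obtain P0 P1 :: "'a fgmod" and p0 d where X: "PI P0" "PI P1" and p0: "mod_epi R P0 I p0" and d: "d \<in> Hom P1 P0"
    "d ` carrier P1 = a_kernel P0 I p0" by (rule coker_PI_E[OF I(2)])
  have fgs: "fg P" "fg P0" "lm P1" using P X by auto
  obtain h where h: "h \<in> Hom P P0" "\<And>x. x \<in> carrier P \<Longrightarrow> p0 (h x) = p x"
    by (rule proj_lift[OF PI_simps(1)[OF P] fgs(2) I(1) p0 s(5)]) blast
  obtain g where g: "g \<in> Hom P0 P" "\<And>x. x \<in> carrier P0 \<Longrightarrow> p (g x) = p0 x"
    by (rule proj_lift[OF PI_simps(1)[OF X(1)] fgs(1) I(1) s(7) epi_simps(1)[OF p0]]) blast
  let ?f = "\<lambda>x. (fst x \<ominus>\<^bsub>P\<^esub> g (h (fst x))) \<oplus>\<^bsub>P\<^esub> g (d (snd x))"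
  have f: "?f \<in> Hom (P \<uplus> P1) P"
    by (rule Hom_copair[OF Hom_diff[OF Hom_id Hom_comp[OF h(1) g(1)] s(2)] Hom_comp[OF d(1) g(1)] s(2)])
  have im: "?f ` carrier (P \<uplus> P1) \<subseteq> k ` carrier K"
  proof (rule image_subsetI, rule s(9))
    fix x assume x: "x \<in> carrier (P \<uplus> P1)"
    then show "?f x \<in> carrier P" by (rule Hom_closed[OF f])
    have c: "fst x \<in> carrier P" "snd x \<in> carrier P1" using x by auto
    have c': "h (fst x) \<in> carrier P0" "g (h (fst x)) \<in> carrier P" "d (snd x) \<in> carrier P0" "g (d (snd x)) \<in> carrier P"
      using Hom_closed[OF h(1) c(1)] Hom_closed[OF g(1) Hom_closed[OF h(1) c(1)]] Hom_closed[OF d(1) c(2)]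
        Hom_closed[OF g(1) Hom_closed[OF d(1) c(2)]] .
    have "d (snd x) \<in> a_kernel P0 I p0" using c(2) d(2) by blast
    then have "p0 (d (snd x)) = \<zero>\<^bsub>I\<^esub>" by (simp add: ker_iff)
    then show "p (?f x) = \<zero>\<^bsub>I\<^esub>"
      using c c' s(2,3) Hom_closed[OF s(5) c(1)] by (simp add: Hom_simps(2)[OF s(5)] Hom_minus[OF s(5,2,3)] g(2) h(2))
  qed
  obtain u where u: "u \<in> Hom (P \<uplus> P1) K" "\<And>x. x \<in> carrier (P \<uplus> P1) \<Longrightarrow> k (u x) = ?f x"
    by (rule factor_mono[OF s(6) f s(1) lm_ds2[OF s(2) fgs(3)] im]) blast
  have "carrier K \<subseteq> u ` carrier (P \<uplus> P1)"
  proof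
    fix y assume y: "y \<in> carrier K"
    have ky: "k y \<in> carrier P" by (rule Hom_closed[OF s(4) y])
    have hk: "h (k y) \<in> carrier P0" by (rule Hom_closed[OF h(1) ky])
    have "h (k y) \<in> a_kernel P0 I p0" using hk h(2)[OF ky] s(8)[OF y] by (simp add: ker_iff)
    then obtain w where w: "w \<in> carrier P1" "h (k y) = d w" unfolding d(2)[symmetric] by blast
    have m: "(k y, w) \<in> carrier (P \<uplus> P1)" using ky w by simp
    have "k (u (k y, w)) = k y" unfolding u(2)[OF m] using ky w(2) Hom_closed[OF g(1) hk] s(2) by simp
    then have "u (k y, w) = y" by (rule mono_eq[OF s(6) Hom_closed[OF u(1) m] y])
    then show "y \<in> u ` carrier (P \<uplus> P1)" by (intro image_eqI[OF _ m]) simp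
  qed
  then have "mod_epi R (P \<uplus> P1) K u" unfolding mod_epi_def using u(1) Hom_closed[OF u(1)] by blast
  then show ?thesis by (rule genPI_I[OF PI_ds2[OF P X(2)] _ s(1)])
qed

subsection \<open>Vanishing of Ext\<close>

text \<open>Compare the presentation by \<open>P\<close> with the one by \<open>I\<close> through
  \<open>a\<close> and \<open>b\<close> over \<open>M\<close>. Then \<open>1 - a b\<close> maps
  \<open>P\<close> into \<open>K\<close> as \<open>r\<close>, and \<open>f r\<close> extends
  \<open>f\<close> up to an error \<open>f c\<close> supported on \<open>F\<close>. This error lifts
  to the projective-injective \<open>Y\<close> that covers \<open>N\<close>, hence extends to
  \<open>I\<close>; so \<open>q L b + f r\<close> extends \<open>f\<close>.\<close>

lemma Ext1_trivial_coker:
  assumes s: "ses F i I \<pi> M" and F: "proj F" and I: "PI I" and N: "genPI N"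
  shows "trivial_group (Ext R 1 M N)"
proof (rule Ext1_trivial)
  note s = ses_simps[OF s]
  have fgI: "fg I" using I by simp
  show fgM: "fg M" by (rule fg_epi[OF fgI s(7,3)])
  show fgN: "fg N" by (rule genPI_fg[OF N])
  obtain Y :: "'a fgmod" and q where Y: "PI Y" "mod_epi R Y N q" by (rule genPI_E[OF N])
  have fgY: "fg Y" and fgF: "fg F" and lmN: "lm N" using Y F fgN by auto
  fix K P :: "'a fgmod" and k p f
  assume P: "proj P" and sP: "ses K k P p M" and f: "f \<in> Hom K N"
  note t = ses_simps[OF sP]
  have fgP: "fg P" using P by simp
  obtain a where a: "a \<in> Hom I P" "\<And>x. x \<in> carrier I \<Longrightarrow> p (a x) = \<pi> x"
    by (rule proj_lift[OF PI_simps(1)[OF I] fgP fgM t(7) s(5)]) blast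
  obtain b where b: "b \<in> Hom P I" "\<And>x. x \<in> carrier P \<Longrightarrow> \<pi> (b x) = p x"
    by (rule proj_lift[OF P fgI fgM s(7) t(5)]) blast
  have ai: "(\<lambda>x. a (i x)) ` carrier F \<subseteq> k ` carrier K"
    by (rule image_subsetI, rule t(9)) (use a Hom_closed[OF s(4)] Hom_closed[OF a(1)] s(8) in auto)
  obtain c where c: "c \<in> Hom F K" "\<And>x. x \<in> carrier F \<Longrightarrow> k (c x) = a (i x)"
    by (rule factor_mono[OF t(6) Hom_comp[OF s(4) a(1)] t(1) s(1) ai]) blast
  obtain l where l: "l \<in> Hom F Y" "\<And>x. x \<in> carrier F \<Longrightarrow> q (l x) = f (c x)"
    by (rule proj_lift[OF F fgY fgN Y(2) Hom_comp[OF c(1) f]]) blast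
  obtain L where L: "L \<in> Hom I Y" "\<And>x. x \<in> carrier F \<Longrightarrow> L (i x) = l x"
    by (rule inj_extend[OF PI_simps(2)[OF Y(1)] fgF fgI s(6) l(1)]) blast
  have ab: "(\<lambda>y. y \<ominus>\<^bsub>P\<^esub> a (b y)) \<in> Hom P P" by (intro Hom_diff Hom_id Hom_comp[OF b(1) a(1)] t(2))
  have im: "(\<lambda>y. y \<ominus>\<^bsub>P\<^esub> a (b y)) ` carrier P \<subseteq> k ` carrier K"
  proof (rule image_subsetI, rule t(9))
    fix y assume y: "y \<in> carrier P"
    have byc: "b y \<in> carrier I" "a (b y) \<in> carrier P" using Hom_closed[OF b(1) y] Hom_closed[OF a(1) Hom_closed[OF b(1) y]] .
    show "y \<ominus>\<^bsub>P\<^esub> a (b y) \<in> carrier P" using y byc t(2) by simp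
    show "p (y \<ominus>\<^bsub>P\<^esub> a (b y)) = \<zero>\<^bsub>M\<^esub>"
      using y byc t(2,3) Hom_closed[OF t(5) y] by (simp add: Hom_minus[OF t(5,2,3)] a(2) b(2))
  qed
  obtain r where r: "r \<in> Hom P K" "\<And>y. y \<in> carrier P \<Longrightarrow> k (r y) = y \<ominus>\<^bsub>P\<^esub> a (b y)"
    by (rule factor_mono[OF t(6) ab t(1,2) im]) blast
  note qL = Hom_comp[OF b(1) Hom_comp[OF L(1) epi_simps(1)[OF Y(2)]]]
  show "\<exists>g\<in>Hom P N. \<forall>x\<in>carrier K. g (k x) = f x"
  proof (intro bexI[OF _ Hom_add[OF qL Hom_comp[OF r(1) f] lmN]] ballI)
    fix x assume x: "x \<in> carrier K"
    have kx: "k x \<in> carrier P" by (rule Hom_closed[OF t(4) x])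
    have "\<pi> (b (k x)) = \<zero>\<^bsub>M\<^esub>" using b(2)[OF kx] t(8)[OF x] by simp
    then obtain z where z: "z \<in> carrier F" "b (k x) = i z" using s(9)[OF Hom_closed[OF b(1) kx]] by blast
    have cz: "c z \<in> carrier K" by (rule Hom_closed[OF c(1) z(1)])
    have "k (r (k x)) = k (x \<ominus>\<^bsub>K\<^esub> c z)"
      using r(2)[OF kx] z c(2)[OF z(1)] x cz by (simp add: Hom_minus[OF t(4,1,2)])
    then have rk: "r (k x) = x \<ominus>\<^bsub>K\<^esub> c z"
      by (rule mono_eq[OF t(6) Hom_closed[OF r(1) kx] lm_minus[OF t(1) x cz]])
    have "q (L (b (k x))) = f (c z)" using z L(2) l(2) by simp
    then have "q (L (b (k x))) \<oplus>\<^bsub>N\<^esub> f (r (k x)) = f (c z) \<oplus>\<^bsub>N\<^esub> (f x \<ominus>\<^bsub>N\<^esub> f (c z))"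
      using rk x cz by (simp add: Hom_minus[OF f t(1) lmN])
    also have "\<dots> = f x"
      using Hom_closed[OF f x] Hom_closed[OF f cz] lmN lm_comm[of N "f (c z)" "f x \<ominus>\<^bsub>N\<^esub> f (c z)"] by simp
    finally show "q (L (b (k x))) \<oplus>\<^bsub>N\<^esub> f (r (k x)) = f x" .
  qed
qed

text \<open>Extend \<open>n f\<close> to \<open>u\<close> on \<open>P\<close>, which may leave
  \<open>N\<close>. The error \<open>\<epsilon> u\<close> vanishes on \<open>K\<close>, so it comes
  from a map on \<open>M\<close>. That map extends to the projective-injective \<open>Y\<close>
  around \<open>M\<close> and lifts to \<open>V\<close> with values in \<open>I\<close>; subtracting
  \<open>V m p\<close> brings \<open>u\<close> back into \<open>N\<close> without changing it on
  \<open>K\<close>.\<close>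

lemma Ext1_trivial_ker:
  assumes s: "ses N n I \<epsilon> E" and E: "inj E" and I: "PI I" and M: "cogenPI M"
  shows "trivial_group (Ext R 1 M N)"
proof (rule Ext1_trivial)
  note s = ses_simps[OF s]
  have fgI: "fg I" using I by simp
  show fgN: "fg N" by (rule fg_mono[OF s(6,1) fgI])
  show fgM: "fg M" by (rule cogenPI_fg[OF M])
  obtain Y :: "'a fgmod" and m where Y: "PI Y" "mod_mono R M Y m" by (rule cogenPI_E[OF M])
  have fgY: "fg Y" and fgE: "fg E" using Y E by auto
  note mh = mono_Hom[OF Y(2)]
  fix K P :: "'a fgmod" and k p f
  assume P: "proj P" and sP: "ses K k P p M" and f: "f \<in> Hom K N"
  note t = ses_simps[OF sP]
  have fgP: "fg P" and fgK: "fg K" using P fg_ses(1)[OF sP] by auto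
  obtain u where u: "u \<in> Hom P I" "\<And>x. x \<in> carrier K \<Longrightarrow> u (k x) = n (f x)"
    by (rule inj_extend[OF PI_simps(2)[OF I] fgK fgP t(6) Hom_comp[OF f s(4)]]) blast
  obtain w where w: "w \<in> Hom M E" "\<And>y. y \<in> carrier P \<Longrightarrow> w (p y) = \<epsilon> (u y)"
  proof (rule factor_epi[OF t(7) Hom_comp[OF u(1) s(5)] t(2,3) s(3)])
    fix y assume "y \<in> carrier P" "p y = \<zero>\<^bsub>M\<^esub>"
    then obtain x where "x \<in> carrier K" "y = k x" using t(9) by blast
    then show "\<epsilon> (u y) = \<zero>\<^bsub>E\<^esub>" using u(2) s(8) Hom_closed[OF f] by simp
  qed blast
  obtain W where W: "W \<in> Hom Y E" "\<And>x. x \<in> carrier M \<Longrightarrow> W (m x) = w x"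
    by (rule inj_extend[OF E fgM fgY Y(2) w(1)]) blast
  obtain V where V: "V \<in> Hom Y I" "\<And>y. y \<in> carrier Y \<Longrightarrow> \<epsilon> (V y) = W y"
    by (rule proj_lift[OF PI_simps(1)[OF Y(1)] fgI fgE s(7) W(1)]) blast
  note Vm = Hom_comp[OF t(5) Hom_comp[OF mh V(1)]]
  have g0: "(\<lambda>y. u y \<ominus>\<^bsub>I\<^esub> V (m (p y))) \<in> Hom P I" by (rule Hom_diff[OF u(1) Vm s(2)])
  have im: "(\<lambda>y. u y \<ominus>\<^bsub>I\<^esub> V (m (p y))) ` carrier P \<subseteq> n ` carrier N"
  proof (rule image_subsetI, rule s(9))
    fix y assume y: "y \<in> carrier P"
    show "u y \<ominus>\<^bsub>I\<^esub> V (m (p y)) \<in> carrier I" by (rule Hom_closed[OF g0 y])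
    have uy: "u y \<in> carrier I" and py: "p y \<in> carrier M" using Hom_closed[OF u(1) y] Hom_closed[OF t(5) y] .
    have mp: "m (p y) \<in> carrier Y" "V (m (p y)) \<in> carrier I"
      using Hom_closed[OF mh py] Hom_closed[OF V(1) Hom_closed[OF mh py]] .
    show "\<epsilon> (u y \<ominus>\<^bsub>I\<^esub> V (m (p y))) = \<zero>\<^bsub>E\<^esub>"
      using uy mp Hom_closed[OF s(5) uy] s(3) by (simp add: Hom_minus[OF s(5,2,3)] V(2) W(2)[OF py] w(2)[OF y])
  qed
  obtain g where g: "g \<in> Hom P N" "\<And>y. y \<in> carrier P \<Longrightarrow> n (g y) = u y \<ominus>\<^bsub>I\<^esub> V (m (p y))"
    by (rule factor_mono[OF s(6) g0 s(1) t(2) im]) blast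
  show "\<exists>g\<in>Hom P N. \<forall>x\<in>carrier K. g (k x) = f x"
  proof (intro bexI[OF _ g(1)] ballI)
    fix x assume x: "x \<in> carrier K"
    have kx: "k x \<in> carrier P" by (rule Hom_closed[OF t(4) x])
    have "V (m (p (k x))) = \<zero>\<^bsub>I\<^esub>"
      using t(8)[OF x] Hom_zero[OF Hom_comp[OF mh V(1)] t(3) s(2)] by simp
    then have "n (g (k x)) = n (f x)"
      using g(2)[OF kx] u(2)[OF x] Hom_closed[OF s(4) Hom_closed[OF f x]] s(2) by simp
    then show "g (k x) = f x" by (rule mono_eq[OF s(6) Hom_closed[OF g(1) kx] Hom_closed[OF f x]])
  qed
qed

end

section \<open>Syzygies and cosyzygies of indecomposable modules\<close>

context artin_inj
begin

lemma funpow_intertwine: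
  assumes "\<And>x. x \<in> A \<Longrightarrow> h x \<in> A" "\<And>x. x \<in> A \<Longrightarrow> p (h x) = e (p x)" "x \<in> A"
  shows "p ((h ^^ n) x) = (e ^^ n) (p x)"
proof -
  have "(h ^^ n) x \<in> A \<and> p ((h ^^ n) x) = (e ^^ n) (p x)" by (induction n) (use assms in auto)
  then show ?thesis by blast
qed

lemma funpow_idem:
  assumes "\<And>x. x \<in> A \<Longrightarrow> e x \<in> A" "\<And>x. x \<in> A \<Longrightarrow> e (e x) = e x" "x \<in> A"
  shows "e ((e ^^ n) x) = e x"
proof -
  have "(e ^^ n) x \<in> A \<and> e ((e ^^ n) x) = e x" by (induction n) (use assms in auto)
  then show ?thesis by blast
qed

text \<open>A decomposition yields the idempotent projecting onto \<open>L\<close> along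
  \<open>N\<close>. If it is bijective then \<open>N\<close> vanishes, and if it is zero then
  \<open>L\<close> does.\<close>

lemma indec_of_idem:
  assumes Z: "fg Z" and nz: "z0 \<in> carrier Z" "z0 \<noteq> \<zero>\<^bsub>Z\<^esub>"
    and idem: "\<And>e. \<lbrakk>e \<in> Hom Z Z; \<And>z. z \<in> carrier Z \<Longrightarrow> e (e z) = e z\<rbrakk> \<Longrightarrow> bij_on Z e \<or> (\<forall>z\<in>carrier Z. e z = \<zero>\<^bsub>Z\<^esub>)"
  shows "indec Z"
  unfolding indecomposable_def
proof (intro conjI allI impI Z)
  have lm: "lm Z" using Z by simp
  show "\<not> zero_module Z" using nz by (auto simp: zero_module_def)
  fix N L assume *: "sm N Z \<and> sm L Z \<and> N \<inter> L = {\<zero>\<^bsub>Z\<^esub>} \<and> N <+>\<^bsub>Z\<^esub> L = carrier Z"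
  then have NL: "sm N Z" "sm L Z" "N \<inter> L = {\<zero>\<^bsub>Z\<^esub>}" "N <+>\<^bsub>Z\<^esub> L = carrier Z" by auto
  note f = internal_sum_bij[OF lm NL]
  have lmN: "lm (sub Z N)" "lm (sub Z L)" using lm_sub[OF lm] NL by auto
  obtain g where g: "g \<in> Hom Z (sub Z N \<uplus> sub Z L)" "\<And>x. x \<in> carrier (sub Z N \<uplus> sub Z L) \<Longrightarrow> g (fst x \<oplus>\<^bsub>Z\<^esub> snd x) = x"
    by (rule miso_inv[OF f lm_ds2[OF lmN]]) blast
  define e where "e z = snd (g z)" for z
  have e: "e \<in> Hom Z Z"
    unfolding e_def by (rule Hom_comp[OF Hom_comp[OF g(1) Hom_snd] Hom_sub[OF lm NL(2)]])
  have eN: "e x = \<zero>\<^bsub>Z\<^esub>" if "x \<in> N" for x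
    using g(2)[of "(x, \<zero>\<^bsub>Z\<^esub>)"] that sm_simps(1)[OF NL(2)] sm_mem[OF NL(1) that] lm by (simp add: e_def)
  have eL: "e x = x" if "x \<in> L" for x
    using g(2)[of "(\<zero>\<^bsub>Z\<^esub>, x)"] that sm_simps(1)[OF NL(1)] sm_mem[OF NL(2) that] lm by (simp add: e_def)
  have "e z \<in> L" if "z \<in> carrier Z" for z using Hom_closed[OF g(1) that] by (auto simp: e_def)
  then have "e (e z) = e z" if "z \<in> carrier Z" for z using eL that by blast
  then consider "bij_on Z e" | "\<forall>z\<in>carrier Z. e z = \<zero>\<^bsub>Z\<^esub>" using idem[OF e] by blast
  then show "N = {\<zero>\<^bsub>Z\<^esub>} \<or> L = {\<zero>\<^bsub>Z\<^esub>}"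
  proof cases
    case 1
    have "x = \<zero>\<^bsub>Z\<^esub>" if "x \<in> N" for x
    proof -
      have "e x = e \<zero>\<^bsub>Z\<^esub>" using eN[OF that] Hom_zero[OF e lm lm] by simp
      then show ?thesis using 1 sm_mem[OF NL(1) that] lm unfolding bij_betw_def inj_on_def by (metis lm_zero)
    qed
    then show ?thesis using sm_simps(1)[OF NL(1)] by blast
  next
    case 2
    have "x = \<zero>\<^bsub>Z\<^esub>" if "x \<in> L" for x using 2 eL[OF that] sm_mem[OF NL(2) that] by metis
    then show ?thesis using sm_simps(1)[OF NL(2)] by blast
  qed
qed

subsection \<open>Cosyzygies\<close>

lemma coker_lift:
  assumes s: "ses P j E p Z" and s': "ses P' j' E' p' Z'" and E: "proj E" "fg E'" and f: "f \<in> Hom Z Z'"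
  obtains h k where "h \<in> Hom E E'" "k \<in> Hom P P'" "\<And>x. x \<in> carrier E \<Longrightarrow> p' (h x) = f (p x)"
    "\<And>x. x \<in> carrier P \<Longrightarrow> j' (k x) = h (j x)"
proof -
  note s = ses_simps[OF s] and s' = ses_simps[OF s']
  have fgZ: "fg Z'" by (rule fg_epi[OF E(2) s'(7,3)])
  obtain h where h: "h \<in> Hom E E'" "\<And>x. x \<in> carrier E \<Longrightarrow> p' (h x) = f (p x)"
    by (rule proj_lift[OF E(1,2) fgZ s'(7) Hom_comp[OF s(5) f]]) blast
  have im: "(\<lambda>x. h (j x)) ` carrier P \<subseteq> j' ` carrier P'"
    by (rule image_subsetI, rule s'(9))
      (use h s(8) Hom_zero[OF f s(3) s'(3)] Hom_closed[OF s(4)] Hom_closed[OF h(1)] in auto)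
  obtain k where k: "k \<in> Hom P P'" "\<And>x. x \<in> carrier P \<Longrightarrow> j' (k x) = h (j x)"
    by (rule factor_mono[OF s'(6) Hom_comp[OF s(4) h(1)] s'(1) s(1) im]) blast
  show ?thesis using that[OF h(1) k(1) h(2) k(2)] by blast
qed

text \<open>If \<open>k\<close> is bijective, essentiality makes \<open>h\<close> injective, hence
  bijective, and \<open>e\<close> surjective, hence bijective. Otherwise some \<open>k^n\<close>
  vanishes, so \<open>h^n\<close> kills \<open>P\<close> and factors through \<open>Z\<close>, which
  makes \<open>e^n\<close> factor through \<open>E\<close>.\<close>

lemma coker_endo:
  assumes s: "ses P j E p Z" and ess: "essential R (j ` carrier P) E" and P: "indec P" and E: "fg E"
    and h: "h \<in> Hom E E" and k: "k \<in> Hom P P" and e: "e \<in> Hom Z Z"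
    and hp: "\<And>x. x \<in> carrier E \<Longrightarrow> p (h x) = e (p x)" and kj: "\<And>x. x \<in> carrier P \<Longrightarrow> j (k x) = h (j x)"
  shows "(bij_on P k \<and> bij_on Z e) \<or> (\<exists>n t. t \<in> Hom Z E \<and> (\<forall>z\<in>carrier Z. (e ^^ n) z = p (t z)))"
proof -
  note s = ses_simps[OF s]
  have fgZ: "fg Z" by (rule fg_epi[OF E s(7,3)])
  consider "bij_on P k" | n where "\<forall>x\<in>carrier P. (k ^^ n) x = \<zero>\<^bsub>P\<^esub>" using indec_endo[OF P k] by blast
  then show ?thesis
  proof cases
    case 1
    have km: "mod_mono R P P k" using 1 k by (simp add: mod_mono_def bij_betw_def)
    have "mod_mono R E E h"
    proof (rule essential_mono[OF ess s(4) h s(1,2,2)])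
      fix x assume x: "x \<in> carrier P" "h (j x) = \<zero>\<^bsub>E\<^esub>"
      then have "k x = \<zero>\<^bsub>P\<^esub>" using kj mono_zero_iff[OF s(6,1,2) Hom_closed[OF k x(1)]] by simp
      then show "x = \<zero>\<^bsub>P\<^esub>" using mono_zero_iff[OF km s(1,1) x(1)] by simp
    qed
    then have hb: "bij_on E h" by (rule mono_endo_bij[OF E])
    have "carrier Z \<subseteq> e ` carrier Z"
    proof
      fix z assume "z \<in> carrier Z"
      then obtain x where x: "x \<in> carrier E" "z = p x" using s(10) by blast
      then obtain y where y: "y \<in> carrier E" "x = h y" using hb unfolding bij_betw_def by blast
      then have "z = e (p y)" using hp x by simp
      then show "z \<in> e ` carrier Z" using Hom_closed[OF s(5) y(1)] by (rule image_eqI)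
    qed
    then have "mod_epi R Z Z e" unfolding mod_epi_def using e Hom_closed[OF e] by blast
    then show ?thesis using 1 epi_endo_bij[OF fgZ] by blast
  next
    case 2
    note hn = Hom_funpow[OF h, of n]
    have h0: "(h ^^ n) x = \<zero>\<^bsub>E\<^esub>" if x: "x \<in> carrier E" "p x = \<zero>\<^bsub>Z\<^esub>" for x
    proof -
      obtain y where y: "y \<in> carrier P" "x = j y" using s(9)[OF x] by blast
      have "j ((k ^^ n) y) = (h ^^ n) (j y)" by (rule funpow_intertwine[of "carrier P"]) (use kj Hom_closed[OF k] y in auto)
      then show ?thesis using 2 y Hom_zero[OF s(4,1,2)] by simp
    qed
    obtain t where t: "t \<in> Hom Z E" "\<And>x. x \<in> carrier E \<Longrightarrow> t (p x) = (h ^^ n) x"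
      by (rule factor_epi[OF s(7) hn s(2,3,2) h0]) blast+
    have "(e ^^ n) z = p (t z)" if "z \<in> carrier Z" for z
    proof -
      have "z \<in> p ` carrier E" using that s(10) by simp
      then obtain x where x: "x \<in> carrier E" "z = p x" by blast
      have "p ((h ^^ n) x) = (e ^^ n) (p x)" by (rule funpow_intertwine[of "carrier E"]) (use hp Hom_closed[OF h] x in auto)
      then show ?thesis using x t(2) by simp
    qed
    then show ?thesis using t(1) by blast
  qed
qed

text \<open>Since \<open>p t e = e\<close>, the map \<open>p\<close> is injective on the image of
  \<open>t e\<close>, which therefore meets \<open>P\<close> trivially. Essentiality of
  \<open>P\<close> in \<open>E\<close> makes this image zero.\<close>

lemma coker_idem_factor:
  assumes s: "ses P j E p Z" and ess: "essential R (j ` carrier P) E"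
    and e: "e \<in> Hom Z Z" "\<And>z. z \<in> carrier Z \<Longrightarrow> e (e z) = e z"
    and t: "t \<in> Hom Z E" "\<And>z. z \<in> carrier Z \<Longrightarrow> e z = p (t z)" and z: "z \<in> carrier Z"
  shows "e z = \<zero>\<^bsub>Z\<^esub>"
proof -
  note s = ses_simps[OF s]
  note te = Hom_comp[OF e(1) t(1)]
  let ?L = "(\<lambda>z. t (e z)) ` carrier Z"
  have L: "sm ?L E" by (rule sm_img[OF te s(3,2)])
  have pt: "p (t (e z)) = e z" if "z \<in> carrier Z" for z using t(2)[OF Hom_closed[OF e(1) that]] e(2)[OF that] by simp
  have zero: "t (e z) = \<zero>\<^bsub>E\<^esub>" if z: "z \<in> carrier Z" and m: "t (e z) \<in> j ` carrier P" for z
  proof -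
    have "p (t (e z)) = \<zero>\<^bsub>Z\<^esub>" using m s(8) by auto
    then show ?thesis using pt[OF z] Hom_zero[OF t(1) s(3,2)] by simp
  qed
  have "?L \<inter> j ` carrier P \<subseteq> {\<zero>\<^bsub>E\<^esub>}"
  proof
    fix y assume y: "y \<in> ?L \<inter> j ` carrier P"
    then obtain w where "w \<in> carrier Z" "y = t (e w)" by blast
    with y show "y \<in> {\<zero>\<^bsub>E\<^esub>}" using zero[of w] by simp
  qed
  moreover have "sm (j ` carrier P) E" by (rule sm_img[OF s(4,1,2)])
  ultimately have "?L \<inter> j ` carrier P = {\<zero>\<^bsub>E\<^esub>}" using sm_simps(1)[OF L] sm_simps(1) by blast
  then have "?L = {\<zero>\<^bsub>E\<^esub>}" using ess L unfolding essential_def by blast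
  then have "t (e z) = \<zero>\<^bsub>E\<^esub>" using z by blast
  then show ?thesis using pt[OF z] Hom_zero[OF s(5,2,3)] by simp
qed

context
  fixes P :: "('a, 'p) module" and E :: "('a, 'e) module" and Z :: "('a, 'z) module" and j p
  assumes s: "ses P j E p Z" and env: "injective_envelope R P j E" and projE: "proj E"
    and P: "indec P" "\<not> inj P"
begin

lemma cosyz_nonzero: "\<exists>z\<in>carrier Z. z \<noteq> \<zero>\<^bsub>Z\<^esub>"
proof (rule ccontr)
  note s = ses_simps[OF s]
  assume "\<not> ?thesis"
  then have "j ` carrier P = carrier E"
    using s(9) Hom_closed[OF s(4)] Hom_closed[OF s(5)] by blast
  then have "bij_betw j (carrier P) (carrier E)" using s(6) by (simp add: bij_betw_def mod_mono_def)
  then have "P \<simeq> E" by (rule miso_bij[OF s(4)])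
  then have "retract P E" by (rule miso_retract[OF _ s(1)])
  then have "inj P" by (rule inj_retract[OF envelope_simps(1)[OF env] _ indec_fg[OF P(1)]])
  with P(2) show False by blast
qed

text \<open>An idempotent \<open>f\<close> that is not bijective has a power factoring through
  \<open>E\<close> by \<open>coker_endo\<close>. Since \<open>f = f f^n\<close>, so does
  \<open>f\<close>, and it is zero by \<open>coker_idem_factor\<close>.\<close>

lemma cosyz_indec: "indec Z"
proof -
  note e = envelope_simps[OF env] and s' = ses_simps[OF s]
  have fgZ: "fg Z" by (rule fg_epi[OF e(5) s'(7,3)])
  obtain z0 where z0: "z0 \<in> carrier Z" "z0 \<noteq> \<zero>\<^bsub>Z\<^esub>" using cosyz_nonzero by blast
  show ?thesis
  proof (rule indec_of_idem[OF fgZ z0])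
    fix f assume f: "f \<in> Hom Z Z" "\<And>z. z \<in> carrier Z \<Longrightarrow> f (f z) = f z"
    obtain h k where h: "h \<in> Hom E E" "k \<in> Hom P P" "\<And>x. x \<in> carrier E \<Longrightarrow> p (h x) = f (p x)"
      "\<And>x. x \<in> carrier P \<Longrightarrow> j (k x) = h (j x)" by (rule coker_lift[OF s s projE e(5) f(1)]) blast
    show "bij_on Z f \<or> (\<forall>z\<in>carrier Z. f z = \<zero>\<^bsub>Z\<^esub>)"
    proof (cases "bij_on Z f")
      case False
      then obtain n t where t: "t \<in> Hom Z E" "\<And>z. z \<in> carrier Z \<Longrightarrow> (f ^^ n) z = p (t z)"
        using coker_endo[OF s e(3) P(1) e(5) h(1,2) f(1) h(3,4)] by blast
      have "f z = p (h (t z))" if z: "z \<in> carrier Z" for z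
      proof -
        have "f z = f ((f ^^ n) z)"
          by (rule funpow_idem[of "carrier Z", symmetric]) (use f(2) Hom_closed[OF f(1)] z in auto)
        then show ?thesis using t z h(3) Hom_closed[OF t(1) z] by simp
      qed
      then show ?thesis using coker_idem_factor[OF s e(3) f Hom_comp[OF t(1) h(1)]] by blast
    qed blast
  qed
qed

lemma cosyz_no_section: assumes "t \<in> Hom Z E" "\<And>z. z \<in> carrier Z \<Longrightarrow> p (t z) = z" shows False
  using coker_idem_factor[OF s envelope_simps(3)[OF env] Hom_id _ assms(1)] assms(2) cosyz_nonzero by metis

lemma cosyz_not_proj: "\<not> proj Z"
proof
  assume Z: "proj Z"
  note s' = ses_simps[OF s]
  obtain t where "t \<in> Hom Z E" "\<And>z. z \<in> carrier Z \<Longrightarrow> p (t z) = z"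
    by (rule proj_lift[OF Z envelope_simps(5)[OF env] proj_fg[OF Z] s'(7) Hom_id]) blast
  then show False by (rule cosyz_no_section)
qed

text \<open>The isomorphism and its inverse lift to the projective middle terms and restrict to
  \<open>k\<close> and \<open>k'\<close>. By \<open>coker_endo\<close> either \<open>k' k\<close> is
  bijective on \<open>P\<close>, or the identity of \<open>Z\<close> factors through
  \<open>E\<close>; the latter would be a section of \<open>p\<close>.\<close>

lemma cosyz_iso_imp:
  assumes s': "ses P' j' E' p' Z'" and E': "proj E'" and P': "indec P'" and iso: "Z \<simeq> Z'"
  shows "P \<simeq> P'"
proof -
  note e = envelope_simps[OF env] and t = ses_simps[OF s]
  obtain f f' where f: "f \<in> Hom Z Z'" "f' \<in> Hom Z' Z" "\<And>x. x \<in> carrier Z \<Longrightarrow> f' (f x) = x"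
    by (rule misoE[OF iso t(3)]) blast
  obtain h k where h: "h \<in> Hom E E'" "k \<in> Hom P P'" "\<And>x. x \<in> carrier E \<Longrightarrow> p' (h x) = f (p x)"
    "\<And>x. x \<in> carrier P \<Longrightarrow> j' (k x) = h (j x)" by (rule coker_lift[OF s s' projE proj_fg[OF E'] f(1)]) blast
  obtain h' k' where h': "h' \<in> Hom E' E" "k' \<in> Hom P' P" "\<And>x. x \<in> carrier E' \<Longrightarrow> p (h' x) = f' (p' x)"
    "\<And>x. x \<in> carrier P' \<Longrightarrow> j (k' x) = h' (j' x)" by (rule coker_lift[OF s' s E' e(5) f(2)]) blast
  have "p (h' (h x)) = p x" if "x \<in> carrier E" for x
    using that h(3) h'(3) f(3) Hom_closed[OF h(1) that] Hom_closed[OF t(5) that] by simp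
  moreover have "j (k' (k x)) = h' (h (j x))" if "x \<in> carrier P" for x
    using that h(4) h'(4) Hom_closed[OF h(2) that] by simp
  ultimately have *: "(bij_on P (\<lambda>x. k' (k x)) \<and> bij_on Z (\<lambda>x. x)) \<or>
      (\<exists>n t. t \<in> Hom Z E \<and> (\<forall>z\<in>carrier Z. ((\<lambda>x. x) ^^ n) z = p (t z)))"
    by (rule coker_endo[OF s e(3) P(1) e(5) Hom_comp[OF h(1) h'(1)] Hom_comp[OF h(2) h'(2)] Hom_id])
  have "((\<lambda>x. x) ^^ n) z = z" for n and z :: 'z by (induction n) auto
  then have "bij_on P (\<lambda>x. k' (k x))" using * cosyz_no_section by metis
  then have "retract P P'" by (rule bij_on_of_comp[OF P(1) indec_fg[OF P'] h(2) h'(2)])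
  then show ?thesis by (rule retract_indec_iso[OF P(1) P'])
qed

end

subsection \<open>Syzygies\<close>

lemma ker_lift:
  assumes s: "ses K k P p I" and s': "ses K' k' P' p' I'" and P: "inj P'" "fg P" and f: "f \<in> Hom K K'"
  obtains h l where "h \<in> Hom P P'" "l \<in> Hom I I'" "\<And>x. x \<in> carrier K \<Longrightarrow> h (k x) = k' (f x)"
    "\<And>x. x \<in> carrier P \<Longrightarrow> l (p x) = p' (h x)"
proof -
  note s = ses_simps[OF s] and s' = ses_simps[OF s']
  have fgK: "fg K" by (rule fg_mono[OF s(6,1) P(2)])
  obtain h where h: "h \<in> Hom P P'" "\<And>x. x \<in> carrier K \<Longrightarrow> h (k x) = k' (f x)"
    by (rule inj_extend[OF P(1) fgK P(2) s(6) Hom_comp[OF f s'(4)]]) blast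
  have 0: "p' (h x) = \<zero>\<^bsub>I'\<^esub>" if x: "x \<in> carrier P" "p x = \<zero>\<^bsub>I\<^esub>" for x
  proof -
    obtain y where "y \<in> carrier K" "x = k y" using s(9)[OF x] by blast
    then show ?thesis using h(2) s'(8) Hom_closed[OF f] by simp
  qed
  obtain l where l: "l \<in> Hom I I'" "\<And>x. x \<in> carrier P \<Longrightarrow> l (p x) = p' (h x)"
    by (rule factor_epi[OF s(7) Hom_comp[OF h(1) s'(5)] s(2,3) s'(3) 0]) blast+
  show ?thesis using that[OF h(1) l(1) h(2) l(2)] by blast
qed

text \<open>If \<open>l\<close> is bijective, superfluity makes \<open>h\<close> surjective, hence
  bijective, and \<open>e\<close> injective, hence bijective. Otherwise some \<open>l^n\<close>
  vanishes, so \<open>h^n\<close> maps \<open>P\<close> into \<open>K\<close> and \<open>e^n\<close>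
  extends over \<open>P\<close>.\<close>

lemma ker_endo:
  assumes s: "ses K k P p I" and sup: "superfluous R (a_kernel P I p) P" and I: "indec I" and P: "fg P"
    and h: "h \<in> Hom P P" and l: "l \<in> Hom I I" and e: "e \<in> Hom K K"
    and hk: "\<And>x. x \<in> carrier K \<Longrightarrow> h (k x) = k (e x)" and lp: "\<And>x. x \<in> carrier P \<Longrightarrow> l (p x) = p (h x)"
  shows "(bij_on I l \<and> bij_on K e) \<or> (\<exists>n r. r \<in> Hom P K \<and> (\<forall>x\<in>carrier K. (e ^^ n) x = r (k x)))"
proof -
  note s = ses_simps[OF s]
  have fgK: "fg K" by (rule fg_mono[OF s(6,1) P])
  consider "bij_on I l" | n where "\<forall>x\<in>carrier I. (l ^^ n) x = \<zero>\<^bsub>I\<^esub>" using indec_endo[OF I l] by blast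
  then show ?thesis
  proof cases
    case 1
    have "mod_epi R P P h"
    proof (rule superfluous_epi[OF sup s(5) h s(3,2,2)])
      fix y assume "y \<in> carrier I"
      then have "y \<in> l ` carrier I" using 1 by (simp add: bij_betw_def)
      then obtain w where w: "w \<in> carrier I" "y = l w" by blast
      then have "w \<in> p ` carrier P" using s(10) by simp
      then obtain x where "x \<in> carrier P" "w = p x" by blast
      then show "\<exists>x\<in>carrier P. p (h x) = y" using w lp by (intro bexI[of _ x]) simp_all
    qed
    then have hb: "bij_on P h" by (rule epi_endo_bij[OF P])
    then have hm: "mod_mono R P P h" using h by (simp add: mod_mono_def bij_betw_def)
    have "mod_mono R K K e"
    proof (rule ker_zero_mono[OF e s(1,1)])
      fix x assume x: "x \<in> carrier K" "e x = \<zero>\<^bsub>K\<^esub>"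
      then have "h (k x) = \<zero>\<^bsub>P\<^esub>" using hk Hom_zero[OF s(4,1,2)] by simp
      then have "k x = \<zero>\<^bsub>P\<^esub>" using mono_zero_iff[OF hm s(2,2) Hom_closed[OF s(4) x(1)]] by simp
      then show "x = \<zero>\<^bsub>K\<^esub>" using mono_zero_iff[OF s(6,1,2) x(1)] by simp
    qed
    then show ?thesis using 1 mono_endo_bij[OF fgK] by blast
  next
    case 2
    note hn = Hom_funpow[OF h, of n] and en = Hom_funpow[OF e, of n]
    have im: "(h ^^ n) ` carrier P \<subseteq> k ` carrier K"
    proof (rule image_subsetI, rule s(9))
      fix x assume x: "x \<in> carrier P"
      show "(h ^^ n) x \<in> carrier P" by (rule Hom_closed[OF hn x])
      have "p ((h ^^ n) x) = (l ^^ n) (p x)" by (rule funpow_intertwine[of "carrier P"]) (use lp Hom_closed[OF h] x in auto)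
      then show "p ((h ^^ n) x) = \<zero>\<^bsub>I\<^esub>" using 2 Hom_closed[OF s(5) x] by simp
    qed
    obtain r where r: "r \<in> Hom P K" "\<And>x. x \<in> carrier P \<Longrightarrow> k (r x) = (h ^^ n) x"
      by (rule factor_mono[OF s(6) hn s(1,2) im]) blast
    have "(e ^^ n) x = r (k x)" if x: "x \<in> carrier K" for x
    proof (rule mono_eq[OF s(6)])
      have kx: "k x \<in> carrier P" by (rule Hom_closed[OF s(4) x])
      show "(e ^^ n) x \<in> carrier K" "r (k x) \<in> carrier K" using Hom_closed[OF en x] Hom_closed[OF r(1) kx] .
      have "k ((e ^^ n) x) = (h ^^ n) (k x)"
        by (rule funpow_intertwine[of "carrier K"]) (use hk Hom_closed[OF e] x in auto)
      then show "k ((e ^^ n) x) = k (r (k x))" using r(2)[OF kx] by simp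
    qed
    then show ?thesis using r(1) by blast
  qed
qed

text \<open>Subtracting \<open>k (e (r y))\<close> moves any \<open>y\<close> into the kernel of
  \<open>e r\<close>. So this kernel and the kernel of \<open>p\<close> together span
  \<open>P\<close>, and by superfluity \<open>e r\<close> vanishes.\<close>

lemma ker_idem_factor:
  assumes s: "ses K k P p I" and sup: "superfluous R (a_kernel P I p) P"
    and e: "e \<in> Hom K K" "\<And>x. x \<in> carrier K \<Longrightarrow> e (e x) = e x"
    and r: "r \<in> Hom P K" "\<And>x. x \<in> carrier K \<Longrightarrow> e x = r (k x)" and x: "x \<in> carrier K"
  shows "e x = \<zero>\<^bsub>K\<^esub>"
proof -
  note s = ses_simps[OF s]
  note er = Hom_comp[OF r(1) e(1)]
  let ?L = "a_kernel P K (\<lambda>y. e (r y))"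
  have L: "sm ?L P" by (rule sm_ker[OF er s(2,1)])
  have rk: "e (r (k z)) = e z" if "z \<in> carrier K" for z using r(2)[OF that] e(2)[OF that] by simp
  have "y \<in> ?L <+>\<^bsub>P\<^esub> a_kernel P I p" if y: "y \<in> carrier P" for y
  proof -
    let ?z = "e (r y)"
    have z: "?z \<in> carrier K" by (rule Hom_closed[OF er y])
    have kz: "k ?z \<in> carrier P" by (rule Hom_closed[OF s(4) z])
    have "e (r (y \<ominus>\<^bsub>P\<^esub> k ?z)) = e (r y) \<ominus>\<^bsub>K\<^esub> e (r (k ?z))" by (rule Hom_minus[OF er s(2,1) y kz])
    also have "\<dots> = \<zero>\<^bsub>K\<^esub>" using rk[OF z] e(2)[OF Hom_closed[OF r(1) y]] z s(1) by simp
    finally have "y \<ominus>\<^bsub>P\<^esub> k ?z \<in> ?L" using y kz s(2) by (simp add: ker_iff)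
    moreover have "k ?z \<in> a_kernel P I p" using s(8)[OF z] kz by (simp add: ker_iff)
    moreover have "y = (y \<ominus>\<^bsub>P\<^esub> k ?z) \<oplus>\<^bsub>P\<^esub> k ?z" using y kz s(2) by simp
    ultimately show ?thesis unfolding set_add_iff by blast
  qed
  then have "?L <+>\<^bsub>P\<^esub> a_kernel P I p = carrier P"
    using sm_subset[OF sm_add[OF s(2) L sm_ker[OF s(5,2,3)]]] by blast
  then have "?L = carrier P" using sup L unfolding superfluous_def by blast
  then have "k x \<in> ?L" using Hom_closed[OF s(4) x] by simp
  then show ?thesis using rk[OF x] by (simp add: ker_iff)
qed

context
  fixes K :: "('a, 'k) module" and P :: "('a, 'p) module" and I :: "('a, 'i) module" and k p
  assumes s: "ses K k P p I" and cov: "projective_cover R P p I" and injP: "inj P"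
    and I: "indec I" "\<not> proj I"
begin

lemma syz_nonzero: "\<exists>x\<in>carrier K. x \<noteq> \<zero>\<^bsub>K\<^esub>"
proof (rule ccontr)
  note s = ses_simps[OF s]
  assume *: "\<not> ?thesis"
  have "mod_mono R P I p"
  proof (rule ker_zero_mono[OF s(5,2,3)])
    fix y assume "y \<in> carrier P" "p y = \<zero>\<^bsub>I\<^esub>"
    then obtain x where "x \<in> carrier K" "y = k x" using s(9) by blast
    then show "y = \<zero>\<^bsub>P\<^esub>" using * Hom_zero[OF s(4,1,2)] by metis
  qed
  then have "bij_betw p (carrier P) (carrier I)" using s(10) by (simp add: bij_betw_def mod_mono_def)
  then have "P \<simeq> I" by (rule miso_bij[OF s(5)])
  then have "proj I" by (rule proj_miso[OF cover_simps(1)[OF cov] _ s(3)])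
  with I(2) show False by blast
qed

lemma syz_indec: "indec K"
proof -
  note c = cover_simps[OF cov] and s' = ses_simps[OF s]
  have fgK: "fg K" by (rule fg_mono[OF s'(6,1) c(5)])
  obtain x0 where x0: "x0 \<in> carrier K" "x0 \<noteq> \<zero>\<^bsub>K\<^esub>" using syz_nonzero by blast
  show ?thesis
  proof (rule indec_of_idem[OF fgK x0])
    fix f assume f: "f \<in> Hom K K" "\<And>z. z \<in> carrier K \<Longrightarrow> f (f z) = f z"
    obtain h l where h: "h \<in> Hom P P" "l \<in> Hom I I" "\<And>x. x \<in> carrier K \<Longrightarrow> h (k x) = k (f x)"
      "\<And>x. x \<in> carrier P \<Longrightarrow> l (p x) = p (h x)" by (rule ker_lift[OF s s injP c(5) f(1)]) blast
    show "bij_on K f \<or> (\<forall>z\<in>carrier K. f z = \<zero>\<^bsub>K\<^esub>)"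
    proof (cases "bij_on K f")
      case False
      then obtain n r where r: "r \<in> Hom P K" "\<And>z. z \<in> carrier K \<Longrightarrow> (f ^^ n) z = r (k z)"
        using ker_endo[OF s c(3) I(1) c(5) h(1,2) f(1) h(3,4)] by blast
      have "f z = f (r (k z))" if z: "z \<in> carrier K" for z
      proof -
        have "f z = f ((f ^^ n) z)"
          by (rule funpow_idem[of "carrier K", symmetric]) (use f(2) Hom_closed[OF f(1)] z in auto)
        then show ?thesis using r(2)[OF z] by simp
      qed
      then show ?thesis using ker_idem_factor[OF s c(3) f Hom_comp[OF r(1) f(1)]] by blast
    qed blast
  qed
qed

lemma syz_no_retraction: assumes "r \<in> Hom P K" "\<And>x. x \<in> carrier K \<Longrightarrow> r (k x) = x" shows False
  using ker_idem_factor[OF s cover_simps(3)[OF cov] Hom_id _ assms(1)] assms(2) syz_nonzero by metis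

lemma syz_not_inj: "\<not> inj K"
proof
  assume K: "inj K"
  note s' = ses_simps[OF s]
  obtain r where "r \<in> Hom P K" "\<And>x. x \<in> carrier K \<Longrightarrow> r (k x) = x"
    by (rule inj_extend[OF K inj_fg[OF K] cover_simps(5)[OF cov] s'(6) Hom_id]) blast
  then show False by (rule syz_no_retraction)
qed

lemma syz_iso_imp:
  assumes s': "ses K' k' P' p' I'" and P': "inj P'" and I': "indec I'" and iso: "K \<simeq> K'"
  shows "I \<simeq> I'"
proof -
  note c = cover_simps[OF cov] and t = ses_simps[OF s]
  obtain f f' where f: "f \<in> Hom K K'" "f' \<in> Hom K' K" "\<And>x. x \<in> carrier K \<Longrightarrow> f' (f x) = x"
    by (rule misoE[OF iso t(1)]) blast
  obtain h l where h: "h \<in> Hom P P'" "l \<in> Hom I I'" "\<And>x. x \<in> carrier K \<Longrightarrow> h (k x) = k' (f x)"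
    "\<And>x. x \<in> carrier P \<Longrightarrow> l (p x) = p' (h x)" by (rule ker_lift[OF s s' P' c(5) f(1)]) blast
  obtain h' l' where h': "h' \<in> Hom P' P" "l' \<in> Hom I' I" "\<And>x. x \<in> carrier K' \<Longrightarrow> h' (k' x) = k (f' x)"
    "\<And>x. x \<in> carrier P' \<Longrightarrow> l' (p' x) = p (h' x)" by (rule ker_lift[OF s' s injP inj_fg[OF P'] f(2)]) blast
  have "h' (h (k x)) = k x" if "x \<in> carrier K" for x
    using that h(3) h'(3) f(3) Hom_closed[OF f(1) that] by simp
  moreover have "l' (l (p x)) = p (h' (h x))" if "x \<in> carrier P" for x
    using that h(4) h'(4) Hom_closed[OF h(1) that] by simp
  ultimately have *: "(bij_on I (\<lambda>x. l' (l x)) \<and> bij_on K (\<lambda>x. x)) \<or>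
      (\<exists>n r. r \<in> Hom P K \<and> (\<forall>x\<in>carrier K. ((\<lambda>x. x) ^^ n) x = r (k x)))"
    by (rule ker_endo[OF s c(3) I(1) c(5) Hom_comp[OF h(1) h'(1)] Hom_comp[OF h(2) h'(2)] Hom_id])
  have "((\<lambda>x. x) ^^ n) z = z" for n and z :: 'k by (induction n) auto
  then have "bij_on I (\<lambda>x. l' (l x))" using * syz_no_retraction by metis
  then have "retract I I'" by (rule bij_on_of_comp[OF I(1) indec_fg[OF I'] h(2) h'(2)])
  then show ?thesis by (rule retract_indec_iso[OF I(1) I'])
qed

end

end

section \<open>Tilting and cotilting modules generated and cogenerated by projective-injectives\<close>

context artin_inj
begin

section \<open>Representatives, additive closures and sums of exact sequences\<close>

lemma rep_exists: "\<lbrakk>iso_representatives R P S; P M\<rbrakk> \<Longrightarrow> \<exists>N\<in>S. M \<simeq> N"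
  unfolding iso_representatives_def by blast

lemma rep_unique: assumes "iso_representatives R P S" "M \<in> S" "N \<in> S" "M \<simeq> N" shows "M = N"
  using assms miso_refl[of M] unfolding iso_representatives_def by blast

lemma rep_prop: "\<lbrakk>iso_representatives R P S; M \<in> S\<rbrakk> \<Longrightarrow> P M"
  unfolding iso_representatives_def by blast

text \<open>Sending each member of \<open>S\<close> to an isomorphic summand in one fixed
  decomposition of \<open>T\<close> is injective. With \<Lambda> and \<open>H\<close> for
  \<open>T\<close> this bounds the sets of representatives.\<close>

lemma finite_of_retracts:
  fixes S :: "'a fgmod set"
  assumes T: "fg T" and S: "\<And>M. M \<in> S \<Longrightarrow> indec M \<and> retract M T" and u: "\<And>M N. \<lbrakk>M \<in> S; N \<in> S; M \<simeq> N\<rbrakk> \<Longrightarrow> M = N"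
  shows "finite S"
proof -
  obtain n X where "decomp T X n" by (rule decomp_exists[OF T])
  then have X: "\<And>i. i < n \<Longrightarrow> indec (X i)" and TX: "T \<simeq> direct_sum {..<n} X" by (auto simp: decomp_def)
  have "\<exists>i. i < n \<and> M \<simeq> X i" if M: "M \<in> S" for M
  proof -
    have iM: "indec M" and "retract M (direct_sum {..<n} X)"
      using S[OF M] retract_trans[OF _ miso_retract[OF TX fg_lm[OF T]]] by auto
    then obtain i where i: "i < n" "retract M (X i)" using retract_ds_indec[OF iM, of "{..<n}" X] X indec_fg by blast
    then show ?thesis using retract_indec_iso[OF iM X] by blast
  qed
  then obtain f where f: "\<And>M. M \<in> S \<Longrightarrow> f M < n \<and> M \<simeq> X (f M)" by metis
  have "inj_on f S"
  proof (rule inj_onI)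
    fix M N assume *: "M \<in> S" "N \<in> S" "f M = f N"
    have "X (f M) \<simeq> N" using f[OF *(2)] miso_sym[of N "X (f N)"] S[OF *(2)] *(3) by simp
    then have "M \<simeq> N" using miso_trans f[OF *(1)] by blast
    then show "M = N" using u * by blast
  qed
  moreover have "f ` S \<subseteq> {..<n}" using f by auto
  ultimately show ?thesis using inj_on_finite finite_lessThan by metis
qed

lemma indec_proj_retract: assumes "indec P" "proj P" shows "retract P (regular_module R)"
  using proj_retract_free[OF assms(2)] retract_power_indec[OF assms(1) fg_regular[OF ring_R]] by blast

lemma indec_inj_retract: assumes "indec I" "inj I" shows "retract I H"
  using inj_retract_cofree[OF assms(2)] retract_power_indec[OF assms(1) inj_fg[OF inj_H]] by blast

lemma add_cat_retract: assumes "X \<in> add_cat R T" shows "\<exists>m. retract X (direct_power m T)"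
proof -
  obtain m and Y :: "'a fgmod" where *: "fg X" "fg Y" "X \<uplus> Y \<simeq> direct_power m T"
    using assms unfolding add_cat_def by blast
  have "retract X (direct_power m T)"
    by (rule retract_trans[OF retract_ds2_l miso_retract[OF *(3)]]) (use * in auto)
  then show ?thesis ..
qed

text \<open>\<open>add_cat\<close> asks for an explicit complement; it is the kernel of the
  retraction, copied to \<open>'a fgmod\<close>.\<close>

lemma retract_add_cat:
  assumes T: "fg T" and X: "fg X" and r: "retract X (direct_power m T)"
  shows "X \<in> add_cat R T"
proof -
  let ?M = "direct_power m T"
  have fgM: "fg ?M" by (rule fg_power[OF ring_R T])
  then have lm: "lm ?M" "lm X" using X by auto
  obtain i p where ip: "i \<in> Hom X ?M" "p \<in> Hom ?M X" "\<And>x. x \<in> carrier X \<Longrightarrow> p (i x) = x"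
    by (rule retractE[OF r]) blast
  note im = split_mono[of i X ?M p, OF ip(1,3)]
  let ?K = "a_kernel ?M X p" and ?L = "i ` carrier X"
  have K: "sm ?K ?M" and L: "sm ?L ?M" using sm_ker[OF ip(2) lm] sm_img[OF ip(1) lm(2,1)] .
  have "?L \<inter> ?K \<subseteq> {\<zero>\<^bsub>?M\<^esub>}"
  proof
    fix y assume y: "y \<in> ?L \<inter> ?K"
    then obtain x where x: "x \<in> carrier X" "y = i x" by blast
    then have "x = \<zero>\<^bsub>X\<^esub>" using y ip(3)[OF x(1)] by (simp add: ker_iff)
    then show "y \<in> {\<zero>\<^bsub>?M\<^esub>}" using x Hom_zero[OF ip(1) lm(2,1)] by simp
  qed
  then have 0: "?L \<inter> ?K = {\<zero>\<^bsub>?M\<^esub>}" using sm_simps(1)[OF K] sm_simps(1)[OF L] by blast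
  have "y \<in> ?L <+>\<^bsub>?M\<^esub> ?K" if y: "y \<in> carrier ?M" for y
  proof -
    have py: "p y \<in> carrier X" by (rule Hom_closed[OF ip(2) y])
    have ipy: "i (p y) \<in> carrier ?M" by (rule Hom_closed[OF ip(1) py])
    have "y \<ominus>\<^bsub>?M\<^esub> i (p y) \<in> ?K"
      using y ipy py lm ip(3)[OF py] by (simp add: ker_iff Hom_minus[OF ip(2) lm])
    moreover have "y = i (p y) \<oplus>\<^bsub>?M\<^esub> (y \<ominus>\<^bsub>?M\<^esub> i (p y))"
      using y ipy lm lm_comm[of ?M "i (p y)" "y \<ominus>\<^bsub>?M\<^esub> i (p y)"] by simp
    ultimately show ?thesis unfolding set_add_iff using py by blast
  qed
  then have s: "?L <+>\<^bsub>?M\<^esub> ?K = carrier ?M" using sm_subset[OF sm_add[OF lm(1) L K]] by blast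
  have iso: "sub ?M ?L \<uplus> sub ?M ?K \<simeq> ?M" by (rule internal_sum_iso[OF lm(1) L K 0 s])
  have XL: "X \<simeq> sub ?M ?L"
    by (rule miso_bij[OF Hom_sub_to[OF ip(1)]]) (use im in \<open>auto simp: mod_mono_def bij_betw_def\<close>)
  obtain Y :: "'a fgmod" where Y: "fg Y" "Y \<simeq> sub ?M ?K" by (rule fg_copy[OF fg_sub[OF fgM K]])
  have "X \<uplus> Y \<simeq> ?M"
    by (rule miso_trans[OF ds2_cong[OF XL Y(2) lm(2) fg_lm[OF Y(1)]] iso])
  then show ?thesis unfolding add_cat_def using X Y(1) by blast
qed

lemma ses_mid:
  assumes "ses A f B g C" "B \<simeq> B'" "lm B'" obtains f' g' where "ses A f' B' g' C"
proof -
  note s = ses_simps[OF assms(1)]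
  obtain \<beta> \<beta>' where \<beta>: "\<beta> \<in> Hom B B'" "\<beta>' \<in> Hom B' B" "\<And>x. x \<in> carrier B \<Longrightarrow> \<beta>' (\<beta> x) = x" "\<And>x. x \<in> carrier B' \<Longrightarrow> \<beta> (\<beta>' x) = x"
    by (rule misoE[OF assms(2) s(2)]) blast
  have "(\<lambda>x. \<beta> (f x)) ` carrier A = a_kernel B' C (\<lambda>x. g (\<beta>' x))"
    using miso_image_kernel[OF \<beta>, of C g] by (simp add: s(11)[symmetric] image_image)
  then have "ses A (\<lambda>x. \<beta> (f x)) B' (\<lambda>x. g (\<beta>' x)) C"
    unfolding short_exact_def
    using s(1,3) assms(3) mono_comp[OF s(6) split_mono[OF \<beta>(1,3)]] epi_comp[OF split_epi[OF \<beta>(1-3)] s(7)] by blast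
  then show ?thesis by (rule that)
qed

text \<open>Serves the sum case of \<open>indec_induct\<close>, where the left term \<open>N\<close>
  is prescribed and the other two terms must again have type \<open>'a fgmod\<close>.\<close>

lemma ses_sum_copy:
  fixes N :: "('a, 'n) module" and E E' :: "'a fgmod"
  assumes s: "ses A j E p Z" "ses A' j' E' p' Z'" and N: "A \<uplus> A' \<simeq> N" "lm N" and E: "PI E" "PI E'"
  obtains E'' Z'' :: "'a fgmod" and j'' p'' where "PI E''" "Z \<uplus> Z' \<simeq> Z''" "Z'' \<simeq> Z \<uplus> Z'" "ses N j'' E'' p'' Z''"
proof -
  obtain E'' :: "'a fgmod" where E'': "PI E''" "E \<uplus> E' \<simeq> E''" by (rule PI_copy[OF PI_ds2[OF E]])
  have fgZ: "fg Z" "fg Z'" using fg_ses(2)[OF s(1)] fg_ses(2)[OF s(2)] E by auto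
  obtain Z'' :: "'a fgmod" where Z'': "fg Z''" "Z \<uplus> Z' \<simeq> Z''" "Z'' \<simeq> Z \<uplus> Z'" by (rule fg_copy[OF fg_ds2[OF fgZ]])
  obtain f g where 1: "ses (A \<uplus> A') f E'' g (Z \<uplus> Z')"
    by (rule ses_mid[OF ses_ds2[OF s] E''(2)]) (use E'' in auto)
  obtain g' where 2: "ses (A \<uplus> A') f E'' g' Z''" by (rule ses_miso[OF 1 Z''(2) fg_lm[OF Z''(1)]])
  obtain f' where "ses N f' E'' g' Z''" by (rule ses_miso1[OF 2 N])
  then show ?thesis using that E''(1) Z''(2,3) by blast
qed

text \<open>The sequence contributed by a projective-injective summand: its cokernel has no
  indecomposable retract, by \<open>indec_retract_nonzero\<close>.\<close>

lemma ses_id_zero: assumes "lm N" shows "ses N (\<lambda>x. x) N (\<lambda>_. \<zero>\<^bsub>N\<^esub>) (sub N {\<zero>\<^bsub>N\<^esub>})"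
proof (rule sesI)
  show "lm (sub N {\<zero>\<^bsub>N\<^esub>})" by (rule lm_sub[OF assms sm_zero[OF assms]])
  have "(\<lambda>_. \<zero>\<^bsub>N\<^esub>) ` carrier N = {\<zero>\<^bsub>N\<^esub>}" using lm_zero[OF assms] by blast
  then show "mod_epi R N (sub N {\<zero>\<^bsub>N\<^esub>}) (\<lambda>_. \<zero>\<^bsub>N\<^esub>)"
    unfolding mod_epi_def using Hom_sub_to[OF Hom_const_zero[OF assms, of N]] by simp
qed (use assms in \<open>auto simp: mod_mono_def Hom_id\<close>)

lemma ses_zero_id: assumes "lm N" shows "ses (sub N {\<zero>\<^bsub>N\<^esub>}) (\<lambda>x. x) N (\<lambda>x. x) N"
  by (rule sesI) (use assms lm_sub[OF assms sm_zero[OF assms]] Hom_sub[OF assms sm_zero[OF assms]] in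
    \<open>auto simp: mod_mono_def mod_epi_def Hom_id\<close>)

lemma indec_retract_nonzero: assumes "indec X" "retract X Z" "lm Z" "carrier Z = {\<zero>\<^bsub>Z\<^esub>}" shows False
proof -
  obtain i p where ip: "i \<in> Hom X Z" "p \<in> Hom Z X" "\<And>x. x \<in> carrier X \<Longrightarrow> p (i x) = x" by (rule retractE[OF assms(2)]) blast
  obtain x where x: "x \<in> carrier X" "x \<noteq> \<zero>\<^bsub>X\<^esub>" by (rule indec_nonzero[OF assms(1)])
  have "i x = \<zero>\<^bsub>Z\<^esub>" using Hom_closed[OF ip(1) x(1)] assms(4) by simp
  then have "x = \<zero>\<^bsub>X\<^esub>" using ip(3)[OF x(1)] Hom_zero[OF ip(2) assms(3)] assms(1) by simp
  with x show False by simp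
qed

text \<open>\<open>f\<close> lifts to a projective-injective module covering \<open>N\<close>
  because \<open>F\<close> is projective, and the lift extends to \<open>E\<close> because that
  module is injective.\<close>

lemma genPI_extend:
  assumes F: "proj F" and E: "fg E" "mod_mono R F E j" and N: "genPI N" and f: "f \<in> Hom F N"
  obtains g where "g \<in> Hom E N" "\<And>x. x \<in> carrier F \<Longrightarrow> g (j x) = f x"
proof -
  obtain Y :: "'a fgmod" and q where Y: "PI Y" "mod_epi R Y N q" by (rule genPI_E[OF N])
  have fgs: "fg Y" "fg N" "fg F" using Y genPI_fg[OF N] F by auto
  obtain l where l: "l \<in> Hom F Y" "\<And>x. x \<in> carrier F \<Longrightarrow> q (l x) = f x"
    by (rule proj_lift[OF F fgs(1,2) Y(2) f]) blast
  obtain L where L: "L \<in> Hom E Y" "\<And>x. x \<in> carrier F \<Longrightarrow> L (j x) = l x"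
    by (rule inj_extend[OF PI_simps(2)[OF Y(1)] fgs(3) E l(1)]) blast
  show ?thesis by (rule that[OF Hom_comp[OF L(1) epi_simps(1)[OF Y(2)]]]) (use l(2) L(2) in simp)
qed

lemma cogenPI_lift:
  assumes I: "inj I" and P: "fg P" "mod_epi R P I p" and N: "cogenPI N" and f: "f \<in> Hom N I"
  obtains g where "g \<in> Hom N P" "\<And>x. x \<in> carrier N \<Longrightarrow> p (g x) = f x"
proof -
  obtain Y :: "'a fgmod" and m where Y: "PI Y" "mod_mono R N Y m" by (rule cogenPI_E[OF N])
  have fgs: "fg Y" "fg N" "fg I" using Y cogenPI_fg[OF N] I by auto
  obtain L where L: "L \<in> Hom Y I" "\<And>x. x \<in> carrier N \<Longrightarrow> L (m x) = f x"
    by (rule inj_extend[OF I fgs(2,1) Y(2) f]) blast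
  obtain G where G: "G \<in> Hom Y P" "\<And>x. x \<in> carrier Y \<Longrightarrow> p (G x) = L x"
    by (rule proj_lift[OF PI_simps(1)[OF Y(1)] P(1) fgs(3) P(2) L(1)]) blast
  show ?thesis
    by (rule that[OF Hom_comp[OF mono_Hom[OF Y(2)] G(1)]]) (use G(2) L(2) Hom_closed[OF mono_Hom[OF Y(2)]] in simp)
qed

lemma envelope_PI:
  assumes "injective_envelope R P j E" "fg P" "ker_PI P" shows "PI E"
proof -
  obtain E0 E1 :: "'a fgmod" and i d where E0: "PI E0" "mod_mono R P E0 i" by (rule ker_PI_E[OF assms(3)])
  have "retract E E0"
    by (rule envelope_retract[OF assms(1) fg_lm[OF assms(2)] _ mono_Hom[OF E0(2)] E0(2)]) (use E0(1) in auto)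
  then show ?thesis by (rule PI_retract[OF _ E0(1) envelope_simps(6)[OF assms(1)]])
qed

lemma cover_PI:
  assumes "projective_cover R P p I" "lm I" "coker_PI I" shows "PI P"
proof -
  obtain P0 P1 :: "'a fgmod" and q d where P0: "PI P0" "mod_epi R P0 I q" by (rule coker_PI_E[OF assms(3)])
  have "retract P P0"
    by (rule cover_retract[OF assms(1,2) _ P0(2)]) (use P0(1) in auto)
  then show ?thesis by (rule PI_retract[OF _ P0(1) cover_simps(6)[OF assms(1)]])
qed

end

locale artin_reps = artin_inj R H for R :: "('a, 'r) ring_scheme" (structure) and H :: "('a, 'h) module" +
  fixes \<Q> \<P> \<I> :: "'a fgmod set" and Q :: "('a, 'a fgmod \<Rightarrow> (nat \<Rightarrow> 'a) set) module"
  assumes reps_Q: "iso_representatives R (\<lambda>M. indecomposable R M \<and> projective R M \<and> injective R M) \<Q>"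
    and reps_P: "iso_representatives R (\<lambda>M. indecomposable R M \<and> projective R M \<and> \<not> injective R M) \<P>"
    and reps_I: "iso_representatives R (\<lambda>M. indecomposable R M \<and> injective R M \<and> \<not> projective R M) \<I>"
    and Q_eq: "Q = direct_sum \<Q> (\<lambda>M. M)"
begin

lemma \<Q>_D: "M \<in> \<Q> \<Longrightarrow> indec M \<and> PI M"
  using rep_prop[OF reps_Q, of M] PI_I[of M] by blast

lemma \<P>_D: "M \<in> \<P> \<Longrightarrow> indec M \<and> proj M \<and> \<not> inj M"
  using rep_prop[OF reps_P, of M] by blast

lemma \<I>_D: "M \<in> \<I> \<Longrightarrow> indec M \<and> inj M \<and> \<not> proj M"
  using rep_prop[OF reps_I, of M] by blast

lemma finite_\<Q>: "finite \<Q>"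
proof (rule finite_of_retracts[OF fg_regular[OF ring_R]])
  fix M assume "M \<in> \<Q>"
  then have "indec M" "PI M" using \<Q>_D by auto
  then show "indec M \<and> retract M (regular_module R)" using indec_proj_retract PI_simps(1) by metis
qed (rule rep_unique[OF reps_Q])

lemma finite_\<P>: "finite \<P>"
proof (rule finite_of_retracts[OF fg_regular[OF ring_R]])
  fix M assume "M \<in> \<P>"
  then show "indec M \<and> retract M (regular_module R)" using \<P>_D indec_proj_retract by metis
qed (rule rep_unique[OF reps_P])

lemma finite_\<I>: "finite \<I>"
proof (rule finite_of_retracts[OF inj_fg[OF inj_H]])
  fix M assume "M \<in> \<I>"
  then show "indec M \<and> retract M H" using \<I>_D indec_inj_retract by metis
qed (rule rep_unique[OF reps_I])

lemma PI_Q: "PI Q"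
  unfolding Q_eq using \<Q>_D finite_\<Q> PI_simps by (intro PI_I proj_ds inj_ds ring_R) blast+

lemma indec_PI_rep: "\<lbrakk>indec X; PI X\<rbrakk> \<Longrightarrow> \<exists>q\<in>\<Q>. X \<simeq> q" for X :: "'a fgmod"
  by (rule rep_exists[OF reps_Q]) simp

lemma retract_Q: "q \<in> \<Q> \<Longrightarrow> retract q Q"
  unfolding Q_eq using \<Q>_D indec_fg fg_lm finite_\<Q> by (intro retract_ds_component[where M = "\<lambda>M. M"]) blast+

lemma PI_retract_Q: assumes "PI Y" shows "\<exists>m. retract Y (direct_power m Q)"
proof (rule retract_power_of_indec)
  fix X :: "'a fgmod" assume X: "indec X" "retract X Y"
  have "PI X" by (rule PI_retract[OF X(2) assms]) (use X in simp)
  then obtain q where q: "q \<in> \<Q>" "X \<simeq> q" using indec_PI_rep[OF X(1)] by blast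
  show "retract X Q" by (rule retract_trans[OF miso_retract[OF q(2)] retract_Q[OF q(1)]]) (use X in simp)
qed (use assms PI_Q in auto)

lemma Gen_iff: "N \<in> Gen R Q \<longleftrightarrow> genPI N"
proof
  assume "N \<in> Gen R Q"
  then obtain m f where "fg N" "mod_epi R (direct_power m Q) N f" unfolding Gen_def by blast
  then show "genPI N" using genPI_I[OF PI_power[OF PI_Q]] fg_lm by blast
next
  assume N: "genPI N"
  then obtain Y :: "'a fgmod" and q where Y: "PI Y" "mod_epi R Y N q" by (rule genPI_E)
  obtain m where m: "retract Y (direct_power m Q)" using PI_retract_Q[OF Y(1)] by blast
  obtain p where "mod_epi R (direct_power m Q) Y p" using retract_epi_mono[OF m] by metis
  then show "N \<in> Gen R Q" unfolding Gen_def using epi_comp[OF _ Y(2)] genPI_fg[OF N] by blast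
qed

lemma Cogen_iff: "N \<in> Cogen R Q \<longleftrightarrow> cogenPI N"
proof
  assume "N \<in> Cogen R Q"
  then obtain m f where "fg N" "mod_mono R N (direct_power m Q) f" unfolding Cogen_def by blast
  then show "cogenPI N" using cogenPI_I[OF PI_power[OF PI_Q]] fg_lm by blast
next
  assume N: "cogenPI N"
  then obtain Y :: "'a fgmod" and q where Y: "PI Y" "mod_mono R N Y q" by (rule cogenPI_E)
  obtain m where m: "retract Y (direct_power m Q)" using PI_retract_Q[OF Y(1)] by blast
  obtain p where "mod_mono R Y (direct_power m Q) p" using retract_epi_mono[OF m] by metis
  then show "N \<in> Cogen R Q" unfolding Cogen_def using mono_comp[OF Y(2)] cogenPI_fg[OF N] by blast
qed

subsection \<open>Tilting modules\<close>

abbreviation cosyz where "cosyz \<equiv> cosyzygy R"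
abbreviation syz where "syz \<equiv> syzygy R"

text \<open>The tags record which members enter as themselves and which through their cosyzygy, so
  that the candidate module is the sum of one finite family.\<close>

definition tilt_ix :: "('a fgmod + 'a fgmod) set" where "tilt_ix = \<Q> <+> \<P>"
definition tilt_fam :: "'a fgmod + 'a fgmod \<Rightarrow> 'a fgmod" where "tilt_fam = case_sum (\<lambda>M. M) cosyz"
definition cotilt_ix :: "('a fgmod + 'a fgmod) set" where "cotilt_ix = \<Q> <+> \<I>"
definition cotilt_fam :: "'a fgmod + 'a fgmod \<Rightarrow> 'a fgmod" where "cotilt_fam = case_sum (\<lambda>M. M) syz"

lemma tilt_sum: "direct_sum2 Q (direct_sum \<P> cosyz) \<simeq> direct_sum tilt_ix tilt_fam"
  unfolding Q_eq tilt_ix_def tilt_fam_def by (rule ds_Plus[OF finite_\<Q> finite_\<P>])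

lemma cotilt_sum: "direct_sum2 Q (direct_sum \<I> syz) \<simeq> direct_sum cotilt_ix cotilt_fam"
  unfolding Q_eq cotilt_ix_def cotilt_fam_def by (rule ds_Plus[OF finite_\<Q> finite_\<I>])

lemma finite_ix: "finite tilt_ix" "finite cotilt_ix"
  using finite_\<Q> finite_\<P> finite_\<I> by (auto simp: tilt_ix_def cotilt_ix_def)

lemma cosyz_fg: "fg M \<Longrightarrow> fg (cosyz M)" and syz_fg: "fg M \<Longrightarrow> fg (syz M)"
  by (rule envelope_exists_cosyzygy, assumption+) (rule cover_exists_syzygy, assumption+)

context
  assumes k: "ker_PI (regular_module R)"
begin

lemma cosyz_data:
  assumes "P \<in> \<P>"
  obtains E :: "'a fgmod" and j p where "injective_envelope R P j E" "ses P j E p (cosyz P)" "PI E" "fg (cosyz P)"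
    "indec (cosyz P)" "\<not> proj (cosyz P)"
proof -
  have P: "indec P" "proj P" "\<not> inj P" "fg P" using \<P>_D[OF assms] by auto
  obtain E :: "'a fgmod" and j p where E: "injective_envelope R P j E" "ses P j E p (cosyz P)" "fg (cosyz P)"
    by (rule envelope_exists_cosyzygy[OF P(4)])
  have PE: "PI E" by (rule envelope_PI[OF E(1) P(4) ker_PI_proj[OF k P(2)]])
  show ?thesis
    using that[OF E(1,2) PE E(3)] cosyz_indec[OF E(2,1) PI_simps(1)[OF PE] P(1,3)] cosyz_not_proj[OF E(2,1) PI_simps(1)[OF PE] P(1,3)]
    by blast
qed

lemma tilt_fam_indec: "i \<in> tilt_ix \<Longrightarrow> indec (tilt_fam i)"
  by (auto simp: tilt_ix_def tilt_fam_def dest: \<Q>_D elim: cosyz_data)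

text \<open>Members of \<Q> are projective and cosyzygies are not, which separates the two kinds;
  two cosyzygies are separated by \<open>cosyz_iso_imp\<close>.\<close>

lemma tilt_fam_noniso:
  assumes "a \<in> tilt_ix" "b \<in> tilt_ix" "a \<noteq> b" shows "\<not> tilt_fam a \<simeq> tilt_fam b"
proof
  assume iso: "tilt_fam a \<simeq> tilt_fam b"
  have np: "\<not> q \<simeq> cosyz P" "\<not> cosyz P \<simeq> q" if qP: "q \<in> \<Q>" "P \<in> \<P>" for q P
  proof -
    have q: "proj q" "lm q" using \<Q>_D[OF qP(1)] by auto
    obtain E :: "'a fgmod" where c: "fg (cosyz P)" "\<not> proj (cosyz P)" by (rule cosyz_data[OF qP(2)])
    show "\<not> q \<simeq> cosyz P" using proj_miso[OF q(1) _ fg_lm[OF c(1)]] c(2) by blast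
    then show "\<not> cosyz P \<simeq> q" using miso_sym[OF _ fg_lm[OF c(1)]] by blast
  qed
  have "P = P'" if PP: "P \<in> \<P>" "P' \<in> \<P>" "cosyz P \<simeq> cosyz P'" for P P'
  proof -
    obtain E :: "'a fgmod" and j p where E: "injective_envelope R P j E" "ses P j E p (cosyz P)" "PI E" by (rule cosyz_data[OF PP(1)])
    obtain E' :: "'a fgmod" and j' p' where E': "ses P' j' E' p' (cosyz P')" "PI E'" by (rule cosyz_data[OF PP(2)])
    have "P \<simeq> P'"
      using cosyz_iso_imp[OF E(2,1) PI_simps(1)[OF E(3)] _ _ E'(1) PI_simps(1)[OF E'(2)] _ PP(3)] \<P>_D[OF PP(1)] \<P>_D[OF PP(2)] by blast
    then show ?thesis by (rule rep_unique[OF reps_P PP(1,2)])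
  qed
  then show False using assms iso np rep_unique[OF reps_Q] by (auto simp: tilt_ix_def tilt_fam_def)
qed

text \<open>Used twice: with \<Lambda> it supplies the exact sequence required of a tilting module,
  and with the kernel of a projective-injective cover of \<open>T\<close> it bounds the summands of
  a given tilting module.\<close>

lemma tilt_copresentation:
  assumes "proj (K :: 'a fgmod)"
  shows "\<exists>(E :: 'a fgmod) (Z :: 'a fgmod) j p. PI E \<and> ses K j E p Z \<and>
    (\<forall>X :: 'a fgmod. indec X \<and> retract X Z \<longrightarrow> (\<exists>P\<in>\<P>. X \<simeq> cosyz P))" (is "?P K")
proof -
  have PIcase: "?P N" if N: "PI N" for N :: "'a fgmod"
  proof -
    have lm: "lm N" using N by simp
    have False if "indec X" "retract X (sub N {\<zero>\<^bsub>N\<^esub>})" for X :: "'a fgmod"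
      by (rule indec_retract_nonzero[OF that]) (simp_all add: lm_sub[OF lm sm_zero[OF lm]])
    then show ?thesis using N ses_id_zero[OF lm] by blast
  qed
  show ?thesis
    using proj_fg[OF assms]
  proof (induction rule: indec_induct)
    case (zero N)
    then show ?case by (intro PIcase PI_zero)
  next
    case (indec N)
    have N: "proj N" by (rule proj_retract[OF assms indec(2) indec_fg[OF indec(1)]])
    show ?case
    proof (cases "inj N")
      case True
      then show ?thesis by (intro PIcase PI_I N)
    next
      case False
      then obtain P where P: "P \<in> \<P>" "N \<simeq> P" using rep_exists[OF reps_P, of N] N indec(1) by blast
      obtain E :: "'a fgmod" and j p where E: "ses P j E p (cosyz P)" "PI E" "indec (cosyz P)" by (rule cosyz_data[OF P(1)])
      have lm: "lm N" using indec(1) by simp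
      obtain j' where j': "ses N j' E p (cosyz P)"
        by (rule ses_miso1[OF E(1) miso_sym[OF P(2) lm] lm])
      have "\<exists>P\<in>\<P>. X \<simeq> cosyz P" if "indec X" "retract X (cosyz P)" for X :: "'a fgmod"
        using retract_indec_iso[OF that(1) E(3) that(2)] P(1) by blast
      then show ?thesis using E(2) j' by blast
    qed
  next
    case (sum A B N)
    then obtain E E' Z Z' :: "'a fgmod" and j p j' p' where *: "PI E" "ses A j E p Z" "PI E'" "ses B j' E' p' Z'"
      and r: "\<forall>X :: 'a fgmod. indec X \<and> retract X Z \<longrightarrow> (\<exists>P\<in>\<P>. X \<simeq> cosyz P)"
        "\<forall>X :: 'a fgmod. indec X \<and> retract X Z' \<longrightarrow> (\<exists>P\<in>\<P>. X \<simeq> cosyz P)" by blast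
    have fgZ: "fg Z" "fg Z'" using fg_ses(2)[OF *(2)] fg_ses(2)[OF *(4)] *(1,3) by auto
    have lmN: "lm N" using \<open>fg N\<close> by simp
    obtain E'' Z'' :: "'a fgmod" and j'' p'' where n: "PI E''" "Z'' \<simeq> Z \<uplus> Z'" "Z \<uplus> Z' \<simeq> Z''" "ses N j'' E'' p'' Z''"
      by (rule ses_sum_copy[OF *(2,4) \<open>A \<uplus> B \<simeq> N\<close> lmN *(1,3)])
    have "\<exists>P\<in>\<P>. X \<simeq> cosyz P" if X: "indec X" "retract X Z''" for X :: "'a fgmod"
    proof -
      have "retract X (Z \<uplus> Z')"
        by (rule retract_trans[OF X(2) miso_retract[OF n(2) ses_simps(3)[OF n(4)]]])
      then show ?thesis using retract_sum_indec[OF X(1) fgZ] r X(1) by blast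
    qed
    then show ?case using n(1,4) by blast
  qed
qed

text \<open>All properties are carried through one induction over the summands. The sequence with
  \<open>F\<close> projective and \<open>I\<close> projective-injective yields both the projective
  dimension and the vanishing of Ext.\<close>

lemma tilt_member_properties:
  fixes N :: "'a fgmod"
  assumes N: "fg N" and sub: "\<And>X :: 'a fgmod. \<lbrakk>indec X; retract X N\<rbrakk> \<Longrightarrow> \<exists>i\<in>tilt_ix. X \<simeq> tilt_fam i"
  shows "genPI N \<and> cogenPI N \<and> (\<exists>(F :: 'a fgmod) (I :: 'a fgmod) i \<pi>. proj F \<and> PI I \<and> ses F i I \<pi> N)" (is "?P N")
proof -
  have PIcase: "?P N" if N: "PI N" for N :: "'a fgmod"
  proof -
    have lm: "lm N" using N by simp
    have "proj (sub N {\<zero>\<^bsub>N\<^esub>})" by (rule proj_zero[OF lm_sub[OF lm sm_zero[OF lm]]]) simp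
    then show ?thesis using N ses_zero_id[OF lm] PI_genPI[OF N] PI_cogenPI[OF N] by blast
  qed
  show ?thesis
    using N
  proof (induction rule: indec_induct)
    case (zero N)
    then show ?case by (intro PIcase PI_zero)
  next
    case (indec X)
    have lm: "lm X" using indec(1) by simp
    obtain i where i: "i \<in> tilt_ix" "X \<simeq> tilt_fam i" using sub[OF indec] by blast
    show ?case
    proof (cases i)
      case (Inl q)
      then have q: "q \<in> \<Q>" "X \<simeq> q" using i by (auto simp: tilt_ix_def tilt_fam_def)
      have "PI X" by (rule PI_retract[OF miso_retract[OF q(2) lm] _ lm]) (use \<Q>_D[OF q(1)] in blast)
      then show ?thesis by (rule PIcase)
    next
      case (Inr P)
      then have P: "P \<in> \<P>" "X \<simeq> cosyz P" using i by (auto simp: tilt_ix_def tilt_fam_def)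
      have P': "proj P" "fg P" using \<P>_D[OF P(1)] by auto
      obtain E :: "'a fgmod" and j p where E: "ses P j E p (cosyz P)" "PI E" "fg (cosyz P)" by (rule cosyz_data[OF P(1)])
      have iso: "cosyz P \<simeq> X" by (rule miso_sym[OF P(2) lm])
      obtain p' where s: "ses P j E p' X" by (rule ses_miso[OF E(1) iso lm])
      have "genPI X" by (rule genPI_I[OF E(2) ses_simps(7)[OF s] lm])
      moreover have "cogenPI X" by (rule coker_cogenPI[OF s P'(2) ker_PI_proj[OF k P'(1)] E(2)])
      ultimately show ?thesis using P'(1) E(2) s by blast
    qed
  next
    case (sum A B N)
    then obtain F F' I I' :: "'a fgmod" and i \<pi> i' \<pi>' where *: "proj F" "PI I" "ses F i I \<pi> A" "proj F'" "PI I'" "ses F' i' I' \<pi>' B"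
      and g: "genPI A" "genPI B" "cogenPI A" "cogenPI B" by blast
    have lm: "lm N" "lm (A \<uplus> B)" using \<open>fg N\<close> \<open>fg A\<close> \<open>fg B\<close> by auto
    have r: "retract N (A \<uplus> B)" by (rule retract_miso[OF \<open>A \<uplus> B \<simeq> N\<close> lm(2)])
    have "genPI N" "cogenPI N"
      using genPI_retract[OF r genPI_ds2[OF g(1,2)] lm(1)] cogenPI_retract[OF r cogenPI_ds2[OF g(3,4)] lm(1)] .
    moreover obtain F'' :: "'a fgmod" where F'': "fg F''" "F \<uplus> F' \<simeq> F''" by (rule fg_copy[of "F \<uplus> F'"]) (use * in auto)
    have pF: "proj F''" by (rule proj_miso[OF proj_ds2[OF *(1,4)] F''(2) fg_lm[OF F''(1)]])
    obtain I'' Z'' :: "'a fgmod" and j'' p'' where n: "PI I''" "A \<uplus> B \<simeq> Z''" "Z'' \<simeq> A \<uplus> B" "ses F'' j'' I'' p'' Z''"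
      by (rule ses_sum_copy[OF *(3,6) F''(2) fg_lm[OF F''(1)] *(2,5)])
    obtain p where "ses F'' j'' I'' p N"
      by (rule ses_miso[OF n(4) miso_trans[OF n(3) \<open>A \<uplus> B \<simeq> N\<close>] lm(1)])
    ultimately show ?case using pF n(1) by blast
  qed
qed

lemma exists_tilting: "\<exists>T :: 'a fgmod. T \<in> Gen R Q \<inter> Cogen R Q \<and> tilting R T"
proof -
  have fgS: "fg (direct_sum tilt_ix tilt_fam)"
    by (rule fg_ds[OF ring_R finite_ix(1)]) (use tilt_fam_indec indec_fg in blast)
  obtain T :: "'a fgmod" where T: "fg T" "T \<simeq> direct_sum tilt_ix tilt_fam" "direct_sum tilt_ix tilt_fam \<simeq> T"
    by (rule fg_copy[OF fgS])
  have fgf: "fg (tilt_fam i)" if "i \<in> tilt_ix" for i using tilt_fam_indec[OF that] by simp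
  have rT: "retract (tilt_fam i) T" if "i \<in> tilt_ix" for i
    by (rule retract_trans[OF retract_ds_component miso_retract[OF T(3) fg_lm[OF fgS]]])
      (use finite_ix(1) that fgf fg_lm in blast)+
  have sub: "\<exists>i\<in>tilt_ix. X \<simeq> tilt_fam i" if X: "indec X" "retract X T" for X :: "'a fgmod"
  proof -
    have "retract X (direct_sum tilt_ix tilt_fam)"
      by (rule retract_trans[OF X(2) miso_retract[OF T(2) fg_lm[OF T(1)]]])
    then obtain i where "i \<in> tilt_ix" "retract X (tilt_fam i)"
      using retract_ds_indec[OF X(1) finite_ix(1), of tilt_fam] fgf by blast
    then show ?thesis using retract_indec_iso[OF X(1) tilt_fam_indec] by blast
  qed
  obtain F I :: "'a fgmod" and i \<pi> where g: "genPI T" "cogenPI T" and s: "proj F" "PI I" "ses F i I \<pi> T"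
    using tilt_member_properties[OF T(1) sub] by blast
  have basic: "basic_module R T"
    by (rule basic_of_family[OF finite_ix(1) tilt_fam_indec tilt_fam_noniso T(1,2)])
  have pd: "projdim R T \<le> 1" by (rule projdim_le_1I[OF s(1) PI_simps(1)[OF s(2)] s(3)])
  have ext: "trivial_group (Ext R 1 T T)" by (rule Ext1_trivial_coker[OF s(3,1,2) g(1)])
  obtain A :: "'a fgmod" where A: "fg A" "regular_module R \<simeq> A" "A \<simeq> regular_module R"
    by (rule fg_copy[OF fg_regular[OF ring_R]])
  have pA: "proj A" by (rule proj_miso[OF proj_regular[OF ring_R] A(2) fg_lm[OF A(1)]])
  obtain E Z :: "'a fgmod" and j p where E: "PI E" "ses A j E p Z"
    and Z: "\<forall>X :: 'a fgmod. indec X \<and> retract X Z \<longrightarrow> (\<exists>P\<in>\<P>. X \<simeq> cosyz P)" using tilt_copresentation[OF pA] by blast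
  obtain j' where j': "ses (regular_module R) j' E p Z" by (rule ses_miso1[OF E(2) A(3) lm_regular[OF ring_R]])
  have fgE: "fg E" "fg Z" using E fg_ses(2)[OF E(2)] by auto
  have "retract X T" if X: "indec X" "retract X E" for X :: "'a fgmod"
  proof -
    have lmX: "lm X" using X by simp
    obtain q where q: "q \<in> \<Q>" "X \<simeq> q" using indec_PI_rep[OF X(1) PI_retract[OF X(2) E(1) lmX]] by blast
    have "Inl q \<in> tilt_ix" unfolding tilt_ix_def by (rule InlI[OF q(1)])
    from rT[OF this] show ?thesis using retract_trans[OF miso_retract[OF q(2) lmX]] by (simp add: tilt_fam_def)
  qed
  then obtain m where "retract E (direct_power m T)" using retract_power_of_indec[OF fgE(1) fg_lm[OF T(1)]] by blast
  then have E': "E \<in> add_cat R T" by (rule retract_add_cat[OF T(1) fgE(1)])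
  have "retract X T" if X: "indec X" "retract X Z" for X :: "'a fgmod"
  proof -
    have lmX: "lm X" using X by simp
    obtain P where P: "P \<in> \<P>" "X \<simeq> cosyz P" using Z X by blast
    have "Inr P \<in> tilt_ix" unfolding tilt_ix_def by (rule InrI[OF P(1)])
    from rT[OF this] show ?thesis using retract_trans[OF miso_retract[OF P(2) lmX]] by (simp add: tilt_fam_def)
  qed
  then obtain m where "retract Z (direct_power m T)" using retract_power_of_indec[OF fgE(2) fg_lm[OF T(1)]] by blast
  then have Z': "Z \<in> add_cat R T" by (rule retract_add_cat[OF T(1) fgE(2)])
  have "tilting R T" unfolding tilting_def using basic pd ext E' Z' j' by blast
  then show ?thesis using g by (auto simp: Gen_iff Cogen_iff)
qed

end

section \<open>Uniqueness of the tilting module\<close>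

lemma add_cat_genPI: assumes "X \<in> add_cat R T" "genPI T" shows "genPI X"
proof -
  obtain m where "retract X (direct_power m T)" using add_cat_retract[OF assms(1)] by blast
  moreover have "lm X" using assms(1) by (simp add: add_cat_def)
  ultimately show ?thesis using genPI_retract[OF _ genPI_power[OF assms(2)]] by blast
qed

lemma add_cat_cogenPI: assumes "X \<in> add_cat R T" "cogenPI T" shows "cogenPI X"
proof -
  obtain m where "retract X (direct_power m T)" using add_cat_retract[OF assms(1)] by blast
  moreover have "lm X" using assms(1) by (simp add: add_cat_def)
  ultimately show ?thesis using cogenPI_retract[OF _ cogenPI_power[OF assms(2)]] by blast
qed

lemma indec_add_cat: assumes "indec X" "retract X M" "M \<in> add_cat R T" "fg T" shows "retract X T"
proof -
  obtain m where "retract M (direct_power m T)" using add_cat_retract[OF assms(3)] by blast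
  then show ?thesis using retract_power_indec[OF assms(1,4) retract_trans[OF assms(2)]] by blast
qed

lemma tilting_ker_PI:
  fixes T :: "('a, 't) module"
  assumes T: "tilting R T" "genPI T" "cogenPI T"
  shows "ker_PI (regular_module R)"
proof -
  obtain T0 T1 :: "'a fgmod" and f g where *: "T0 \<in> add_cat R T" "T1 \<in> add_cat R T" "ses (regular_module R) f T0 g T1"
    using T(1) unfolding tilting_def by blast
  show ?thesis
    by (rule ker_PI_of_tilting[OF proj_regular[OF ring_R] *(3) add_cat_genPI[OF *(1) T(2)]
      add_cat_cogenPI[OF *(1) T(3)] add_cat_cogenPI[OF *(2) T(3)]])
qed

text \<open>Two inclusions between sets of indecomposable retracts. The sequence of \<Lambda> shows
  that every member of the family occurs in \<open>T\<close>; a presentation of \<open>T\<close> by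
  a projective-injective module shows that nothing else does. Basicness turns this into an
  isomorphism by \<open>basic_iso_family\<close>.\<close>

lemma tilting_unique:
  fixes T :: "('a, 't) module"
  assumes T: "tilting R T" "genPI T" "cogenPI T"
  shows "T \<simeq> direct_sum2 Q (direct_sum \<P> cosyz)"
proof -
  note k = tilting_ker_PI[OF T]
  have fgT: "fg T" by (rule genPI_fg[OF T(2)])
  have basic: "basic_module R T" and pd: "projdim R T \<le> 1" using T(1) by (auto simp: tilting_def)
  obtain T0 T1 :: "'a fgmod" and f g where T0: "T0 \<in> add_cat R T" and T1: "T1 \<in> add_cat R T"
    and s: "ses (regular_module R) f T0 g T1"
    using T(1) unfolding tilting_def by blast
  note s' = ses_simps[OF s]
  have fgs: "fg T0" "fg T1" using T0 T1 by (auto simp: add_cat_def)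
  have YT: "retract (tilt_fam i) T" if i: "i \<in> tilt_ix" for i
  proof (cases i)
    case (Inl q)
    then have q: "q \<in> \<Q>" using i by (auto simp: tilt_ix_def)
    have q': "indec q" "PI q" using \<Q>_D[OF q] by auto
    obtain a where a: "mod_mono R q (regular_module R) a"
      using retract_epi_mono[OF indec_proj_retract[OF q'(1) PI_simps(1)[OF q'(2)]]] by metis
    \<comment> \<open>\<open>q\<close> embeds into \<Lambda>, hence into \<open>T0\<close>, and
      splits off because it is injective.\<close>
    have "retract q T0" by (rule inj_mono_retract[OF PI_simps(2)[OF q'(2)] fgs(1) mono_comp[OF a s'(6)]])
    then show ?thesis using indec_add_cat[OF q'(1) _ T0 fgT] by (simp add: Inl tilt_fam_def)
  next
    case (Inr P)
    then have P: "P \<in> \<P>" using i by (auto simp: tilt_ix_def)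
    have P': "indec P" "proj P" "fg P" using \<P>_D[OF P] by auto
    obtain E :: "'a fgmod" and j p where E: "ses P j E p (cosyz P)" "PI E" "fg (cosyz P)" "indec (cosyz P)" "\<not> proj (cosyz P)"
      by (rule cosyz_data[OF k P])
    note e = ses_simps[OF E(1)]
    have fgE: "fg E" using E by simp
    obtain a b where ab: "a \<in> Hom P (regular_module R)" "b \<in> Hom (regular_module R) P" "\<And>x. x \<in> carrier P \<Longrightarrow> b (a x) = x"
      by (rule retractE[OF indec_proj_retract[OF P'(1,2)]]) blast
    obtain h where h: "h \<in> Hom E T0" "\<And>x. x \<in> carrier P \<Longrightarrow> h (j x) = f (a x)"
      by (rule genPI_extend[OF P'(2) fgE e(6) add_cat_genPI[OF T0 T(2)] Hom_comp[OF ab(1) s'(4)]]) blast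
    obtain g' where g': "g' \<in> Hom T0 E" "\<And>y. y \<in> carrier (regular_module R) \<Longrightarrow> g' (f y) = j (b y)"
      by (rule inj_extend[OF PI_simps(2)[OF E(2)] fg_regular[OF ring_R] fgs(1) s'(6) Hom_comp[OF ab(2) e(4)]]) blast
    have "retract (cosyz P) (E \<uplus> T1)" by (rule retract_coker[OF E(1) s ab h g'])
    then have "retract (cosyz P) E \<or> retract (cosyz P) T1" by (rule retract_sum_indec[OF E(4) fgE fgs(2)])
    \<comment> \<open>A retract of \<open>E\<close> is projective, which the cosyzygy is not; so it
      must occur in \<open>T1\<close>.\<close>
    moreover have "\<not> retract (cosyz P) E" using proj_retract[OF PI_simps(1)[OF E(2)] _ E(3)] E(5) by blast
    ultimately show ?thesis using indec_add_cat[OF E(4) _ T1 fgT] by (simp add: Inr tilt_fam_def)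
  qed
  obtain Y :: "'a fgmod" and q where Y: "PI Y" "mod_epi R Y T q" by (rule genPI_E[OF T(2)])
  have fgY: "fg Y" and lmY: "lm Y" using Y by auto
  let ?K = "sub Y (a_kernel Y T q)"
  have sK: "ses ?K (\<lambda>x. x) Y q T" by (rule ses_ker[OF Y(2) lmY fg_lm[OF fgT]])
  obtain P1 P0 :: "'a fgmod" and u v where P: "proj P1" "proj P0" "ses P1 u P0 v T"
    by (rule projdim_le_1D[OF pd fgT])
  \<comment> \<open>Here the bound on the projective dimension enters. The kernel then has a second
    embedding into a projective-injective \<open>E\<close> with cokernel \<open>Z\<close> made of
    cosyzygies, and comparing the two embeddings makes \<open>T\<close> a retract of
    \<open>Y \<uplus> Z\<close>.\<close>
  have pK: "proj ?K" by (rule ker_proj[OF P PI_simps(1)[OF Y(1)] sK])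
  obtain E Z :: "'a fgmod" and j p where E: "PI E" "ses ?K j E p Z"
    and Z: "\<forall>X :: 'a fgmod. indec X \<and> retract X Z \<longrightarrow> (\<exists>P\<in>\<P>. X \<simeq> cosyz P)" using tilt_copresentation[OF k pK] by blast
  have fgE: "fg E" "fg Z" "fg ?K" using E fg_ses(2)[OF E(2)] pK by auto
  obtain h where h: "h \<in> Hom Y E" "\<And>x. x \<in> carrier ?K \<Longrightarrow> h x = j x"
    by (rule inj_extend[OF PI_simps(2)[OF E(1)] fgE(3) fgY ses_simps(6)[OF sK] ses_simps(4)[OF E(2)]]) blast
  obtain h' where h': "h' \<in> Hom E Y" "\<And>x. x \<in> carrier ?K \<Longrightarrow> h' (j x) = x"
    by (rule inj_extend[OF PI_simps(2)[OF Y(1)] fgE(3,1) ses_simps(6)[OF E(2)] ses_simps(4)[OF sK]]) blast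
  have TZ: "retract T (Y \<uplus> Z)" by (rule retract_coker[OF sK E(2) Hom_id Hom_id _ h h']) simp
  have TY: "\<exists>i\<in>tilt_ix. X \<simeq> tilt_fam i" if X: "indec X" "retract X T" for X :: "'a fgmod"
  proof -
    have "retract X Y \<or> retract X Z" by (rule retract_sum_indec[OF X(1) fgY fgE(2) retract_trans[OF X(2) TZ]])
    then show ?thesis
    proof
      assume "retract X Y"
      then have "PI X" by (rule PI_retract[OF _ Y(1) fg_lm[OF indec_fg[OF X(1)]]])
      then obtain q where "q \<in> \<Q>" "X \<simeq> q" using indec_PI_rep[OF X(1)] by blast
      then show ?thesis by (intro bexI[of _ "Inl q"]) (auto simp: tilt_ix_def tilt_fam_def)
    next
      assume "retract X Z"
      then obtain P where "P \<in> \<P>" "X \<simeq> cosyz P" using Z X(1) by blast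
      then show ?thesis by (intro bexI[of _ "Inr P"]) (auto simp: tilt_ix_def tilt_fam_def)
    qed
  qed
  have "T \<simeq> direct_sum tilt_ix tilt_fam"
    by (rule basic_iso_family[OF basic finite_ix(1) tilt_fam_indec[OF k] tilt_fam_noniso[OF k] YT TY])
  moreover have "direct_sum tilt_ix tilt_fam \<simeq> direct_sum2 Q (direct_sum \<P> cosyz)"
    by (rule miso_sym[OF tilt_sum lm_ds2[OF fg_lm[OF proj_fg[OF PI_simps(1)[OF PI_Q]]] lm_ds[OF finite_\<P> _ ring_R]]])
      (use \<P>_D indec_fg cosyz_fg fg_lm in blast)
  ultimately show ?thesis by (rule miso_trans)
qed

end

context artin_reps
begin

subsection \<open>Cotilting modules\<close>

context
  assumes k: "coker_PI H"
begin

lemma syz_data: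
  assumes "I \<in> \<I>"
  obtains P :: "'a fgmod" and p j where "projective_cover R P p I" "ses (syz I) j P p I" "PI P" "fg (syz I)"
    "indec (syz I)" "\<not> inj (syz I)"
proof -
  have I: "indec I" "inj I" "\<not> proj I" "fg I" using \<I>_D[OF assms] by auto
  obtain P :: "'a fgmod" and p j where P: "projective_cover R P p I" "ses (syz I) j P p I" "fg (syz I)"
    by (rule cover_exists_syzygy[OF I(4)])
  have PP: "PI P" by (rule cover_PI[OF P(1) fg_lm[OF I(4)] coker_PI_inj[OF k I(2)]])
  show ?thesis
    using that[OF P(1,2) PP P(3)] syz_indec[OF P(2,1) PI_simps(2)[OF PP] I(1,3)] syz_not_inj[OF P(2,1) PI_simps(2)[OF PP] I(1,3)]
    by blast
qed

lemma cotilt_fam_indec: "i \<in> cotilt_ix \<Longrightarrow> indec (cotilt_fam i)"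
  by (auto simp: cotilt_ix_def cotilt_fam_def dest: \<Q>_D elim: syz_data)

lemma cotilt_fam_noniso:
  assumes "a \<in> cotilt_ix" "b \<in> cotilt_ix" "a \<noteq> b" shows "\<not> cotilt_fam a \<simeq> cotilt_fam b"
proof
  assume iso: "cotilt_fam a \<simeq> cotilt_fam b"
  have np: "\<not> q \<simeq> syz I" "\<not> syz I \<simeq> q" if qI: "q \<in> \<Q>" "I \<in> \<I>" for q I
  proof -
    have q: "inj q" "lm q" using \<Q>_D[OF qI(1)] by auto
    obtain P :: "'a fgmod" where c: "fg (syz I)" "\<not> inj (syz I)" by (rule syz_data[OF qI(2)])
    show "\<not> q \<simeq> syz I" using inj_miso[OF q(1) _ fg_lm[OF c(1)]] c(2) by blast
    then show "\<not> syz I \<simeq> q" using miso_sym[OF _ fg_lm[OF c(1)]] by blast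
  qed
  have "I = I'" if II: "I \<in> \<I>" "I' \<in> \<I>" "syz I \<simeq> syz I'" for I I'
  proof -
    obtain P :: "'a fgmod" and p j where P: "projective_cover R P p I" "ses (syz I) j P p I" "PI P" by (rule syz_data[OF II(1)])
    obtain P' :: "'a fgmod" and p' j' where P': "ses (syz I') j' P' p' I'" "PI P'" by (rule syz_data[OF II(2)])
    have "I \<simeq> I'"
      using syz_iso_imp[OF P(2,1) PI_simps(2)[OF P(3)] _ _ P'(1) PI_simps(2)[OF P'(2)] _ II(3)] \<I>_D[OF II(1)] \<I>_D[OF II(2)] by blast
    then show ?thesis by (rule rep_unique[OF reps_I II(1,2)])
  qed
  then show False using assms iso np rep_unique[OF reps_Q] by (auto simp: cotilt_ix_def cotilt_fam_def)
qed

text \<open>Applied to \<open>H\<close> for the existence of a cotilting module, and to the cokernel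
  of an embedding of \<open>C\<close> into a projective-injective module for its uniqueness.\<close>

lemma cotilt_presentation:
  assumes "inj (W :: 'a fgmod)"
  shows "\<exists>(E :: 'a fgmod) (Z :: 'a fgmod) j p. PI E \<and> ses Z j E p W \<and>
    (\<forall>X :: 'a fgmod. indec X \<and> retract X Z \<longrightarrow> (\<exists>I\<in>\<I>. X \<simeq> syz I))" (is "?P W")
proof -
  have PIcase: "?P N" if N: "PI N" for N :: "'a fgmod"
  proof -
    have lm: "lm N" using N by simp
    have False if "indec X" "retract X (sub N {\<zero>\<^bsub>N\<^esub>})" for X :: "'a fgmod"
      by (rule indec_retract_nonzero[OF that]) (simp_all add: lm_sub[OF lm sm_zero[OF lm]])
    then show ?thesis using N ses_zero_id[OF lm] by blast
  qed
  show ?thesis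
    using inj_fg[OF assms]
  proof (induction rule: indec_induct)
    case (zero N)
    then show ?case by (intro PIcase PI_zero)
  next
    case (indec N)
    have N: "inj N" by (rule inj_retract[OF assms indec(2) indec_fg[OF indec(1)]])
    show ?case
    proof (cases "proj N")
      case True
      then show ?thesis by (intro PIcase PI_I N)
    next
      case False
      then obtain I where I: "I \<in> \<I>" "N \<simeq> I" using rep_exists[OF reps_I, of N] N indec(1) by blast
      obtain P :: "'a fgmod" and p j where P: "ses (syz I) j P p I" "PI P" "indec (syz I)" by (rule syz_data[OF I(1)])
      have lm: "lm N" using indec(1) by simp
      obtain p' where p': "ses (syz I) j P p' N"
        by (rule ses_miso[OF P(1) miso_sym[OF I(2) lm] lm])
      have "\<exists>I\<in>\<I>. X \<simeq> syz I" if "indec X" "retract X (syz I)" for X :: "'a fgmod"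
        using retract_indec_iso[OF that(1) P(3) that(2)] I(1) by blast
      then show ?thesis using P(2) p' by blast
    qed
  next
    case (sum A B N)
    then obtain E E' Z Z' :: "'a fgmod" and j p j' p' where *: "PI E" "ses Z j E p A" "PI E'" "ses Z' j' E' p' B"
      and r: "\<forall>X :: 'a fgmod. indec X \<and> retract X Z \<longrightarrow> (\<exists>I\<in>\<I>. X \<simeq> syz I)"
        "\<forall>X :: 'a fgmod. indec X \<and> retract X Z' \<longrightarrow> (\<exists>I\<in>\<I>. X \<simeq> syz I)" by blast
    have fgZ: "fg Z" "fg Z'" using fg_ses(1)[OF *(2)] fg_ses(1)[OF *(4)] *(1,3) by auto
    have lmN: "lm N" using \<open>fg N\<close> by simp
    obtain Z'' :: "'a fgmod" where Z'': "fg Z''" "Z \<uplus> Z' \<simeq> Z''" "Z'' \<simeq> Z \<uplus> Z'" by (rule fg_copy[OF fg_ds2[OF fgZ]])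
    obtain E'' N' :: "'a fgmod" and j'' p'' where n: "PI E''" "A \<uplus> B \<simeq> N'" "N' \<simeq> A \<uplus> B" "ses Z'' j'' E'' p'' N'"
      by (rule ses_sum_copy[OF *(2,4) Z''(2) fg_lm[OF Z''(1)] *(1,3)])
    obtain q where q: "ses Z'' j'' E'' q N"
      by (rule ses_miso[OF n(4) miso_trans[OF n(3) \<open>A \<uplus> B \<simeq> N\<close>] lmN])
    have "\<exists>I\<in>\<I>. X \<simeq> syz I" if X: "indec X" "retract X Z''" for X :: "'a fgmod"
    proof -
      have "retract X (Z \<uplus> Z')"
        by (rule retract_trans[OF X(2) miso_retract[OF Z''(3) fg_lm[OF Z''(1)]]])
      then show ?thesis using retract_sum_indec[OF X(1) fgZ] r X(1) by blast
    qed
    then show ?case using n(1) q by blast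
  qed
qed

lemma cotilt_member_properties:
  fixes N :: "'a fgmod"
  assumes N: "fg N" and sub: "\<And>X :: 'a fgmod. \<lbrakk>indec X; retract X N\<rbrakk> \<Longrightarrow> \<exists>i\<in>cotilt_ix. X \<simeq> cotilt_fam i"
  shows "genPI N \<and> cogenPI N \<and> (\<exists>(I :: 'a fgmod) (E :: 'a fgmod) n \<epsilon>. inj E \<and> PI I \<and> ses N n I \<epsilon> E)" (is "?P N")
proof -
  have PIcase: "?P N" if N: "PI N" for N :: "'a fgmod"
  proof -
    have lm: "lm N" using N by simp
    have "inj (sub N {\<zero>\<^bsub>N\<^esub>})" by (rule inj_zero[OF lm_sub[OF lm sm_zero[OF lm]]]) simp
    then show ?thesis using N ses_id_zero[OF lm] PI_genPI[OF N] PI_cogenPI[OF N] by blast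
  qed
  show ?thesis
    using N
  proof (induction rule: indec_induct)
    case (zero N)
    then show ?case by (intro PIcase PI_zero)
  next
    case (indec X)
    have lm: "lm X" using indec(1) by simp
    obtain i where i: "i \<in> cotilt_ix" "X \<simeq> cotilt_fam i" using sub[OF indec] by blast
    show ?case
    proof (cases i)
      case (Inl q)
      then have q: "q \<in> \<Q>" "X \<simeq> q" using i by (auto simp: cotilt_ix_def cotilt_fam_def)
      have "PI X" by (rule PI_retract[OF miso_retract[OF q(2) lm] _ lm]) (use \<Q>_D[OF q(1)] in blast)
      then show ?thesis by (rule PIcase)
    next
      case (Inr I)
      then have I: "I \<in> \<I>" "X \<simeq> syz I" using i by (auto simp: cotilt_ix_def cotilt_fam_def)
      have I': "inj I" "fg I" using \<I>_D[OF I(1)] by auto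
      obtain P :: "'a fgmod" and p j where P: "ses (syz I) j P p I" "PI P" "fg (syz I)" by (rule syz_data[OF I(1)])
      have iso: "syz I \<simeq> X" by (rule miso_sym[OF I(2) lm])
      obtain j' where s: "ses X j' P p I" by (rule ses_miso1[OF P(1) iso lm])
      have "cogenPI X" by (rule cogenPI_I[OF P(2) ses_simps(6)[OF s] lm])
      moreover have "genPI X" by (rule ker_genPI[OF s I'(2) coker_PI_inj[OF k I'(1)] P(2)])
      ultimately show ?thesis using I'(1) P(2) s by blast
    qed
  next
    case (sum A B N)
    then obtain F F' I I' :: "'a fgmod" and i \<pi> i' \<pi>' where *: "inj F" "PI I" "ses A i I \<pi> F" "inj F'" "PI I'" "ses B i' I' \<pi>' F'"
      and g: "genPI A" "genPI B" "cogenPI A" "cogenPI B" by blast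
    have lm: "lm N" "lm (A \<uplus> B)" using \<open>fg N\<close> \<open>fg A\<close> \<open>fg B\<close> by auto
    have r: "retract N (A \<uplus> B)" by (rule retract_miso[OF \<open>A \<uplus> B \<simeq> N\<close> lm(2)])
    have "genPI N" "cogenPI N"
      using genPI_retract[OF r genPI_ds2[OF g(1,2)] lm(1)] cogenPI_retract[OF r cogenPI_ds2[OF g(3,4)] lm(1)] .
    moreover obtain I'' F'' :: "'a fgmod" and j'' p'' where n: "PI I''" "F \<uplus> F' \<simeq> F''" "F'' \<simeq> F \<uplus> F'" "ses N j'' I'' p'' F''"
      by (rule ses_sum_copy[OF *(3,6) \<open>A \<uplus> B \<simeq> N\<close> lm(1) *(2,5)])
    moreover have "inj F''" by (rule inj_miso[OF inj_ds2[OF *(1,4)] n(2) ses_simps(3)[OF n(4)]])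
    ultimately show ?case by blast
  qed
qed

text \<open>\<open>cotilting\<close> speaks of \<open>K\<close> and \<open>J\<close>, which are
  absent here; so its clauses are spelled out with \<open>H\<close> in place of D \<Lambda>.\<close>

lemma exists_cotilting:
  "\<exists>C :: 'a fgmod. C \<in> Gen R Q \<inter> Cogen R Q \<and> basic_module R C \<and> injdim R C \<le> 1 \<and> trivial_group (Ext R 1 C C) \<and>
    (\<exists>(C0 :: 'a fgmod) (C1 :: 'a fgmod) f g. C0 \<in> add_cat R C \<and> C1 \<in> add_cat R C \<and> ses C0 f C1 g H)"
proof -
  have fgS: "fg (direct_sum cotilt_ix cotilt_fam)"
    by (rule fg_ds[OF ring_R finite_ix(2)]) (use cotilt_fam_indec indec_fg in blast)
  obtain T :: "'a fgmod" where T: "fg T" "T \<simeq> direct_sum cotilt_ix cotilt_fam" "direct_sum cotilt_ix cotilt_fam \<simeq> T"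
    by (rule fg_copy[OF fgS])
  have fgf: "fg (cotilt_fam i)" if "i \<in> cotilt_ix" for i using cotilt_fam_indec[OF that] by simp
  have rT: "retract (cotilt_fam i) T" if "i \<in> cotilt_ix" for i
    by (rule retract_trans[OF retract_ds_component miso_retract[OF T(3) fg_lm[OF fgS]]])
      (use finite_ix(2) that fgf fg_lm in blast)+
  have sub: "\<exists>i\<in>cotilt_ix. X \<simeq> cotilt_fam i" if X: "indec X" "retract X T" for X :: "'a fgmod"
  proof -
    have "retract X (direct_sum cotilt_ix cotilt_fam)"
      by (rule retract_trans[OF X(2) miso_retract[OF T(2) fg_lm[OF T(1)]]])
    then obtain i where "i \<in> cotilt_ix" "retract X (cotilt_fam i)"
      using retract_ds_indec[OF X(1) finite_ix(2), of cotilt_fam] fgf by blast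
    then show ?thesis using retract_indec_iso[OF X(1) cotilt_fam_indec] by blast
  qed
  obtain I F :: "'a fgmod" and i \<pi> where g: "genPI T" "cogenPI T" and s: "inj F" "PI I" "ses T i I \<pi> F"
    using cotilt_member_properties[OF T(1) sub] by blast
  have basic: "basic_module R T"
    by (rule basic_of_family[OF finite_ix(2) cotilt_fam_indec cotilt_fam_noniso T(1,2)])
  have id: "injdim R T \<le> 1" by (rule injdim_le_1I[OF s(1) PI_simps(2)[OF s(2)] s(3)])
  have ext: "trivial_group (Ext R 1 T T)" by (rule Ext1_trivial_ker[OF s(3,1,2) g(2)])
  obtain A :: "'a fgmod" where A: "fg A" "H \<simeq> A" "A \<simeq> H"
    by (rule fg_copy[OF inj_fg[OF inj_H]])
  have iA: "inj A" by (rule inj_miso[OF inj_H A(2) fg_lm[OF A(1)]])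
  obtain E Z :: "'a fgmod" and j p where E: "PI E" "ses Z j E p A"
    and Z: "\<forall>X :: 'a fgmod. indec X \<and> retract X Z \<longrightarrow> (\<exists>I\<in>\<I>. X \<simeq> syz I)" using cotilt_presentation[OF iA] by blast
  obtain p' where p': "ses Z j E p' H" by (rule ses_miso[OF E(2) A(3) fg_lm[OF inj_fg[OF inj_H]]])
  have fgE: "fg E" "fg Z" using E fg_ses(1)[OF E(2)] by auto
  have "retract X T" if X: "indec X" "retract X E" for X :: "'a fgmod"
  proof -
    have lmX: "lm X" using X by simp
    obtain q where q: "q \<in> \<Q>" "X \<simeq> q" using indec_PI_rep[OF X(1) PI_retract[OF X(2) E(1) lmX]] by blast
    have "Inl q \<in> cotilt_ix" unfolding cotilt_ix_def by (rule InlI[OF q(1)])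
    from rT[OF this] show ?thesis using retract_trans[OF miso_retract[OF q(2) lmX]] by (simp add: cotilt_fam_def)
  qed
  then obtain m where "retract E (direct_power m T)" using retract_power_of_indec[OF fgE(1) fg_lm[OF T(1)]] by blast
  then have E': "E \<in> add_cat R T" by (rule retract_add_cat[OF T(1) fgE(1)])
  have "retract X T" if X: "indec X" "retract X Z" for X :: "'a fgmod"
  proof -
    have lmX: "lm X" using X by simp
    obtain I where I: "I \<in> \<I>" "X \<simeq> syz I" using Z X by blast
    have "Inr I \<in> cotilt_ix" unfolding cotilt_ix_def by (rule InrI[OF I(1)])
    from rT[OF this] show ?thesis using retract_trans[OF miso_retract[OF I(2) lmX]] by (simp add: cotilt_fam_def)
  qed
  then obtain m where "retract Z (direct_power m T)" using retract_power_of_indec[OF fgE(2) fg_lm[OF T(1)]] by blast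
  then have Z': "Z \<in> add_cat R T" by (rule retract_add_cat[OF T(1) fgE(2)])
  have "T \<in> Gen R Q \<inter> Cogen R Q" using g by (auto simp: Gen_iff Cogen_iff)
  then show ?thesis using basic id ext E' Z' p' by blast
qed

end

lemma cotilting_coker_PI:
  fixes C0 C1 :: "'a fgmod"
  assumes "C0 \<in> add_cat R C" "C1 \<in> add_cat R C" "ses C0 f C1 g H" "genPI C" "cogenPI C"
  shows "coker_PI H"
  by (rule coker_PI_of_cotilting[OF inj_H assms(3) add_cat_genPI[OF assms(2,4)]
      add_cat_cogenPI[OF assms(2,5)] add_cat_genPI[OF assms(1,4)]])

text \<open>A projective-injective \<open>q\<close> is a quotient of \<open>H\<close>, hence of
  \<open>C1\<close>, and splits off because it is projective. A syzygy is a retract of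
  \<open>P \<uplus> C0\<close> but not of the injective \<open>P\<close>. Conversely, injective
  dimension at most 1 makes the cokernel of \<open>C\<close> in \<open>Y\<close> injective, and its
  presentation bounds the summands of \<open>C\<close>.\<close>

lemma cotilting_unique:
  fixes C :: "('a, 'c) module" and C0 C1 :: "'a fgmod"
  assumes C: "genPI C" "cogenPI C" and basic: "basic_module R C" and id: "injdim R C \<le> 1"
    and C0: "C0 \<in> add_cat R C" and C1: "C1 \<in> add_cat R C" and s: "ses C0 f C1 g H"
  shows "C \<simeq> direct_sum2 Q (direct_sum \<I> syz)"
proof -
  note k = cotilting_coker_PI[OF C0 C1 s C]
  have fgC: "fg C" by (rule genPI_fg[OF C(1)])
  note s' = ses_simps[OF s]
  have fgs: "fg C0" "fg C1" using C0 C1 by (auto simp: add_cat_def)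
  have fgH: "fg H" by (rule inj_fg[OF inj_H])
  have YT: "retract (cotilt_fam i) C" if i: "i \<in> cotilt_ix" for i
  proof (cases i)
    case (Inl q)
    then have q: "q \<in> \<Q>" using i by (auto simp: cotilt_ix_def)
    have q': "indec q" "PI q" using \<Q>_D[OF q] by auto
    obtain a where a: "mod_epi R H q a"
      using retract_epi_mono[OF indec_inj_retract[OF q'(1) PI_simps(2)[OF q'(2)]]] by metis
    have "retract q C1" by (rule proj_epi_retract[OF PI_simps(1)[OF q'(2)] fgs(2) epi_comp[OF s'(7) a]])
    then show ?thesis using indec_add_cat[OF q'(1) _ C1 fgC] by (simp add: Inl cotilt_fam_def)
  next
    case (Inr I)
    then have I: "I \<in> \<I>" using i by (auto simp: cotilt_ix_def)
    have I': "indec I" "inj I" "fg I" using \<I>_D[OF I] by auto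
    obtain P :: "'a fgmod" and p j where P: "ses (syz I) j P p I" "PI P" "fg (syz I)" "indec (syz I)" "\<not> inj (syz I)"
      by (rule syz_data[OF k I])
    note e = ses_simps[OF P(1)]
    have fgP: "fg P" using P by simp
    obtain a b where ab: "a \<in> Hom I H" "b \<in> Hom H I" "\<And>x. x \<in> carrier I \<Longrightarrow> b (a x) = x"
      by (rule retractE[OF indec_inj_retract[OF I'(1,2)]]) blast
    obtain h where h: "h \<in> Hom P C1" "\<And>x. x \<in> carrier P \<Longrightarrow> g (h x) = a (p x)"
      by (rule proj_lift[OF PI_simps(1)[OF P(2)] fgs(2) fgH s'(7) Hom_comp[OF e(5) ab(1)]]) blast
    obtain g' where g': "g' \<in> Hom C1 P" "\<And>y. y \<in> carrier C1 \<Longrightarrow> p (g' y) = b (g y)"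
      by (rule cogenPI_lift[OF I'(2) fgP e(7) add_cat_cogenPI[OF C1 C(2)] Hom_comp[OF s'(5) ab(2)]]) blast
    have "retract (syz I) (P \<uplus> C0)" by (rule retract_ker[OF P(1) s ab h g'])
    then have "retract (syz I) P \<or> retract (syz I) C0" by (rule retract_sum_indec[OF P(4) fgP fgs(1)])
    moreover have "\<not> retract (syz I) P" using inj_retract[OF PI_simps(2)[OF P(2)] _ P(3)] P(5) by blast
    ultimately show ?thesis using indec_add_cat[OF P(4) _ C0 fgC] by (simp add: Inr cotilt_fam_def)
  qed
  obtain Y :: "'a fgmod" and m where Y: "PI Y" "mod_mono R C Y m" by (rule cogenPI_E[OF C(2)])
  have fgY: "fg Y" using Y by auto
  obtain V :: "'a fgmod" and q where V: "fg V" "ses C m Y q V" by (rule ses_coker[OF Y(2) fg_lm[OF fgC] fgY])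
  obtain E1 E0 :: "'a fgmod" and u v where E: "inj E1" "inj E0" "ses C u E0 v E1"
    by (rule injdim_le_1D[OF id fgC])
  have iV: "inj V" by (rule coker_inj[OF E PI_simps(2)[OF Y(1)] V(2)])
  obtain P Z :: "'a fgmod" and j p where P: "PI P" "ses Z j P p V"
    and Z: "\<forall>X :: 'a fgmod. indec X \<and> retract X Z \<longrightarrow> (\<exists>I\<in>\<I>. X \<simeq> syz I)" using cotilt_presentation[OF k iV] by blast
  have fgP: "fg P" "fg Z" using P fg_ses(1)[OF P(2)] by auto
  obtain h where h: "h \<in> Hom Y P" "\<And>x. x \<in> carrier Y \<Longrightarrow> p (h x) = q x"
    by (rule proj_lift[OF PI_simps(1)[OF Y(1)] fgP(1) V(1) ses_simps(7)[OF P(2)] ses_simps(5)[OF V(2)]]) blast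
  obtain h' where h': "h' \<in> Hom P Y" "\<And>x. x \<in> carrier P \<Longrightarrow> q (h' x) = p x"
    by (rule proj_lift[OF PI_simps(1)[OF P(1)] fgY V(1) ses_simps(7)[OF V(2)] ses_simps(5)[OF P(2)]]) blast
  have CZ: "retract C (Y \<uplus> Z)" by (rule retract_ker[OF V(2) P(2) Hom_id Hom_id _ h h']) simp
  have TY: "\<exists>i\<in>cotilt_ix. X \<simeq> cotilt_fam i" if X: "indec X" "retract X C" for X :: "'a fgmod"
  proof -
    have "retract X Y \<or> retract X Z" by (rule retract_sum_indec[OF X(1) fgY fgP(2) retract_trans[OF X(2) CZ]])
    then show ?thesis
    proof
      assume "retract X Y"
      then have "PI X" by (rule PI_retract[OF _ Y(1) fg_lm[OF indec_fg[OF X(1)]]])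
      then obtain q where "q \<in> \<Q>" "X \<simeq> q" using indec_PI_rep[OF X(1)] by blast
      then show ?thesis by (intro bexI[of _ "Inl q"]) (auto simp: cotilt_ix_def cotilt_fam_def)
    next
      assume "retract X Z"
      then obtain I where "I \<in> \<I>" "X \<simeq> syz I" using Z X(1) by blast
      then show ?thesis by (intro bexI[of _ "Inr I"]) (auto simp: cotilt_ix_def cotilt_fam_def)
    qed
  qed
  have "C \<simeq> direct_sum cotilt_ix cotilt_fam"
    by (rule basic_iso_family[OF basic finite_ix(2) cotilt_fam_indec[OF k] cotilt_fam_noniso[OF k] YT TY])
  moreover have "direct_sum cotilt_ix cotilt_fam \<simeq> direct_sum2 Q (direct_sum \<I> syz)"
    by (rule miso_sym[OF cotilt_sum lm_ds2[OF fg_lm[OF proj_fg[OF PI_simps(1)[OF PI_Q]]] lm_ds[OF finite_\<I> _ ring_R]]])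
      (use \<I>_D indec_fg syz_fg fg_lm in blast)
  ultimately show ?thesis by (rule miso_trans)
qed

end

section \<open>The dual of an artin algebra\<close>

context artin_ring
begin

lemma sm_jacobson_radical: assumes "cring R" shows "sm (jacobson_radical R) (regular_module R)"
  by (rule smI[OF lm_regular[OF ring_R]])
    (auto simp: jacobson_radical_def intro: additive_subgroup.zero_closed additive_subgroup.a_closed
      ideal.I_l_closed maximalideal.axioms(1) ideal.axioms(1) ring.ring_simprules[OF ring_R])

text \<open>A minimal ideal not contained in the maximal ideal \<open>m\<close> is contained in all other maximal ideals,
  so multiplication by an element of it outside \<open>m\<close> maps every ideal below \<open>m\<close> into the radical.\<close>

lemma residue_hom:
  assumes "cring R" and A: "sm A (regular_module R)" "A \<noteq> carrier R"
  obtains \<theta> where "\<theta> \<in> Hom (regular_module R) (quot_module (regular_module R) (jacobson_radical R))"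
    "\<And>a. a \<in> A \<Longrightarrow> \<theta> a = \<zero>\<^bsub>quot_module (regular_module R) (jacobson_radical R)\<^esub>"
    "\<theta> \<one> \<noteq> \<zero>\<^bsub>quot_module (regular_module R) (jacobson_radical R)\<^esub>"
proof -
  interpret cring R by (rule assms(1))
  let ?M = "regular_module R" and ?r = "jacobson_radical R"
  note si = sm_regular_iff[OF assms(1)]
  have lm: "lm ?M" by (rule lm_regular[OF ring_R])
  obtain m where m: "sm m ?M" "m \<noteq> carrier R" "A \<subseteq> m"
    and max: "\<And>L. \<lbrakk>sm L ?M; L \<noteq> carrier R; A \<subseteq> L; m \<subseteq> L\<rbrakk> \<Longrightarrow> L = m"
  proof (rule chain_extremal[OF cc_regular, of A "{L. sm L ?M \<and> L \<noteq> carrier R \<and> A \<subseteq> L}" True])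
    fix N assume "N \<in> {L. sm L ?M \<and> L \<noteq> carrier R \<and> A \<subseteq> L}"
      and "\<And>L. \<lbrakk>L \<in> {L. sm L ?M \<and> L \<noteq> carrier R \<and> A \<subseteq> L}; chain_le True N L\<rbrakk> \<Longrightarrow> L = N"
    then show thesis by (intro that[of N]) (simp_all add: chain_le_def)
  qed (use A in simp_all)
  have m_max: "maximalideal m R"
  proof (rule maximalidealI)
    show "ideal m R" "carrier R \<noteq> m" using m(1,2) si by auto
    show "L = m \<or> L = carrier R" if "ideal L R" "m \<subseteq> L" for L
      using max[of L] that m(3) si by blast
  qed
  obtain V where V: "sm V ?M" "\<not> V \<subseteq> m" and min: "\<And>L. \<lbrakk>sm L ?M; \<not> L \<subseteq> m; L \<subseteq> V\<rbrakk> \<Longrightarrow> L = V"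
  proof (rule chain_extremal[OF cc_regular, of "carrier R" "{L. sm L ?M \<and> \<not> L \<subseteq> m}" False])
    show "carrier R \<in> {L. sm L ?M \<and> \<not> L \<subseteq> m}" using sm_carrier[OF lm] m(2) sm_subset[OF m(1)] by auto
    fix N assume "N \<in> {L. sm L ?M \<and> \<not> L \<subseteq> m}"
      and "\<And>L. \<lbrakk>L \<in> {L. sm L ?M \<and> \<not> L \<subseteq> m}; chain_le False N L\<rbrakk> \<Longrightarrow> L = N"
    then show thesis by (intro that[of N]) (simp_all add: chain_le_def)
  qed simp_all
  obtain u where u: "u \<in> V" "u \<notin> m" using V(2) by blast
  have uR: "u \<in> carrier R" using sm_mem[OF V(1) u(1)] by simp
  \<comment> \<open>If \<open>u\<close> is outside \<open>m'\<close>, then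
    \<open>V \<inter> m'\<close> is smaller than \<open>V\<close> and lies in \<open>m\<close> by
    minimality. But for \<open>w\<close> in \<open>m'\<close> outside \<open>m\<close> the product
    \<open>u w\<close> is in this intersection and, \<open>m\<close> being prime, not in
    \<open>m\<close>.\<close>
  have um: "u \<in> m'" if m': "maximalideal m' R" "m' \<noteq> m" for m'
  proof (rule ccontr)
    assume nu: "u \<notin> m'"
    interpret m': maximalideal m' R by (rule m'(1))
    interpret m: maximalideal m R by (rule m_max)
    have s': "sm m' ?M" using si m'.is_ideal by blast
    have "V \<inter> m' \<noteq> V" using u(1) nu by blast
    then have sub: "V \<inter> m' \<subseteq> m" using min[OF sm_Int[OF lm V(1) s']] by blast
    have "\<not> m' \<subseteq> m" using m'.I_maximal[OF m.is_ideal _ m.a_subset] m'(2) m(2) by blast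
    then obtain w where w: "w \<in> m'" "w \<notin> m" by blast
    have wR: "w \<in> carrier R" using w(1) m'.a_subset by blast
    have "u \<otimes> w \<in> V \<inter> m'"
      using sm_simps(3)[OF V(1), of w u] m'.I_l_closed[OF w(1) uR] u(1) wR uR by (simp add: m_comm)
    then show False
      using primeideal.I_prime[OF maximalideal_prime[OF m_max] uR wR] sub u(2) w(2) by blast
  qed
  have r: "sm ?r ?M" by (rule sm_jacobson_radical[OF assms(1)])
  let ?q = "\<lambda>x. a_r_coset ?M ?r x"
  note q = lm_quot[OF lm r]
  have 0: "?q x = \<zero>\<^bsub>quot_module ?M ?r\<^esub> \<longleftrightarrow> x \<in> ?r" if "x \<in> carrier R" for x
    using q(3) that by (auto simp: set_eq_iff ker_iff)
  show ?thesis
  proof (rule that[of "\<lambda>x. ?q (u \<otimes> x)"])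
    show "(\<lambda>x. ?q (u \<otimes> x)) \<in> Hom ?M (quot_module ?M ?r)"
      by (rule Hom_comp[OF Hom_mult[OF assms(1) uR] epi_simps(1)[OF q(2)]])
    show "?q (u \<otimes> \<one>) \<noteq> \<zero>\<^bsub>quot_module ?M ?r\<^esub>"
      using 0[OF uR] uR u(2) m_max by (auto simp: jacobson_radical_def)
    fix a assume a: "a \<in> A"
    have aR: "a \<in> carrier R" using sm_mem[OF A(1) a] by simp
    have "u \<otimes> a \<in> m'" if m': "maximalideal m' R" for m'
    proof -
      interpret m': maximalideal m' R by (rule m')
      show ?thesis using um[OF m'] a m(3) m'.I_l_closed[of a u] m'.I_r_closed[of u a] uR aR by blast
    qed
    then have "u \<otimes> a \<in> ?r" using uR aR by (auto simp: jacobson_radical_def)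
    then show "?q (u \<otimes> a) = \<zero>\<^bsub>quot_module ?M ?r\<^esub>" using 0 uR aR by simp
  qed
qed

text \<open>\<open>K x\<close> is \<open>K\<close> modulo the annihilator of \<open>x\<close>. A map
  from \<open>K\<close> to \<open>K / rad K\<close> that kills this annihilator but not
  \<open>1\<close> therefore induces a map on \<open>K x\<close> that is nonzero at
  \<open>x\<close>; followed by the embedding into \<open>J\<close>, it extends to
  \<open>N\<close>.\<close>

lemma separating_hom:
  assumes "cring R" and J: "injective_envelope R (quot_module (regular_module R) (jacobson_radical R)) \<iota> J"
    and N: "fg N" and x: "x \<in> carrier N" "x \<noteq> \<zero>\<^bsub>N\<^esub>"
  obtains h where "h \<in> Hom N J" "h x \<noteq> \<zero>\<^bsub>J\<^esub>"
proof -
  let ?M = "regular_module R" and ?S = "quot_module (regular_module R) (jacobson_radical R)"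
  interpret cring R by (rule assms(1))
  note e = envelope_simps[OF J]
  have lm: "lm ?M" "lm N" by (rule lm_regular[OF ring_R], rule fg_lm[OF N])
  have \<rho>: "(\<lambda>k. k \<odot>\<^bsub>N\<^esub> x) \<in> Hom ?M N"
    by (rule HomI) (use x(1) lm in \<open>simp_all add: lm_smult_l_distr lm_smult_assoc\<close>)
  let ?V = "(\<lambda>k. k \<odot>\<^bsub>N\<^esub> x) ` carrier ?M" and ?A = "a_kernel ?M N (\<lambda>k. k \<odot>\<^bsub>N\<^esub> x)"
  have V: "sm ?V N" by (rule sm_img[OF \<rho> lm])
  have "\<one> \<notin> ?A" using x lm by (simp add: ker_iff)
  then have "?A \<noteq> carrier R" by auto
  then obtain \<theta> where \<theta>: "\<theta> \<in> Hom ?M ?S" "\<And>a. a \<in> ?A \<Longrightarrow> \<theta> a = \<zero>\<^bsub>?S\<^esub>" "\<theta> \<one> \<noteq> \<zero>\<^bsub>?S\<^esub>"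
    using residue_hom[OF assms(1) sm_ker[OF \<rho> lm]] by metis
  have lmS: "lm ?S" by (rule lm_quot(1)[OF lm(1) sm_jacobson_radical[OF assms(1)]])
  have lmV: "lm (sub N ?V)" by (rule lm_sub[OF lm(2) V])
  have ep: "mod_epi R ?M (sub N ?V) (\<lambda>k. k \<odot>\<^bsub>N\<^esub> x)"
    unfolding mod_epi_def using Hom_sub_to[OF \<rho>] by simp
  obtain g where g: "g \<in> Hom (sub N ?V) J" "\<And>k. k \<in> carrier ?M \<Longrightarrow> g (k \<odot>\<^bsub>N\<^esub> x) = \<iota> (\<theta> k)"
  proof (rule factor_epi[OF ep Hom_comp[OF \<theta>(1) mono_Hom[OF e(2)]] lm(1) lmV fg_lm[OF e(5)]])
    fix k assume "k \<in> carrier ?M" "k \<odot>\<^bsub>N\<^esub> x = \<zero>\<^bsub>sub N ?V\<^esub>"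
    then have "k \<in> ?A" by (simp add: ker_iff)
    then show "\<iota> (\<theta> k) = \<zero>\<^bsub>J\<^esub>" using \<theta>(2) Hom_zero[OF mono_Hom[OF e(2)] lmS fg_lm[OF e(5)]] by simp
  qed blast
  have i: "mod_mono R (sub N ?V) N (\<lambda>x. x)" using Hom_sub[OF lm(2) V] by (simp add: mod_mono_def)
  obtain h where h: "h \<in> Hom N J" "\<And>y. y \<in> carrier (sub N ?V) \<Longrightarrow> h y = g y"
    by (rule inj_extend[OF e(1) fg_sub[OF N V] N i g(1)]) blast
  have "x = \<one> \<odot>\<^bsub>N\<^esub> x" using x(1) lm by simp
  moreover have "\<one> \<odot>\<^bsub>N\<^esub> x \<in> carrier (sub N ?V)" by simp
  ultimately have "h x = \<iota> (\<theta> \<one>)" using h(2) g(2)[of \<one>] by simp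
  moreover have "\<iota> (\<theta> \<one>) \<noteq> \<zero>\<^bsub>J\<^esub>"
    using e(2)[unfolded mono_iff[OF lmS fg_lm[OF e(5)]]] \<theta>(3) Hom_closed[OF \<theta>(1)] by auto
  ultimately show ?thesis using that[OF h(1)] by simp
qed

end

locale artin_alg =
  fixes K :: "('k, 's) ring_scheme" and \<phi> :: "'k \<Rightarrow> 'a" and \<Lambda> :: "('a, 'r) ring_scheme"
  assumes artin_algebra: "artin_algebra K \<phi> \<Lambda>"
begin

abbreviation rs :: "('a, 'm) module \<Rightarrow> ('k, 'm) module" where "rs \<equiv> restrict_scalars \<phi>"

lemma cring_K: "cring K" and ring_\<Lambda>: "ring \<Lambda>" and \<phi>_hom: "\<phi> \<in> ring_hom K \<Lambda>"
  and fg_\<Lambda>: "fg_module K (rs (regular_module \<Lambda>))"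
  and \<phi>_central: "\<lbrakk>k \<in> carrier K; x \<in> carrier \<Lambda>\<rbrakk> \<Longrightarrow> \<phi> k \<otimes>\<^bsub>\<Lambda>\<^esub> x = x \<otimes>\<^bsub>\<Lambda>\<^esub> \<phi> k"
  using artin_algebra by (auto simp: artin_algebra_def artinian_cring_def)

sublocale K: artin_ring K
proof (rule artin_ring.intro)
  show "ring K" by (rule cring.axioms(1)[OF cring_K])
  show "base_ring.chain_cond K up (regular_module K)" for up
    by (rule base_ring.artinian_cring_cc) (use artin_algebra in \<open>simp add: artin_algebra_def\<close>)
qed

lemma \<phi>_closed [simp]: "k \<in> carrier K \<Longrightarrow> \<phi> k \<in> carrier \<Lambda>"
  by (rule ring_hom_closed[OF \<phi>_hom])

lemma rs_simps [simp]: "carrier (rs M) = carrier M" "\<zero>\<^bsub>rs M\<^esub> = \<zero>\<^bsub>M\<^esub>" "x \<oplus>\<^bsub>rs M\<^esub> y = x \<oplus>\<^bsub>M\<^esub> y" "k \<odot>\<^bsub>rs M\<^esub> x = \<phi> k \<odot>\<^bsub>M\<^esub> x"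
  by (simp_all add: restrict_scalars_def)

sublocale L: base_ring \<Lambda> .

lemma lm_rs: assumes "left_module \<Lambda> M" shows "left_module K (rs M)"
proof (rule K.lmI[OF K.ring_R])
  show "abelian_group (rs M)"
  proof (rule abelian_groupI)
    fix x assume "x \<in> carrier (rs M)"
    then show "\<exists>y\<in>carrier (rs M). y \<oplus>\<^bsub>rs M\<^esub> x = \<zero>\<^bsub>rs M\<^esub>"
      using assms by (intro bexI[of _ "\<ominus>\<^bsub>M\<^esub> x"]) auto
  qed (use assms in \<open>auto simp: L.lm_ac\<close>)
qed (use assms in \<open>auto simp: L.lm_smult_l_distr L.lm_smult_r_distr L.lm_smult_assoc
    ring_hom_add[OF \<phi>_hom] ring_hom_mult[OF \<phi>_hom] ring_hom_one[OF \<phi>_hom]\<close>)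

lemma sm_rs: assumes "left_module \<Lambda> M" "submodule N \<Lambda> M" shows "submodule N K (rs M)"
  using L.sm_simps[OF assms(2)] L.sm_subset[OF assms(2)] by (intro K.smI[OF lm_rs[OF assms(1)]]) auto

lemma cc_rs: assumes "K.chain_cond up (rs M)" "left_module \<Lambda> M" shows "L.chain_cond up M"
  using assms(1) sm_rs[OF assms(2)] unfolding K.chain_cond_def L.chain_cond_def by blast

lemma Hom_rs: "f \<in> mod_hom \<Lambda> M N \<Longrightarrow> f \<in> mod_hom K (rs M) (rs N)"
  by (auto simp: mod_hom_def)

text \<open>A chain of \<Lambda>-submodules is a chain of \<open>K\<close>-submodules, so both chain
  conditions descend from \<Lambda> as a finitely generated \<open>K\<close>-module.\<close>

sublocale L: artin_ring \<Lambda>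
  by (rule artin_ring.intro) (rule ring_\<Lambda>, rule cc_rs[OF K.fg_cc[OF fg_\<Lambda>] L.lm_regular[OF ring_\<Lambda>]])

lemma fg_rs: assumes "fg_module \<Lambda> M" shows "fg_module K (rs M)"
proof -
  obtain n f where f: "mod_epi \<Lambda> (direct_power n (regular_module \<Lambda>)) M f" by (rule L.free_epi[OF assms])
  have "rs (direct_power n (regular_module \<Lambda>)) = direct_power n (rs (regular_module \<Lambda>))"
    by (simp add: direct_power_def direct_sum_def restrict_scalars_def)
  then have "fg_module K (rs (direct_power n (regular_module \<Lambda>)))"
    using K.fg_power[OF K.ring_R fg_\<Lambda>] by simp
  moreover have "mod_epi K (rs (direct_power n (regular_module \<Lambda>))) (rs M) f"
    using f Hom_rs unfolding mod_epi_def by auto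
  ultimately show ?thesis by (rule K.fg_epi) (rule lm_rs[OF L.fg_lm[OF assms]])
qed

lemma fg_of_rs: assumes "fg_module K (rs M)" "left_module \<Lambda> M" shows "fg_module \<Lambda> M"
proof -
  obtain S where "finite S" "S \<subseteq> carrier (rs M)" "\<And>N. \<lbrakk>submodule N K (rs M); S \<subseteq> N\<rbrakk> \<Longrightarrow> N = carrier (rs M)"
    using K.fgE[OF assms(1)] by blast
  then show ?thesis by (intro L.fgI[OF assms(2)]) (use sm_rs[OF assms(2)] in auto)
qed

end

locale duality = artin_alg K \<phi> \<Lambda> for K :: "('k, 's) ring_scheme" and \<phi> :: "'k \<Rightarrow> 'a" and \<Lambda> :: "('a, 'r) ring_scheme" +
  fixes J :: "('k, 'j) module"
  assumes duality_module: "duality_module K J"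
begin

abbreviation A where "A \<equiv> rs (regular_module \<Lambda>)"
abbreviation D where "D \<equiv> dual_regular K \<phi> \<Lambda> J"

lemma inj_J: "injective K J" and lm_J [simp]: "left_module K J"
  using duality_module unfolding duality_module_def by (auto intro: K.envelope_simps)

lemma D_simps:
  "carrier D = mod_hom K A J \<inter> extensional (carrier \<Lambda>)" "\<zero>\<^bsub>D\<^esub> = (\<lambda>x\<in>carrier \<Lambda>. \<zero>\<^bsub>J\<^esub>)"
  "f \<oplus>\<^bsub>D\<^esub> g = (\<lambda>x\<in>carrier \<Lambda>. f x \<oplus>\<^bsub>J\<^esub> g x)" "a \<odot>\<^bsub>D\<^esub> f = (\<lambda>x\<in>carrier \<Lambda>. f (x \<otimes>\<^bsub>\<Lambda>\<^esub> a))"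
  by (simp_all add: dual_regular_def Hom_group_def Let_def)

lemma lm_A: "left_module K A"
  by (rule lm_rs[OF L.lm_regular[OF ring_\<Lambda>]])

lemma D_mem: assumes "f \<in> carrier D"
  shows "x \<in> carrier \<Lambda> \<Longrightarrow> f x \<in> carrier J"
    "\<lbrakk>x \<in> carrier \<Lambda>; y \<in> carrier \<Lambda>\<rbrakk> \<Longrightarrow> f (x \<oplus>\<^bsub>\<Lambda>\<^esub> y) = f x \<oplus>\<^bsub>J\<^esub> f y"
    "\<lbrakk>k \<in> carrier K; x \<in> carrier \<Lambda>\<rbrakk> \<Longrightarrow> f (\<phi> k \<otimes>\<^bsub>\<Lambda>\<^esub> x) = k \<odot>\<^bsub>J\<^esub> f x"
    "x \<notin> carrier \<Lambda> \<Longrightarrow> f x = undefined"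
  using assms by (auto simp: D_simps mod_hom_def extensional_def)

lemma D_memI:
  assumes "\<And>x. x \<in> carrier \<Lambda> \<Longrightarrow> f x \<in> carrier J"
    "\<And>x y. \<lbrakk>x \<in> carrier \<Lambda>; y \<in> carrier \<Lambda>\<rbrakk> \<Longrightarrow> f (x \<oplus>\<^bsub>\<Lambda>\<^esub> y) = f x \<oplus>\<^bsub>J\<^esub> f y"
    "\<And>k x. \<lbrakk>k \<in> carrier K; x \<in> carrier \<Lambda>\<rbrakk> \<Longrightarrow> f (\<phi> k \<otimes>\<^bsub>\<Lambda>\<^esub> x) = k \<odot>\<^bsub>J\<^esub> f x"
  shows "(\<lambda>x\<in>carrier \<Lambda>. f x) \<in> carrier D"
proof -
  interpret ring \<Lambda> by (rule ring_\<Lambda>)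
  show ?thesis using assms by (auto simp: D_simps mod_hom_def)
qed

lemma D_eqI: assumes "f \<in> carrier D" "g \<in> carrier D" "\<And>x. x \<in> carrier \<Lambda> \<Longrightarrow> f x = g x" shows "f = g"
  using assms by (auto simp: D_simps intro: extensionalityI)

lemma lm_D: "left_module \<Lambda> D"
proof -
  interpret \<Lambda>: ring \<Lambda> by (rule ring_\<Lambda>)
  have add: "f \<oplus>\<^bsub>D\<^esub> g \<in> carrier D" if "f \<in> carrier D" "g \<in> carrier D" for f g
    unfolding D_simps(3)
    by (rule D_memI) (simp_all add: D_mem[OF that(1)] D_mem[OF that(2)] K.lm_ac K.lm_smult_r_distr)
  have zero: "\<zero>\<^bsub>D\<^esub> \<in> carrier D"
    unfolding D_simps(2) by (rule D_memI) simp_all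
  have smult: "a \<odot>\<^bsub>D\<^esub> f \<in> carrier D" if "a \<in> carrier \<Lambda>" "f \<in> carrier D" for a f
    unfolding D_simps(4)
    by (rule D_memI) (simp_all add: D_mem[OF that(2)] that(1) \<Lambda>.l_distr \<Lambda>.m_assoc)
  have neg: "(\<lambda>x\<in>carrier \<Lambda>. \<ominus>\<^bsub>J\<^esub> f x) \<in> carrier D" if "f \<in> carrier D" for f
    by (rule D_memI) (simp_all add: D_mem[OF that] K.lm_neg_add K.lm_smult_neg)
  have "abelian_group D"
  proof (rule abelian_groupI)
    fix f assume f: "f \<in> carrier D"
    show "\<exists>g\<in>carrier D. g \<oplus>\<^bsub>D\<^esub> f = \<zero>\<^bsub>D\<^esub>"
      by (rule bexI[OF _ neg[OF f]]) (auto simp: D_simps(2,3) D_mem[OF f])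
    show "\<zero>\<^bsub>D\<^esub> \<oplus>\<^bsub>D\<^esub> f = f"
      by (rule D_eqI[OF add[OF zero f] f]) (simp add: D_simps(2,3) D_mem[OF f])
    fix g assume g: "g \<in> carrier D"
    show "f \<oplus>\<^bsub>D\<^esub> g = g \<oplus>\<^bsub>D\<^esub> f" unfolding D_simps
      by (rule restrict_ext) (simp add: D_mem[OF f] D_mem[OF g] K.lm_comm)
    fix h assume h: "h \<in> carrier D"
    show "f \<oplus>\<^bsub>D\<^esub> g \<oplus>\<^bsub>D\<^esub> h = f \<oplus>\<^bsub>D\<^esub> (g \<oplus>\<^bsub>D\<^esub> h)" unfolding D_simps
      by (rule restrict_ext) (simp add: D_mem[OF f] D_mem[OF g] D_mem[OF h] K.lm_assoc)
  qed (use add zero in auto)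
  then show ?thesis
  proof (rule L.lmI[OF ring_\<Lambda>])
    fix x assume x: "x \<in> carrier D"
    show "\<one>\<^bsub>\<Lambda>\<^esub> \<odot>\<^bsub>D\<^esub> x = x" by (rule D_eqI[OF smult[OF _ x] x]) (auto simp: D_simps)
  next
    fix a x assume *: "a \<in> carrier \<Lambda>" "x \<in> carrier D"
    show "a \<odot>\<^bsub>D\<^esub> x \<in> carrier D" by (rule smult[OF *])
    fix b assume b: "b \<in> carrier \<Lambda>"
    show "(a \<oplus>\<^bsub>\<Lambda>\<^esub> b) \<odot>\<^bsub>D\<^esub> x = a \<odot>\<^bsub>D\<^esub> x \<oplus>\<^bsub>D\<^esub> b \<odot>\<^bsub>D\<^esub> x" unfolding D_simps
      by (rule restrict_ext) (simp add: D_mem[OF *(2)] *(1) b \<Lambda>.r_distr)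
    show "(a \<otimes>\<^bsub>\<Lambda>\<^esub> b) \<odot>\<^bsub>D\<^esub> x = a \<odot>\<^bsub>D\<^esub> (b \<odot>\<^bsub>D\<^esub> x)" unfolding D_simps
      by (rule restrict_ext) (simp add: *(1) b \<Lambda>.m_assoc)
  next
    fix a x y assume *: "a \<in> carrier \<Lambda>" "x \<in> carrier D" "y \<in> carrier D"
    show "a \<odot>\<^bsub>D\<^esub> (x \<oplus>\<^bsub>D\<^esub> y) = a \<odot>\<^bsub>D\<^esub> x \<oplus>\<^bsub>D\<^esub> a \<odot>\<^bsub>D\<^esub> y" unfolding D_simps
      by (rule restrict_ext) (simp add: *(1))
  qed
qed

text \<open>Evaluation at finitely many \<open>K\<close>-generators of \<Lambda> embeds the dual
  into a finite power of \<open>J\<close>. Submodules of finitely generated \<open>K\<close>-modules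
  are finitely generated, and generators over \<open>K\<close> generate over \<Lambda>.\<close>

lemma fg_D: "fg_module \<Lambda> D"
proof (rule fg_of_rs[OF _ lm_D])
  obtain S where S: "finite S" "S \<subseteq> carrier A" "\<And>N. \<lbrakk>submodule N K A; S \<subseteq> N\<rbrakk> \<Longrightarrow> N = carrier A"
    using K.fgE[OF fg_\<Lambda>] by blast
  let ?P = "direct_sum S (\<lambda>_. J)" and ?e = "\<lambda>f. \<lambda>s\<in>S. f s"
  have fgP: "fg_module K ?P" by (rule K.fg_ds[OF K.ring_R S(1)]) (rule K.inj_fg[OF inj_J])
  have e: "?e \<in> mod_hom K (rs D) ?P"
  proof (rule K.HomI)
    fix f assume f: "f \<in> carrier (rs D)"
    then show "?e f \<in> carrier ?P" using S(1,2) D_mem(1)[of f] by auto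
    fix g assume g: "g \<in> carrier (rs D)"
    show "?e (f \<oplus>\<^bsub>rs D\<^esub> g) = ?e f \<oplus>\<^bsub>?P\<^esub> ?e g" using S(1,2) by (auto simp: D_simps intro!: restrict_ext)
  next
    fix k f assume "k \<in> carrier K" "f \<in> carrier (rs D)"
    then show "?e (k \<odot>\<^bsub>rs D\<^esub> f) = k \<odot>\<^bsub>?P\<^esub> ?e f"
      using S(1,2) D_mem(3)[of f k] by (auto simp: D_simps(4) \<phi>_central[symmetric] subset_iff intro!: restrict_ext)
  qed
  have "mod_mono K (rs D) ?P ?e"
    unfolding K.mono_iff[OF lm_rs[OF lm_D] K.fg_lm[OF fgP]]
  proof (intro conjI e ballI impI)
    fix f assume f: "f \<in> carrier (rs D)" "?e f = \<zero>\<^bsub>?P\<^esub>"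
    then have fH: "f \<in> mod_hom K A J" and fD: "f \<in> carrier D" by (auto simp: D_simps)
    have "f s = \<zero>\<^bsub>J\<^esub>" if "s \<in> S" for s using fun_cong[OF f(2), of s] that by simp
    then have "S \<subseteq> a_kernel A J f" using S(2) by (auto simp: K.ker_iff)
    then have "a_kernel A J f = carrier A" by (rule S(3)[OF K.sm_ker[OF fH lm_A lm_J]])
    then have *: "f x = \<zero>\<^bsub>J\<^esub>" if "x \<in> carrier \<Lambda>" for x using that by (auto simp: K.ker_iff set_eq_iff)
    show "f = \<zero>\<^bsub>rs D\<^esub>"
      unfolding rs_simps by (rule D_eqI[OF fD L.lm_zero[OF lm_D]]) (simp add: * D_simps(2))
  qed
  then show "fg_module K (rs D)" by (rule K.fg_mono[OF _ lm_rs[OF lm_D] fgP])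
qed

text \<open>The adjunction \<open>Hom\<^sub>K(M, J) \<cong> Hom\<^sub>\<Lambda>(M, D \<Lambda>)\<close>.\<close>

lemma adjoint:
  assumes M: "left_module \<Lambda> M" and h: "h \<in> mod_hom K (rs M) J"
  shows "(\<lambda>x. \<lambda>a\<in>carrier \<Lambda>. h (a \<odot>\<^bsub>M\<^esub> x)) \<in> mod_hom \<Lambda> M D"
proof (rule L.HomI)
  interpret \<Lambda>: ring \<Lambda> by (rule ring_\<Lambda>)
  note hs = K.Hom_simps[OF h, simplified]
  fix x assume x: "x \<in> carrier M"
  show "(\<lambda>a\<in>carrier \<Lambda>. h (a \<odot>\<^bsub>M\<^esub> x)) \<in> carrier D"
    by (rule D_memI) (use M x in \<open>simp_all add: hs L.lm_smult_l_distr L.lm_smult_assoc\<close>)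
  fix y assume "y \<in> carrier M"
  then show "(\<lambda>a\<in>carrier \<Lambda>. h (a \<odot>\<^bsub>M\<^esub> (x \<oplus>\<^bsub>M\<^esub> y))) = (\<lambda>a\<in>carrier \<Lambda>. h (a \<odot>\<^bsub>M\<^esub> x)) \<oplus>\<^bsub>D\<^esub> (\<lambda>a\<in>carrier \<Lambda>. h (a \<odot>\<^bsub>M\<^esub> y))"
    unfolding D_simps using M x by (intro restrict_ext) (simp add: hs L.lm_smult_r_distr)
next
  interpret \<Lambda>: ring \<Lambda> by (rule ring_\<Lambda>)
  fix b x assume "b \<in> carrier \<Lambda>" "x \<in> carrier M"
  then show "(\<lambda>a\<in>carrier \<Lambda>. h (a \<odot>\<^bsub>M\<^esub> (b \<odot>\<^bsub>M\<^esub> x))) = b \<odot>\<^bsub>D\<^esub> (\<lambda>a\<in>carrier \<Lambda>. h (a \<odot>\<^bsub>M\<^esub> x))"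
    unfolding D_simps using M by (intro restrict_ext) (simp add: L.lm_smult_assoc)
qed

text \<open>Evaluating \<open>f\<close> at \<open>1\<close> gives a \<open>K\<close>-map to
  \<open>J\<close>, which extends by injectivity of \<open>J\<close>; the adjoint of the extension
  then extends \<open>f\<close>, because \<open>f x a = f (a x) 1\<close>.\<close>

lemma inj_D: "injective \<Lambda> D"
  unfolding injective_def
proof (intro conjI fg_D allI impI)
  interpret \<Lambda>: ring \<Lambda> by (rule ring_\<Lambda>)
  fix M N :: "'a fgmod" and j f
  assume "fg_module \<Lambda> M \<and> fg_module \<Lambda> N \<and> mod_mono \<Lambda> M N j \<and> f \<in> mod_hom \<Lambda> M D"
  then have M: "fg_module \<Lambda> M" and N: "fg_module \<Lambda> N" and j: "mod_mono \<Lambda> M N j" and f: "f \<in> mod_hom \<Lambda> M D" by auto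
  have lmM: "left_module \<Lambda> M" and lmN: "left_module \<Lambda> N" using M N by auto
  note fs = L.Hom_simps[OF f] and js = L.Hom_simps[OF L.mono_Hom[OF j]]
  have j': "mod_mono K (rs M) (rs N) j" using j Hom_rs unfolding mod_mono_def by auto
  have f': "(\<lambda>x. f x \<one>\<^bsub>\<Lambda>\<^esub>) \<in> mod_hom K (rs M) J"
  proof (rule K.HomI)
    fix x assume x: "x \<in> carrier (rs M)"
    then show "f x \<one>\<^bsub>\<Lambda>\<^esub> \<in> carrier J" using D_mem(1)[OF fs(1)] by simp
    fix y assume "y \<in> carrier (rs M)"
    then show "f (x \<oplus>\<^bsub>rs M\<^esub> y) \<one>\<^bsub>\<Lambda>\<^esub> = f x \<one>\<^bsub>\<Lambda>\<^esub> \<oplus>\<^bsub>J\<^esub> f y \<one>\<^bsub>\<Lambda>\<^esub>" using x by (simp add: fs(2) D_simps(3))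
  next
    fix k x assume "k \<in> carrier K" "x \<in> carrier (rs M)"
    then show "f (k \<odot>\<^bsub>rs M\<^esub> x) \<one>\<^bsub>\<Lambda>\<^esub> = k \<odot>\<^bsub>J\<^esub> f x \<one>\<^bsub>\<Lambda>\<^esub>"
      using D_mem(3)[OF fs(1), of x k "\<one>\<^bsub>\<Lambda>\<^esub>"] by (simp add: fs(3) D_simps(4))
  qed
  obtain g where g: "g \<in> mod_hom K (rs N) J" "\<And>x. x \<in> carrier (rs M) \<Longrightarrow> g (j x) = f x \<one>\<^bsub>\<Lambda>\<^esub>"
    by (rule K.inj_extend[OF inj_J fg_rs[OF M] fg_rs[OF N] j' f']) blast
  show "\<exists>g\<in>mod_hom \<Lambda> N D. \<forall>x\<in>carrier M. g (j x) = f x"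
  proof (intro bexI[OF _ adjoint[OF lmN g(1)]] ballI)
    fix x assume x: "x \<in> carrier M"
    show "(\<lambda>a\<in>carrier \<Lambda>. g (a \<odot>\<^bsub>N\<^esub> j x)) = f x"
    proof (rule D_eqI[OF L.Hom_closed[OF adjoint[OF lmN g(1)] js(1)[OF x]] fs(1)[OF x]])
      fix a assume a: "a \<in> carrier \<Lambda>"
      have "g (a \<odot>\<^bsub>N\<^esub> j x) = f (a \<odot>\<^bsub>M\<^esub> x) \<one>\<^bsub>\<Lambda>\<^esub>"
        using g(2)[of "a \<odot>\<^bsub>M\<^esub> x"] js(3)[OF a x] lmM a x by simp
      also have "\<dots> = f x a" using fs(3)[OF a x] a by (simp add: D_simps(4))
      finally show "(\<lambda>a\<in>carrier \<Lambda>. g (a \<odot>\<^bsub>N\<^esub> j x)) a = f x a" using a by simp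
    qed
  qed
qed

lemma D_separates:
  assumes "fg_module \<Lambda> M" "x \<in> carrier M" "x \<noteq> \<zero>\<^bsub>M\<^esub>"
  obtains h where "h \<in> mod_hom \<Lambda> M D" "h x \<noteq> \<zero>\<^bsub>D\<^esub>"
proof -
  interpret \<Lambda>: ring \<Lambda> by (rule ring_\<Lambda>)
  have lm: "left_module \<Lambda> M" using assms(1) by simp
  obtain \<iota> where \<iota>: "injective_envelope K (quot_module (regular_module K) (jacobson_radical K)) \<iota> J"
    using duality_module unfolding duality_module_def by blast
  obtain h where h: "h \<in> mod_hom K (rs M) J" "h x \<noteq> \<zero>\<^bsub>J\<^esub>"
    by (rule K.separating_hom[OF cring_K \<iota> fg_rs[OF assms(1)], of x]) (use assms in auto)
  \<comment> \<open>The value of this function at \<open>1\<close> is \<open>h x\<close>.\<close>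
  have "(\<lambda>a\<in>carrier \<Lambda>. h (a \<odot>\<^bsub>M\<^esub> x)) \<noteq> \<zero>\<^bsub>D\<^esub>"
  proof
    assume "(\<lambda>a\<in>carrier \<Lambda>. h (a \<odot>\<^bsub>M\<^esub> x)) = \<zero>\<^bsub>D\<^esub>"
    from fun_cong[OF this, of "\<one>\<^bsub>\<Lambda>\<^esub>"] h(2) show False using assms(2) lm by (simp add: D_simps(2))
  qed
  then show ?thesis using that[OF adjoint[OF lm h(1)]] by simp
qed

text \<open>Among the common kernels \<open>Z n h\<close> of finitely many maps to the dual choose a
  minimal one. A nonzero element in it would be separated by one more map, giving a smaller common
  kernel; so it is zero and the chosen maps form an embedding.\<close>

lemma D_cogenerates:
  assumes M: "fg_module \<Lambda> M" shows "\<exists>n j. mod_mono \<Lambda> M (direct_power n D) j"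
proof -
  have lm: "left_module \<Lambda> M" using M by simp
  define Z where "Z n h = {x \<in> carrier M. \<forall>i<n. h i x = \<zero>\<^bsub>D\<^esub>}" for n :: nat and h
  let ?\<S> = "{Z n h | n h. \<forall>i<n. h i \<in> mod_hom \<Lambda> M D}"
  have "carrier M = Z 0 undefined" by (simp add: Z_def)
  then have ne: "carrier M \<in> ?\<S>" by blast
  have sm: "submodule N \<Lambda> M" if N: "N \<in> ?\<S>" for N
  proof -
    obtain n h where NZ: "N = Z n h" and h: "\<And>i. i < n \<Longrightarrow> h i \<in> mod_hom \<Lambda> M D" using N by blast
    show ?thesis unfolding NZ Z_def
      by (rule L.smI[OF lm]) (use lm lm_D in \<open>auto simp: L.Hom_zero[OF h] L.Hom_simps(2,3)[OF h]\<close>)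
  qed
  obtain N where N: "N \<in> ?\<S>" and min: "\<And>L. \<lbrakk>L \<in> ?\<S>; chain_le False N L\<rbrakk> \<Longrightarrow> L = N"
    by (rule L.chain_extremal[OF L.fg_cc[OF M] ne sm]) blast+
  then obtain n h where Nn: "N = Z n h" and h: "\<And>i. i < n \<Longrightarrow> h i \<in> mod_hom \<Lambda> M D" by blast
  have "x = \<zero>\<^bsub>M\<^esub>" if x: "x \<in> N" for x
  proof (rule ccontr)
    assume x0: "x \<noteq> \<zero>\<^bsub>M\<^esub>"
    have xM: "x \<in> carrier M" using x by (simp add: Nn Z_def)
    obtain g where g: "g \<in> mod_hom \<Lambda> M D" "g x \<noteq> \<zero>\<^bsub>D\<^esub>" by (rule D_separates[OF M xM x0])
    have "\<forall>i<Suc n. (h(n := g)) i \<in> mod_hom \<Lambda> M D" using h g(1) by (auto simp: less_Suc_eq)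
    then have "Z (Suc n) (h(n := g)) \<in> ?\<S>" by blast
    moreover have "Z (Suc n) (h(n := g)) \<subseteq> N" by (auto simp: Nn Z_def less_Suc_eq)
    ultimately have "Z (Suc n) (h(n := g)) = N" using min by (simp add: chain_le_def)
    then have "x \<in> Z (Suc n) (h(n := g))" using x by simp
    then have "(h(n := g)) n x = \<zero>\<^bsub>D\<^esub>" unfolding Z_def by blast
    with g(2) show False by simp
  qed
  note Z0 = this
  let ?P = "direct_power n D" and ?e = "\<lambda>x. \<lambda>i\<in>{..<n}. h i x"
  have "?e \<in> mod_hom \<Lambda> M ?P"
    unfolding direct_power_def by (rule L.Hom_tuple) (use h in auto)
  moreover have "x = \<zero>\<^bsub>M\<^esub>" if x: "x \<in> carrier M" "?e x = \<zero>\<^bsub>?P\<^esub>" for x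
  proof (rule Z0)
    have "h i x = \<zero>\<^bsub>D\<^esub>" if "i < n" for i
      using fun_cong[OF x(2), of i] that by (simp add: direct_power_def)
    then show "x \<in> N" using x(1) by (simp add: Nn Z_def)
  qed
  ultimately have "mod_mono \<Lambda> M ?P ?e"
    using L.mono_iff[OF lm L.fg_lm[OF L.fg_power[OF ring_\<Lambda> fg_D]]] by blast
  then show ?thesis by blast
qed

sublocale artin_inj \<Lambda> D
  by (rule artin_inj.intro[OF L.artin_ring_axioms], rule artin_inj_axioms.intro) (rule inj_D, rule D_cogenerates)

end

theorem theorem1:
  fixes K :: "('k, 's) ring_scheme" and \<phi> :: "'k \<Rightarrow> 'a" and \<Lambda> :: "('a, 'r) ring_scheme"
    and J :: "('k, 'j) module"
    and \<Q> \<P> \<I> :: "'a fgmod set"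
    and Q :: "('a, 'a fgmod \<Rightarrow> (nat \<Rightarrow> 'a) set) module"
  assumes "artin_algebra K \<phi> \<Lambda>"
    and "duality_module K J"
    and "iso_representatives \<Lambda>
           (\<lambda>M. indecomposable \<Lambda> M \<and> projective \<Lambda> M \<and> injective \<Lambda> M) \<Q>"
    and "iso_representatives \<Lambda>
           (\<lambda>M. indecomposable \<Lambda> M \<and> projective \<Lambda> M \<and> \<not> injective \<Lambda> M) \<P>"
    and "iso_representatives \<Lambda>
           (\<lambda>M. indecomposable \<Lambda> M \<and> injective \<Lambda> M \<and> \<not> projective \<Lambda> M) \<I>"
    and "Q = direct_sum \<Q> (\<lambda>M. M)"
  shows
    "((domdim \<Lambda> \<ge> 2 \<longleftrightarrow> (\<exists>T :: 'a fgmod. T \<in> Gen \<Lambda> Q \<inter> Cogen \<Lambda> Q \<and> tilting \<Lambda> T)) \<and>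
      (domdim \<Lambda> \<ge> 2 \<longleftrightarrow> (\<exists>C :: 'a fgmod. C \<in> Gen \<Lambda> Q \<inter> Cogen \<Lambda> Q \<and> cotilting K \<phi> J \<Lambda> C))) \<and>
     (\<forall>T :: ('a, 't) module. T \<in> Gen \<Lambda> Q \<inter> Cogen \<Lambda> Q \<and> tilting \<Lambda> T \<longrightarrow>
        mod_iso \<Lambda> T (direct_sum2 Q (direct_sum \<P> (cosyzygy \<Lambda>)))) \<and>
     (\<forall>C :: ('a, 'c) module. C \<in> Gen \<Lambda> Q \<inter> Cogen \<Lambda> Q \<and> cotilting K \<phi> J \<Lambda> C \<longrightarrow>
        mod_iso \<Lambda> C (direct_sum2 Q (direct_sum \<I> (syzygy \<Lambda>))))"
proof -
  interpret duality K \<phi> \<Lambda> J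
    by (rule duality.intro[OF artin_alg.intro[OF assms(1)] duality_axioms.intro[OF assms(2)]])
  interpret artin_reps \<Lambda> "dual_regular K \<phi> \<Lambda> J" \<Q> \<P> \<I> Q
    by (rule artin_reps.intro[OF artin_inj_axioms artin_reps_axioms.intro[OF assms(3-6)]])
  have C: "cotilting K \<phi> J \<Lambda> C \<longleftrightarrow> basic_module \<Lambda> C \<and> injdim \<Lambda> C \<le> 1 \<and> trivial_group (Ext \<Lambda> 1 C C) \<and>
      (\<exists>(C0 :: 'a fgmod) (C1 :: 'a fgmod) f g. C0 \<in> add_cat \<Lambda> C \<and> C1 \<in> add_cat \<Lambda> C \<and>
        short_exact \<Lambda> C0 f C1 g (dual_regular K \<phi> \<Lambda> J))" for C :: "('a, 'd) module"
    by (rule cotilting_def)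
  have mem: "M \<in> Gen \<Lambda> Q \<inter> Cogen \<Lambda> Q \<longleftrightarrow> genPI M \<and> cogenPI M" for M :: "('a, 'd) module"
    by (simp add: Gen_iff Cogen_iff)
  have "domdim \<Lambda> \<ge> 2 \<longleftrightarrow> (\<exists>T :: 'a fgmod. T \<in> Gen \<Lambda> Q \<inter> Cogen \<Lambda> Q \<and> tilting \<Lambda> T)"
    unfolding domdim_ge_2 using exists_tilting tilting_ker_PI mem by blast
  \<comment> \<open>For the cotilting half the condition is first moved from \<Lambda> to its dual
    by \<open>ker_PI_regular_iff\<close>.\<close>
  moreover have "domdim \<Lambda> \<ge> 2 \<longleftrightarrow> (\<exists>C :: 'a fgmod. C \<in> Gen \<Lambda> Q \<inter> Cogen \<Lambda> Q \<and> cotilting K \<phi> J \<Lambda> C)"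
    unfolding domdim_ge_2 ker_PI_regular_iff C using exists_cotilting cotilting_coker_PI mem by blast
  moreover have "mod_iso \<Lambda> T (direct_sum2 Q (direct_sum \<P> (cosyzygy \<Lambda>)))"
    if "T \<in> Gen \<Lambda> Q \<inter> Cogen \<Lambda> Q" "tilting \<Lambda> T" for T :: "('a, 't) module"
    using tilting_unique that mem by blast
  moreover have "mod_iso \<Lambda> C (direct_sum2 Q (direct_sum \<I> (syzygy \<Lambda>)))"
    if "C \<in> Gen \<Lambda> Q \<inter> Cogen \<Lambda> Q" "cotilting K \<phi> J \<Lambda> C" for C :: "('a, 'c) module"
    using cotilting_unique that mem unfolding C by blast
  ultimately show ?thesis by blast
qed

end
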